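(* Let $d=d(n)$ be a sequence of positive integers such that $\frac{\log^{12} n}{(\log\log n)^4}\le d(n)$ for all large $n$ and $d(n)=O(n)$ (i.e. $\limsup_{n\to\infty} d(n)/n<\infty$). For each $n$ let $\pi_n^1,\dots,\pi_n^d$ be independent uniformly random permutations of $[n]=\{1,\dots,n\}$, let $P_n^\ell$ be the permutation matrix $P_n^\ell(i,j)=\mathbf 1(\pi_n^\ell(i)=j)$, and let $S_n^d=\sum_{\ell=1}^d P_n^\ell$. Then the empirical spectral distribution of $S_n^d/\sqrt d$ converges weakly, in probability, to the uniform probability distribution on the unit disk $\{z\in\mathbb C:|z|\le 1\}$ as $n\to\infty$.
   Context: For an $n\times n$ matrix $M_n$ with eigenvalues $\lambda_1,\dots,\lambda_n$ (with multiplicity), its empirical spectral distribution is $L_{M_n}=\frac1n\sum_{i=1}^n\delta_{\lambda_i}$. A sequence of random probability measures $\mu_n$ on $\mathbb C$ converges weakly in probability to $\mu$ if for every bounded continuous $f:\mathbb C\to\mathbb R$, $\int f\,d\mu_n-\int f\,d\mu\to0$ in probability. *)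

theory Defs
  imports "HOL-Probability.Probability" "HOL-Library.Landau_Symbols"
    "HOL-Computational_Algebra.Polynomial"
    "Jordan_Normal_Form.Char_Poly"
begin

definition ESD :: "complex mat \<Rightarrow> complex measure" where
  "ESD A = measure_pmf (pmf_of_multiset (proots (char_poly A)))"

text \<open>Sum of the permutation matrices P^l(i,j) = 1(pi_l(i) = j), l < d,
  indices i,j in {0..<n} (i.e. [n] relabelled), divided by sqrt d.\<close>
definition scaled_perm_sum :: "nat \<Rightarrow> nat \<Rightarrow> (nat \<Rightarrow> nat \<Rightarrow> nat) \<Rightarrow> complex mat" where
  "scaled_perm_sum n d \<pi> =
     mat n n (\<lambda>(i,j). complex_of_real
        (real (card {l \<in> {..<d}. \<pi> l i = j}) / sqrt (real d)))"

definition rand_perms :: "nat \<Rightarrow> nat \<Rightarrow> (nat \<Rightarrow> nat \<Rightarrow> nat) pmf" where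
  "rand_perms n d = Pi_pmf {..<d} id (\<lambda>_. pmf_of_set {p. p permutes {..<n}})"

definition unif_disk :: "complex measure" where
  "unif_disk = uniform_measure lborel (cball 0 1)"

definition weak_conv_in_prob ::
    "(nat \<Rightarrow> 'w pmf) \<Rightarrow> (nat \<Rightarrow> 'w \<Rightarrow> complex measure) \<Rightarrow> complex measure \<Rightarrow> bool" where
  "weak_conv_in_prob P \<mu> \<nu> \<longleftrightarrow>
     (\<forall>f :: complex \<Rightarrow> real. continuous_on UNIV f \<and> bounded (range f) \<longrightarrow>
        (\<forall>\<epsilon>>0. (\<lambda>n. measure_pmf.prob (P n)
            {\<omega>. \<bar>(\<integral>z. f z \<partial>(\<mu> n \<omega>)) - (\<integral>z. f z \<partial>\<nu>)\<bar> > \<epsilon>}) \<longlonglongrightarrow> 0))"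

end

theory Submission
 imports Defs "HOL-Complex_Analysis.Complex_Analysis" "HOL-Real_Asymp.Real_Asymp"
  "Jordan_Normal_Form.Schur_Decomposition"
begin

text \<open>
 Girko's method. For \<open>A = S / sqrt d\<close> let \<open>h\<^sub>1, \<dots>, h\<^sub>n\<close> be the eigenvalues of \<open>(A - z)(A - z)\<^sup>*\<close>.
 The logarithmic potential of the spectral distribution at \<open>z\<close> is the mean of \<open>ln h\<^sub>i / 2\<close>, and it has to be
 compared with the potential of the disk.

 For the regularization \<open>ln (h\<^sub>i + t\<^sup>2) / 2\<close> consider the resolvent of the hermitization of \<open>A - z\<close> at \<open>\<i>t\<close>.
 Interchanging two values of one permutation preserves the uniform law and perturbs the hermitization by rank two;
 averaging the second order expansion over all such swaps gives the loop equations up to an error of order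
 \<open>1 / (sqrt d t\<^sup>3)\<close>. The regularized potential is then an explicit function of the normalized trace.

 The regularization is removed by a lower bound \<open>exp (-20 d powr (1/10))\<close> for the least singular value of \<open>S - w\<close>.
 Almost null vectors are spread out: for a vector with a gap between its large and its small coordinates,
 swaps within pairs of rows make a small image unlikely, and a net over the large coordinates finishes the argument.
 For a spread vector that is almost orthogonal to all rows but two, the random swaps between the two rows
 contribute a sum of independent signs, to which the Littlewood-Offord inequality applies.

 Finally the mean of \<open>ln |z - a|\<close> over a circle of radius \<open>r\<close> about \<open>w\<close> is \<open>ln (max r |w - a|)\<close>, and the differences
 of these functions for the radii \<open>2r\<close> and \<open>r\<close> are bumps that approximate all test functions.
\<close>

section \<open>Uniform permutation tuples and anti-concentration\<close>

text \<open>Two exponents drive the estimates. The loop equations bound the mean normalized trace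
  down to height \<open>t = d powr (-1/8)\<close>, where \<open>sqrt d * t ^ 4 = 1\<close>. Below
  it, removing the regularization costs at most \<open>t\<close> times the trace times the logarithm
  of the inverse least singular value, so a loss of \<open>d powr (1/10)\<close> in that logarithm
  is affordable because 1/10 < 1/8. The logarithm arises from about \<open>ln n\<close> scales of
  ratio \<open>40 * d\<close>; the lower bound on \<open>d\<close>, used as
  \<open>ln n <= d powr (1/11)\<close>, keeps it that small. An obstacle to the singular value bound
  is that all row sums of \<open>S\<close> equal \<open>d\<close>: constant vectors are exceptional,
  so vectors and their images are treated modulo constants. A second obstacle appears at the end.
  The potentials converge in probability at each single \<open>z\<close>, but integrating over
  circles requires uniform integrability. The Frobenius norm provides it from above only; from below
  the logarithm is truncated at a radius \<open>rho\<close>, whose effect on circular means is at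
  most \<open>rho / r\<close>.\<close>

type_synonym perms = "nat => nat => nat"

text \<open>Freezing the slots beyond \<open>d\<close> to \<open>id\<close> matches the default of
  \<open>rand_perms\<close> and makes the sample space finite, so that all probabilities below are
  quotients of cardinalities.\<close>

definition tuples :: "nat => nat => perms set" where
 "tuples n d = PiE_dflt {..<d} id (%_. {p. p permutes {..<n}})"

lemma finite_perm_tuples [simp]: "finite (tuples n d)"
 unfolding tuples_def by (rule finite_PiE_dflt) (auto simp: finite_permutations)

lemma card_perm_tuples: "card (tuples n d) = fact n ^ d"
 unfolding tuples_def by (subst card_PiE_dflt) (auto simp: finite_permutations card_permutations)

lemma tuples_nonempty [simp]: "tuples n d ~= {}"
 using card_perm_tuples[of n d] by (metis card.empty fact_nonzero power_not_zero)

lemma tuples_permutes: "P : tuples n d ==> l < d ==> P l permutes {..<n}"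
 by (auto simp: tuples_def PiE_dflt_def)

lemma tuples_bound [intro]: "P : tuples n d ==> i < n ==> l < d ==> P l i < n"
 using tuples_permutes permutes_in_image by fastforce

lemma rand_perms_eq: "rand_perms n d = pmf_of_set (tuples n d)"
 unfolding rand_perms_def tuples_def
 by (rule Pi_pmf_of_set) (auto simp: finite_permutations intro: permutes_id)

lemma prob_rand_perms:
 "measure_pmf.prob (rand_perms n d) {P. Q P} = card {P : tuples n d. Q P} / card (tuples n d)"
proof -
 have "tuples n d \<inter> {P. Q P} = {P : tuples n d. Q P}" by auto
 then show ?thesis
 unfolding rand_perms_eq
 by (subst measure_pmf_of_set) simp_all
qed

text \<open>Combine \<open>(n choose k) >= (n/k)^k\<close> with
  \<open>k^k / fact k <= exp k\<close>, the latter being one term of the exponential series. The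
  factor \<open>exp 1 / n\<close> is the price of one prescribed value of a permutation in the first
  moment bounds below.\<close>

lemma fact_diff_le_exp_power:
 assumes "k <= n" "n > 0"
 shows "fact (n - k) <= fact n * (exp 1 / real n) ^ k"
proof (cases "k = 0")
 case False
 have e: "real k ^ k / fact k <= exp (real k)"
 proof -
  have "(SUM j:{k}. real k ^ j /\<^sub>R fact j) <= (\<Sum>j. real k ^ j /\<^sub>R fact j)"
   using summable_exp_generic[of "real k"] by (intro sum_le_suminf) auto
  then show ?thesis unfolding exp_def by (simp add: field_simps)
 qed
 have b: "(real n / real k) ^ k <= real (n choose k)"
  by (rule binomial_ge_n_over_k_pow_k) fact
 have ek: "exp (1::real) ^ k = exp (real k)" by (metis exp_of_nat_mult mult.right_neutral)
 have "fact n = fact k * fact (n - k) * real (n choose k)"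
  using binomial_fact_lemma[OF assms(1)] by (metis of_nat_fact of_nat_mult)
 also have "... >= fact k * fact (n - k) * (real n / real k) ^ k"
  using b by (intro mult_left_mono) auto
 finally have "fact k * fact (n - k) * (real n / real k) ^ k <= (fact n :: real)" .
 moreover have "real k ^ k <= exp (real k) * fact k" using e by (simp add: field_simps)
 moreover have "fact k * fact (n - k) * real n ^ k = fact k * fact (n - k) * (real n / real k) ^ k * real k ^ k"
  using False by (simp add: power_divide)
 ultimately have "fact k * fact (n-k) * real n ^ k <= fact n * (exp (real k) * fact k)"
  by (metis (no_types, lifting) mult_mono fact_ge_zero of_nat_0_le_iff zero_le_power)
 then have "fact (n-k) * real n ^ k * fact k <= fact n * (exp (real k) * fact k)" by (simp add: mult_ac)
 then have "fact (n-k) * real n ^ k <= fact n * exp (real k)" by (simp add: mult.assoc[symmetric])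
 then show ?thesis using assms by (simp add: power_divide ek field_simps)
qed auto

text \<open>If one solution \<open>q\<close> exists, composing with its inverse embeds all solutions
  into the permutations of the unconstrained points. The existence of \<open>q\<close> also forces
  \<open>F\<close> to be the graph of a function, so that \<open>card F\<close> points are really
  fixed.\<close>

lemma card_permutes_prescribed_le:
 assumes "F <= {..<n} \<times> UNIV" "finite F" "n > 0"
 shows "real (card {p. p permutes {..<n} & (ALL (i,k):F. p i = k)}) <= fact n * (exp 1 / real n) ^ card F"
proof (cases "{p. p permutes {..<n} & (ALL (i,k):F. p i = k)} = {}")
 case True
 then show ?thesis unfolding True by simp
next
 case False
 then obtain q where "q permutes {..<n} & (ALL (i,k):F. q i = k)" by blast
 then have q: "q permutes {..<n}" "!!i k. (i,k) : F ==> q i = k" by auto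
 define J where "J = fst ` F"
 have inj: "inj_on fst F" by (rule inj_onI) (metis q(2) prod.collapse)
 have cJ: "card J = card F" unfolding J_def by (rule card_image[OF inj])
 have J: "J <= {..<n}" using assms unfolding J_def by auto
 let ?P = "{p. p permutes {..<n} & (ALL (i,k):F. p i = k)}"
 have "card ?P <= card {p. p permutes ({..<n} - J)}"
 proof (rule card_inj_on_le[where f = "%p. inv_into UNIV q \<circ> p"])
  show "inj_on (%p. inv_into UNIV q \<circ> p) ?P"
   using permutes_inv_o(1)[OF q(1)] by (metis (no_types, lifting) inj_onI comp_assoc id_comp)
  show "(%p. inv_into UNIV q \<circ> p) ` ?P <= {p. p permutes {..<n} - J}"
  proof
   fix p' assume "p' : (%p. inv_into UNIV q \<circ> p) ` ?P"
   then obtain p where p': "p' = inv_into UNIV q \<circ> p" and p: "p permutes {..<n}" "ALL (i,k):F. p i = k" by blast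
   have "p' permutes {..<n}" unfolding p' using p(1) q(1) by (intro permutes_compose permutes_inv)
   moreover have "p' x = x" if "x : J" for x
   proof -
    from that obtain k where "(x,k) : F" unfolding J_def by auto
    then have "p x = q x" using p(2) q(2) by fastforce
    then show ?thesis unfolding p' by (simp add: permutes_inverses[OF q(1)])
   qed
   ultimately show "p' : {p. p permutes {..<n} - J}"
    by (auto intro!: permutes_superset[of _ "{..<n}"])
  qed
 qed (auto simp: finite_permutations)
 also have "... = fact (n - card F)"
  using J by (subst card_permutations[OF refl]) (auto simp: card_Diff_subset finite_subset cJ)
 finally have "real (card ?P) <= real (fact (n - card F))" by (rule of_nat_mono)
 then have "real (card ?P) <= fact (n - card F)" by (simp only: of_nat_fact)
 also have "... <= fact n * (exp 1 / real n) ^ card F"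
  using J cJ assms(3) by (intro fact_diff_le_exp_power) (metis card_lessThan card_mono finite_lessThan)+
 finally show ?thesis .
qed

lemma card_tuples_prescribed_le:
 assumes "E <= {..<d} \<times> {..<n} \<times> UNIV" "finite E" "n > 0"
 shows "real (card {P : tuples n d. ALL (l,i,k):E. P l i = k}) <= card (tuples n d) * (exp 1 / real n) ^ card E"
proof -
 define F where "F l = {(i,k). (l,i,k) : E}" for l
 have fF: "finite (F l)" for l
  unfolding F_def by (rule finite_subset[of _ "snd ` E"]) (force simp: assms(2))+
 have FF: "F l <= {..<n} \<times> UNIV" for l using assms(1) unfolding F_def by auto
 have ES: "E = Sigma {..<d} F" using assms(1) unfolding F_def by auto
 have cE: "card E = (SUM l<d. card (F l))" unfolding ES by (rule card_SigmaI) (auto simp: fF)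
 have "{P : tuples n d. ALL (l,i,k):E. P l i = k} =
  PiE_dflt {..<d} id (%l. {p. p permutes {..<n} & (ALL (i,k):F l. p i = k)})"
  using assms(1) unfolding tuples_def PiE_dflt_def F_def by fastforce
 then have "real (card {P : tuples n d. ALL (l,i,k):E. P l i = k}) =
  (PROD l<d. real (card {p. p permutes {..<n} & (ALL (i,k):F l. p i = k)}))"
  by (simp, subst card_PiE_dflt) (auto simp: finite_permutations)
 also have "... <= (PROD l<d. fact n * (exp 1 / real n) ^ card (F l))"
  by (intro prod_mono conjI card_permutes_prescribed_le FF fF assms) auto
 also have "... = card (tuples n d) * (exp 1 / real n) ^ card E"
  by (simp add: prod.distrib card_perm_tuples cE power_sum)
 finally show ?thesis .
qed

lemma permutes_swap_compose:
 "p permutes S ==> i : S ==> j : S ==> (p \<circ> Transposition.transpose i j) permutes S"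
 by (intro permutes_compose permutes_swap_id)

text \<open>Given that \<open>A\<close> avoids \<open>T\<close>, all values in \<open>T\<close> are
  taken at the \<open>n - card A\<close> positions outside \<open>A\<close>. By swaps these
  positions are equally likely to hit \<open>T\<close>, so the next one does so with conditional
  probability at least \<open>card T / n\<close>.\<close>

lemma card_permutes_avoid_le:
 assumes "A <= {..<n}" "T <= {..<n}" "n > 0"
 shows "real (card {p. p permutes {..<n} & (ALL i:A. p i ~: T)}) <= fact n * (1 - card T / n) ^ card A"
proof -
 have "finite A" using assms finite_subset by blast
 then show ?thesis using assms(1)
 proof (induction A)
  case empty
  have "card {p. p permutes {..<n}} = fact n" by (simp add: card_permutations)
  then have "real (card {p. p permutes {..<n}}) = fact n" by (simp only: of_nat_fact)
  then show ?case by simp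
 next
  case (insert i A)
  define N where "N = {p. p permutes {..<n} & (ALL i:A. p i ~: T)}"
  define B where "B j = {p : N. p j : T}" for j
  have fN: "finite N" unfolding N_def by (rule finite_subset[OF _ finite_permutations[of "{..<n}"]]) auto
  have IH: "real (card N) <= fact n * (1 - card T / n) ^ card A" using insert unfolding N_def by auto
  have fT: "finite T" using assms finite_subset by blast
  have Tn: "card T <= n" using assms(2) by (metis card_lessThan card_mono finite_lessThan)
  have eq: "card (B j) = card (B i)" if j: "j : {..<n} - A" for j
  proof (rule bij_betw_same_card[of "%p. p \<circ> Transposition.transpose i j"], rule bij_betwI[where g = "%p. p \<circ> Transposition.transpose i j"])
   have tr: "Transposition.transpose i j k = k" if "k : A" for k
    using that j insert.hyps by (auto simp: Transposition.transpose_def)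
   show "(%p. p \<circ> Transposition.transpose i j) : B j \<rightarrow> B i" "(%p. p \<circ> Transposition.transpose i j) : B i \<rightarrow> B j"
    using j insert.prems unfolding B_def N_def
    by (auto intro!: permutes_swap_compose simp: tr)
  qed (auto simp: comp_assoc transpose_comp_involutory)
  have "(n - card A) * card (B i) = (SUM j:{..<n} - A. card (B j))"
  proof -
   have "A <= {..<n}" using insert.prems by simp
   then have "card ({..<n} - A) = n - card A" using insert.hyps(1) by (simp add: card_Diff_subset)
   moreover have "(SUM j:{..<n} - A. card (B j)) = (SUM j:{..<n} - A. card (B i))" by (intro sum.cong refl eq)
   ultimately show ?thesis by simp
  qed
  also have "... = (SUM j:{..<n} - A. SUM p:N. of_bool (p j : T))"
   unfolding B_def using fN by (intro sum.cong refl) (simp add: Int_def)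
  also have "... = (SUM p:N. SUM j:{..<n} - A. of_bool (p j : T))" by (rule sum.swap)
  also have "... = (SUM p:N. card T)"
  proof (rule sum.cong[OF refl])
   fix p assume p: "p : N"
   have "bij_betw p {j : {..<n} - A. p j : T} T"
   proof (rule bij_betw_imageI)
    show "inj_on p {j : {..<n} - A. p j : T}" using p permutes_inj[of p "{..<n}"] unfolding N_def by (auto intro: inj_on_subset)
    show "p ` {j : {..<n} - A. p j : T} = T"
    proof safe
     fix t assume t: "t : T"
     then have "t < n" using assms by auto
     then obtain j where "j < n" "p j = t" using p unfolding N_def
      by (metis (mono_tags, lifting) image_iff lessThan_iff mem_Collect_eq permutes_image)
     then show "t : p ` {j : {..<n} - A. p j : T}" using t p unfolding N_def by auto
    qed
   qed
   then have "card {j : {..<n} - A. p j : T} = card T" by (rule bij_betw_same_card)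
   then show "(SUM j:{..<n} - A. of_bool (p j : T)) = card T" by (simp add: Int_def)
  qed
  finally have "(n - card A) * card (B i) = card N * card T" by simp
  then have "card N * card T <= n * card (B i)"
   by (metis diff_le_self mult_le_mono1)
  then have "real (card N) * card T <= n * real (card (B i))" by (metis of_nat_le_iff of_nat_mult)
  then have Bi: "real (card (B i)) >= card N * (card T / n)" using assms(3) by (simp add: field_simps)
  have "{p. p permutes {..<n} & (ALL i:insert i A. p i ~: T)} = N - B i" unfolding N_def B_def by auto
  then have "real (card {p. p permutes {..<n} & (ALL i:insert i A. p i ~: T)}) = real (card N) - card (B i)"
   using fN by (simp add: card_Diff_subset B_def of_nat_diff card_mono)
  also have "... <= real (card N) * (1 - card T / n)" using Bi by (simp add: algebra_simps)
  also have "... <= (fact n * (1 - card T / n) ^ card A) * (1 - card T / n)"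
   using Tn assms(3) by (intro mult_right_mono IH) (simp add: field_simps)
  finally show ?case using insert by (simp add: mult_ac)
 qed
qed

lemma card_tuples_avoid_le:
 assumes "A <= {..<d} \<times> {..<n}" "T <= {..<n}" "n > 0"
 shows "real (card {P : tuples n d. ALL (l,i):A. P l i ~: T}) <= card (tuples n d) * (1 - card T / n) ^ card A"
proof -
 define F where "F l = {i. (l,i) : A}" for l
 have FF: "F l <= {..<n}" for l using assms(1) unfolding F_def by auto
 have ES: "A = Sigma {..<d} F" using assms(1) unfolding F_def by auto
 have cE: "card A = (SUM l<d. card (F l))" unfolding ES
  by (rule card_SigmaI) (auto intro: finite_subset[OF FF])
 have "{P : tuples n d. ALL (l,i):A. P l i ~: T} =
  PiE_dflt {..<d} id (%l. {p. p permutes {..<n} & (ALL i:F l. p i ~: T)})"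
  using assms(1) unfolding tuples_def PiE_dflt_def F_def by fastforce
 then have "real (card {P : tuples n d. ALL (l,i):A. P l i ~: T}) =
  (PROD l<d. real (card {p. p permutes {..<n} & (ALL i:F l. p i ~: T)}))"
  by (simp, subst card_PiE_dflt) (auto simp: finite_permutations)
 also have "... <= (PROD l<d. fact n * (1 - card T / n) ^ card (F l))"
  by (intro prod_mono conjI card_permutes_avoid_le FF assms) auto
 also have "... = card (tuples n d) * (1 - card T / n) ^ card A"
  by (simp add: prod.distrib card_perm_tuples cE power_sum)
 finally show ?thesis .
qed

text \<open>The change of variables \<open>h p\<close> leaves all other factors alone, so the factor
  \<open>f p\<close> may be replaced by its mean over \<open>x\<close> and \<open>h p x\<close>,
  which is at most 1; the factors are removed one at a time. This takes the place of independence of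
  the row pairs.\<close>

lemma sum_prod_involution_le:
 fixes f :: "'p => 'x => real"
 assumes "finite P" "finite X"
  and "!!p x. p : P ==> x : X ==> f p x >= 0"
  and "!!p. p : P ==> bij_betw (h p) X X"
  and "!!p x. p : P ==> x : X ==> f p x + f p (h p x) <= 2"
  and "!!p q x. p : P ==> q : P ==> p ~= q ==> x : X ==> f q (h p x) = f q x"
 shows "(SUM x:X. PROD p:P. f p x) <= card X"
 using assms(1,3-)
proof (induction P)
 case empty
 then show ?case by simp
next
 case (insert p P)
 have inv: "(PROD q:P. f q (h p x)) = (PROD q:P. f q x)" if "x : X" for x
  using that insert by (intro prod.cong refl insert.prems(4)) auto
 have "(SUM x:X. f p x * (PROD q:P. f q x)) = (SUM x:X. f p (h p x) * (PROD q:P. f q (h p x)))"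
  using sum.reindex_bij_betw[OF insert.prems(2)[of p], of "%x. f p x * (PROD q:P. f q x)"] by simp
 also have "... = (SUM x:X. f p (h p x) * (PROD q:P. f q x))" by (intro sum.cong refl) (simp add: inv)
 finally have "2 * (SUM x:X. f p x * (PROD q:P. f q x)) = (SUM x:X. (f p x + f p (h p x)) * (PROD q:P. f q x))"
  by (simp add: sum.distrib algebra_simps)
 also have "... <= (SUM x:X. 2 * (PROD q:P. f q x))"
  using insert.prems by (intro sum_mono mult_right_mono prod_nonneg) auto
 also have "... = 2 * (SUM x:X. PROD q:P. f q x)" by (simp add: sum_distrib_left)
 finally have "(SUM x:X. f p x * (PROD q:P. f q x)) <= (SUM x:X. PROD q:P. f q x)" by simp
 also have "... <= card X" using insert.prems by (intro insert.IH) auto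
 finally show ?case using insert by simp
qed

section \<open>Antichains and the Littlewood-Offord inequality\<close>

text \<open>By averaging over the ground sets with one point removed.\<close>
lemma LYM_inequality:
 assumes "finite S" "F <= Pow S" "!!A B. A : F ==> B : F ==> A <= B ==> A = B"
 shows "(SUM A:F. 1 / real (card S choose card A)) <= 1"
 using assms
proof (induction "card S" arbitrary: S F)
 case 0
 then have "S = {}" by simp
 then have "F <= {{}}" using 0 by simp
 then have "F = {} \<or> F = {{}}" by blast
 then show ?case by (auto simp: \<open>S = {}\<close>)
next
 case (Suc m)
 have fF: "finite F" using Suc.prems by (meson finite_Pow_iff finite_subset)
 show ?case
 proof (cases "S : F")
  case True
  then have "F = {S}" using Suc.prems by blast
  then show ?thesis by simp
 next
  case False
  define Fx where "Fx x = {A : F. x ~: A}" for x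
  have cA: "card A <= m" if "A : F" for A
  proof -
   have "A \<subset> S" using that False Suc.prems by blast
   then show ?thesis using Suc.hyps Suc.prems(1) psubset_card_mono[of S A] by simp
  qed
  have "(SUM A:Fx x. 1 / real (m choose card A)) <= 1" if x: "x : S" for x
  proof -
   have "card (S - {x}) = m" using Suc x by simp
   moreover have "(SUM A:Fx x. 1 / real (card (S - {x}) choose card A)) <= 1"
    using Suc x by (intro Suc.hyps(1)) (auto simp: Fx_def)
   ultimately show ?thesis by simp
  qed
  then have "(SUM x:S. SUM A:Fx x. 1 / real (m choose card A)) <= (SUM x:S. 1)" by (intro sum_mono)
  also have "... = Suc m" using Suc by simp
  also have "(SUM x:S. SUM A:Fx x. 1 / real (m choose card A)) = (SUM A:F. SUM x:S - A. 1 / real (m choose card A))"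
   unfolding Fx_def sum.swap_restrict[OF Suc.prems(1) fF]
   by (intro sum.cong refl) (auto intro!: sum.cong simp: set_diff_eq)
  also have "... = (SUM A:F. real (Suc m) * (1 / real (card S choose card A)))"
  proof (rule sum.cong[OF refl])
   fix A assume A: "A : F"
   have c: "card (S - A) = Suc m - card A" using A Suc
    by (metis PowD card_Diff_subset finite_subset in_mono)
   have "(Suc m - card A) * (Suc m choose card A) = Suc m * (m choose card A)"
    using binomial_absorb_comp[of "Suc m" "card A"] by simp
   then have e: "real (Suc m - card A) * real (Suc m choose card A) = real (Suc m) * real (m choose card A)"
    by (metis of_nat_mult)
   have "real (m choose card A) > 0" "real (Suc m choose card A) > 0" using cA[OF A] by (simp_all add: zero_less_binomial)
   then show "(SUM x:S - A. 1 / real (m choose card A)) = real (Suc m) * (1 / real (card S choose card A))"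
    using e by (simp add: c Suc.hyps(2)[symmetric] field_simps del: of_nat_Suc binomial_Suc_Suc)
  qed
  finally have "real (Suc m) * (SUM A:F. 1 / real (card S choose card A)) <= real (Suc m)"
   by (simp add: sum_distrib_left)
  then show ?thesis by (simp del: of_nat_Suc)
 qed
qed

text \<open>Consecutive central coefficients have ratio \<open>2 * (2k+1) / (k+1)\<close>, and the
  geometric mean of \<open>2k+1\<close> and \<open>2k+3\<close> is at most \<open>2k+2\<close>, so
  the product with the square root grows at most by the factor 4.\<close>

lemma central_binomial_upper: "real (2 * k choose k) * sqrt (2 * real k + 1) <= 4 ^ k"
proof (induction k)
 case (Suc k)
 define c where "c = real (2 * k choose k)"
 have "Suc k * (Suc k * (2 * Suc k choose Suc k)) = Suc k * (2 * (2 * k + 1) * (2 * k choose k))"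
 proof -
  have "Suc k * (2 * Suc k choose Suc k) = 2 * Suc k * ((2*k+1) choose k)"
   using Suc_times_binomial_eq[of "2*k+1" k] by simp
  moreover have "Suc k * ((2*k+1) choose k) = (2*k+1) * (2*k choose k)"
   using binomial_absorb_comp[of "2*k+1" k] by simp
  ultimately show ?thesis by (simp add: algebra_simps)
 qed
 then have "Suc k * (2 * Suc k choose Suc k) = 2 * (2 * k + 1) * (2 * k choose k)"
  by (metis Suc_not_Zero mult_cancel1)
 then have "real (Suc k) * real (2 * Suc k choose Suc k) = 2 * (2 * real k + 1) * c"
  unfolding c_def by (subst of_nat_mult[symmetric]) (simp only: of_nat_mult of_nat_add of_nat_1 of_nat_numeral)
 then have e: "real (2 * Suc k choose Suc k) = 2 * (2 * real k + 1) * c / (real k + 1)"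
  by (simp add: field_simps)
 have s: "sqrt (2 * real k + 1) * sqrt (2 * real k + 3) <= 2 * (real k + 1)"
  by (rule power2_le_imp_le) (auto simp: power_mult_distrib power2_eq_square algebra_simps)
 have "real (2 * Suc k choose Suc k) * sqrt (2 * real (Suc k) + 1)
   = 2 * (c * sqrt (2 * real k + 1)) * (sqrt (2 * real k + 1) * sqrt (2 * real k + 3)) / (real k + 1)"
 proof -
  have a: "2 * real k + 1 = sqrt (2 * real k + 1) * sqrt (2 * real k + 1)" by simp
  have b: "2 * real (Suc k) + 1 = 2 * real k + 3" by simp
  have "2 * x * c / (real k + 1) * y = 2 * (c * u) * (u * y) / (real k + 1)" if "x = u * u" for x y u :: real
   using that by (simp add: field_simps)
  from this[OF a] show ?thesis unfolding e b .
 qed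
 also have "... <= 2 * 4 ^ k * (2 * (real k + 1)) / (real k + 1)"
  using Suc unfolding c_def[symmetric] by (intro divide_right_mono mult_mono s) (auto simp: c_def)
 also have "... = 4 ^ Suc k" by (simp add: field_simps)
 finally show ?case .
qed simp

lemma binomial_le_two_power_div_sqrt:
 assumes "m > 0"
 shows "real (m choose k) <= 2 ^ m / sqrt (real m)"
proof -
 have "real (m choose k) <= real (m choose (m div 2))" by (simp add: binomial_maximum)
 also have "... <= 2 ^ m / sqrt (real m)"
 proof (cases "even m")
  case True
  then obtain j where j: "m = 2 * j" by auto
  have "real (2 * j choose j) * sqrt (real m) <= real (2 * j choose j) * sqrt (2 * real j + 1)"
   using j by (intro mult_left_mono) auto
  then have "real (m choose (m div 2)) * sqrt (real m) <= 2 ^ m"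
   using order_trans[OF _ central_binomial_upper[of j]] j by (simp add: power_mult)
  then show ?thesis using assms by (simp add: field_simps)
 next
  case False
  then obtain j where j: "m = 2 * j + 1" by (metis oddE)
  \<comment> \<open>The middle coefficient of an odd row is half of the next central one, which
    reduces the odd case to the bound for central coefficients.\<close>
  have "2 * (2 * j + 1 choose j) = (2 * Suc j choose Suc j)"
   using binomial_symmetric[of j "2*j+1"] by simp
  then have h: "2 * real (2 * j + 1 choose j) = real (2 * Suc j choose Suc j)" by (metis of_nat_mult of_nat_numeral)
  have "2 * real (m choose (m div 2)) * sqrt (real m) <= real (2 * Suc j choose Suc j) * sqrt (2 * real (Suc j) + 1)"
   unfolding h[symmetric] using j by (intro mult_mono) auto
  also have "... <= 4 ^ Suc j" by (rule central_binomial_upper)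
  also have "... = 2 * 2 ^ m" using j by (simp add: power_mult)
  finally show ?thesis using assms by (simp add: field_simps)
 qed
 finally show ?thesis .
qed

lemma Sperner_bound:
 assumes "finite S" "S ~= {}" "F <= Pow S" "!!A B. A : F ==> B : F ==> A <= B ==> A = B"
 shows "real (card F) <= 2 ^ card S / sqrt (card S)"
proof -
 define N where "N = 2 ^ card S / sqrt (card S)"
 have c: "card S > 0" using assms by (simp add: card_gt_0_iff)
 have "card F * (1 / N) = (SUM A:F. 1 / N)" by simp
 also have "... <= (SUM A:F. 1 / real (card S choose card A))"
  unfolding N_def using assms c binomial_le_two_power_div_sqrt[OF c]
  by (intro sum_mono divide_left_mono mult_pos_pos)
   (auto simp: zero_less_binomial card_mono subset_iff)
 also have "... <= 1" by (rule LYM_inequality) (use assms in auto)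
 finally show ?thesis using c unfolding N_def by (simp add: field_simps)
qed

text \<open>Erdos's argument: the symmetric difference with the set of negative coefficients makes
  all of them positive. Enlarging a set then raises the sum by at least \<open>2 * th\<close>, the
  full width of the window, so the admissible sets form an antichain.\<close>

lemma Littlewood_Offord_real:
 fixes c :: "'a => real"
 assumes S: "finite S" "S ~= {}" and c: "!!l. l : S ==> \<bar>c l\<bar> >= th" and "th > 0"
 shows "real (card {Z : Pow S. \<bar>(SUM l:S. if l : Z then c l else - c l) - b\<bar> < th}) <= 2 ^ card S / sqrt (card S)"
proof -
 define N where "N = {l : S. c l < 0}"
 define sd where "sd Z = (Z - N) \<union> (N - Z)" for Z
 have sdd: "sd (sd Z) = Z" for Z unfolding sd_def by auto
 define F0 where "F0 = {Z : Pow S. \<bar>(SUM l:S. if l : Z then c l else - c l) - b\<bar> < th}"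
 have eq: "(SUM l:S. if l : Z then c l else - c l) = (SUM l:S. if l : sd Z then \<bar>c l\<bar> else - \<bar>c l\<bar>)" for Z
  by (rule sum.cong) (auto simp: sd_def N_def)
 have inj: "inj_on sd F0" by (metis inj_on_inverseI sdd)
 have "real (card (sd ` F0)) <= 2 ^ card S / sqrt (card S)"
 proof (rule Sperner_bound[OF S])
  show "sd ` F0 <= Pow S" unfolding F0_def sd_def N_def by auto
  fix A B assume A: "A : sd ` F0" and B: "B : sd ` F0" and "A <= B"
  have AS: "A <= S" "B <= S" using A B unfolding F0_def sd_def N_def by auto
  let ?s = "%A. (SUM l:S. if l : A then \<bar>c l\<bar> else - \<bar>c l\<bar>)"
  have sA: "\<bar>?s A - b\<bar> < th" "\<bar>?s B - b\<bar> < th" using A B unfolding F0_def eq by (auto simp: sdd)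
  show "A = B"
  proof (rule ccontr)
   assume "A ~= B"
   then obtain x where x: "x : B" "x ~: A" using \<open>A <= B\<close> by auto
   have "?s B - ?s A = (SUM l:S. if l : B - A then 2 * \<bar>c l\<bar> else 0)"
    unfolding sum_subtractf[symmetric] using \<open>A <= B\<close> by (intro sum.cong) auto
   also have "... >= (SUM l:{x}. if l : B - A then 2 * \<bar>c l\<bar> else 0)"
    using x AS S by (intro sum_mono2) auto
   finally have "?s B - ?s A >= 2 * th" using x AS c[of x] by auto
   then show False using sA by linarith
  qed
 qed
 then show ?thesis unfolding card_image[OF inj] unfolding F0_def .
qed

text \<open>For at least half of the large coefficients the same one of real and imaginary part is
  at least \<open>th / 2\<close>; hence the halved window and the 2 under the root. The signs at all
  other indices are frozen and only shift the centre.\<close>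

lemma Littlewood_Offord_complex:
 fixes c :: "'a => complex"
 assumes S: "finite S" and D: "D <= card {l : S. cmod (c l) >= th}" "D > 0" and "th > 0"
 shows "real (card {Z : Pow S. cmod ((SUM l:S. if l : Z then c l else - c l) - b) < th / 2}) <= 2 ^ card S * sqrt (2 / D)"
proof -
 let ?s = "%Z. SUM l:S. if l : Z then c l else - c l" and ?t = "%(f :: complex => real) Z. SUM l:S. if l : Z then f (c l) else - f (c l)"
 have main: "real (card {Z : Pow S. \<bar>?t f Z - f b\<bar> < th / 2}) <= 2 ^ card S * sqrt (2 / D)"
  if h: "card {l : S. \<bar>f (c l)\<bar> >= th / 2} * 2 >= D" for f :: "complex => real"
 proof -
  define S1 where "S1 = {l : S. \<bar>f (c l)\<bar> >= th / 2}"
  have "card S1 > 0" using h D(2) unfolding S1_def by (intro Nat.gr0I) simp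
  then have S1: "finite S1" "S1 <= S" "S1 ~= {}" unfolding S1_def by (auto simp: card_gt_0_iff)
  define g where "g Z = (SUM l:S1. if l : Z then f (c l) else - f (c l))" for Z
  define g2 where "g2 Z = (SUM l:S-S1. if l : Z then f (c l) else - f (c l))" for Z
  have split: "?t f Z = g (Z \<inter> S1) + g2 (Z - S1)" for Z
   unfolding g_def g2_def using S S1 by (subst sum.subset_diff[of S1 S]) (auto simp: algebra_simps intro!: sum.cong arg_cong2[of _ _ _ _ "(+)"])
  let ?F = "{Z : Pow S. \<bar>?t f Z - f b\<bar> < th / 2}"
  let ?G = "%Y. {Z : Pow S1. \<bar>g Z - (f b - g2 Y)\<bar> < th / 2}"
  have "card ?F <= card (Sigma (Pow (S - S1)) ?G)"
  proof (rule card_inj_on_le[where f = "%Z. (Z - S1, Z \<inter> S1)"])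
   show "inj_on (%Z. (Z - S1, Z \<inter> S1)) ?F" by (auto simp: inj_on_def)
   show "(%Z. (Z - S1, Z \<inter> S1)) ` ?F <= Sigma (Pow (S - S1)) ?G"
    unfolding split by (auto simp: algebra_simps)
   show "finite (Sigma (Pow (S - S1)) ?G)" using S S1 by auto
  qed
  also have "... = (SUM Y:Pow (S - S1). card (?G Y))" using S S1 by (intro card_SigmaI) auto
  finally have "card ?F <= (SUM Y:Pow (S - S1). card (?G Y))" .
  then have "real (card ?F) <= real (SUM Y:Pow (S - S1). card (?G Y))" by (rule of_nat_mono)
  then have "real (card ?F) <= (SUM Y:Pow (S - S1). real (card (?G Y)))" by (simp only: of_nat_sum)
  also have "... <= (SUM Y:Pow (S - S1). 2 ^ card S1 / sqrt (card S1))"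
   unfolding g_def using \<open>th > 0\<close> S1 by (intro sum_mono Littlewood_Offord_real) (auto simp: S1_def)
  also have "... = 2 ^ card (S - S1) * 2 ^ card S1 / sqrt (card S1)"
   using S by (simp add: card_Pow)
  also have "... = 2 ^ card S / sqrt (card S1)"
   using S S1 by (simp flip: power_add add: card_Diff_subset card_mono)
  also have "... <= 2 ^ card S * sqrt (2 / D)"
  proof -
   have "real D <= 2 * real (card S1)" using h unfolding S1_def by linarith
   moreover have "card S1 > 0" using S1 by (simp add: card_gt_0_iff)
   ultimately have "1 / real (card S1) <= 2 / D" using D(2) by (simp add: field_simps)
   then have "1 / sqrt (card S1) <= sqrt (2 / D)" by (metis real_sqrt_divide real_sqrt_le_iff real_sqrt_one)
   then have "2 ^ card S * (1 / sqrt (card S1)) <= 2 ^ card S * sqrt (2 / D)" by (intro mult_left_mono) auto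
   then show ?thesis by simp
  qed
  finally show ?thesis .
 qed
 have "{l : S. cmod (c l) >= th} <= {l : S. \<bar>Re (c l)\<bar> >= th / 2} \<union> {l : S. \<bar>Im (c l)\<bar> >= th / 2}"
  using cmod_le by (smt (verit, ccfv_threshold) Un_iff field_sum_of_halves mem_Collect_eq subsetI)
 then have "card {l : S. cmod (c l) >= th} <= card {l : S. \<bar>Re (c l)\<bar> >= th / 2} + card {l : S. \<bar>Im (c l)\<bar> >= th / 2}"
  using S by (intro order_trans[OF card_mono card_Un_le]) auto
 then consider "card {l : S. \<bar>Re (c l)\<bar> >= th / 2} * 2 >= D" | "card {l : S. \<bar>Im (c l)\<bar> >= th / 2} * 2 >= D"
  using D by linarith
 then obtain f where f: "f = Re \<or> f = Im" "card {l : S. \<bar>f (c l)\<bar> >= th / 2} * 2 >= D" by metis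
 have sub: "{Z : Pow S. cmod (?s Z - b) < th / 2}
  <= {Z : Pow S. \<bar>?t f Z - f b\<bar> < th / 2}"
 proof safe
  fix Z assume "cmod (?s Z - b) < th / 2"
  moreover have "f (?s Z - b) = ?t f Z - f b"
   using f(1) by (auto intro!: sum.cong)
  moreover have "\<bar>f x\<bar> <= cmod x" for x using f(1) abs_Re_le_cmod abs_Im_le_cmod by auto
  ultimately show "\<bar>?t f Z - f b\<bar> < th / 2"
   by (metis order_le_less_trans)
 qed
 have "real (card {Z : Pow S. cmod (?s Z - b) < th / 2})
  <= real (card {Z : Pow S. \<bar>?t f Z - f b\<bar> < th / 2})"
  using S by (intro of_nat_mono card_mono[OF _ sub]) auto
 also have "... <= 2 ^ card S * sqrt (2 / D)" by (rule main[OF f(2)])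
 finally show ?thesis .
qed

lemma binomial_le_exp_power:
 assumes "k > 0"
 shows "real (N choose k) <= (exp 1 * N / k) ^ k"
proof -
 have e: "real k ^ k / fact k <= exp (real k)"
 proof -
  have "(SUM j:{k}. real k ^ j /\<^sub>R fact j) <= (\<Sum>j. real k ^ j /\<^sub>R fact j)"
   using summable_exp_generic[of "real k"] by (intro sum_le_suminf) auto
  then show ?thesis unfolding exp_def by (simp add: field_simps)
 qed
 have ek: "exp (1::real) ^ k = exp (real k)" by (metis exp_of_nat_mult mult.right_neutral)
 have "(N choose k) * fact k <= N ^ k" by (rule binomial_fact_pow)
 then have "real (N choose k) * fact k <= real N ^ k" by (metis of_nat_fact of_nat_le_iff of_nat_mult of_nat_power)
 then have "real (N choose k) <= real N ^ k / fact k" by (simp add: field_simps)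
 also have "... = (real N ^ k / real k ^ k) * (real k ^ k / fact k)" using assms by simp
 also have "... <= (real N ^ k / real k ^ k) * exp (real k)" by (intro mult_left_mono e) auto
 also have "... = (exp 1 * N / k) ^ k" by (simp add: power_divide power_mult_distrib ek)
 finally show ?thesis .
qed

lemma card_tuples_contains_le:
 assumes "finite \<E>" "!!E. E : \<E> ==> E <= {..<d} \<times> {..<n} \<times> UNIV & finite E & card E = b" "n > 0"
 shows "real (card {P : tuples n d. EX E:\<E>. ALL (l,i,k):E. P l i = k}) <= card (tuples n d) * (card \<E> * (exp 1 / real n) ^ b)"
proof -
 have "{P : tuples n d. EX E:\<E>. ALL (l,i,k):E. P l i = k} = (UN E:\<E>. {P : tuples n d. ALL (l,i,k):E. P l i = k})"
  by blast
 then have "real (card {P : tuples n d. EX E:\<E>. ALL (l,i,k):E. P l i = k}) <= real (SUM E:\<E>. card {P : tuples n d. ALL (l,i,k):E. P l i = k})"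
  using card_UN_le[OF assms(1)] by (intro of_nat_mono) simp
 also have "... <= (SUM E:\<E>. card (tuples n d) * (exp 1 / real n) ^ b)"
  unfolding of_nat_sum
 proof (rule sum_mono)
  fix E assume "E : \<E>"
  then show "real (card {P : tuples n d. ALL (l,i,k):E. P l i = k}) <= card (tuples n d) * (exp 1 / real n) ^ b"
   using card_tuples_prescribed_le[of E d n] assms by auto
 qed
 finally show ?thesis by (simp add: mult_ac)
qed

section \<open>The least singular value\<close>

definition swap_at :: "nat => nat => nat => perms => nat => nat => nat" where
 "swap_at l i j P = P(l := P l \<circ> Transposition.transpose i j)"

lemma swap_at_apply: "swap_at l i j P l' k = (if l' = l then P l (Transposition.transpose i j k) else P l' k)"
 by (simp add: swap_at_def)

lemma swap_at_simps [simp]: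
 "swap_at l i j P l i = P l j" "swap_at l i j P l j = P l i"
 "l' ~= l ==> swap_at l i j P l' k = P l' k"
 "k ~= i ==> k ~= j ==> swap_at l i j P l' k = P l' k"
 by (auto simp: swap_at_apply)

lemma swap_at_in: "P : tuples n d ==> l < d ==> i < n ==> j < n ==> swap_at l i j P : tuples n d"
 by (auto simp: tuples_def PiE_dflt_def swap_at_def intro!: permutes_swap_compose)

lemma swap_at_swap_at [simp]: "swap_at l i j (swap_at l i j P) = P"
 by (auto simp: swap_at_def comp_assoc transpose_comp_involutory fun_eq_iff)

lemma bij_swap_at: "l < d ==> i < n ==> j < n ==> bij_betw (swap_at l i j) (tuples n d) (tuples n d)"
 by (rule bij_betwI[where g = "swap_at l i j"]) (auto intro: swap_at_in)

text \<open>This is \<open>S - w\<close>, with \<open>S\<close> not normalized, acting on a vector.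
  Writing it as a sum over the permutations shows that a swap in one of them alters one summand in
  each of two rows.\<close>

definition perm_op :: "nat => complex => perms => (nat => complex) => nat => complex" where
 "perm_op d w P v i = (SUM l<d. v (P l i)) - w * v i"

lemma perm_op_diff: "perm_op d w P (%i. u i - v i) i = perm_op d w P u i - perm_op d w P v i"
 by (simp add: perm_op_def sum_subtractf algebra_simps)

lemma perm_op_scale: "perm_op d w P (%i. c * v i) i = c * perm_op d w P v i"
 by (simp add: perm_op_def sum_distrib_left algebra_simps)

lemma perm_op_const: "perm_op d w P (%i. c) i = (of_nat d - w) * c"
 by (simp add: perm_op_def algebra_simps)

lemma perm_op_norm_le:
 assumes "P : tuples n d" "i < n" "!!k. k < n ==> cmod (v k) <= b"
 shows "cmod (perm_op d w P v i) <= (d + cmod w) * b"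
proof -
 have "cmod (perm_op d w P v i) <= (SUM l<d. cmod (v (P l i))) + cmod w * cmod (v i)"
  unfolding perm_op_def
  by (rule order_trans[OF norm_triangle_ineq4 add_mono[OF norm_sum]]) (simp add: norm_mult)
 also have "... <= (SUM l<d. b) + cmod w * b"
  using assms by (intro add_mono sum_mono mult_left_mono) auto
 finally show ?thesis by (simp add: algebra_simps)
qed

text \<open>A slot \<open>l\<close> is good for the row pair \<open>{2p, 2p+1}\<close> if exactly one of its two images is relevant:
 interchanging them then visibly changes the difference of the two row sums.\<close>
definition good_slot :: "nat set => nat set => perms => nat => nat => bool" where
 "good_slot T' T P p l \<longleftrightarrow> P l (2*p) : T' & P l (2*p+1) ~: T \<or> P l (2*p+1) : T' & P l (2*p) ~: T"

definition good_pair :: "nat => nat set => nat set => perms => nat => bool" where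
 "good_pair d0 T' T P p \<longleftrightarrow> (EX l<d0. good_slot T' T P p l)"

definition good_count :: "nat => nat => nat set => nat set => perms => nat" where
 "good_count n d0 T' T P = card {p. p < n div 2 & good_pair d0 T' T P p}"

text \<open>Goodness is symmetric in the two rows. Hence the least good slot of a pair is not
  changed by swapping there, and the map that performs this swap is an involution of the sample
  space.\<close>

lemma good_slot_swap:
 "good_slot T' T (swap_at l (2*p) (2*p+1) P) q l' = good_slot T' T P q l'"
proof (cases "q = p")
 case True
 then show ?thesis by (cases "l' = l") (auto simp: good_slot_def)
next
 case False
 then have "2*q ~= 2*p" "2*q ~= 2*p+1" "2*q+1 ~= 2*p" "2*q+1 ~= 2*p+1" by presburger+
 then show ?thesis by (simp add: good_slot_def)
qed

lemma good_pair_swap: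
 "good_pair d0 T' T (swap_at l (2*p) (2*p+1) P) q = good_pair d0 T' T P q"
 unfolding good_pair_def good_slot_swap ..

text \<open>At a good pair, a configuration and its swap are not both balanced, since swapping moves
  the row difference by at least \<open>2 * \<sigma>\<close>. Weighting balanced good pairs by 2,
  other balanced pairs by 1 and unbalanced ones by 0 gives factors of mean at most 1, whose product
  is at least \<open>2 ^ h\<close> on the event.\<close>

lemma card_pairs_balanced_le:
 fixes v :: "nat => complex"
 assumes d0: "d0 <= d" and v0: "!!k. k ~: T ==> v k = 0" and v1: "!!k. k : T' ==> cmod (v k) >= \<sigma>"
 shows "real (card {P : tuples n d. (ALL p < n div 2. cmod (perm_op d w P v (2*p) - perm_op d w P v (2*p+1)) < \<sigma>) & h <= good_count n d0 T' T P}) * 2 ^ h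
  <= card (tuples n d)"
proof -
 define ok where "ok P p \<longleftrightarrow> cmod (perm_op d w P v (2*p) - perm_op d w P v (2*p+1)) < \<sigma>" for P p
 define f :: "nat => perms => real" where
  "f p P = (if ok P p then if good_pair d0 T' T P p then 2 else 1 else 0)" for p P
 define lp where "lp P p = (LEAST l. l < d0 & good_slot T' T P p l)" for P p
 define h' where "h' p P = (if good_pair d0 T' T P p then swap_at (lp P p) (2*p) (2*p+1) P else P)" for p P
 have lp: "lp P p < d0" "good_slot T' T P p (lp P p)" if "good_pair d0 T' T P p" for P p
  using that LeastI_ex[of "%l. l < d0 & good_slot T' T P p l"] unfolding lp_def good_pair_def by auto
 have lp_swap: "lp (swap_at l (2*p) (2*p+1) P) q = lp P q" for l p P q
  unfolding lp_def good_slot_swap ..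
 let ?Om = "tuples n d"
 have "(SUM P:?Om. PROD p<n div 2. f p P) <= card ?Om"
 proof (rule sum_prod_involution_le[where h = h'])
  fix p assume p: "p : {..<n div 2}"
  then have pn: "2*p < n" "2*p+1 < n" by auto
  have h'in: "h' p P : ?Om" if "P : ?Om" for P
   using that pn lp(1)[of P p] d0 unfolding h'_def by (auto intro!: swap_at_in)
  have h'h': "h' p (h' p P) = P" for P
   unfolding h'_def using good_pair_swap lp_swap by auto
  show "bij_betw (h' p) ?Om ?Om"
   by (rule bij_betwI[where g = "h' p"]) (auto simp: h'in h'h')
  fix P assume pi: "P : ?Om"
  show "f p P >= 0" by (simp add: f_def)
  show "f p P + f p (h' p P) <= 2"
  proof (cases "good_pair d0 T' T P p")
   case True
   define l where "l = lp P p"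
   have l: "l < d" "good_slot T' T P p l" using lp[OF True] d0 unfolding l_def by auto
   have h'eq: "h' p P = swap_at l (2*p) (2*p+1) P" unfolding h'_def l_def using True by simp
   have rows: "perm_op d w (h' p P) v (2*p) = perm_op d w P v (2*p) - v (P l (2*p)) + v (P l (2*p+1))"
    "perm_op d w (h' p P) v (2*p+1) = perm_op d w P v (2*p+1) - v (P l (2*p+1)) + v (P l (2*p))"
   proof -
    have s: "(SUM la<d. v (swap_at l (2*p) (2*p+1) P la k)) = (SUM la<d. v (P la k)) - v (P l k) + v (swap_at l (2*p) (2*p+1) P l k)" for k
    proof -
     have "(SUM la:{..<d}-{l}. v (swap_at l (2*p) (2*p+1) P la k)) = (SUM la:{..<d}-{l}. v (P la k))"
      by (intro sum.cong) auto
     then show ?thesis using l(1) by (simp add: sum.remove[of "{..<d}" l])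
    qed
    show "perm_op d w (h' p P) v (2*p) = perm_op d w P v (2*p) - v (P l (2*p)) + v (P l (2*p+1))"
     "perm_op d w (h' p P) v (2*p+1) = perm_op d w P v (2*p+1) - v (P l (2*p+1)) + v (P l (2*p))"
     unfolding perm_op_def h'eq s by simp_all
   qed
   have big: "cmod (v (P l (2*p)) - v (P l (2*p+1))) >= \<sigma>"
    using l(2) v0 v1 unfolding good_slot_def by (auto simp: norm_minus_commute)
   have "~ (ok P p & ok (h' p P) p)"
   proof
    assume a: "ok P p & ok (h' p P) p"
    have "2 * (v (P l (2*p)) - v (P l (2*p+1))) =
     (perm_op d w P v (2*p) - perm_op d w P v (2*p+1)) - (perm_op d w (h' p P) v (2*p) - perm_op d w (h' p P) v (2*p+1))"
     unfolding rows by simp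
    then have "cmod (2 * (v (P l (2*p)) - v (P l (2*p+1)))) <= cmod (perm_op d w P v (2*p) - perm_op d w P v (2*p+1))
     + cmod (perm_op d w (h' p P) v (2*p) - perm_op d w (h' p P) v (2*p+1))"
     by (metis norm_triangle_ineq4)
    then have "2 * cmod (v (P l (2*p)) - v (P l (2*p+1))) < 2 * \<sigma>"
     using a unfolding ok_def norm_mult by simp
    then show False using big by simp
   qed
   then show ?thesis unfolding f_def using True by auto
  next
   case False
   then show ?thesis unfolding f_def h'_def by auto
  qed
  fix q assume q: "q : {..<n div 2}" "p ~= q"
  then have ne: "2*q ~= 2*p" "2*q ~= 2*p+1" "2*q+1 ~= 2*p" "2*q+1 ~= 2*p+1" by presburger+
  have "ok (swap_at l (2*p) (2*p+1) P) q = ok P q" for l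
   unfolding ok_def perm_op_def using ne by simp
  then show "f q (h' p P) = f q P" unfolding f_def h'_def using good_pair_swap by simp
 qed auto
 moreover have "(SUM P:{P : ?Om. (ALL p < n div 2. ok P p) & h <= good_count n d0 T' T P}. 2 ^ h) <= (SUM P:?Om. PROD p<n div 2. f p P)"
 proof (rule sum_le_included[where i = "%x. x"])
  show "ALL x:{P : ?Om. (ALL p < n div 2. ok P p) & h <= good_count n d0 T' T P}.
   EX y:?Om. y = x & (2::real) ^ h <= (PROD p<n div 2. f p y)"
  proof safe
   fix P assume a: "P : ?Om" "ALL p < n div 2. ok P p" "h <= good_count n d0 T' T P"
   have "(PROD p<n div 2. f p P) = (PROD p<n div 2. if good_pair d0 T' T P p then 2 else 1)"
    using a(2) by (intro prod.cong) (auto simp: f_def)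
   also have "... = 2 ^ good_count n d0 T' T P"
    by (simp add: prod.If_cases good_count_def Int_def)
   also have "... >= 2 ^ h" using a(3) by (intro power_increasing) auto
   finally show "EX y:?Om. y = P & (2::real) ^ h <= (PROD p<n div 2. f p y)" using a by blast
  qed
 qed (auto simp: f_def intro!: prod_nonneg)
 ultimately show ?thesis unfolding ok_def by simp
qed

section \<open>Abundance of good pairs by first moment counting\<close>

definition partner :: "nat => nat" where "partner i = (if even i then i + 1 else i - 1)"

lemma partner_div [simp]: "partner i div 2 = i div 2"
 unfolding partner_def by (auto elim!: evenE oddE)

text \<open>Exactly \<open>d0 * m\<close> entries (slot, row) have their image in \<open>T'\<close>.
  If few row pairs are good, then either \<open>4 * h\<close> of these entries have a partner row
  whose image also lies in \<open>T\<close> (configurations \<open>E1\<close>), or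
  \<open>4 * h\<close> of the remaining ones sit in at most \<open>h\<close> row pairs
  (configurations \<open>E2\<close>). Either way \<open>4 * h\<close> values are prescribed, and a
  union bound over the configurations leaves a factor \<open>(1/2) ^ h\<close>.\<close>

lemma card_few_good_pairs_le:
 assumes T: "T' <= T" "T <= {..<n}" "card T' = m" "card T <= m'"
  and d0: "d0 <= d" and h: "8 * h <= d0 * m" "d0 * m <= 16 * h" "h > 0"
  and n: "128 * (d0 * m) <= n" "432 * m' <= n"
 shows "real (card {P : tuples n d. good_count n d0 T' T P < h}) <= card (tuples n d) * (2 * (1/2) ^ h)"
proof -
 let ?I = "%Hs. {i. i < n & i div 2 : Hs}" and ?B = "(2 * h * (d0 * m)) choose (4*h)"
 let ?F = "%Hs. {E. E <= {..<d0} \<times> ?I Hs \<times> T' & card E = 4*h}" and ?H = "{Hs. Hs <= {..n div 2} & card Hs = h}"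
 let ?x = "exp 1 * (real (d0*m) * n * m') / (2*h)" and ?y = "exp 1 * real (2 * h * (d0 * m)) / real (4 * h)"
 have n0: "n > 0" using h n by (metis gr0I le_zero_eq mult_eq_0_iff not_numeral_le_zero zero_neq_numeral)
 have fT: "finite T" "finite T'" using T finite_subset by (blast, metis finite_lessThan finite_subset)
 define Uts where "Uts = {..<d0} \<times> {..<n} \<times> T' \<times> T"
 define ed :: "nat \<times> nat \<times> nat \<times> nat => (nat \<times> nat \<times> nat) set"
  where "ed = (%(l,i,t,t'). {(l,i,t),(l,partner i,t')})"
 define E1 where "E1 = {E. EX W. W <= Uts & card W = 2*h & E = (UN u:W. ed u) & card E = 4*h & E <= {..<d} \<times> {..<n} \<times> UNIV}"
 define E2 where "E2 = {E. EX Hs. Hs <= {..n div 2} & card Hs = h & E <= {..<d0} \<times> ?I Hs \<times> T' & card E = 4*h}"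
 have fUn: "finite Uts" unfolding Uts_def using fT by auto
 have E1s: "E1 <= (%W. UN u:W. ed u) ` {W. W <= Uts & card W = 2*h}" unfolding E1_def by auto
 have fE1: "finite E1" by (rule finite_subset[OF E1s]) (use fUn in auto)
 have "card E1 <= card {W. W <= Uts & card W = 2*h}"
  using fUn by (intro order_trans[OF card_mono[OF _ E1s] card_image_le]) auto
 also have "... = card Uts choose (2*h)" by (rule n_subsets[OF fUn])
 finally have cE1: "real (card E1) <= real (card Uts choose (2*h))" by simp
 have cUn: "real (card Uts) <= real (d0 * m) * n * m'"
 proof -
  have "card Uts = d0 * (n * (m * card T))" unfolding Uts_def using T(3) by (simp add: card_cartesian_product)
  also have "... <= d0 * (n * (m * m'))" using T(4) by simp
  finally have "real (card Uts) <= real (d0 * (n * (m * m')))" by (rule of_nat_mono)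
  then show ?thesis by (simp add: algebra_simps)
 qed
 have e3: "exp 1 <= (3::real)" by (rule exp_le)
 have b1: "card E1 * (exp 1 / real n) ^ (4*h) <= (1/2) ^ h"
 proof -
  have "real (card Uts choose (2*h)) <= (exp 1 * card Uts / (2*h)) ^ (2*h)"
   using binomial_le_exp_power[of "2*h" "card Uts"] h by simp
  also have "... <= ?x ^ (2*h)"
   by (intro power_mono divide_right_mono mult_left_mono cUn) auto
  finally have "card E1 * (exp 1 / real n) ^ (4*h) <= ?x ^ (2*h) * (exp 1 / real n) ^ (4*h)"
   using cE1 by (intro mult_right_mono) auto
  also have "... = (?x * (exp 1 / real n) ^ 2) ^ (2*h)"
   by (simp only: power_mult_distrib power_mult[symmetric]) (simp add: mult.commute)
  also have "... <= (1/2) ^ (2*h)"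
  proof (rule power_mono)
   have "?x * (exp 1 / real n) ^ 2 = exp 1 ^ 3 * (real (d0*m) / (2*h)) * (m' / n)"
    using n0 by (simp add: power2_eq_square power3_eq_cube field_simps)
   \<comment> \<open>The origin of 432: \<open>27 * 8 / 432 = 1/2\<close>, where
     \<open>d0 * m <= 16 * h\<close> supplies the 8.\<close>
   also have "... <= 3 ^ 3 * 8 * (1/432)"
   proof (intro mult_mono power_mono)
    have "real (d0*m) <= real (16 * h)" using h(2) by (rule of_nat_mono)
    then show "real (d0*m) / (2*h) <= 8" using h(3) by (simp add: field_simps)
    have "real (432 * m') <= n" using n(2) by (rule of_nat_mono)
    then show "real m' / n <= 1/432" using n0 by (simp add: field_simps)
   qed (use e3 in auto)
   finally show "?x * (exp 1 / real n) ^ 2 <= 1/2" by simp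
  qed auto
  also have "... <= (1/2) ^ h" by (intro power_decreasing) auto
  finally show ?thesis .
 qed
 have E2s: "E2 <= (UN Hs:?H. (?F Hs))"
  unfolding E2_def by blast
 have fE2': "finite (?F Hs)" for Hs
  by (rule finite_subset[of _ "Pow ({..<d0} \<times> ?I Hs \<times> T')"]) (use fT in auto)
 have fE2: "finite E2" by (rule finite_subset[OF E2s]) (use fE2' in auto)
 have cHs: "card (?F Hs) <= ?B"
  if Hs: "Hs <= {..n div 2}" "card Hs = h" for Hs
 proof -
  have fHs: "finite Hs" using Hs finite_subset by blast
  have "?I Hs <= (%(p,b'). 2*p+b') ` (Hs \<times> {0,1})"
  proof safe
   fix i assume "i div 2 : Hs"
   then have "(i div 2, i mod 2) : Hs \<times> {0,1}" by auto
   moreover have "i = (%(p,b'). 2*p+b') (i div 2, i mod 2)" by simp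
   ultimately show "i : (%(p,b'). 2*p+b') ` (Hs \<times> {0,1})" by (rule rev_image_eqI)
  qed
  then have "card (?I Hs) <= card (Hs \<times> {0,1::nat})"
   using fHs by (intro order_trans[OF card_mono card_image_le]) auto
  also have "... = 2 * h" using Hs by (simp add: card_cartesian_product)
  finally have "card (?I Hs) <= 2 * h" .
  then have "card ({..<d0} \<times> ?I Hs \<times> T') <= d0 * (2 * h * m)"
   using T(3) by (simp add: card_cartesian_product)
  then have c: "card ({..<d0} \<times> ?I Hs \<times> T') <= 2 * h * (d0 * m)" by (simp add: mult_ac)
  have "card (?F Hs) = card ({..<d0} \<times> ?I Hs \<times> T') choose (4*h)"
   by (rule n_subsets) (use fT in auto)
  also have "... <= ?B" by (rule binomial_right_mono[OF c])
  finally show ?thesis .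
 qed
 have b2: "card E2 * (exp 1 / real n) ^ (4*h) <= (1/2) ^ h"
 proof -
  have "card E2 <= (SUM Hs:?H. card (?F Hs))"
   by (rule order_trans[OF card_mono[OF _ E2s] card_UN_le]) (use fE2' in auto)
  also have "... <= (SUM Hs:?H. ?B)"
   by (intro sum_mono cHs) auto
  also have "... = (Suc (n div 2) choose h) * ?B"
   by (simp add: n_subsets)
  also have "... <= (n choose h) * ?B"
  proof -
   have "Suc (n div 2) <= n" using n h by (cases "n >= 2") auto
   then show ?thesis by (intro mult_right_mono binomial_right_mono) auto
  qed
  finally have "card E2 <= (n choose h) * ?B" .
  then have "real (card E2) <= real (n choose h) * real ?B"
   by (simp only: of_nat_mult[symmetric] of_nat_le_iff)
  also have "... <= (exp 1 * n / h) ^ h * ?y ^ (4*h)"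
   using h by (intro mult_mono binomial_le_exp_power) auto
  finally have "card E2 * (exp 1 / real n) ^ (4*h) <= (exp 1 * n / h) ^ h * ?y ^ (4*h) * (exp 1 / real n) ^ (4*h)"
   by (intro mult_right_mono) auto
  also have "... = ((exp 1 * n / h) * (?y * (exp 1 / real n)) ^ 4) ^ h"
   by (simp only: power_mult_distrib power_mult mult.assoc)
  also have "... <= (1/2) ^ h"
  proof (rule power_mono)
   have k16: "real (d0*m) <= 16 * h" using h(2) by (metis of_nat_le_iff of_nat_mult of_nat_numeral)
   have hn: "real h / n <= 1/1024"
   proof -
    have "1024 * h <= n" using h n by linarith
    then have "real (1024 * h) <= n" by (rule of_nat_mono)
    then show ?thesis using n0 by (simp add: field_simps)
   qed
   have "?y * (exp 1 / real n) = exp 1 ^ 2 * real (d0 * m) / (2 * n)"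
    using h by (simp add: field_simps power2_eq_square)
   also have "... <= exp 1 ^ 2 * (16 * h) / (2 * n)"
    by (intro divide_right_mono mult_left_mono k16) auto
   also have "... = 8 * exp 1 ^ 2 * (h / n)" by simp
   finally have "(exp 1 * n / h) * (?y * (exp 1 / real n)) ^ 4
    <= (exp 1 * n / h) * (8 * exp 1 ^ 2 * (h / n)) ^ 4"
    by (intro mult_left_mono power_mono) auto
   also have "... = 4096 * exp 1 ^ 9 * (h / n) ^ 3"
    using h n0 by (simp add: power_mult_distrib field_simps eval_nat_numeral)
   also have "... <= 4096 * 3 ^ 9 * (1/1024) ^ 3"
    by (intro mult_mono power_mono hn e3) auto
   also have "... <= 1/2" by (simp add: power3_eq_cube)
   finally show "(exp 1 * n / h) * (?y * (exp 1 / real n)) ^ 4 <= 1/2" .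
  qed auto
  finally show ?thesis .
 qed
 let ?C = "%\<E>. {P : tuples n d. EX E:\<E>. ALL (l,i,k):E. P l i = k}"
 have sub: "{P : tuples n d. good_count n d0 T' T P < h} <= ?C E1 \<union> ?C E2"
 proof
  fix P assume "P : {P : tuples n d. good_count n d0 T' T P < h}"
  then have pi: "P : tuples n d" and few: "good_count n d0 T' T P < h" by auto
  have perm: "P l permutes {..<n}" if "l < d0" for l using tuples_permutes[OF pi] that d0 by auto
  define Fl where "Fl l = {i. i < n & P l i : T'}" for l
  define SL where "SL = Sigma {..<d0} Fl"
  have "card (Fl l) = m" if "l < d0" for l
  proof -
   have "bij_betw (P l) (Fl l) T'"
   proof (rule bij_betw_imageI)
    show "inj_on (P l) (Fl l)" using permutes_inj[OF perm[OF that]] by (auto intro: inj_on_subset)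
    have "t : P l ` Fl l" if "t : T'" for t
    proof -
     have "t : P l ` {..<n}" using that T permutes_image[OF perm[OF \<open>l < d0\<close>]] by auto
     then show ?thesis using that unfolding Fl_def by auto
    qed
    then show "P l ` Fl l = T'" unfolding Fl_def by auto
   qed
   then show ?thesis using T(3) bij_betw_same_card by metis
  qed
  then have cSL: "card SL = d0 * m" unfolding SL_def by (subst card_SigmaI) (auto simp: Fl_def)
  have fSL: "finite SL" unfolding SL_def Fl_def by auto
  define Bad where "Bad = {(l,i) : SL. partner i < n & P l (partner i) : T}"
  have BadS: "Bad <= SL" unfolding Bad_def by auto
  have fBad: "finite Bad" using BadS fSL finite_subset by blast
  show "P : ?C E1 \<union> ?C E2"
  proof (cases "card Bad >= 4*h")
   case True
   \<comment> \<open>Two bad entries may share slot and row pair and would then prescribe the same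
     two values. One representative per block makes the prescriptions disjoint, at the cost of
     halving their number.\<close>
   define blk where "blk = (%(l::nat,i::nat). (l, i div 2))"
   have "card Bad <= 2 * card (blk ` Bad)"
   proof -
    have "Bad <= (%((l,p),b'). (l,2*p+b')) ` ((blk ` Bad) \<times> {0,1})"
    proof safe
     fix l i assume b: "(l,i) : Bad"
     have "((l,i div 2),i mod 2) : (blk ` Bad) \<times> {0,1}" using b unfolding blk_def by force
     moreover have "(l,i) = (%((l,p),b'). (l,2*p+b')) ((l,i div 2),i mod 2)" by simp
     ultimately show "(l,i) : (%((l,p),b'). (l,2*p+b')) ` ((blk ` Bad) \<times> {0,1})" by (rule rev_image_eqI)
    qed
    then have "card Bad <= card ((blk ` Bad) \<times> {0,1::nat})"
     using fBad by (intro order_trans[OF card_mono card_image_le]) auto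
    then show ?thesis by (simp add: card_cartesian_product)
   qed
   then have "2*h <= card (blk ` Bad)" using True by linarith
   then obtain Q where Q: "Q <= blk ` Bad" "card Q = 2*h" using obtain_subset_with_card_n by metis
   have "ALL q:Q. EX b:Bad. blk b = q" using Q by blast
   then obtain r where r: "!!q. q : Q ==> r q : Bad & blk (r q) = q" by metis
   define un where "un = (%(l,i). (l::nat,i::nat,P l i,P l (partner i)))"
   define W where "W = un ` r ` Q"
   let ?e = "%((l,p),b'). (l,2*p+b',P l (2*p+b'))"
   have injr: "inj_on r Q" by (metis r inj_onI)
   have inju: "inj un" unfolding un_def inj_def by auto
   have cW: "card W = 2*h" unfolding W_def using Q(2) card_image[OF injr] card_image[OF inj_on_subset[OF inju subset_UNIV]] by metis
   have WU: "W <= Uts"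
   proof -
    have "un b : Uts" if "b : Bad" for b
     using that unfolding un_def Uts_def Bad_def SL_def Fl_def by auto
    then show ?thesis unfolding W_def using r by blast
   qed
   define E where "E = (UN u:W. ed u)"
   have Eeq: "E = (UN q:Q. ed (un (r q)))" unfolding E_def W_def by auto
   have edun: "ed (un b) = {(l,i,k). (l, i div 2) = blk b & k = P l i}" for b
   proof -
    obtain l i where b: "b = (l,i)" by (cases b)
    have "j = i \<or> j = partner i" if "j div 2 = i div 2" for j
     using that unfolding partner_def by (cases "even i"; cases "even j") (auto elim!: evenE oddE)
    then show ?thesis unfolding b ed_def un_def blk_def by auto
   qed
   have Eeq2: "E = ?e ` (Q \<times> {0,1})"
   proof -
    have "E = {(l,i,k). (l,i div 2) : Q & k = P l i}" unfolding Eeq edun using r by auto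
    also have "... = ?e ` (Q \<times> {0,1})" (is "_ = ?R")
    proof safe
     fix l i assume b: "(l,i div 2) : Q"
     then have "((l,i div 2),i mod 2) : Q \<times> {0,1}" by force
     moreover have "(l,i,P l i) = ?e ((l,i div 2),i mod 2)" by simp
     ultimately show "(l,i,P l i) : ?R" by (rule rev_image_eqI)
    qed auto
    finally show ?thesis .
   qed
   have "inj_on ?e (Q \<times> {0,1::nat})"
    by (rule inj_onI) (auto, presburger+)
   then have "card E = card (Q \<times> {0,1::nat})" unfolding Eeq2 by (rule card_image)
   then have cE: "card E = 4*h" using Q(2) by (simp add: card_cartesian_product)
   have "E <= {..<d} \<times> {..<n} \<times> UNIV"
   proof -
    have "ed (un b) <= {..<d} \<times> {..<n} \<times> UNIV" if "b : Bad" for b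
     using that d0 unfolding ed_def un_def Bad_def SL_def Fl_def by auto
    then show ?thesis unfolding Eeq using r by blast
   qed
   then have "E : E1" unfolding E1_def using WU cW cE E_def by blast
   moreover have "ALL (l,i,k):E. P l i = k" unfolding Eeq edun by auto
   ultimately show ?thesis using pi by blast
  next
   case False
   define Gd where "Gd = SL - Bad"
   have "card Gd = card SL - card Bad" unfolding Gd_def using BadS fBad by (simp add: card_Diff_subset)
   then have "card Gd >= 4*h" using False cSL h by linarith
   then obtain Q where Q: "Q <= Gd" "card Q = 4*h" using obtain_subset_with_card_n by metis
   \<comment> \<open>For odd \<open>n\<close> the last row has no partner below \<open>n\<close>; it
     is counted as an extra pair with index \<open>n div 2\<close>. The strict bound
     \<open>good_count < h\<close> leaves room for it.\<close>
   define Gp where "Gp = insert (n div 2) {p. p < n div 2 & good_pair d0 T' T P p}"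
   have "card Gp <= h" unfolding Gp_def using few card_insert_le_m1[of h "{p. p < n div 2 & good_pair d0 T' T P p}"] h
    by (simp add: good_count_def card_insert_if)
   moreover have "Gp <= {..n div 2}" unfolding Gp_def by auto
   moreover have "h <= card {..n div 2}" using h n by simp
   ultimately obtain Hs where Hs: "Gp <= Hs" "Hs <= {..n div 2}" "card Hs = h"
    using exists_subset_between[of Gp h "{..n div 2}"] by auto
   have blkG: "i div 2 : Gp" if g: "(l,i) : Gd" for l i
   proof (cases "i div 2 < n div 2")
    case True
    have li: "l < d0" "i < n" "P l i : T'" using g unfolding Gd_def SL_def Fl_def by auto
    have "partner i < n" using True li unfolding partner_def by (auto elim!: evenE)
    then have nT: "P l (partner i) ~: T" using g unfolding Gd_def Bad_def by auto
    have "good_slot T' T P (i div 2) l"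
     using li(3) nT unfolding good_slot_def partner_def by (cases "even i") (auto elim!: evenE oddE)
    then show ?thesis unfolding Gp_def good_pair_def using True li by auto
   next
    case False
    moreover have "i < n" using g unfolding Gd_def SL_def Fl_def by auto
    then have "i div 2 <= n div 2" by (simp add: div_le_mono)
    ultimately show ?thesis unfolding Gp_def by auto
   qed
   define E where "E = (%(l,i). (l,i,P l i)) ` Q"
   have "inj_on (%(l,i). (l,i,P l i)) Q" by (auto simp: inj_on_def)
   then have cE: "card E = 4*h" unfolding E_def using Q(2) by (simp add: card_image)
   have "E <= {..<d0} \<times> ?I Hs \<times> T'"
   proof
    fix e assume "e : E"
    then obtain l i where e: "e = (l,i,P l i)" "(l,i) : Gd" unfolding E_def using Q(1) by auto
    have "i div 2 : Hs" using blkG[OF e(2)] Hs by auto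
    then show "e : {..<d0} \<times> ?I Hs \<times> T'"
     using e unfolding Gd_def SL_def Fl_def by auto
   qed
   then have "E : E2" unfolding E2_def using Hs cE by blast
   moreover have "ALL (l,i,k):E. P l i = k" unfolding E_def by auto
   ultimately show ?thesis using pi by blast
  qed
 qed
 have "real (card {P : tuples n d. good_count n d0 T' T P < h}) <= real (card (?C E1)) + real (card (?C E2))"
 proof -
  have "card {P : tuples n d. good_count n d0 T' T P < h} <= card (?C E1) + card (?C E2)"
   by (rule order_trans[OF card_mono[OF _ sub] card_Un_le]) auto
  then show ?thesis by (simp only: of_nat_add[symmetric] of_nat_le_iff)
 qed
 also have "... <= card (tuples n d) * (card E1 * (exp 1 / real n) ^ (4*h)) + card (tuples n d) * (card E2 * (exp 1 / real n) ^ (4*h))"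
 proof (intro add_mono card_tuples_contains_le fE1 fE2 n0)
  have c4: "card E = 4 * h ==> finite E" for E :: "(nat \<times> nat \<times> nat) set" using h(3) by (metis card.infinite mult_is_0 not_gr0 zero_neq_numeral)
  show "E <= {..<d} \<times> {..<n} \<times> UNIV & finite E & card E = 4 * h" if "E : E1" for E
   using that c4 unfolding E1_def by blast
  show "E <= {..<d} \<times> {..<n} \<times> UNIV & finite E & card E = 4 * h" if "E : E2" for E
  proof -
   from that obtain Hs where "E <= {..<d0} \<times> ?I Hs \<times> T'" "card E = 4*h" unfolding E2_def by blast
   then show ?thesis using c4[of E] d0 by fastforce
  qed
 qed
 also have "... <= card (tuples n d) * (1/2) ^ h + card (tuples n d) * (1/2) ^ h"
  by (intro add_mono mult_left_mono b1 b2) auto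
 finally show ?thesis by (simp add: algebra_simps)
qed

section \<open>Nets and gaps between coordinate scales\<close>

definition grid :: "real => complex set" where
 "grid del = (%(a,b). Complex (del * of_int a) (del * of_int b)) ` ({-\<lceil>1/del\<rceil>..\<lceil>1/del\<rceil>} \<times> {-\<lceil>1/del\<rceil>..\<lceil>1/del\<rceil>})"

lemma finite_grid [simp]: "finite (grid del)"
 by (simp add: grid_def)

lemma card_grid_le:
 assumes "0 < del" "del <= 1"
 shows "real (card (grid del)) <= (5 / del) ^ 2"
proof -
 let ?I = "{-\<lceil>1/del\<rceil>..\<lceil>1/del\<rceil>}"
 have c: "\<lceil>1/del\<rceil> >= 1" using assms by (simp add: one_le_ceiling)
 have I: "real (card ?I) <= 5 / del"
 proof -
  have "real (card ?I) = 2 * of_int \<lceil>1/del\<rceil> + 1" using c by (simp add: of_nat_nat del: one_le_ceiling)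
  also have "... <= 2 * (1/del + 1) + 1"
   using of_int_ceiling_le_add_one[of "1/del"] by (intro add_mono mult_left_mono) auto
  also have "... <= 5 / del" using assms by (simp add: field_simps)
  finally show ?thesis .
 qed
 have "card (grid del) <= card (?I \<times> ?I)" unfolding grid_def by (rule card_image_le) auto
 then have "real (card (grid del)) <= real (card ?I) * real (card ?I)" by (metis card_cartesian_product of_nat_le_iff of_nat_mult)
 also have "... <= (5/del) * (5/del)" using assms by (intro mult_mono I) auto
 finally show ?thesis by (simp add: power2_eq_square)
qed

lemma grid_approx:
 assumes "0 < del" "cmod y <= 1"
 shows "EX g:grid del. cmod (y - g) <= 2 * del"
proof -
 define a where "a = \<lfloor>Re y / del\<rfloor>"
 define b where "b = \<lfloor>Im y / del\<rfloor>"
 have r: "\<bar>Re y\<bar> <= 1" "\<bar>Im y\<bar> <= 1" using abs_Re_le_cmod[of y] abs_Im_le_cmod[of y] assms by auto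
 have fl: "\<lfloor>x / del\<rfloor> : {-\<lceil>1/del\<rceil>..\<lceil>1/del\<rceil>}" if "\<bar>x\<bar> <= 1" for x
 proof -
  have "x / del <= 1 / del" "- (1/del) <= x / del" using that assms by (simp_all add: field_simps)
  then have "\<lfloor>x / del\<rfloor> <= \<lfloor>1/del\<rfloor>" "\<lfloor>- (1/del)\<rfloor> <= \<lfloor>x / del\<rfloor>" by (simp_all add: floor_mono)
  moreover have "\<lfloor>1/del\<rfloor> <= \<lceil>1/del\<rceil>" by (rule floor_le_ceiling)
  ultimately show ?thesis by (simp add: ceiling_def)
 qed
 have fe: "\<bar>x - del * of_int \<lfloor>x / del\<rfloor>\<bar> <= del" for x
 proof -
  have "0 <= x / del - of_int \<lfloor>x / del\<rfloor>" "x / del - of_int \<lfloor>x / del\<rfloor> <= 1" by linarith+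
  then have "0 <= del * (x / del - of_int \<lfloor>x / del\<rfloor>)" "del * (x / del - of_int \<lfloor>x / del\<rfloor>) <= del * 1"
   using assms by (auto intro!: mult_left_mono)
  then show ?thesis using assms by (simp add: right_diff_distrib)
 qed
 let ?g = "Complex (del * of_int a) (del * of_int b)"
 have "?g : grid del" unfolding grid_def a_def b_def using fl[OF r(1)] fl[OF r(2)] by (intro image_eqI[of _ _ "(a,b)"]) (auto simp: a_def b_def)
 moreover have "cmod (y - ?g) <= \<bar>Re (y - ?g)\<bar> + \<bar>Im (y - ?g)\<bar>" by (rule cmod_le)
 moreover have "... <= del + del" unfolding a_def b_def using fe by (intro add_mono) auto
 ultimately show ?thesis by (intro bexI[of _ ?g]) auto
qed

definition net :: "nat => nat => real => (nat => complex) set" where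
 "net n m del = (UN T:{T. T <= {..<n} & card T = m}. PiE_dflt T 0 (%_. grid del))"

lemma finite_net: "finite (net n m del)"
 unfolding net_def by (intro finite_UN_I finite_PiE_dflt) (auto intro: finite_subset[of _ "{..<n}"])

lemma card_net_le:
 assumes "0 < del" "del <= 1"
 shows "real (card (net n m del)) <= (n * (5 / del) ^ 2) ^ m"
proof -
 let ?S = "{T. T <= {..<n} & card T = m}"
 have "card (net n m del) <= (SUM T:?S. card (PiE_dflt T 0 (%_. grid del)))"
  unfolding net_def by (rule card_UN_le) auto
 also have "... = (SUM T:?S. card (grid del) ^ m)"
  by (intro sum.cong refl, subst card_PiE_dflt) (auto intro: finite_subset[of _ "{..<n}"])
 also have "... = (n choose m) * card (grid del) ^ m" by (simp add: n_subsets)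
 also have "... <= n ^ m * card (grid del) ^ m"   proof (rule mult_right_mono)
  have "(n choose m) * 1 <= (n choose m) * fact m" by (intro mult_left_mono) auto
  also have "... <= n ^ m" by (rule binomial_fact_pow)
  finally show "(n choose m) <= n ^ m" by simp
 qed simp
 finally have "real (card (net n m del)) <= (real n * real (card (grid del))) ^ m"
  by (metis of_nat_le_iff of_nat_mult of_nat_power power_mult_distrib)
 also have "... <= (n * (5 / del) ^ 2) ^ m"
  by (intro power_mono mult_left_mono card_grid_le assms) auto
 finally show ?thesis .
qed

text \<open>The constant \<open>kappa\<close> is free because vectors will be studied modulo
  constants, and subtracting a constant from a vector shifts its image by a constant. The ratio
  \<open>40 * d\<close> between the two thresholds exceeds the bound \<open>2 * d\<close> for the
  sup norm of \<open>S - w\<close> by enough to absorb a discretization.\<close>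

definition gap_event :: "nat => nat => complex => nat => nat => real => perms => bool" where
 "gap_event n d w m m' tau P \<longleftrightarrow> (EX y kappa. (ALL i<n. cmod (y i) <= 1) & m <= card {i. i < n & tau <= cmod (y i)} &
  card {i. i < n & tau / (40 * d) < cmod (y i)} <= m' & (ALL i<n. cmod (perm_op d w P y i - kappa) <= tau / (40 * d)))"

text \<open>With \<open>del = tau / (40 * d)\<close>, discarding small coordinates and rounding the
  others to the grid moves the image by at most \<open>4 * d * del\<close>. In the difference of two
  rows \<open>kappa\<close> cancels and what remains is below \<open>tau / 2\<close>, a size that
  the large coordinates keep after rounding. So some net vector with \<open>m\<close> large entries
  has all its row pairs balanced, and a union bound over the net applies.\<close>

lemma card_gap_event_le:
 assumes d: "d > 0" "cmod w <= d" and tau: "0 < tau" "tau <= 1"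
  and d0: "d0 <= d" and h: "8 * h <= d0 * m" "d0 * m <= 16 * h" "h > 0"
  and n: "128 * (d0 * m) <= n" "432 * m' <= n"
 shows "real (card {P : tuples n d. gap_event n d w m m' tau P})
  <= card (tuples n d) * ((n * (200 * d / tau) ^ 2) ^ m' * (3 * (1/2) ^ h))"
proof -
 define del where "del = tau / (40 * d)"
 have del: "0 < del" "del <= 1" "tau = 40 * d * del" using tau d unfolding del_def by (auto simp: field_simps)
 let ?Om = "tuples n d"
 define \<sigma> where "\<sigma> = tau / 2"
 define T where "T v = {i. i < n & v i ~= 0}" for v :: "nat => complex"
 define Big where "Big v = {i. i < n & \<sigma> <= cmod (v i)}" for v :: "nat => complex"
 define N where "N = {v : net n m' del. m <= card (Big v)}"
 have fN: "finite N" unfolding N_def using finite_net by auto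
 define ev where "ev v P \<longleftrightarrow> (ALL p < n div 2. cmod (perm_op d w P v (2*p) - perm_op d w P v (2*p+1)) < \<sigma>)" for v P
 have single: "real (card {P : ?Om. ev v P}) <= card ?Om * (3 * (1/2) ^ h)" if v: "v : N" for v
 proof -
  obtain T' where T': "T' <= Big v" "card T' = m"
   using v obtain_subset_with_card_n unfolding N_def by blast
  obtain S where S: "S <= {..<n}" "card S = m'" "v : PiE_dflt S 0 (%_. grid del)"
   using v unfolding N_def net_def by blast
  have v0: "v k = 0" if "k ~: S" for k using S(3) that by (auto simp: PiE_dflt_def)
  have TS: "T v <= S" unfolding T_def using v0 by auto
  have cT: "card (T v) <= m'" using S TS by (metis card_mono finite_lessThan finite_subset)
  have T'T: "T' <= T v" using T' tau unfolding T_def Big_def \<sigma>_def by fastforce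
  have vT: "v k = 0" if "k ~: T v" for k using that v0 S(1) unfolding T_def by blast
  have vT': "\<sigma> <= cmod (v k)" if "k : T'" for k using that T' unfolding Big_def by auto
  let ?A = "{P : ?Om. ev v P & h <= good_count n d0 T' (T v) P}"
  let ?B = "{P : ?Om. good_count n d0 T' (T v) P < h}"
  have A: "real (card ?A) * 2 ^ h <= card ?Om"
   unfolding ev_def by (rule card_pairs_balanced_le[OF d0]) (use vT vT' in auto)
  have B: "real (card ?B) <= card ?Om * (2 * (1/2) ^ h)"
   by (rule card_few_good_pairs_le[OF T'T _ T'(2) cT d0 h n]) (auto simp: T_def)
  have "{P : ?Om. ev v P} <= ?A \<union> ?B" by auto
  then have "card {P : ?Om. ev v P} <= card ?A + card ?B"
   by (intro order_trans[OF card_mono card_Un_le]) auto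
  then have "real (card {P : ?Om. ev v P}) <= real (card ?A) + real (card ?B)" by (simp only: of_nat_add[symmetric] of_nat_le_iff)
  also have "... <= card ?Om * (1/2) ^ h + card ?Om * (2 * (1/2) ^ h)"
   using A B by (intro add_mono) (auto simp: power_one_over field_simps)
  finally show ?thesis by (simp add: algebra_simps)
 qed
 have sub: "{P : ?Om. gap_event n d w m m' tau P} <= (UN v:N. {P : ?Om. ev v P})"
 proof
  fix P assume "P : {P : ?Om. gap_event n d w m m' tau P}"
  then obtain y kappa where pi: "P : ?Om" and y: "!!i. i < n ==> cmod (y i) <= 1" "m <= card {i. i < n & tau <= cmod (y i)}"
   "card {i. i < n & del < cmod (y i)} <= m'" "!!i. i < n ==> cmod (perm_op d w P y i - kappa) <= del"
   unfolding gap_event_def del_def by blast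
  have "m' <= card {..<n}" using n by simp
  then obtain S where S: "{i. i < n & del < cmod (y i)} <= S" "S <= {..<n}" "card S = m'"
   using exists_subset_between[OF y(3), of "{..<n}"] by auto
  have "ALL i:S. EX g:grid del. cmod (y i - g) <= 2 * del"
   using S(2) by (intro ballI grid_approx del(1) y(1)) auto
  then obtain g where g: "!!i. i : S ==> g i : grid del" "!!i. i : S ==> cmod (y i - g i) <= 2 * del" by metis
  define v where "v i = (if i : S then g i else 0)" for i
  have near: "cmod (y i - v i) <= 2 * del" if "i < n" for i
   using that g(2) S(1) del(1) unfolding v_def by (cases "i : S"; force)
  have "v : net n m' del" unfolding net_def using S g(1) by (auto simp: PiE_dflt_def v_def)
  moreover have "{i. i < n & tau <= cmod (y i)} <= Big v"
  proof safe
   fix i assume i: "i < n" "tau <= cmod (y i)"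
   have "cmod (y i) <= cmod (v i) + 2 * del" using near[OF i(1)] norm_triangle_ineq2[of "y i" "v i"] by linarith
   moreover have "4 * del <= tau" using del d by (simp add: field_simps)
   ultimately show "i : Big v" using i unfolding Big_def \<sigma>_def by auto
  qed
  then have "m <= card (Big v)" by (rule order_trans[OF y(2) card_mono, rotated]) (auto simp: Big_def)
  ultimately have vN: "v : N" unfolding N_def by auto
  have pv: "cmod (perm_op d w P v i - kappa) <= 5 * d * del" if i: "i < n" for i
  proof -
   have "cmod (perm_op d w P (%i. y i - v i) i) <= (d + cmod w) * (2 * del)"
    by (rule perm_op_norm_le[OF pi i near])
   also have "... <= (d + d) * (2 * del)" using d del by (intro mult_right_mono add_left_mono) auto
   finally have "cmod (perm_op d w P y i - perm_op d w P v i) <= 4 * d * del" by (simp add: perm_op_diff)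
   moreover have "cmod (perm_op d w P v i - kappa) <= cmod (perm_op d w P y i - perm_op d w P v i) + cmod (perm_op d w P y i - kappa)"
    by (metis norm_minus_commute norm_triangle_ineq4 diff_add_cancel add_diff_eq norm_diff_triangle_le order_refl)
   ultimately have "cmod (perm_op d w P v i - kappa) <= 4 * d * del + del" using y(4)[OF i] by linarith
   also have "... <= 4 * d * del + d * del" using d del by simp
   finally show ?thesis by (simp add: algebra_simps)
  qed
  have "ev v P" unfolding ev_def
  proof (intro allI impI)
   fix p assume p: "p < n div 2"
   have "cmod (perm_op d w P v (2*p) - perm_op d w P v (2*p+1)) <= cmod (perm_op d w P v (2*p) - kappa) + cmod (perm_op d w P v (2*p+1) - kappa)"
    by (metis norm_minus_commute norm_diff_triangle_le order_refl)
   also have "... <= 5 * d * del + 5 * d * del" using p by (intro add_mono pv) auto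
   also have "... < \<sigma>" unfolding \<sigma>_def using del d by simp
   finally show "cmod (perm_op d w P v (2*p) - perm_op d w P v (2*p+1)) < \<sigma>" .
  qed
  then show "P : (UN v:N. {P : ?Om. ev v P})" using vN pi by blast
 qed
 have "card {P : ?Om. gap_event n d w m m' tau P} <= (SUM v:N. card {P : ?Om. ev v P})"
  by (rule order_trans[OF card_mono[OF _ sub] card_UN_le[OF fN]]) (use fN in auto)
 then have "real (card {P : ?Om. gap_event n d w m m' tau P}) <= (SUM v:N. real (card {P : ?Om. ev v P}))"
  by (simp only: of_nat_sum[symmetric] of_nat_le_iff)
 also have "... <= (SUM v:N. card ?Om * (3 * (1/2) ^ h))" by (intro sum_mono single)
 also have "... = card N * (card ?Om * (3 * (1/2) ^ h))" by simp
 also have "... <= (n * (5 / del) ^ 2) ^ m' * (card ?Om * (3 * (1/2) ^ h))"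
 proof (rule mult_right_mono)
  have "card N <= card (net n m' del)" unfolding N_def by (intro card_mono finite_net) auto
  then show "real (card N) <= (n * (5 / del) ^ 2) ^ m'" using card_net_le[OF del(1,2), of n m'] by linarith
 qed auto
 finally show ?thesis unfolding del_def by (simp add: field_simps)
qed

text \<open>Start from the single coordinate of modulus 1. Without a gap event at scale
  \<open>k\<close>, lowering the threshold by the factor \<open>40 * d\<close> multiplies the
  guaranteed number of coordinates above it by \<open>g\<close>, as long as it is below
  \<open>M\<close>. The condition \<open>M <= g ^ (K - 1)\<close> ensures that \<open>M\<close> is
  reached before the last step.\<close>

lemma gap_chain:
 assumes ev: "!!k. k < K ==> ~ gap_event n d w (min (g ^ k) M) (g * min (g ^ k) M) (1 / (40 * real d) ^ k) P"
  and K: "M <= g ^ (K - 1)" "K > 0" and d: "d > 0" and g: "g > 0"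
  and y: "!!i. i < n ==> cmod (y i) <= 1" "i0 < n" "cmod (y i0) = 1"
  and My: "!!i. i < n ==> cmod (perm_op d w P y i - kappa) <= 1 / (40 * real d) ^ K"
 shows "g * M < card {i. i < n & 1 / (40 * real d) ^ K < cmod (y i)}"
proof -
 have one: "(1::real) <= 40 * d" using d by simp
 have step: "min (g ^ k) M <= card {i. i < n & 1 / (40 * real d) ^ k <= cmod (y i)} -->
   g * min (g ^ k) M < card {i. i < n & 1 / (40 * real d) ^ Suc k < cmod (y i)}" if k: "k < K" for k
 proof
  assume a: "min (g ^ k) M <= card {i. i < n & 1 / (40 * real d) ^ k <= cmod (y i)}"
  have eq: "1 / (40 * real d) ^ k / real (40 * d) = 1 / (40 * real d) ^ Suc k" by (simp add: field_simps)
  have "1 / (40 * real d) ^ K <= 1 / (40 * real d) ^ Suc k"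
   using k one d by (intro divide_left_mono power_increasing mult_pos_pos zero_less_power) auto
  then have "ALL i<n. cmod (perm_op d w P y i - kappa) <= 1 / (40 * real d) ^ Suc k" using My order_trans by blast
  then have "~ card {i. i < n & 1 / (40 * real d) ^ Suc k < cmod (y i)} <= g * min (g ^ k) M"
  proof -
   assume b: "ALL i<n. cmod (perm_op d w P y i - kappa) <= 1 / (40 * real d) ^ Suc k"
   show ?thesis
   proof
    assume "card {i. i < n & 1 / (40 * real d) ^ Suc k < cmod (y i)} <= g * min (g ^ k) M"
    then have "gap_event n d w (min (g ^ k) M) (g * min (g ^ k) M) (1 / (40 * real d) ^ k) P"
     unfolding gap_event_def eq using a b y(1) by (intro exI[of _ y] exI[of _ kappa] conjI allI impI) (assumption | blast)+
    then show False using ev[OF k] by simp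
   qed
  qed
  then show "g * min (g ^ k) M < card {i. i < n & 1 / (40 * real d) ^ Suc k < cmod (y i)}" by simp
 qed
 have base: "min (g ^ k) M <= card {i. i < n & 1 / (40 * real d) ^ k <= cmod (y i)}" if "k < K" for k
  using that
 proof (induction k)
  case 0
  have "card {i0} <= card {i. i < n & 1 <= cmod (y i)}" using y by (intro card_mono) auto
  then show ?case by simp
 next
  case (Suc k)
  then have "g * min (g ^ k) M < card {i. i < n & 1 / (40 * real d) ^ Suc k < cmod (y i)}" using step by auto
  also have "... <= card {i. i < n & 1 / (40 * real d) ^ Suc k <= cmod (y i)}" by (intro card_mono) auto
  finally have "g * min (g ^ k) M <= card {i. i < n & 1 / (40 * real d) ^ Suc k <= cmod (y i)}" by simp
  moreover have "min (g ^ Suc k) M <= g * min (g ^ k) M"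
  proof -
   have "M <= g * M" using g by simp
   then show ?thesis by (cases "g ^ k <= M") (auto intro: order_trans[OF min.cobounded2])
  qed
  ultimately show ?case by linarith
 qed
 have "K - 1 < K" using K by simp
 then have "g * min (g ^ (K-1)) M < card {i. i < n & 1 / (40 * real d) ^ Suc (K-1) < cmod (y i)}"
  using step base by blast
 moreover have "min (g ^ (K-1)) M = M" "Suc (K-1) = K" using K by auto
 ultimately show ?thesis by metis
qed

section \<open>Separated coordinate sets and mixing of row pairs\<close>

lemma median_exists:
 fixes f :: "nat => real"
 assumes "n > 0"
 shows "EX c. n <= 2 * card {k. k < n & f k <= c} & n <= 2 * card {k. k < n & c <= f k}"
proof -
 define X where "X = {x : f ` {..<n}. n <= 2 * card {k. k < n & f k <= x}}"
 have "Max (f ` {..<n}) : X"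
 proof -
  have "{k. k < n & f k <= Max (f ` {..<n})} = {..<n}" by auto
  moreover have "Max (f ` {..<n}) : f ` {..<n}" using assms by (intro Max_in) auto
  ultimately show ?thesis unfolding X_def by simp
 qed
 then have X: "finite X" "X ~= {}" unfolding X_def by auto
 define c where "c = Min X"
 have cX: "c : X" unfolding c_def using X by (rule Min_in)
 have lt: "2 * card {k. k < n & f k < c} <= n"
 proof (cases "{k. k < n & f k < c} = {}")
  case True
  then show ?thesis unfolding True by simp
 next
  case False
  define x where "x = Max (f ` {k. k < n & f k < c})"
  have xin: "x : f ` {k. k < n & f k < c}" unfolding x_def using False by (intro Max_in) auto
  have "{k. k < n & f k < c} <= {k. k < n & f k <= x}" unfolding x_def by auto
  then have le: "card {k. k < n & f k < c} <= card {k. k < n & f k <= x}" by (intro card_mono) auto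
  have "x ~: X"
  proof
   assume "x : X"
   then have "c <= x" unfolding c_def using X by simp
   then show False using xin by auto
  qed
  then have "2 * card {k. k < n & f k <= x} < n" using xin unfolding X_def by auto
  then show ?thesis using le by linarith
 qed
 have "{..<n} = {k. k < n & f k < c} \<union> {k. k < n & c <= f k}" by auto
 then have "n <= card {k. k < n & f k < c} + card {k. k < n & c <= f k}"
  by (metis card_Un_le card_lessThan)
 then have "n <= 2 * card {k. k < n & c <= f k}" using lt by linarith
 then show ?thesis using cX unfolding X_def by blast
qed

text \<open>Take the point formed by the medians of the real and of the imaginary parts. An entry
  far from it lies beyond one of four lines at distance \<open>th / 2\<close>, whence the loss of 4,
  and half of all entries lie on the other side of the corresponding median.\<close>

lemma separated_sets:
 fixes v :: "nat => complex"
 assumes "n > 0" "!!c. s <= card {k. k < n & th < cmod (v k - c)}"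
 shows "EX A B. A <= {..<n} & B <= {..<n} & s <= 4 * card A & n <= 2 * card B & (ALL a:A. ALL b:B. th / 2 <= cmod (v a - v b))"
proof -
 obtain c1 where c1: "n <= 2 * card {k. k < n & Re (v k) <= c1}" "n <= 2 * card {k. k < n & c1 <= Re (v k)}"
  using median_exists[OF assms(1), of "%k. Re (v k)"] by blast
 obtain c2 where c2: "n <= 2 * card {k. k < n & Im (v k) <= c2}" "n <= 2 * card {k. k < n & c2 <= Im (v k)}"
  using median_exists[OF assms(1), of "%k. Im (v k)"] by blast
 define A1 where "A1 = {k. k < n & Re (v k) > c1 + th/2}"
 define A2 where "A2 = {k. k < n & Re (v k) < c1 - th/2}"
 define A3 where "A3 = {k. k < n & Im (v k) > c2 + th/2}"
 define A4 where "A4 = {k. k < n & Im (v k) < c2 - th/2}"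
 have "{k. k < n & th < cmod (v k - Complex c1 c2)} <= A1 \<union> A2 \<union> A3 \<union> A4"
 proof safe
  fix k assume k: "k < n" "th < cmod (v k - Complex c1 c2)" "k ~: A4" "k ~: A3" "k ~: A2"
  have "cmod (v k - Complex c1 c2) <= \<bar>Re (v k) - c1\<bar> + \<bar>Im (v k) - c2\<bar>"
   using cmod_le[of "v k - Complex c1 c2"] by simp
  then show "k : A1" using k unfolding A1_def A2_def A3_def A4_def by auto
 qed
 then have "card {k. k < n & th < cmod (v k - Complex c1 c2)} <= card (A1 \<union> A2 \<union> A3 \<union> A4)"
  by (intro card_mono) (auto simp: A1_def A2_def A3_def A4_def)
 also have "... <= card A1 + card A2 + card A3 + card A4"
  using card_Un_le[of A1 A2] card_Un_le[of "A1 \<union> A2" A3] card_Un_le[of "A1 \<union> A2 \<union> A3" A4] by linarith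
 finally have "s <= card A1 + card A2 + card A3 + card A4" using assms(2)[of "Complex c1 c2"] by linarith
 then consider "s <= 4 * card A1" | "s <= 4 * card A2" | "s <= 4 * card A3" | "s <= 4 * card A4" by linarith
 then show ?thesis
 proof cases
  case 1
  have "th / 2 <= cmod (v a - v b)" if "a : A1" "Re (v b) <= c1" for a b
   using that abs_Re_le_cmod[of "v a - v b"] unfolding A1_def by auto
  then show ?thesis using 1 c1 by (intro exI[of _ A1] exI[of _ "{k. k < n & Re (v k) <= c1}"]) (auto simp: A1_def)
 next
  case 2
  have "th / 2 <= cmod (v a - v b)" if "a : A2" "c1 <= Re (v b)" for a b
   using that abs_Re_le_cmod[of "v a - v b"] unfolding A2_def by auto
  then show ?thesis using 2 c1 by (intro exI[of _ A2] exI[of _ "{k. k < n & c1 <= Re (v k)}"]) (auto simp: A2_def)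
 next
  case 3
  have "th / 2 <= cmod (v a - v b)" if "a : A3" "Im (v b) <= c2" for a b
   using that abs_Im_le_cmod[of "v a - v b"] unfolding A3_def by auto
  then show ?thesis using 3 c2 by (intro exI[of _ A3] exI[of _ "{k. k < n & Im (v k) <= c2}"]) (auto simp: A3_def)
 next
  case 4
  have "th / 2 <= cmod (v a - v b)" if "a : A4" "c2 <= Im (v b)" for a b
   using that abs_Im_le_cmod[of "v a - v b"] unfolding A4_def by auto
  then show ?thesis using 4 c2 by (intro exI[of _ A4] exI[of _ "{k. k < n & c2 <= Im (v k)}"]) (auto simp: A4_def)
 qed
qed

text \<open>Enlarge the set of hits to exactly \<open>q\<close> entries of \<open>S\<close>; all
  other entries then avoid \<open>T\<close>.\<close>

lemma card_few_hits_le: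
 assumes S: "S <= {..<d} \<times> {..<n}" "T <= {..<n}" "n > 0" "q <= card S"
 shows "real (card {P : tuples n d. card {(l,i) : S. P l i : T} <= q})
  <= card (tuples n d) * ((card S choose q) * (1 - card T / n) ^ (card S - q))"
proof -
 let ?Om = "tuples n d"
 have fS: "finite S" using S finite_subset by blast
 have "{P : ?Om. card {(l,i) : S. P l i : T} <= q} <= (UN Q:{Q. Q <= S & card Q = q}. {P : ?Om. ALL (l,i):S - Q. P l i ~: T})"
 proof
  fix P assume "P : {P : ?Om. card {(l,i) : S. P l i : T} <= q}"
  then have a: "P : ?Om" "card {(l,i) : S. P l i : T} <= q" by auto
  obtain Q where "{(l,i) : S. P l i : T} <= Q" "Q <= S" "card Q = q"
   using exists_subset_between[OF a(2) S(4) _ fS] by auto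
  then have "ALL (l,i):S - Q. P l i ~: T" "Q : {Q. Q <= S & card Q = q}" by auto
  then show "P : (UN Q:{Q. Q <= S & card Q = q}. {P : ?Om. ALL (l,i):S - Q. P l i ~: T})" using a(1) by blast
 qed
 then have "card {P : ?Om. card {(l,i) : S. P l i : T} <= q} <= (SUM Q:{Q. Q <= S & card Q = q}. card {P : ?Om. ALL (l,i):S - Q. P l i ~: T})"
  by (rule order_trans[OF card_mono card_UN_le, rotated]) (use fS in auto)
 then have "real (card {P : ?Om. card {(l,i) : S. P l i : T} <= q}) <= (SUM Q:{Q. Q <= S & card Q = q}. real (card {P : ?Om. ALL (l,i):S - Q. P l i ~: T}))"
  by (simp only: of_nat_sum[symmetric] of_nat_le_iff)
 also have "... <= (SUM Q:{Q. Q <= S & card Q = q}. card ?Om * (1 - card T / n) ^ (card S - q))"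
 proof (rule sum_mono)
  fix Q assume "Q : {Q. Q <= S & card Q = q}"
  then have Q: "Q <= S" "card Q = q" by auto
  then have "card (S - Q) = card S - q" using fS by (simp add: card_Diff_subset finite_subset)
  then show "real (card {P : ?Om. ALL (l,i):S - Q. P l i ~: T}) <= card ?Om * (1 - card T / n) ^ (card S - q)"
   using card_tuples_avoid_le[of "S - Q" d n T] S by auto
 qed
 also have "... = card ?Om * ((card S choose q) * (1 - card T / n) ^ (card S - q))"
  by (simp add: n_subsets[OF fS])
 finally show ?thesis .
qed

definition mixing :: "nat => nat => real => nat => perms => bool" where
 "mixing n d al D P \<longleftrightarrow> (ALL A B. A <= {..<n} --> B <= {..<n} --> al * real n <= real (card A) --> n <= 2 * card B -->
  real (card {(i,j). i < n & j < n & card {l. l < d & P l i : A & P l j : B} < D}) <= 2 * al * real n * real n)"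

text \<open>If mixing fails, either \<open>r\<close> rows hit \<open>A\<close> in fewer than
  \<open>d1\<close> slots each, or one row has \<open>d1\<close> slots hitting \<open>A\<close>
  within which \<open>r\<close> rows hit \<open>B\<close> fewer than \<open>D\<close> times each.
  Such a lack of hits is exponentially unlikely in the number \<open>d * r\<close> or
  \<open>d1 * r\<close> of trials; this has to beat the at most \<open>4 ^ n\<close> or
  \<open>2 ^ d * 4 ^ n\<close> choices of the sets.\<close>

lemma card_not_mixing_le:
 assumes n: "n > 0" and al: "0 < al" "al <= 1" and r: "al * n <= r" "r <= n" "real r <= al * n + 1"
  and d1: "0 < d1" "4 * d1 <= d" "real d1 * (1 + ln (d / d1)) <= al * d / 4"
  and D: "D > 0" "16 * D <= d1" "d1 <= 32 * D"
 shows "real (card {P : tuples n d. ~ mixing n d al D P})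
  <= card (tuples n d) * (4 ^ n * exp (- al * d * r / 2) + n * 2 ^ d * 4 ^ n * (1/2) powr (d1 * r / 2))"
proof -
 let ?Om = "tuples n d"
 define E1 where "E1 A J P \<longleftrightarrow> card {(l,i) : {..<d} \<times> J. P l i : A} <= d1 * r" for A J and P :: "nat => nat => nat"
 define E2 where "E2 L B J P \<longleftrightarrow> card {(l,j) : L \<times> J. P l j : B} <= D * r" for L B J and P :: "nat => nat => nat"
 define P1 where "P1 = {(A,J). A <= {..<n} & J <= {..<n} & al * real n <= real (card A) & card J = r}"
 define P2 where "P2 = {(L,B,J). L <= {..<d} & B <= {..<n} & J <= {..<n} & card L = d1 & n <= 2 * card B & card J = r}"
 have r0: "r > 0" using r al n by (metis mult_pos_pos not_gr0 of_nat_0 of_nat_0_less_iff not_le)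
 have fP1: "finite P1" unfolding P1_def by (rule finite_subset[of _ "Pow {..<n} \<times> Pow {..<n}"]) auto
 have fP2: "finite P2" unfolding P2_def by (rule finite_subset[of _ "Pow {..<d} \<times> Pow {..<n} \<times> Pow {..<n}"]) auto
 have cP1: "real (card P1) <= 4 ^ n"
 proof -
  have "card P1 <= card (Pow {..<n} \<times> Pow {..<n})" unfolding P1_def by (intro card_mono) auto
  also have "... = 4 ^ n" by (simp add: card_cartesian_product card_Pow flip: power_mult_distrib)
  finally show ?thesis by (metis of_nat_le_iff of_nat_numeral of_nat_power)
 qed
 have cP2: "real (card P2) <= 2 ^ d * 4 ^ n"
 proof -
  have "card P2 <= card (Pow {..<d} \<times> Pow {..<n} \<times> Pow {..<n})" unfolding P2_def by (intro card_mono) auto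
  also have "... = 2 ^ d * 4 ^ n" by (simp add: card_cartesian_product card_Pow flip: power_mult_distrib)
  finally have "real (card P2) <= real (2 ^ d * 4 ^ n)" by (rule of_nat_mono)
  then show ?thesis by simp
 qed
 have p1: "real (card {P : ?Om. E1 A J P}) <= card ?Om * exp (- al * d * r / 2)" if "(A,J) : P1" for A J
 proof -
  have AJ: "A <= {..<n}" "J <= {..<n}" "al * real n <= real (card A)" "card J = r" using that unfolding P1_def by auto
  have cS: "card ({..<d} \<times> J) = d * r" using AJ by (simp add: card_cartesian_product)
  have dd: "d1 <= d" using d1 by linarith
  have "real (card {P : ?Om. E1 A J P}) <= card ?Om * (((d * r) choose (d1 * r)) * (1 - card A / n) ^ (d * r - d1 * r))"
   unfolding E1_def using card_few_hits_le[of "{..<d} \<times> J" d n A "d1 * r"] AJ n dd unfolding cS by auto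
  also have "... <= card ?Om * (exp (al * d / 4 * r) * exp (- (al * (3 * d / 4 * r))))"
  proof (intro mult_left_mono mult_mono)
   have "real ((d * r) choose (d1 * r)) <= (exp 1 * real (d * r) / real (d1 * r)) ^ (d1 * r)"
    using d1 r0 by (intro binomial_le_exp_power) auto
   also have "... = (exp (1 + ln (d / d1))) ^ (d1 * r)"
    using d1 r0 by (simp add: exp_add)
   also have "... = exp (real d1 * (1 + ln (d / d1)) * r)"
    by (simp add: exp_of_nat_mult[symmetric] mult_ac)
   also have "... <= exp (al * d / 4 * r)" using mult_right_mono[OF d1(3), of "real r"] by simp
   finally show "real ((d * r) choose (d1 * r)) <= exp (al * d / 4 * r)" .
   have cA: "card A <= n" using AJ by (metis card_lessThan card_mono finite_lessThan)
   have "(1 - card A / n) ^ (d * r - d1 * r) <= (1 - al) ^ (d * r - d1 * r)"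
    using AJ(3) n cA by (intro power_mono) (auto simp: field_simps)
   also have "... <= exp (- al) ^ (d * r - d1 * r)"
    using exp_ge_add_one_self[of "-al"] al by (intro power_mono) auto
   also have "... = exp (- (al * real (d * r - d1 * r)))" by (simp add: exp_of_nat_mult[symmetric] mult_ac)
   also have "... <= exp (- (al * (3 * d / 4 * r)))"
   proof -
    have "real (d * r - d1 * r) = (real d - real d1) * r" using dd by (simp add: of_nat_diff left_diff_distrib)
    also have "... >= (3 * real d / 4) * r" using d1 by (intro mult_right_mono) auto
    finally show ?thesis using al by (simp add: mult_left_mono)
   qed
   finally show "(1 - card A / n) ^ (d * r - d1 * r) <= exp (- (al * (3 * d / 4 * r)))" .
   show "0 <= (1 - card A / n) ^ (d * r - d1 * r)" using cA n by (intro zero_le_power) (auto simp: field_simps)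
  qed auto
  also have "... = card ?Om * exp (- al * d * r / 2)"
   by (simp flip: exp_add add: field_simps)
  finally show ?thesis .
 qed
 have p2: "real (card {P : ?Om. E2 L B J P}) <= card ?Om * (1/2) powr (d1 * r / 2)" if "(L,B,J) : P2" for L B J
 proof -
  have LBJ: "L <= {..<d}" "B <= {..<n}" "J <= {..<n}" "card L = d1" "n <= 2 * card B" "card J = r" using that unfolding P2_def by auto
  have cS: "card (L \<times> J) = d1 * r" using LBJ by (simp add: card_cartesian_product)
  have Dd: "D <= d1" using D by linarith
  have "L \<times> J <= {..<d} \<times> {..<n}" using LBJ by blast
  then have "real (card {P : ?Om. E2 L B J P}) <= card ?Om * (((d1 * r) choose (D * r)) * (1 - card B / n) ^ (d1 * r - D * r))"
   unfolding E2_def using card_few_hits_le[of "L \<times> J" d n B "D * r"] LBJ n Dd unfolding cS by auto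
  also have "... <= card ?Om * (2 powr (7 * real (D * r)) * (1/2) powr (real (d1 * r - D * r)))"
  proof (intro mult_left_mono mult_mono)
   have "real ((d1 * r) choose (D * r)) <= (exp 1 * real (d1 * r) / real (D * r)) ^ (D * r)"
    using D r0 by (intro binomial_le_exp_power) auto
   \<comment> \<open>The ratio \<open>d1 / D <= 32\<close> bounds the base by 96, below
     \<open>2 ^ 7\<close>; together with \<open>16 * D <= d1\<close> the exponents leave
     \<open>d1 - 8 * D >= d1 / 2\<close>.\<close>
   also have "... <= (2 ^ 7) ^ (D * r)"
   proof (rule power_mono)
    have "real d1 <= 32 * D" using D(3) by (metis of_nat_le_iff of_nat_mult of_nat_numeral)
    then have "real d1 / D <= 32" using D(1) by (simp add: field_simps)
    then have "exp 1 * (real d1 / D) <= 3 * 32" by (intro mult_mono exp_le) auto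
    then show "exp 1 * real (d1 * r) / real (D * r) <= 2 ^ 7" using r0 by simp
   qed auto
   also have "... = 2 powr (real (7 * (D * r)))" by (simp only: power_mult[symmetric]) (subst powr_realpow, auto)
   also have "... = 2 powr (7 * real (D * r))" by simp
   finally show "real ((d1 * r) choose (D * r)) <= 2 powr (7 * real (D * r))" .
   have cB: "card B <= n" using LBJ by (metis card_lessThan card_mono finite_lessThan)
   have "real n <= 2 * card B" using LBJ(5) by (metis of_nat_le_iff of_nat_mult of_nat_numeral)
   then have "1 - card B / n <= 1/2" using n by (simp add: field_simps)
   then have "(1 - card B / n) ^ (d1 * r - D * r) <= (1/2) ^ (d1 * r - D * r)"
    using cB n by (intro power_mono) (auto simp: field_simps)
   then show "(1 - card B / n) ^ (d1 * r - D * r) <= (1/2) powr (real (d1 * r - D * r))" by (simp add: powr_realpow)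
   show "0 <= (1 - card B / n) ^ (d1 * r - D * r)" using cB n by (intro zero_le_power) (auto simp: field_simps)
  qed auto
  also have "... = card ?Om * (1/2) powr (real (d1 * r - D * r) - 7 * real (D * r))"
   by (simp add: powr_diff powr_divide powr_minus field_simps)
  also have "... <= card ?Om * (1/2) powr (d1 * r / 2)"
  proof (intro mult_left_mono powr_mono')
   have e: "real (d1 * r - D * r) = (real d1 - real D) * r" using Dd by (simp add: of_nat_diff left_diff_distrib)
   have "16 * real D <= d1" using D(2) by (metis of_nat_le_iff of_nat_mult of_nat_numeral)
   then have "real d1 / 2 * r <= (real d1 - real D - 7 * real D) * r" by (intro mult_right_mono) auto
   then show "real (d1 * r) / 2 <= real (d1 * r - D * r) - 7 * real (D * r)" unfolding e by (simp add: algebra_simps)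
  qed auto
  finally show ?thesis .
 qed
 have sub: "{P : ?Om. ~ mixing n d al D P} <= (UN (A,J):P1. {P : ?Om. E1 A J P}) \<union> (UN (L,B,J):P2. {P : ?Om. E2 L B J P})"
 proof
  fix P assume "P : {P : ?Om. ~ mixing n d al D P}"
  then obtain A B where pi: "P : ?Om" and AB: "A <= {..<n}" "B <= {..<n}" "al * real n <= real (card A)" "n <= 2 * card B"
   and many: "~ real (card {(i,j). i < n & j < n & card {l. l < d & P l i : A & P l j : B} < D}) <= 2 * al * real n * real n"
   unfolding mixing_def by auto
  define Li where "Li i = {l. l < d & P l i : A}" for i
  define I where "I = {i. i < n & card (Li i) < d1}"
  define Ji where "Ji i = {j. j < n & card {l : Li i. P l j : B} < D}" for i
  show "P : (UN (A,J):P1. {P : ?Om. E1 A J P}) \<union> (UN (L,B,J):P2. {P : ?Om. E2 L B J P})"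
  proof (cases "r <= card I")
   case True
   then obtain J where J: "J <= I" "card J = r" using obtain_subset_with_card_n by blast
   have fJ: "finite J" using J r0 card_ge_0_finite by blast
   have "{(l,i) : {..<d} \<times> J. P l i : A} = (%(i,l). (l,i)) ` Sigma J Li" unfolding Li_def by auto
   then have "card {(l,i) : {..<d} \<times> J. P l i : A} = card (Sigma J Li)"
    by (simp add: card_image inj_on_def)
   also have "... = (SUM i:J. card (Li i))" using fJ by (intro card_SigmaI) (auto simp: Li_def)
   also have "... <= (SUM i:J. d1)" using J unfolding I_def by (intro sum_mono) (auto dest: subsetD)
   also have "... = d1 * r" using J by simp
   finally have "E1 A J P" unfolding E1_def .
   moreover have "(A,J) : P1" unfolding P1_def using AB J unfolding I_def by auto
   ultimately show ?thesis using pi by blast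
  next
   case False
   show ?thesis
   proof (cases "EX i<n. i ~: I & r <= card (Ji i)")
    case True
    then obtain i where i: "i < n" "d1 <= card (Li i)" "r <= card (Ji i)" unfolding I_def by auto
    obtain L where L: "L <= Li i" "card L = d1" using i(2) obtain_subset_with_card_n by blast
    obtain J where J: "J <= Ji i" "card J = r" using i(3) obtain_subset_with_card_n by blast
    have fJ: "finite J" using J r0 card_ge_0_finite by blast
    have "{(l,j) : L \<times> J. P l j : B} = (%(j,l). (l,j)) ` Sigma J (%j. {l : L. P l j : B})" by auto
    then have "card {(l,j) : L \<times> J. P l j : B} = card (Sigma J (%j. {l : L. P l j : B}))"
     by (simp add: card_image inj_on_def)
    also have "... = (SUM j:J. card {l : L. P l j : B})"
    proof -
     have "finite L" using L d1 card_ge_0_finite by metis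
     then show ?thesis using fJ by (intro card_SigmaI) auto
    qed
    also have "... <= (SUM j:J. D)"
    proof (rule sum_mono)
     fix j assume "j : J"
     then have "card {l : Li i. P l j : B} < D" using J unfolding Ji_def by auto
     moreover have "card {l : L. P l j : B} <= card {l : Li i. P l j : B}"
      using L by (intro card_mono) (auto simp: Li_def)
     ultimately show "card {l : L. P l j : B} <= D" by linarith
    qed
    also have "... = D * r" using J by simp
    finally have "E2 L B J P" unfolding E2_def .
    moreover have "(L,B,J) : P2" unfolding P2_def using AB L J unfolding Ji_def Li_def by auto
    ultimately show ?thesis using pi by blast
   next
    case noJ: False
    define BP where "BP = {(i,j). i < n & j < n & card {l. l < d & P l i : A & P l j : B} < D}"
    have "BP <= (I \<times> {..<n}) \<union> Sigma ({..<n} - I) Ji"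
    proof
     fix x assume "x : BP"
     then obtain i j where x: "x = (i,j)" "i < n" "j < n" "card {l. l < d & P l i : A & P l j : B} < D" unfolding BP_def by auto
     have "{l. l < d & P l i : A & P l j : B} = {l : Li i. P l j : B}" unfolding Li_def by auto
     then show "x : (I \<times> {..<n}) \<union> Sigma ({..<n} - I) Ji" using x unfolding Ji_def by auto
    qed
    then have "card BP <= card (I \<times> {..<n}) + card (Sigma ({..<n} - I) Ji)"
     by (intro order_trans[OF card_mono card_Un_le]) (auto simp: I_def Ji_def)
    also have "... = card I * n + (SUM i:{..<n} - I. card (Ji i))"
     by (simp add: card_cartesian_product, subst card_SigmaI) (auto simp: Ji_def)
    also have "... <= (r - 1) * n + (SUM i:{..<n} - I. (r - 1))"
     using False noJ by (intro add_mono mult_right_mono sum_mono) (auto simp: not_le)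
    also have "... <= (r - 1) * n + n * (r - 1)"
    proof -
     have "card ({..<n} - I) <= n" using card_mono[of "{..<n}" "{..<n} - I"] by auto
     then show ?thesis by (simp add: mult_right_mono del: diff_is_0_eq)
    qed
    finally have "real (card BP) <= real ((r - 1) * n + n * (r - 1))" by (rule of_nat_mono)
    also have "... = 2 * (real r - 1) * n"
    proof -
     have "real (r - 1) = real r - 1" using r0 by (simp add: of_nat_diff)
     then show ?thesis by (simp only: of_nat_add of_nat_mult) (simp add: algebra_simps)
    qed
    also have "... <= 2 * (al * n) * n" using r(3) by (intro mult_right_mono mult_left_mono) auto
    finally show ?thesis using many unfolding BP_def by (simp add: mult_ac)
   qed
  qed
 qed
 have n1: "(1::real) <= n" using n by simp
 have "card {P : ?Om. ~ mixing n d al D P} <= (SUM (A,J):P1. card {P : ?Om. E1 A J P}) + (SUM (L,B,J):P2. card {P : ?Om. E2 L B J P})"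
 proof -
  have "card {P : ?Om. ~ mixing n d al D P} <= card (UN (A,J):P1. {P : ?Om. E1 A J P}) + card (UN (L,B,J):P2. {P : ?Om. E2 L B J P})"
   by (rule order_trans[OF card_mono[OF _ sub] card_Un_le]) (use fP1 fP2 in auto)
  also have "... <= (SUM (A,J):P1. card {P : ?Om. E1 A J P}) + (SUM (L,B,J):P2. card {P : ?Om. E2 L B J P})"
   by (intro add_mono order_trans[OF card_UN_le[OF fP1]] order_trans[OF card_UN_le[OF fP2]]) (auto simp: case_prod_beta)
  finally show ?thesis .
 qed
 then have "real (card {P : ?Om. ~ mixing n d al D P}) <= (SUM x:P1. real (card {P : ?Om. E1 (fst x) (snd x) P})) + (SUM x:P2. real (card {P : ?Om. E2 (fst x) (fst (snd x)) (snd (snd x)) P}))"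
  unfolding case_prod_beta by (simp only: of_nat_sum[symmetric] of_nat_add[symmetric] of_nat_le_iff)
 also have "... <= (SUM x:P1. card ?Om * exp (- al * d * r / 2)) + (SUM x:P2. card ?Om * (1/2) powr (d1 * r / 2))"
  by (intro add_mono sum_mono p1 p2) auto
 also have "... = card P1 * (card ?Om * exp (- al * d * r / 2)) + card P2 * (card ?Om * (1/2) powr (d1 * r / 2))" by simp
 also have "... <= 4 ^ n * (card ?Om * exp (- al * d * r / 2)) + (2 ^ d * 4 ^ n) * (card ?Om * (1/2) powr (d1 * r / 2))"
  by (intro add_mono mult_right_mono cP1 cP2) auto
 also have "... <= 4 ^ n * (card ?Om * exp (- al * d * r / 2)) + n * ((2 ^ d * 4 ^ n) * (card ?Om * (1/2) powr (d1 * r / 2)))"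
  by (intro add_left_mono mult_right_mono[OF n1, of "(2 ^ d * 4 ^ n) * (card ?Om * (1/2) powr (d1 * r / 2))", simplified mult_1]) auto
 finally show ?thesis by (simp add: algebra_simps)
qed

section \<open>Simultaneous swaps of two rows and independent signs\<close>

definition swap_set :: "nat set => nat => nat => perms => nat => nat => nat" where
 "swap_set Z i j P = (%l. if l : Z then P l \<circ> Transposition.transpose i j else P l)"

lemma swap_set_in: "P : tuples n d ==> Z <= {..<d} ==> i < n ==> j < n ==> swap_set Z i j P : tuples n d"
 by (auto simp: tuples_def PiE_dflt_def swap_set_def intro!: permutes_swap_compose)

lemma swap_set_swap_set [simp]: "swap_set Z i j (swap_set Z i j P) = P"
 by (auto simp: swap_set_def comp_assoc transpose_comp_involutory fun_eq_iff)

lemma bij_swap_set: "Z <= {..<d} ==> i < n ==> j < n ==> bij_betw (swap_set Z i j) (tuples n d) (tuples n d)"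
 by (rule bij_betwI[where g = "swap_set Z i j"]) (auto intro: swap_set_in)

lemma perm_op_swap_set_other: "k ~= i ==> k ~= j ==> perm_op d w (swap_set Z i j P) u k = perm_op d w P u k"
 by (auto simp: perm_op_def swap_set_def intro!: sum.cong)

lemma perm_op_swap_set_add:
 "perm_op d w (swap_set Z i j P) u i + perm_op d w (swap_set Z i j P) u j = perm_op d w P u i + perm_op d w P u j"
proof -
 have "(SUM l<d. u (swap_set Z i j P l i) + u (swap_set Z i j P l j)) = (SUM l<d. u (P l i) + u (P l j))"
  by (intro sum.cong) (auto simp: swap_set_def)
 then show ?thesis by (simp add: perm_op_def sum.distrib algebra_simps)
qed

text \<open>A uniformly random \<open>Z\<close> turns this into a sum of independent signs with
  coefficients \<open>u (P l j) - u (P l i)\<close>, shifted by a constant. All other rows, and the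
  sum of these two, do not see \<open>Z\<close>.\<close>

lemma perm_op_swap_set_diff:
 "perm_op d w (swap_set Z i j P) u i - perm_op d w (swap_set Z i j P) u j
 = (SUM l<d. if l : Z then u (P l j) - u (P l i) else - (u (P l j) - u (P l i))) - w * (u i - u j)"
proof -
 have "(SUM l<d. u (swap_set Z i j P l i) - u (swap_set Z i j P l j)) = (SUM l<d. if l : Z then u (P l j) - u (P l i) else - (u (P l j) - u (P l i)))"
  by (intro sum.cong) (auto simp: swap_set_def)
 then show ?thesis by (simp add: perm_op_def sum_subtractf algebra_simps)
qed

text \<open>This set does not change when rows \<open>i\<close> and \<open>j\<close> are interchanged in some of the permutations,
 so that a vector chosen from it is independent of these interchanges.\<close>
definition near_kernel :: "nat => nat => complex => real => real => nat => nat => nat => perms => (nat => complex) set" where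
 "near_kernel n d w eps th D i j P = {u. (ALL k<n. cmod (u k) <= 1) & (ALL k<n. k ~= i & k ~= j --> cmod (perm_op d w P u k) <= eps) &
  cmod (perm_op d w P u i + perm_op d w P u j) <= 2 * eps & D <= card {l. l < d & th <= cmod (u (P l i) - u (P l j))}}"

lemma near_kernel_swap_set: "near_kernel n d w eps th D i j (swap_set Z i j P) = near_kernel n d w eps th D i j P"
proof -
 have e: "cmod (u (swap_set Z i j P l i) - u (swap_set Z i j P l j)) = cmod (u (P l i) - u (P l j))" for u :: "nat => complex" and l
  by (auto simp: swap_set_def norm_minus_commute)
 have "(ALL k<n. k ~= i & k ~= j --> cmod (perm_op d w (swap_set Z i j P) u k) <= eps) =
   (ALL k<n. k ~= i & k ~= j --> cmod (perm_op d w P u k) <= eps)" for u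
  by (auto simp: perm_op_swap_set_other)
 then show ?thesis unfolding near_kernel_def perm_op_swap_set_add e by simp
qed

definition row_event :: "nat => nat => complex => real => real => nat => nat => nat => perms => bool" where
 "row_event n d w eps th D i j P \<longleftrightarrow> near_kernel n d w eps th D i j P ~= {} &
  (let u = (SOME u. u : near_kernel n d w eps th D i j P) in cmod (perm_op d w P u i - perm_op d w P u j) < th / 2)"

text \<open>Each swap set preserves the uniform law, so the event may be averaged over all
  \<open>Z\<close>. Along such an orbit the chosen \<open>u\<close> is one fixed vector, because it
  depends on \<open>P\<close> only through the invariant set \<open>near_kernel\<close>, and the
  Littlewood-Offord bound applies with at least \<open>D\<close> coefficients of size
  \<open>th\<close>.\<close>

lemma card_row_event_le:
 assumes "i < n" "j < n" "D > 0" "th > 0"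
 shows "real (card {P : tuples n d. row_event n d w eps th D i j P}) <= card (tuples n d) * sqrt (2 / D)"
proof -
 let ?Om = "tuples n d"
 let ?Q = "row_event n d w eps th D i j"
 have fib: "real (card {Z : Pow {..<d}. ?Q (swap_set Z i j P)}) <= 2 ^ d * sqrt (2 / D)" for P
 proof (cases "near_kernel n d w eps th D i j P = {}")
  case True
  then show ?thesis unfolding row_event_def near_kernel_swap_set by simp
 next
  case False
  define u where "u = (SOME u. u : near_kernel n d w eps th D i j P)"
  have u: "u : near_kernel n d w eps th D i j P" unfolding u_def using False some_in_eq by blast
  have "{l. l < d & th <= cmod (u (P l i) - u (P l j))} = {l : {..<d}. th <= cmod (u (P l j) - u (P l i))}"
   by (auto simp: norm_minus_commute)
  then have D: "D <= card {l : {..<d}. th <= cmod (u (P l j) - u (P l i))}" using u unfolding near_kernel_def by auto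
  have "{Z : Pow {..<d}. ?Q (swap_set Z i j P)} <= {Z : Pow {..<d}. cmod ((SUM l<d. if l : Z then u (P l j) - u (P l i) else - (u (P l j) - u (P l i))) - w * (u i - u j)) < th / 2}"
   unfolding row_event_def near_kernel_swap_set Let_def perm_op_swap_set_diff u_def by auto
  then have "real (card {Z : Pow {..<d}. ?Q (swap_set Z i j P)}) <= real (card {Z : Pow {..<d}. cmod ((SUM l<d. if l : Z then u (P l j) - u (P l i) else - (u (P l j) - u (P l i))) - w * (u i - u j)) < th / 2})"
   by (intro of_nat_mono card_mono) auto
  also have "... <= 2 ^ card {..<d} * sqrt (2 / D)"
   by (rule Littlewood_Offord_complex[OF _ D assms(3,4)]) auto
  finally show ?thesis by simp
 qed
 have "2 ^ d * real (card {P : ?Om. ?Q P}) = (SUM Z:Pow {..<d}. SUM P:?Om. of_bool (?Q P))"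
  by (simp add: card_Pow Int_def)
 also have "... = (SUM Z:Pow {..<d}. SUM P:?Om. of_bool (?Q (swap_set Z i j P)))"
  using assms by (intro sum.cong refl sum.reindex_bij_betw[OF bij_swap_set, symmetric]) auto
 also have "... = (SUM P:?Om. SUM Z:Pow {..<d}. of_bool (?Q (swap_set Z i j P)))" by (rule sum.swap)
 also have "... = (SUM P:?Om. real (card {Z : Pow {..<d}. ?Q (swap_set Z i j P)}))"
  by (intro sum.cong refl) (simp add: Int_def)
 also have "... <= (SUM P:?Om. 2 ^ d * sqrt (2 / D))" by (intro sum_mono fib)
 finally have "2 ^ d * real (card {P : ?Om. ?Q P}) <= 2 ^ d * (card ?Om * sqrt (2 / D))" by (simp add: mult_ac)
 then show ?thesis by simp
qed

section \<open>Transposition: left and right almost null vectors\<close>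

definition inv_tuple :: "perms => nat => nat => nat" where
 "inv_tuple P = (%l. inv_into UNIV (P l))"

lemma inv_tuple_in: "P : tuples n d ==> inv_tuple P : tuples n d"
 by (auto simp: tuples_def PiE_dflt_def inv_tuple_def permutes_inv inv_id[unfolded id_def] id_def)

lemma inv_tuple_inv_tuple: "P : tuples n d ==> inv_tuple (inv_tuple P) = P"
proof
 fix l assume pi: "P : tuples n d"
 have "bij (P l)" using pi by (cases "l < d") (auto simp: tuples_def PiE_dflt_def permutes_bij)
 then show "inv_tuple (inv_tuple P) l = P l" by (simp add: inv_tuple_def inv_inv_eq)
qed

lemma card_inv_tuple: "card {P : tuples n d. Q (inv_tuple P)} = card {P : tuples n d. Q P}"
proof (rule bij_betw_same_card[of inv_tuple], rule bij_betwI[where g = inv_tuple])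
 show "inv_tuple : {P : tuples n d. Q P} \<rightarrow> {P : tuples n d. Q (inv_tuple P)}"
  by (auto simp: inv_tuple_in inv_tuple_inv_tuple)
qed (auto simp: inv_tuple_in inv_tuple_inv_tuple)

text \<open>Inverting the permutations transposes \<open>S\<close>. As inversion preserves the law
  of the tuple, estimates for vectors on the right also hold on the left.\<close>

lemma perm_op_transpose:
 assumes "P : tuples n d"
 shows "(SUM i<n. x i * perm_op d w P u i) = (SUM k<n. perm_op d w (inv_tuple P) x k * u k)"
proof -
 have "(SUM i<n. x i * u (P l i)) = (SUM k<n. x (inv_tuple P l k) * u k)" if "l < d" for l
 proof -
  have p: "P l permutes {..<n}" using assms that by (rule tuples_permutes)
  have "(SUM k<n. x (inv_tuple P l k) * u k) = (SUM i<n. x (inv_tuple P l (P l i)) * u (P l i))"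
   using sum.permute[OF p, of "%k. x (inv_tuple P l k) * u k"] by (simp add: comp_def)
  then show ?thesis by (simp add: inv_tuple_def permutes_inverses[OF p])
 qed
 then have "(SUM l<d. SUM i<n. x i * u (P l i)) = (SUM l<d. SUM k<n. x (inv_tuple P l k) * u k)"
  by simp
 then have "(SUM i<n. SUM l<d. x i * u (P l i)) = (SUM k<n. SUM l<d. x (inv_tuple P l k) * u k)"
  by (subst (1 2) sum.swap)
 then show ?thesis
  by (simp add: perm_op_def sum_distrib_left sum_distrib_right algebra_simps sum_subtractf)
qed

text \<open>A square matrix and its transpose have the same least singular value. If
  \<open>K\<close> is singular, a kernel vector serves; otherwise solve \<open>K v = cnj x\<close>,
  so that the squared norm of \<open>x\<close> is the pairing of \<open>x K\<close> with
  \<open>v\<close>, and apply Cauchy-Schwarz.\<close>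

lemma singular_vector_dual:
 fixes K :: "nat => nat => complex"
 assumes x: "(SUM k<n. (cmod (SUM i<n. x i * K i k))^2) <= eps\<^sup>2 * (SUM i<n. (cmod (x i))^2)" "(SUM i<n. (cmod (x i))^2) > 0"
  and eps: "eps >= 0"
 shows "EX v. (SUM i<n. (cmod (SUM k<n. K i k * v k))^2) <= eps\<^sup>2 * (SUM i<n. (cmod (v i))^2) & (SUM i<n. (cmod (v i))^2) > 0"
proof -
 define A where "A = mat n n (%(i,k). K i k)"
 have A: "A : carrier_mat n n" by (simp add: A_def)
 have mv: "(A *\<^sub>v v) $ i = (SUM k<n. K i k * v $ k)" if "i < n" "v : carrier_vec n" for v i
  using that by (auto simp: A_def scalar_prod_def atLeast0LessThan intro!: sum.cong)
 show ?thesis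
 proof (cases "det A = 0")
  case True
  then obtain v where v: "v : carrier_vec n" "v ~= 0\<^sub>v n" "A *\<^sub>v v = 0\<^sub>v n"
   using det_0_iff_vec_prod_zero[OF A] by auto
  have z: "(SUM k<n. K i k * v $ k) = 0" if "i < n" for i using mv[OF that v(1)] v(3) that by simp
  obtain k where k: "k < n" "v $ k ~= 0" using v(1,2) by (metis carrier_vecD eq_vecI index_zero_vec(1) index_zero_vec(2))
  have "(SUM i<n. (cmod (v $ i))^2) > 0"
   using k by (intro sum_pos2[of _ k]) auto
  then show ?thesis using z by (intro exI[of _ "%k. v $ k"]) auto
 next
  case False
  then obtain B where B: "B : carrier_mat n n" "A * B = 1\<^sub>m n"
   using det_non_zero_imp_unit[OF A False, of "()"] unfolding Units_def ring_mat_def by auto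
  define xc where "xc = vec n (%i. cnj (x i))"
  define v where "v = B *\<^sub>v xc"
  have vc: "v : carrier_vec n" unfolding v_def xc_def using B by auto
  have "A *\<^sub>v v = xc" unfolding v_def using B A by (metis assoc_mult_mat_vec one_mult_mat_vec vec_carrier xc_def)
  then have Kv: "(SUM k<n. K i k * v $ k) = cnj (x i)" if "i < n" for i using mv[OF that vc] that by (simp add: xc_def)
  define X where "X = (SUM i<n. (cmod (x i))^2)"
  define V where "V = (SUM i<n. (cmod (v $ i))^2)"
  have "complex_of_real X = (SUM i<n. x i * cnj (x i))" unfolding X_def of_real_sum complex_norm_square ..
  also have "... = (SUM i<n. x i * (SUM k<n. K i k * v $ k))" by (intro sum.cong) (auto simp: Kv)
  also have "... = (SUM k<n. (SUM i<n. x i * K i k) * v $ k)"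
   unfolding sum_distrib_left sum_distrib_right by (subst sum.swap) (simp add: mult_ac)
  finally have "X <= cmod (SUM k<n. (SUM i<n. x i * K i k) * v $ k)" by (metis abs_ge_self norm_of_real)
  also have "... <= (SUM k<n. cmod (SUM i<n. x i * K i k) * cmod (v $ k))"
   by (rule order_trans[OF norm_sum]) (simp add: norm_mult)
  finally have "X^2 <= (SUM k<n. cmod (SUM i<n. x i * K i k) * cmod (v $ k))^2"
   using x(2) unfolding X_def by (intro power_mono) auto
  also have "... <= (SUM k<n. (cmod (SUM i<n. x i * K i k))^2) * V"
   unfolding V_def by (rule Cauchy_Schwarz_ineq_sum)
  also have "... <= (eps\<^sup>2 * X) * V" using x(1) unfolding X_def V_def by (intro mult_right_mono sum_nonneg) auto
  finally have "X * X <= X * (eps\<^sup>2 * V)" by (simp add: power2_eq_square mult_ac)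
  then have XV: "X <= eps\<^sup>2 * V" using x(2) unfolding X_def[symmetric] by simp
  then have "V > 0" using x(2) unfolding X_def[symmetric] V_def
   by (metis (no_types, lifting) less_le_trans mult_not_zero order_le_less sum_nonneg zero_le_power2)
  moreover have "(SUM i<n. (cmod (SUM k<n. K i k * v $ k))^2) = X" unfolding X_def by (intro sum.cong) (auto simp: Kv)
  ultimately show ?thesis using XV unfolding V_def by (intro exI[of _ "%k. v $ k"]) auto
 qed
qed

lemma perm_op_dual:
 assumes pi: "P : tuples n d" and eps: "eps >= 0"
  and x: "(SUM k<n. (cmod (perm_op d w (inv_tuple P) x k))^2) <= eps\<^sup>2 * (SUM i<n. (cmod (x i))^2)" "(SUM i<n. (cmod (x i))^2) > 0"
 shows "EX v. (SUM i<n. (cmod (perm_op d w P v i))^2) <= eps\<^sup>2 * (SUM i<n. (cmod (v i))^2) & (SUM i<n. (cmod (v i))^2) > 0"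
proof -
 define K where "K i k = perm_op d w P (%j. of_bool (j = k)) i" for i k
 have K: "perm_op d w P v i = (SUM k<n. K i k * v k)" if "i < n" for v i
 proof -
  have a: "v j = (SUM k<n. of_bool (j = k) * v k)" if "j < n" for j
   using that by (simp add: of_bool_def if_distrib if_distribR cong: if_cong)
  have "(SUM l<d. v (P l i)) = (SUM l<d. SUM k<n. of_bool (P l i = k) * v k)"
   by (intro sum.cong refl a) (use pi that in auto)
  also have "... = (SUM k<n. (SUM l<d. of_bool (P l i = k)) * v k)"
   by (subst sum.swap) (simp only: sum_distrib_right)
  finally have 1: "(SUM l<d. v (P l i)) = (SUM k<n. (SUM l<d. of_bool (P l i = k)) * v k)" .
  have 2: "w * v i = (SUM k<n. w * of_bool (i = k) * v k)"
   by (subst a[OF that]) (simp only: sum_distrib_left mult.assoc)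
  show ?thesis unfolding K_def perm_op_def 1 2 by (simp only: left_diff_distrib sum_subtractf)
 qed
 have KT: "(SUM i<n. x i * K i k) = perm_op d w (inv_tuple P) x k" if "k < n" for k
  unfolding K_def perm_op_transpose[OF pi] using that by (simp add: of_bool_def if_distrib cong: if_cong)
 have "(SUM k<n. (cmod (SUM i<n. x i * K i k))^2) <= eps\<^sup>2 * (SUM i<n. (cmod (x i))^2)" using x(1) KT by simp
 from singular_vector_dual[OF this x(2) eps] obtain v where
  "(SUM i<n. (cmod (SUM k<n. K i k * v k))^2) <= eps\<^sup>2 * (SUM i<n. (cmod (v i))^2)" "(SUM i<n. (cmod (v i))^2) > 0" by blast
 then show ?thesis using K by (intro exI[of _ v]) simp
qed

definition spreading :: "nat => nat => complex => nat => real => perms => bool" where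
 "spreading n d w s tau P \<longleftrightarrow> (ALL y kappa i0. (ALL i<n. cmod (y i) <= 1) --> i0 < n --> cmod (y i0) = 1 -->
  (ALL i<n. cmod (perm_op d w P y i - kappa) <= tau) --> s < card {i. i < n & tau < cmod (y i)})"

text \<open>Spreading is applied to \<open>v - c\<close> rescaled to sup norm 1, whose image is
  within \<open>tau\<close> of a constant. The rescaling is harmless: if all entries of
  \<open>v\<close> were within 1/8 of \<open>c\<close>, the image of \<open>v\<close> would be
  comparable to \<open>(d - w) * c\<close>, which is large because
  \<open>cmod w <= d / 2\<close>.\<close>

lemma spreading_imp_spread:
 assumes sp: "spreading n d w s tau P" and pi: "P : tuples n d" and w: "cmod w <= d / 2" and d: "d > 0"
  and v: "!!i. i < n ==> cmod (v i) <= 1" "i1 < n" "cmod (v i1) = 1"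
  and Mv: "!!i. i < n ==> cmod (perm_op d w P v i) <= eps" and eps: "8 * eps <= tau" and tau: "0 < tau" "tau <= 1"
 shows "s < card {k. k < n & tau / 8 < cmod (v k - c)}"
proof -
 define del where "del = Max ((%k. cmod (v k - c)) ` {..<n})"
 have ne: "{..<n} ~= {}" using v(2) by auto
 have delle: "cmod (v k - c) <= del" if "k < n" for k unfolding del_def using that by (intro Max_ge) auto
 obtain i0 where i0: "i0 < n" "cmod (v i0 - c) = del"
 proof -
  have "del : (%k. cmod (v k - c)) ` {..<n}" unfolding del_def using ne by (intro Max_in) auto
  then show ?thesis using that by auto
 qed
 have rep: "perm_op d w P (%k. v k - c) i = perm_op d w P v i - (of_nat d - w) * c" for i
  by (simp add: perm_op_diff perm_op_const)
 have "del >= 1/8"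
 proof (rule ccontr)
  assume "~ del >= 1/8"
  then have small: "del < 1/8" by simp
  have "cmod (v i1) <= cmod c + del" using delle[OF v(2)] norm_triangle_ineq2[of "v i1" c] by linarith
  then have c: "cmod c >= 7/8" using small v(3) by linarith
  have "cmod (of_nat d - w) >= d / 2" using w norm_triangle_ineq2[of "of_nat d :: complex" w] by simp
  then have "cmod ((of_nat d - w) * c) >= d / 2 * (7/8)" unfolding norm_mult using c by (intro mult_mono) auto
  moreover have "cmod (perm_op d w P (%k. v k - c) i1) <= (d + cmod w) * del"
   by (rule perm_op_norm_le[OF pi v(2) delle])
  moreover have "(d + cmod w) * del <= (d + d/2) * (1/8)"
   using w small i0(2) by (intro mult_mono) (auto intro: order_trans[OF norm_ge_zero])
  moreover have "cmod ((of_nat d - w) * c) <= cmod (perm_op d w P v i1) + cmod (perm_op d w P (%k. v k - c) i1)"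
   unfolding rep by (metis norm_minus_commute norm_triangle_sub)
  moreover have "cmod (perm_op d w P v i1) <= 1/8" using Mv[OF v(2)] eps tau by linarith
  moreover have "real d >= 1" using d by simp
  ultimately show False by (simp add: field_simps)
 qed
 then have del0: "del > 0" by simp
 define y where "y k = (v k - c) / del" for k
 have y: "ALL i<n. cmod (y i) <= 1" "cmod (y i0) = 1"
  using delle i0 del0 unfolding y_def by (auto simp: norm_divide)
 define kappa where "kappa = - ((of_nat d - w) * c) / del"
 have "cmod (perm_op d w P y i - kappa) <= tau" if "i < n" for i
 proof -
  have "y = (%k. (1 / complex_of_real del) * (v k - c))" unfolding y_def by auto
  then have "perm_op d w P y i - kappa = perm_op d w P v i / del"
   unfolding kappa_def by (simp only: perm_op_scale rep) (simp add: field_simps add_divide_distrib diff_divide_distrib)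
  then have "cmod (perm_op d w P y i - kappa) = cmod (perm_op d w P v i) / del" using del0 by (simp add: norm_divide)
  also have "... <= eps / (1/8)" using Mv[OF that] \<open>del >= 1/8\<close>
   by (intro frac_le) (auto intro: order_trans[OF norm_ge_zero])
  finally show ?thesis using eps by simp
 qed
 then have "s < card {i. i < n & tau < cmod (y i)}" using sp y i0(1) unfolding spreading_def by blast
 also have "... <= card {k. k < n & tau / 8 < cmod (v k - c)}"
 proof (intro card_mono subsetI)
  fix k assume "k : {i. i < n & tau < cmod (y i)}"
  then have "k < n" "tau * del < cmod (v k - c)" using del0 unfolding y_def by (auto simp: norm_divide field_simps)
  moreover have "tau * (1/8) <= tau * del" using tau \<open>del >= 1/8\<close> by (intro mult_left_mono) auto
  ultimately show "k : {k. k < n & tau / 8 < cmod (v k - c)}" by auto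
 qed auto
 finally show ?thesis .
qed

lemma normalize_sup:
 fixes v :: "nat => complex"
 assumes v: "(SUM i<n. (cmod (perm_op d w P v i))^2) <= eps\<^sup>2 * (SUM i<n. (cmod (v i))^2)" "(SUM i<n. (cmod (v i))^2) > 0" "eps >= 0"
 shows "EX u i1. (ALL i<n. cmod (u i) <= 1) & i1 < n & cmod (u i1) = 1 & (ALL i<n. cmod (perm_op d w P u i) <= eps * sqrt n)"
proof -
 define m where "m = Max ((%i. cmod (v i)) ` {..<n})"
 have ne: "{..<n} ~= {}" using v(2) by (cases n) auto
 have mle: "cmod (v i) <= m" if "i < n" for i unfolding m_def using that by (intro Max_ge) auto
 obtain i1 where i1: "i1 < n" "cmod (v i1) = m"
 proof -
  have "m : (%i. cmod (v i)) ` {..<n}" unfolding m_def using ne by (intro Max_in) auto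
  then show ?thesis using that by auto
 qed
 have m0: "m > 0"
 proof (rule ccontr)
  assume "~ m > 0"
  then have "cmod (v i) = 0" if "i < n" for i using mle[OF that] norm_ge_zero[of "v i"] by linarith
  then show False using v(2) by simp
 qed
 have sq: "(SUM i<n. (cmod (v i))^2) <= n * m^2"
 proof -
  have "(SUM i<n. (cmod (v i))^2) <= (SUM i<n. m^2)" by (intro sum_mono power_mono mle) auto
  then show ?thesis by simp
 qed
 have row: "cmod (perm_op d w P v i) <= eps * sqrt n * m" if "i < n" for i
 proof (rule power2_le_imp_le)
  have "(cmod (perm_op d w P v i))^2 <= (SUM i<n. (cmod (perm_op d w P v i))^2)"
   using that by (intro member_le_sum) auto
  also have "... <= eps\<^sup>2 * (n * m^2)" using v(1) mult_left_mono[OF sq, of "eps\<^sup>2"] by simp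
  also have "... = (eps * sqrt n * m)^2" by (simp add: power_mult_distrib)
  finally show "(cmod (perm_op d w P v i))^2 <= (eps * sqrt n * m)^2" .
 qed (use m0 v(3) in auto)
 define u where "u i = (1 / complex_of_real m) * v i" for i
 have pu: "perm_op d w P u i = (1 / complex_of_real m) * perm_op d w P v i" for i
  unfolding u_def by (rule perm_op_scale)
 show ?thesis
  using mle i1 row m0 by (intro exI[of _ u] exI[of _ i1]) (auto simp: pu, auto simp: u_def norm_mult norm_divide field_simps)
qed

text \<open>The use of \<open>inv_tuple\<close> means that row vectors are multiplied from the left;
  this is the side on which the Gram matrix of \<open>A - z\<close> will need lower bounds.\<close>

definition small_singular :: "nat => nat => complex => real => perms => bool" where
 "small_singular n d w eps P \<longleftrightarrow> (EX x. (SUM k<n. (cmod (perm_op d w (inv_tuple P) x k))^2) <= eps\<^sup>2 * (SUM i<n. (cmod (x i))^2) & (SUM i<n. (cmod (x i))^2) > 0)"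

text \<open>The vector \<open>u\<close> chosen for \<open>(i,j)\<close> need not be the almost null
  vector \<open>v\<close>: its image is known to be small outside these two rows only. Pairing that
  image with a left almost null vector \<open>x\<close> shows that \<open>x i - x j\<close> times
  the difference of the two rows is small. Since \<open>x\<close> is spread,
  \<open>x i - x j\<close> exceeds \<open>tau / 8\<close> in modulus for
  \<open>4 * al * n * n\<close> pairs, and mixing excludes at most half as many.\<close>

lemma many_row_events:
 fixes al tau eps :: real
 assumes pi: "P : tuples n d" and bad: "small_singular n d w eps P"
  and sp: "spreading n d w s tau P" "spreading n d w s tau (inv_tuple P)" and mix: "mixing n d al D P"
  and w: "cmod w <= d / 2" and d: "d > 0" and al: "4 * al * n <= s" "al > 0"
  and eps: "eps > 0" "2048 * n * (eps * sqrt n) <= tau\<^sup>2" and tau: "0 < tau" "tau <= 1"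
 shows "2 * al * n * n <= real (card {(i,j). i < n & j < n & row_event n d w (eps * sqrt n) (tau / 16) D i j P})"
proof -
 define eps1 where "eps1 = eps * sqrt n"
 from bad obtain x0 where x0: "(SUM k<n. (cmod (perm_op d w (inv_tuple P) x0 k))^2) <= eps\<^sup>2 * (SUM i<n. (cmod (x0 i))^2)" "(SUM i<n. (cmod (x0 i))^2) > 0"
  unfolding small_singular_def by blast
 have n0: "n > 0" using x0(2) by (cases n) auto
 obtain v0 where v0: "(SUM i<n. (cmod (perm_op d w P v0 i))^2) <= eps\<^sup>2 * (SUM i<n. (cmod (v0 i))^2)" "(SUM i<n. (cmod (v0 i))^2) > 0"
  using perm_op_dual[OF pi _ x0] eps(1) by auto
 obtain x ix where x: "ALL i<n. cmod (x i) <= 1" "ix < n" "cmod (x ix) = 1" "ALL i<n. cmod (perm_op d w (inv_tuple P) x i) <= eps1"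
  using normalize_sup[OF x0] eps(1) unfolding eps1_def by auto
 obtain v iv where v: "ALL i<n. cmod (v i) <= 1" "iv < n" "cmod (v iv) = 1" "ALL i<n. cmod (perm_op d w P v i) <= eps1"
  using normalize_sup[OF v0] eps(1) unfolding eps1_def by auto
 have e0: "eps1 >= 0" unfolding eps1_def using eps by simp
 have e1: "8 * eps1 <= tau"
 proof -
  have "8 * eps1 <= 2048 * n * eps1" using n0 e0 by (intro mult_right_mono) auto
  also have "... <= tau\<^sup>2" using eps(2) unfolding eps1_def by simp
  also have "... <= tau * 1" unfolding power2_eq_square using tau by (intro mult_left_mono) auto
  finally show ?thesis by simp
 qed
 have xs: "s < card {k. k < n & tau / 8 < cmod (x k - c)}" for c
  using x by (intro spreading_imp_spread[OF sp(2) inv_tuple_in[OF pi] w d, where ?i1.0 = ix and eps = eps1] e1 tau) auto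
 have vs: "s < card {k. k < n & tau / 8 < cmod (v k - c)}" for c
  using v by (intro spreading_imp_spread[OF sp(1) pi w d, where ?i1.0 = iv and eps = eps1] e1 tau) auto
 \<comment> \<open>\<open>A\<close> and \<open>B\<close> are separated for \<open>v\<close>. For
   most row pairs mixing then supplies \<open>D\<close> slots in which the values of
   \<open>v\<close> differ by at least \<open>tau / 16\<close>, so that \<open>near_kernel\<close>
   contains \<open>v\<close> and is not empty.\<close>
 obtain A B where AB: "A <= {..<n}" "B <= {..<n}" "s <= 4 * card A" "n <= 2 * card B" "ALL a:A. ALL b:B. tau / 8 / 2 <= cmod (v a - v b)"
  using separated_sets[OF n0 less_imp_le[OF vs]] by blast
 have "real s <= 4 * real (card A)" using AB(3) by linarith
 then have cA: "al * real n <= real (card A)" using al by linarith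
 define Pr where "Pr = {(i,j). i < n & j < n & tau / 8 < cmod (x j - x i)}"
 define BP where "BP = {(i,j). i < n & j < n & card {l. l < d & P l i : A & P l j : B} < D}"
 have fin: "finite Pr" "finite BP" unfolding Pr_def BP_def by (rule finite_subset[of _ "{..<n} \<times> {..<n}"]; auto)+
 have cBP: "real (card BP) <= 2 * al * real n * real n" using mix AB(1,2,4) cA unfolding mixing_def BP_def by blast
 have "Pr = Sigma {..<n} (%i. {k. k < n & tau / 8 < cmod (x k - x i)})" unfolding Pr_def by auto
 then have "card Pr = (SUM i<n. card {k. k < n & tau / 8 < cmod (x k - x i)})" by simp
 also have "... >= (SUM i<n. s)" using xs by (intro sum_mono less_imp_le)
 finally have "n * s <= card Pr" by simp
 then have "real n * real s <= card Pr" by (metis of_nat_le_iff of_nat_mult)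
 moreover have "real n * (4 * al * n) <= real n * s" using al(1) by (intro mult_left_mono) auto
 ultimately have cP: "4 * al * n * n <= card Pr" by (simp add: mult_ac)
 have "Pr - BP <= {(i,j). i < n & j < n & row_event n d w eps1 (tau / 16) D i j P}"
 proof
  fix ij assume "ij : Pr - BP"
  moreover obtain i j where "ij = (i,j)" by (cases ij)
  ultimately have ij: "ij = (i,j)" "i < n" "j < n" "tau / 8 < cmod (x j - x i)"
   "D <= card {l. l < d & P l i : A & P l j : B}" unfolding Pr_def BP_def by auto
  have "i ~= j" using ij(4) tau by auto
  let ?Y = "near_kernel n d w eps1 (tau / 16) D i j P"
  have "v : ?Y"
  proof -
   have "{l. l < d & P l i : A & P l j : B} <= {l. l < d & tau / 16 <= cmod (v (P l i) - v (P l j))}"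
    using AB(5) by auto
   then have "D <= card {l. l < d & tau / 16 <= cmod (v (P l i) - v (P l j))}"
    by (intro order_trans[OF ij(5) card_mono]) auto
   moreover have "cmod (perm_op d w P v i + perm_op d w P v j) <= 2 * eps1"
   proof -
    have "cmod (perm_op d w P v i) <= eps1" "cmod (perm_op d w P v j) <= eps1" using v(4) ij by auto
    then show ?thesis using norm_triangle_ineq[of "perm_op d w P v i" "perm_op d w P v j"] by linarith
   qed
   ultimately show ?thesis unfolding near_kernel_def using v by auto
  qed
  then have ne: "?Y ~= {}" by auto
  define u where "u = (SOME u. u : ?Y)"
  have u: "u : ?Y" unfolding u_def using ne some_in_eq by blast
  then have u1: "!!k. k < n ==> cmod (u k) <= 1" "!!k. k < n ==> k ~= i ==> k ~= j ==> cmod (perm_op d w P u k) <= eps1"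
   "cmod (perm_op d w P u i + perm_op d w P u j) <= 2 * eps1" unfolding near_kernel_def by auto
  define a where "a = perm_op d w P u i"
  define b where "b = perm_op d w P u j"
  define rest where "rest = (SUM k:{..<n}-{i}-{j}. x k * perm_op d w P u k)"
  define tot where "tot = (SUM k<n. x k * perm_op d w P u k)"
  have split: "tot = x i * a + x j * b + rest"
   unfolding tot_def rest_def a_def b_def using ij \<open>i ~= j\<close>
   by (simp add: sum.remove[of "{..<n}" i] sum.remove[of "{..<n}-{i}" j])
  have "cmod tot <= n * eps1"
  proof -
   have "cmod tot <= (SUM k<n. cmod (perm_op d w (inv_tuple P) x k * u k))" unfolding tot_def perm_op_transpose[OF pi] by (rule norm_sum)
   also have "... <= (SUM k<n. eps1 * 1)" unfolding norm_mult using x(4) u1(1) e0 by (intro sum_mono mult_mono) auto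
   finally show ?thesis by simp
  qed
  moreover have "cmod rest <= n * eps1"
  proof -
   have "cmod rest <= (SUM k:{..<n}-{i}-{j}. cmod (x k * perm_op d w P u k))" unfolding rest_def by (rule norm_sum)
   also have "... <= (SUM k:{..<n}-{i}-{j}. 1 * eps1)" unfolding norm_mult using x(1) u1(2) e0 by (intro sum_mono mult_mono) auto
   also have "... <= (SUM k<n. 1 * eps1)" using e0 by (intro sum_mono2) auto
   finally show ?thesis by simp
  qed
  moreover have "cmod ((x i + x j) / 2 * (a + b)) <= 1 * (2 * eps1)"
  proof -
   have "cmod (x i) <= 1" "cmod (x j) <= 1" using x(1) ij by auto
   then have "cmod (x i + x j) <= 2" using norm_triangle_ineq[of "x i" "x j"] by linarith
   then show ?thesis unfolding norm_mult norm_divide using u1(3) unfolding a_def b_def by (intro mult_mono) auto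
  qed
  \<comment> \<open>Half sums and half differences isolate the unknown: the sum \<open>a + b\<close>
    of the two rows is small by the definition of \<open>near_kernel\<close>, so only
    \<open>a - b\<close> is left.\<close>
  moreover have e: "(x i - x j) / 2 * (a - b) = tot - rest - (x i + x j) / 2 * (a + b)" unfolding split by (simp add: field_simps)
  have "cmod ((x i - x j) / 2 * (a - b)) <= cmod tot + cmod rest + cmod ((x i + x j) / 2 * (a + b))"
   unfolding e by (rule order_trans[OF norm_triangle_ineq4 add_right_mono[OF norm_triangle_ineq4]])
  ultimately have "cmod ((x i - x j) / 2 * (a - b)) <= 2 * n * eps1 + 2 * eps1" by simp
  also have "... <= 4 * n * eps1"
  proof -
   have "1 * eps1 <= n * eps1" using n0 e0 by (intro mult_right_mono) auto
   then show ?thesis by (simp add: mult.commute)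
  qed
  finally have ub: "cmod (x j - x i) * cmod (a - b) <= 8 * n * eps1" by (simp add: norm_mult norm_divide norm_minus_commute)
  have "cmod (a - b) < tau / 16 / 2"
  proof (rule ccontr)
   assume "~ cmod (a - b) < tau / 16 / 2"
   then have "tau / 8 * (tau / 32) < cmod (x j - x i) * cmod (a - b)" using ij(4) tau
    by (intro mult_less_le_imp_less) auto
   then have "tau\<^sup>2 < 2048 * n * eps1" using ub by (simp add: power2_eq_square)
   then show False using eps(2) unfolding eps1_def by simp
  qed
  then have "row_event n d w eps1 (tau / 16) D i j P" unfolding row_event_def Let_def using ne unfolding u_def[symmetric] a_def b_def by auto
  then show "ij : {(i,j). i < n & j < n & row_event n d w eps1 (tau / 16) D i j P}" using ij by auto
 qed
 then have "card (Pr - BP) <= card {(i,j). i < n & j < n & row_event n d w eps1 (tau / 16) D i j P}"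
  by (intro card_mono) (auto intro: finite_subset[of _ "{..<n} \<times> {..<n}"])
 moreover have "card Pr - card BP <= card (Pr - BP)" using fin diff_card_le_card_Diff by blast
 ultimately have "card Pr <= card BP + card {(i,j). i < n & j < n & row_event n d w eps1 (tau / 16) D i j P}" by linarith
 then have "real (card Pr) <= real (card BP) + real (card {(i,j). i < n & j < n & row_event n d w eps1 (tau / 16) D i j P})"
  by (simp only: of_nat_add[symmetric] of_nat_le_iff)
 then show ?thesis using cP cBP unfolding eps1_def by linarith
qed

text \<open>Double counting of triples \<open>(P,i,j)\<close>: every tuple in \<open>G\<close>
  carries at least \<open>2 * al * n * n\<close> row events, while each row event has probability at
  most \<open>sqrt (2 / D)\<close>. Spreading is required of the tuple and of its inverse, hence
  \<open>2 * p1\<close>.\<close>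

lemma card_small_singular_le:
 fixes p1 p2 :: real
 assumes n: "n > 0" and p1: "real (card {P : tuples n d. ~ spreading n d w s tau P}) <= card (tuples n d) * p1"
  and p2: "real (card {P : tuples n d. ~ mixing n d al D P}) <= card (tuples n d) * p2"
  and w: "cmod w <= d / 2" and d: "d > 0" and D: "D > 0" and al: "4 * al * n <= s" "al > 0"
  and eps: "eps > 0" "2048 * n * (eps * sqrt n) <= tau\<^sup>2" and tau: "0 < tau" "tau <= 1"
 shows "real (card {P : tuples n d. small_singular n d w eps P}) <= card (tuples n d) * (2 * p1 + p2 + sqrt (2 / D) / (2 * al))"
proof -
 let ?Om = "tuples n d"
 let ?R = "%i j. row_event n d w (eps * sqrt n) (tau / 16) D i j"
 define G where "G = {P : ?Om. small_singular n d w eps P & spreading n d w s tau P & spreading n d w s tau (inv_tuple P) & mixing n d al D P}"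
 have fG: "finite G" unfolding G_def by simp
 have "(SUM P:G. 2 * al * n * n) <= (SUM P:G. real (card {(i,j). i < n & j < n & ?R i j P}))"
 proof (rule sum_mono)
  fix P assume "P : G"
  then show "2 * al * n * n <= real (card {(i,j). i < n & j < n & ?R i j P})"
   unfolding G_def using many_row_events[OF _ _ _ _ _ w d al eps tau] by blast
 qed
 also have "... <= (SUM P:?Om. real (card {(i,j). i < n & j < n & ?R i j P}))"
  by (intro sum_mono2) (auto simp: G_def)
 also have "... = (SUM P:?Om. SUM i<n. SUM j<n. of_bool (?R i j P))"
 proof (rule sum.cong[OF refl])
  fix P
  have "{(i,j). i < n & j < n & ?R i j P} = {x : {..<n} \<times> {..<n}. ?R (fst x) (snd x) P}" by auto
  then have "real (card {(i,j). i < n & j < n & ?R i j P}) = (SUM x:{..<n} \<times> {..<n}. of_bool (?R (fst x) (snd x) P))"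
   by (simp add: Int_def)
  also have "... = (SUM i<n. SUM j<n. of_bool (?R i j P))"
  proof (subst sum.cartesian_product, rule sum.cong[OF refl])
   fix y show "of_bool (?R (fst y) (snd y) P) = (case y of (i,j) => of_bool (?R i j P))" by (cases y) simp
  qed
  finally show "real (card {(i,j). i < n & j < n & ?R i j P}) = (SUM i<n. SUM j<n. of_bool (?R i j P))" .
 qed
 also have "... = (SUM i<n. SUM j<n. SUM P:?Om. of_bool (?R i j P))"
  by (subst sum.swap, intro sum.cong refl, subst sum.swap, rule refl)
 also have "... = (SUM i<n. SUM j<n. real (card {P : ?Om. ?R i j P}))" by (simp add: Int_def)
 also have "... <= (SUM i<n. SUM j<n. card ?Om * sqrt (2 / D))"
  using D tau by (intro sum_mono card_row_event_le) auto
 finally have "(2 * al * n * n) * card G <= (real n * real n) * (card ?Om * sqrt (2 / D))" by (simp add: mult_ac)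
 then have "(real n * real n) * (2 * al * card G) <= (real n * real n) * (card ?Om * sqrt (2 / D))" by (simp add: mult_ac)
 then have "2 * al * card G <= card ?Om * sqrt (2 / D)" using n by simp
 then have cG: "real (card G) <= card ?Om * (sqrt (2 / D) / (2 * al))" using al(2) by (simp add: field_simps)
 let ?N1 = "{P : ?Om. ~ spreading n d w s tau P}" let ?N2 = "{P : ?Om. ~ spreading n d w s tau (inv_tuple P)}"
 let ?N3 = "{P : ?Om. ~ mixing n d al D P}"
 have N2: "card ?N2 = card ?N1" by (rule card_inv_tuple)
 have "{P : ?Om. small_singular n d w eps P} <= G \<union> ?N1 \<union> ?N2 \<union> ?N3" unfolding G_def by auto
 then have "card {P : ?Om. small_singular n d w eps P} <= card (G \<union> ?N1 \<union> ?N2 \<union> ?N3)" using fG by (intro card_mono) auto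
 also have "... <= card G + card ?N1 + card ?N2 + card ?N3"
  using card_Un_le[of G ?N1] card_Un_le[of "G \<union> ?N1" ?N2] card_Un_le[of "G \<union> ?N1 \<union> ?N2" ?N3] by linarith
 finally have "real (card {P : ?Om. small_singular n d w eps P}) <= real (card G) + real (card ?N1) + real (card ?N1) + real (card ?N3)"
  unfolding N2 by (simp only: of_nat_add[symmetric] of_nat_le_iff)
 then show ?thesis using cG p1 p2 by (simp add: algebra_simps)
qed

text \<open>A union over the \<open>K\<close> scales of \<open>gap_chain\<close>. \<open>Lam\<close>
  bounds the logarithm of the net size per coordinate; with \<open>g * m\<close> coordinates and
  \<open>64 * g * Lam <= d0\<close> the net has at most \<open>2 powr (d0 * m / 32)\<close> points,
  half the exponent of the gain \<open>2 powr (- (d0 * m / 16))\<close> from balanced pairs.\<close>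

lemma card_not_spreading_le:
 fixes n d d0 g M K :: nat and Lam :: real
 assumes n: "n > 0" and d: "d > 0" "cmod w <= d" and Lam: "ln n + 2 * ln (200 * d) + 2 * K * ln (40 * d) <= Lam"
  and g: "64 * real g * Lam <= real d0" "0 < g" "4 * g <= d0" and d0: "8 <= d0" "d0 <= d"
  and M: "128 * (d0 * M) <= n" "M > 0" "M <= g ^ (K - 1)" "K > 0"
 shows "real (card {P : tuples n d. ~ spreading n d w (g * M) (1 / (40 * d) ^ K) P})
  <= card (tuples n d) * (K * (3 * 2 powr (- (d0 / 32))))"
proof -
 let ?Om = "tuples n d"
 define m where "m k = min (g ^ k) M" for k
 let ?E = "%k. {P : ?Om. gap_event n d w (m k) (g * m k) (1 / (40 * real d) ^ k) P}"
 have d1: "real d >= 1" using d by simp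
 have step: "real (card (?E k)) <= card ?Om * (3 * 2 powr (- (d0 / 32)))" if k: "k < K" for k
 proof -
  have m0: "m k > 0" "m k <= M" unfolding m_def using g M by auto
  define h where "h = (d0 * m k) div 8"
  have "d0 * 1 <= d0 * m k" using m0 by (intro mult_left_mono) auto
  then have "d0 <= d0 * m k" by (simp only: mult_1_right)
  then have dm: "8 <= d0 * m k" using d0 by linarith
  have h: "8 * h <= d0 * m k" "d0 * m k <= 16 * h" "h > 0"
  proof -
   have "a <= 16 * (a div 8) & a div 8 > 0" if "8 <= a" for a :: nat using that by presburger
   from this[OF dm] show "d0 * m k <= 16 * h" "h > 0" unfolding h_def by blast+
   show "8 * h <= d0 * m k" unfolding h_def by simp
  qed
  have dmM: "d0 * m k <= d0 * M" using m0 by simp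
  have n2: "432 * (g * m k) <= n"
  proof -
   have "4 * g * m k <= d0 * m k" using g(3) by (intro mult_right_mono) auto
   then show ?thesis using dmM M(1) by linarith
  qed
  define tau where "tau = 1 / (40 * real d) ^ k"
  have p1: "(1::real) <= (40 * real d) ^ k" using d1 by (intro one_le_power) auto
  have tau: "0 < tau" "tau <= 1" unfolding tau_def using p1 by auto
  have n1: "128 * (d0 * m k) <= n" using dmM M(1) by linarith
  have "real (card (?E k)) <= card ?Om * ((real n * (200 * real d / tau) ^ 2) ^ (g * m k) * (3 * (1/2) ^ h))"
   unfolding tau_def[symmetric] using card_gap_event_le[OF d tau d0(2) h n1 n2] by simp
  also have "... <= card ?Om * (2 powr (d0 * m k / 32) * (3 * 2 powr (- (d0 * m k / 16))))"
  proof (intro mult_left_mono mult_mono)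
   have pos: "0 < real n * (200 * real d / tau) ^ 2" using n d tau by simp
   have l1: "ln (real n * (200 * real d / tau) ^ 2) = ln n + 2 * ln (200 * real d / tau)"
    using n d tau by (simp add: ln_mult_pos ln_realpow)
   have l2: "200 * real d / tau = (200 * real d) * (40 * real d) ^ k" unfolding tau_def by simp
   have l3: "ln ((40 * real d) ^ k) = k * ln (40 * real d)" using d by (simp only: ln_realpow)
   have l4: "ln ((200 * real d) * (40 * real d) ^ k) = ln (200 * real d) + ln ((40 * real d) ^ k)"
    using d by (intro ln_mult_pos) auto
   have "ln (real n * (200 * real d / tau) ^ 2) = ln n + 2 * ln (200 * d) + 2 * k * ln (40 * d)"
    unfolding l1 unfolding l2 l4 l3 by simp
   also have "... <= ln n + 2 * ln (200 * d) + 2 * K * ln (40 * d)"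
    using k d1 by (intro add_left_mono mult_right_mono) auto
   also have "... <= Lam" by (rule Lam)
   finally have le: "ln (real n * (200 * real d / tau) ^ 2) <= Lam" .
   have "(real n * (200 * real d / tau) ^ 2) ^ (g * m k) = exp (real (g * m k) * ln (real n * (200 * real d / tau) ^ 2))"
    unfolding exp_of_nat_mult using pos by simp
   also have "... <= exp (real (g * m k) * Lam)" using le by (simp add: mult_left_mono)
   also have "... <= exp (ln 2 * (d0 * m k / 32))"
   proof -
    have "real (g * m k) * Lam = (64 * g * Lam) * m k / 64" by simp
    also have "... <= d0 * m k / 64" using mult_right_mono[OF g(1), of "real (m k)"] by simp
    also have "... = (1/2) * (d0 * m k / 32)" by simp
    also have "... <= ln 2 * (d0 * m k / 32)" using ln2_ge_two_thirds by (intro mult_right_mono) auto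
    finally show ?thesis by simp
   qed
   also have "... = 2 powr (d0 * m k / 32)" by (simp add: powr_def mult_ac)
   finally show "(real n * (200 * real d / tau) ^ 2) ^ (g * m k) <= 2 powr (d0 * m k / 32)" .
   have "real (d0 * m k) <= 16 * h" using h(2) by (metis of_nat_le_iff of_nat_mult of_nat_numeral)
   then have "2 powr (- real h) <= 2 powr (- (d0 * m k / 16))" by (intro powr_mono) auto
   moreover have "(1/2::real) ^ h = 2 powr (- real h)" by (simp add: powr_minus powr_realpow power_one_over inverse_eq_divide)
   ultimately show "(1/2) ^ h <= 2 powr (- (d0 * m k / 16))" by simp
  qed auto
  also have "... = card ?Om * (3 * 2 powr (- (d0 * m k / 32)))"
   by (simp add: powr_add[symmetric] mult.left_commute[of _ 3])
  also have "... <= card ?Om * (3 * 2 powr (- (d0 / 32)))"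
  proof -
   have "real d0 * 1 <= real d0 * m k" using m0 by (intro mult_left_mono) auto
   then show ?thesis by (intro mult_left_mono powr_mono) auto
  qed
  finally show ?thesis .
 qed
 have "{P : ?Om. ~ spreading n d w (g * M) (1 / (40 * d) ^ K) P} <= (\<Union>k<K. ?E k)"
 proof
  fix P assume a: "P : {P : ?Om. ~ spreading n d w (g * M) (1 / (40 * d) ^ K) P}"
  show "P : (\<Union>k<K. ?E k)"
  proof (rule ccontr)
   assume "P ~: (\<Union>k<K. ?E k)"
   then have ev: "!!k. k < K ==> ~ gap_event n d w (min (g ^ k) M) (g * min (g ^ k) M) (1 / (40 * real d) ^ k) P"
    using a unfolding m_def by auto
   have "spreading n d w (g * M) (1 / (40 * d) ^ K) P"
    unfolding spreading_def using gap_chain[OF ev M(3,4) d(1) g(2)] by auto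
   then show False using a by auto
  qed
 qed
 then have "card {P : ?Om. ~ spreading n d w (g * M) (1 / (40 * d) ^ K) P} <= (SUM k<K. card (?E k))"
  by (intro order_trans[OF card_mono card_UN_le]) auto
 then have "real (card {P : ?Om. ~ spreading n d w (g * M) (1 / (40 * d) ^ K) P}) <= (SUM k<K. real (card (?E k)))"
  by (simp only: of_nat_sum[symmetric] of_nat_le_iff)
 also have "... <= (SUM k<K. card ?Om * (3 * 2 powr (- (d0 / 32))))" by (intro sum_mono step) auto
 finally show ?thesis by (simp add: mult_ac)
qed

section \<open>Choice of parameters and the bound for the least singular value\<close>

lemma nat_div_ge_half: "b > 0 ==> b <= a ==> real a / (2 * real b) <= real (a div b)"
proof -
 assume b: "b > 0" "b <= a"
 have "a < b * (a div b) + b" using b by (metis add.commute add_less_cancel_left div_mult_mod_eq mod_less_divisor mult.commute)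
 moreover have "1 <= a div b" using b by (simp add: div_greater_zero_iff Suc_leI)
 then have "b * 1 <= b * (a div b)" by (intro mult_left_mono) auto
 ultimately have "a <= 2 * (b * (a div b))" by linarith
 then have "real a <= real (2 * (b * (a div b)))" by (rule of_nat_mono)
 then show ?thesis using b by (simp add: field_simps)
qed

lemma floor_ge_half:
 fixes x :: real
 assumes "1 <= x"
 shows "x / 2 <= real (nat \<lfloor>x\<rfloor>)"
proof -
 have "1 <= \<lfloor>x\<rfloor>" using assms by simp
 then have "real (nat \<lfloor>x\<rfloor>) = of_int \<lfloor>x\<rfloor>" "(1::real) <= of_int \<lfloor>x\<rfloor>" by auto
 then show ?thesis using floor_correct[of x] by linarith
qed

text \<open>Orders of magnitude: \<open>g\<close> is about \<open>d0 / Lam\<close>, \<open>M\<close>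
  about \<open>n / d0\<close>, the density \<open>al\<close> about \<open>1 / Lam\<close> and
  \<open>D\<close> about \<open>al^2 * d\<close>. The dominant error is the anti-concentration term
  \<open>sqrt (2 / D) / al\<close>, of order \<open>Lam^2 / sqrt d\<close>, hence
  \<open>d powr (-3/10)\<close> because \<open>Lam <= d powr (1/10)\<close>.\<close>

lemma small_singular_finite_bound:
 fixes C Lam eps :: real and n d K :: nat
 assumes n: "n >= 256" and d: "real d <= C * n" and C: "C >= 1" and w: "cmod w <= d / 2"
  and K: "K = nat \<lceil>log 2 n\<rceil> + 1" and Lam: "Lam = ln n + 2 * ln (200 * d) + 2 * K * ln (40 * d)"
  and x: "Lam <= real d powr (1/10)" "1 <= Lam"
  and big: "real d powr (9/10) >= 128 * 256 * C" "real d >= 8 * 256 * C" "real d powr (8/10) >= 16 * 131072 ^ 2"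
   "(2 + 2 * ln (131072 * Lam)) / (131072 * Lam) <= 1/4" 
   "real d powr (8/10) >= 8 * 131072 ^ 2" "real d powr (7/10) >= 8 * (8 + 2 * C) * 131072 ^ 3"
  and eps: "eps = (1 / (40 * d) ^ K)^2 / (2048 * real n ^ 2)"
 shows "real (card {P : tuples n d. small_singular n d w eps P})
  <= card (tuples n d) * (6 * real d powr (1/10) * 2 powr (- (d / (8192 * C))) + exp (- real n) + (1/2) powr n + 16 * 131072 ^ 2 * real d powr (- 3/10))"
proof -
 have d1: "real d >= 1" and dge: "real d >= 2048" using big(2) C by auto
 then have dpos: "d > 0" by simp
 have npos: "n > 0" using n by simp
 \<comment> \<open>131072 is \<open>4 * 128 * 256\<close>: the roundings below give
   \<open>g >= d0 / (128 * Lam)\<close> and \<open>M >= n / (256 * d0)\<close>, and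
   \<open>4 * al * n <= g * M\<close> is wanted for \<open>al = 1 / L\<close>.\<close>
 define L where "L = 131072 * Lam"
 \<comment> \<open>Since \<open>d\<close> may be comparable to \<open>n\<close> or larger, only
   \<open>d0\<close> of the permutations are used to produce good pairs; this lets
   \<open>128 * d0 * M <= n\<close> hold with some \<open>M >= 1\<close>.\<close>
 define d0 where "d0 = min d (n div 128)"
 have d0: "d0 <= d" "128 * d0 <= n" unfolding d0_def by auto
 have d0ge: "real d / (256 * C) <= d0"
 proof -
  have "real n / (2 * real 128) <= real (n div 128)" using n by (intro nat_div_ge_half) auto
  moreover have "real d / C <= n" using d C by (simp add: field_simps)
  ultimately have "real d / (256 * C) <= real (n div 128)" by (simp add: field_simps)
  moreover have "real d / (256 * C) <= d" using C d1 by (simp add: field_simps)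
  ultimately show ?thesis unfolding d0_def by (simp add: min_def)
 qed
 have d08: "8 <= d0"
 proof -
  have "8 <= real d / (256 * C)" using big(2) C by (simp add: field_simps)
  then show ?thesis using d0ge by linarith
 qed
 define g where "g = nat \<lfloor>real d0 / (64 * Lam)\<rfloor>"
 have gq: "real d0 / (64 * Lam) >= 2"
 proof -
  have "128 * Lam * (256 * C) <= 128 * real d powr (1/10) * (256 * C)" using x C by (intro mult_right_mono mult_left_mono) auto
  also have "... = (128 * 256 * C) * real d powr (1/10)" by simp
  also have "... <= real d powr (9/10) * real d powr (1/10)" using big(1) by (intro mult_right_mono) auto
  also have "... = d" using d1 by (simp add: powr_add[symmetric])
  finally have "128 * Lam <= real d / (256 * C)" using C by (simp add: field_simps)
  then show ?thesis using d0ge x(2) by (simp add: field_simps)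
 qed
 have g2: "g >= 2" unfolding g_def using gq by linarith
 have gle: "real g <= real d0 / (64 * Lam)" unfolding g_def using gq by linarith
 have gL: "64 * real g * Lam <= real d0" using gle x(2) by (simp add: field_simps)
 have gge: "real d0 / (128 * Lam) <= g"
  using floor_ge_half[of "real d0 / (64 * Lam)"] gq unfolding g_def by simp
 have g4: "4 * g <= d0"
 proof -
  have "64 * real g * 1 <= 64 * real g * Lam" using x(2) by (intro mult_left_mono) auto
  then show ?thesis using gL by linarith
 qed
 define M where "M = n div (128 * d0)"
 have M1: "128 * (d0 * M) <= n" unfolding M_def by (metis div_times_less_eq_dividend mult.assoc mult.commute)
 have M0: "M > 0" unfolding M_def using d0(2) d08 by (simp add: div_greater_zero_iff)
 have Mge: "real n / (2 * real (128 * d0)) <= M" unfolding M_def using d0(2) d08 by (intro nat_div_ge_half) auto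
 have MK: "M <= g ^ (K - 1)"
 proof -
  have "real n = 2 powr (log 2 n)" using npos by simp
  also have "... <= 2 powr (real (nat \<lceil>log 2 n\<rceil>))" by (intro powr_mono) linarith+
  also have "... = 2 ^ (K - 1)" unfolding K by (simp add: powr_realpow)
  finally have "n <= 2 ^ (K - 1)" by (metis of_nat_le_iff of_nat_numeral of_nat_power)
  also have "... <= g ^ (K - 1)" using g2 by (intro power_mono) auto
  finally show ?thesis unfolding M_def by (meson div_le_dividend order_trans)
 qed
 define tau where "tau = 1 / (40 * real d) ^ K"
 have pK: "(1::real) <= (40 * real d) ^ K" using d1 by (intro one_le_power) auto
 have tau: "0 < tau" "tau <= 1" unfolding tau_def using pK by auto
 have wd: "cmod w <= d" using w by simp
 have P1: "real (card {P : tuples n d. ~ spreading n d w (g * M) tau P}) <= card (tuples n d) * (K * (3 * 2 powr (- (d0 / 32))))"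
  unfolding tau_def using card_not_spreading_le[OF npos dpos wd _ gL _ g4 d08 d0(1) M1 M0 MK] Lam g2 K by simp
 define al where "al = 1 / L"
 have L1: "L >= 131072" unfolding L_def using x(2) by simp
 have Lle: "L <= 131072 * real d powr (1/10)" unfolding L_def using x(1) by simp
 have al: "0 < al" "al <= 1" unfolding al_def using L1 by auto
 have s: "4 * al * n <= g * M"
 proof -
  have "4 * al * n = (real d0 / (128 * Lam)) * (real n / (2 * real (128 * d0)))"
   unfolding al_def L_def using d08 x(2) by (simp add: field_simps)
  also have "... <= real g * real M" using gge Mge x(2) by (intro mult_mono) auto
  finally show ?thesis by simp
 qed
 define r where "r = nat \<lceil>al * n\<rceil>"
 have an: "al * n >= 0" using al by simp
 have r: "al * n <= r" "real r <= al * n + 1" unfolding r_def using an by linarith+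
 have rn: "r <= n"
 proof -
  have "al * real n <= 1 * real n" using al by (intro mult_right_mono) auto
  then show ?thesis unfolding r_def by (simp add: ceiling_le_iff nat_le_iff)
 qed
 define d1' where "d1' = nat \<lfloor>al\<^sup>2 * d\<rfloor>"
 have ad: "al\<^sup>2 * d >= real d powr (8/10) / 131072 ^ 2"
 proof -
  have "L^2 <= (131072 * real d powr (1/10))^2" using Lle L1 by (intro power_mono) auto
  also have "... = 131072 ^ 2 * real d powr (2/10)" by (simp add: power_mult_distrib power2_eq_square powr_add[symmetric])
  finally have "real d / L^2 >= real d / (131072 ^ 2 * real d powr (2/10))" using L1 d1 by (intro divide_left_mono) auto
  moreover have "real d / real d powr (2/10) = real d powr (8/10)" using powr_diff[of "real d" 1 "2/10"] d1 by simp
  ultimately have "real d powr (8/10) / 131072 ^ 2 <= real d / L^2" by (simp add: mult.commute flip: divide_divide_eq_left)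
  then show ?thesis unfolding al_def by (simp add: power_divide)
 qed
 have ad16: "al\<^sup>2 * d >= 16" using ad big(3) by (simp add: field_simps)
 have d1'ge: "al\<^sup>2 * d / 2 <= d1'" "16 <= d1'" and d1'le: "real d1' <= al\<^sup>2 * d"
  using floor_ge_half[of "al\<^sup>2 * d"] ad16 unfolding d1'_def by (simp, linarith, linarith)
 have al2: "al\<^sup>2 <= al / 131072"
  unfolding al_def power2_eq_square using L1 by (simp add: field_simps)
 have d14: "4 * d1' <= d"
 proof -
  have "al\<^sup>2 * d <= al / 131072 * d" using al2 by (intro mult_right_mono) auto
  also have "... <= 1 / 131072 * d" using al by (intro mult_right_mono) auto
  finally have "4 * real d1' <= d" using d1'le by linarith
  then show ?thesis by linarith
 qed
 have d1ln: "real d1' * (1 + ln (d / d1')) <= al * d / 4"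
 proof -
  have "d / d1' <= 2 * L^2"
  proof -
   have "real d <= 2 * L^2 * (al\<^sup>2 * d / 2)" unfolding al_def using L1 by (simp add: field_simps power_divide)
   also have "... <= 2 * L^2 * d1'" using d1'ge by (intro mult_left_mono) auto
   finally show ?thesis using d1'ge by (simp add: field_simps)
  qed
  then have "ln (d / d1') <= ln (2 * L^2)" using dpos d1'ge by (intro ln_mono) auto
  also have "... = ln 2 + 2 * ln L" using L1 by (simp add: ln_mult ln_realpow)
  also have "... <= 1 + 2 * ln L" using ln_2_less_1 by simp
  finally have "1 + ln (d / d1') <= 2 + 2 * ln L" by simp
  then have "real d1' * (1 + ln (d / d1')) <= (al\<^sup>2 * d) * (2 + 2 * ln L)"
   using d1'le L1 d14 d1'ge by (intro mult_mono) (auto intro!: add_nonneg_nonneg)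
  also have "... = (al * d) * ((2 + 2 * ln L) / L)" unfolding al_def using L1 by (simp add: power2_eq_square field_simps)
  also have "... <= (al * d) * (1/4)" using big(4) al unfolding L_def by (intro mult_left_mono) auto
  finally show ?thesis by simp
 qed
 define D where "D = d1' div 16"
 have D: "D > 0" "16 * D <= d1'" "d1' <= 32 * D"
 proof -
  have "a div 16 > 0 & a <= 32 * (a div 16)" if "16 <= a" for a :: nat using that by presburger
  from this[OF d1'ge(2)] show "D > 0" "d1' <= 32 * D" unfolding D_def by blast+
  show "16 * D <= d1'" unfolding D_def by simp
 qed
 have P2: "real (card {P : tuples n d. ~ mixing n d al D P}) <= card (tuples n d) * (4 ^ n * exp (- al * d * r / 2) + real n * 2 ^ d * 4 ^ n * (1/2) powr (d1' * r / 2))"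
  using card_not_mixing_le[OF npos al r(1) rn r(2) _ d14 d1ln D] d1'ge by simp
 have eps: "eps > 0" "2048 * real n * (eps * sqrt n) <= tau\<^sup>2"
 proof -
  show "eps > 0" unfolding eps using npos dpos by simp
  have "sqrt n <= n" using npos by (intro real_le_lsqrt) (auto simp: power2_eq_square)
  then have "2048 * real n * (eps * sqrt n) <= 2048 * real n * (eps * n)" using \<open>eps > 0\<close> by (intro mult_left_mono) auto
  also have "... = tau\<^sup>2" unfolding eps tau_def using npos by (simp add: power2_eq_square)
  finally show "2048 * real n * (eps * sqrt n) <= tau\<^sup>2" by simp
 qed
 have "real (card {P : tuples n d. small_singular n d w eps P}) <= card (tuples n d) *
  (2 * (K * (3 * 2 powr (- (d0 / 32)))) + (4 ^ n * exp (- al * d * r / 2) + real n * 2 ^ d * 4 ^ n * (1/2) powr (d1' * r / 2)) + sqrt (2 / D) / (2 * al))"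
  using card_small_singular_le[OF npos P1 P2 w dpos D(1) _ al(1) eps tau] s by simp
 also have "... <= card (tuples n d) * ((6 * real d powr (1/10) * 2 powr (- (d / (8192 * C)))) + (exp (- real n) + (1/2) powr n) + 16 * 131072 ^ 2 * real d powr (- 3/10))"
 proof (intro mult_left_mono add_mono)
  have "real K <= real d powr (1/10)"
  proof -
   have "exp 1 <= 40 * real d" using exp_le d1 by linarith
   then have "1 <= ln (40 * real d)" using d1 by (subst ln_ge_iff) auto
   then have "1 * real K <= (2 * ln (40 * real d)) * real K" by (intro mult_right_mono) auto
   also have "... <= Lam"
   proof -
    have "ln (real n) >= 0" "ln (200 * real d) >= 0" using npos d1 by auto
    then show ?thesis unfolding Lam by (simp add: mult_ac)
   qed
   finally show ?thesis using x(1) by simp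
  qed
  moreover have "2 powr (- (d0 / 32)) <= 2 powr (- (d / (8192 * C)))"
  proof (rule powr_mono)
   have "d / (8192 * C) = (d / (256 * C)) / 32" by simp
   also have "... <= d0 / 32" using d0ge by (intro divide_right_mono) auto
   finally show "- (real d0 / 32) <= - (d / (8192 * C))" by simp
  qed auto
  ultimately have "real K * (3 * 2 powr (- (d0 / 32))) <= real d powr (1/10) * (3 * 2 powr (- (d / (8192 * C))))"
   by (intro mult_mono) auto
  then show "2 * (K * (3 * 2 powr (- (d0 / 32)))) <= 6 * real d powr (1/10) * 2 powr (- (d / (8192 * C)))" by simp
  have rge: "al * n <= r" by (rule r)
  show "4 ^ n * exp (- al * d * r / 2) <= exp (- real n)"
  proof -
   have "4 * real n <= (al\<^sup>2 * d / 2) * n"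
   proof (rule mult_right_mono)
    show "4 <= al\<^sup>2 * d / 2" using ad big(5) by (simp add: field_simps)
   qed auto
   also have "... = (al * d / 2) * (al * n)" by (simp add: power2_eq_square)
   also have "... <= (al * d / 2) * r" using al rge by (intro mult_left_mono) auto
   finally have "- al * d * r / 2 <= - (4 * real n)" by simp
   then have "exp (- al * d * r / 2) <= exp (- (4 * real n))" by simp
   moreover have "(4::real) ^ n <= exp (3 * real n)"
   proof -
    have "(4::real) <= exp 3" using exp_ge_add_one_self[of 3] by simp
    then have "(4::real) ^ n <= exp 3 ^ n" by (intro power_mono) auto
    then show ?thesis by (simp add: exp_of_nat_mult[symmetric] mult.commute)
   qed
   ultimately have "4 ^ n * exp (- al * d * r / 2) <= exp (3 * real n) * exp (- (4 * real n))" by (intro mult_mono) auto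
   also have "... = exp (- real n)" by (simp flip: exp_add)
   finally show ?thesis .
  qed
  show "real n * 2 ^ d * 4 ^ n * (1/2) powr (d1' * r / 2) <= (1/2) powr n"
  proof -
   have a3: "al\<^sup>2 * d * al >= 8 * (8 + 2 * C)"
   proof -
    have "al >= 1 / (131072 * real d powr (1/10))" unfolding al_def using Lle L1 d1 by (intro divide_left_mono) auto
    then have "(real d powr (8/10) / 131072 ^ 2) * (1 / (131072 * real d powr (1/10))) <= (al\<^sup>2 * d) * al"
     using ad al by (intro mult_mono) auto
    moreover have "real d powr (8/10) / real d powr (1/10) = real d powr (7/10)" by (simp add: powr_diff[symmetric])
    ultimately have "real d powr (7/10) / 131072 ^ 3 <= al\<^sup>2 * d * al" by (simp add: field_simps power2_eq_square power3_eq_cube)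
    then show ?thesis using big(6) by (simp add: field_simps)
   qed
   have "(8 + 2 * C) * n <= (al\<^sup>2 * d * al / 8) * n" using a3 by (intro mult_right_mono) auto
   also have "... <= (al\<^sup>2 * d / 2) * (al * n) / 2" using al by (simp add: field_simps)
   also have "... <= d1' * r / 2" using mult_mono[OF d1'ge(1) rge] al by (simp add: mult_ac)
   finally have e: "(8 + 2 * C) * n <= d1' * r / 2" .
   have "real n <= 2 powr n" using of_nat_less_two_power[of n] by (simp add: powr_realpow)
   moreover have "(2::real) ^ d <= 2 powr (C * n)" using d by (simp add: powr_realpow[symmetric])
   moreover have "(4::real) ^ n = 2 powr (2 * n)" by (simp add: powr_realpow[symmetric] powr_powr[symmetric])
   moreover have "(1/2) powr (d1' * r / 2) <= 2 powr (- ((8 + 2 * C) * n))"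
   proof -
    have "(1/2::real) powr (d1' * r / 2) = 2 powr (- (d1' * r / 2))" by (simp add: powr_minus powr_divide inverse_eq_divide)
    then show ?thesis using e by simp
   qed
   ultimately have "real n * 2 ^ d * 4 ^ n * (1/2) powr (d1' * r / 2) <= 2 powr n * 2 powr (C * n) * 2 powr (2 * n) * 2 powr (- ((8 + 2 * C) * n))"
    by (intro mult_mono) auto
   also have "... = 2 powr (n + C * n + 2 * n - (8 + 2 * C) * n)" by (simp add: powr_add[symmetric] powr_diff[symmetric] algebra_simps)
   also have "... <= 2 powr (- real n)"
   proof (intro powr_mono)
    have "0 <= C * real n" using C by simp
    then show "n + C * n + 2 * n - (8 + 2 * C) * n <= - real n" by (simp add: algebra_simps)
   qed auto
   also have "... = (1/2) powr n" by (simp add: powr_minus powr_divide inverse_eq_divide)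
   finally show ?thesis by simp
  qed
  show "sqrt (2 / D) / (2 * al) <= 16 * 131072 ^ 2 * real d powr (- 3/10)"
  proof -
   have "al\<^sup>2 * d / 2 <= 32 * D" using d1'ge(1) D(3) by linarith
   then have Dge: "al\<^sup>2 * d / 64 <= D" by simp
   have "2 / D <= 2 / (al\<^sup>2 * d / 64)" using Dge al dpos D by (intro divide_left_mono) auto
   also have "... <= (16 * L)^2 / d" unfolding al_def using L1 dpos by (simp add: field_simps power_divide)
   finally have "sqrt (2 / D) <= sqrt ((16 * L)^2 / d)" by simp
   also have "... = 16 * L / sqrt d" unfolding real_sqrt_divide using L1 by (simp only: real_sqrt_abs)
   finally have "sqrt (2 / D) / (2 * al) <= (16 * L / sqrt d) / (2 * al)" using al by (intro divide_right_mono) auto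
   also have "... = 8 * L^2 / sqrt d" unfolding al_def by (simp add: power2_eq_square)
   also have "... <= 8 * (131072 * real d powr (1/10))^2 / sqrt d"
    using Lle L1 by (intro divide_right_mono mult_left_mono power_mono) auto
   also have "... = 8 * 131072 ^ 2 * (real d powr (2/10) / real d powr (1/2))"
    by (simp add: power_mult_distrib power2_eq_square powr_add[symmetric] powr_half_sqrt)
   also have "real d powr (2/10) / real d powr (1/2) = real d powr (- 3/10)" by (simp add: powr_diff[symmetric])
   also have "8 * 131072 ^ 2 * real d powr (- 3/10) <= 16 * 131072 ^ 2 * real d powr (- 3/10)" by (intro mult_right_mono) auto
   finally show ?thesis .
  qed
 qed auto
 finally show ?thesis by (simp add: algebra_simps)
qed

text \<open>\<open>Lam\<close> is of order \<open>ln n * ln d\<close>, and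
  \<open>ln n <= d powr (1/11)\<close> leaves room for the factor \<open>ln d\<close> below
  \<open>d powr (1/10)\<close>. The threshold \<open>eps\<close> is essentially the square of the
  last scale \<open>1 / (40 * d) ^ K\<close>, so \<open>ln (1 / eps)\<close> is at most
  \<open>11 + 2 * Lam\<close>.\<close>

lemma least_singular_value_bound:
 fixes d :: "nat => nat" and z :: complex and C :: real
 assumes dinf: "filterlim d at_top at_top"
  and lnn: "eventually (%n. ln (real n) <= real (d n) powr (1/11)) at_top"
  and up: "eventually (%n. real (d n) <= C * real n) at_top"
 obtains eps :: "nat => real" where
  "eventually (%n. 0 < eps n & eps n <= 1 & ln (1 / eps n) <= 20 * real (d n) powr (1/10)) at_top"
  "(%n. card {P : tuples n (d n). small_singular n (d n) (z * sqrt (d n)) (eps n) P} / card (tuples n (d n))) \<longlonglongrightarrow> 0"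
proof -
 define C' where "C' = max C 1"
 have C': "C' >= 1" unfolding C'_def by simp
 have up': "eventually (%n. real (d n) <= C' * real n) at_top"
  using up by eventually_elim (auto simp: C'_def intro: order_trans[OF _ mult_right_mono[of C "max C 1"]])
 define X where "X n = real (d n)" for n
 have Xinf: "filterlim X at_top at_top" unfolding X_def using dinf by (rule filterlim_compose[OF filterlim_real_sequentially])
 define K where "K n = nat \<lceil>log 2 (real n)\<rceil> + 1" for n
 define Lam where "Lam n = ln (real n) + 2 * ln (200 * X n) + 2 * real (K n) * ln (40 * X n)" for n
 define eps where "eps n = (1 / (40 * X n) ^ K n)^2 / (2048 * real n ^ 2)" for n
 have ev: "eventually (%n. Q (X n)) at_top" if "eventually Q at_top" for Q
  using Xinf that unfolding filterlim_iff by blast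
 have e1: "eventually (%x::real. x powr (1/11) + 2 * ln (200 * x) + 2 * (2 * x powr (1/11) + 2) * ln (40 * x) <= x powr (1/10)) at_top"
  by real_asymp
 have e2: "eventually (%x::real. x powr (9/10) >= 128 * 256 * C') at_top" by real_asymp
 have e3: "eventually (%x::real. x >= 8 * 256 * C') at_top" by real_asymp
 have e4: "eventually (%x::real. x powr (8/10) >= 16 * 131072 ^ 2) at_top" by real_asymp
 have e6: "eventually (%x::real. x powr (7/10) >= 8 * (8 + 2 * C') * 131072 ^ 3) at_top" by real_asymp
 have e7: "eventually (%x::real. (2 + 2 * ln (131072 * x)) / (131072 * x) <= 1/4) at_top" by real_asymp
 have e8: "eventually (%x::real. cmod z * sqrt x <= x / 2) at_top" by real_asymp
 have e9: "eventually (%n::nat. n >= 256) at_top" by (rule eventually_ge_at_top)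
 have Lb: "eventually (%n. 2 * ln (200 * X n) <= Lam n & Lam n <= X n powr (1/10) & ln (1 / eps n) <= 20 * X n powr (1/10) & 0 < eps n & eps n <= 1) at_top"
  using lnn ev[OF e1] ev[OF e3] e9
 proof eventually_elim
  case (elim n)
  have x1: "X n >= 1" using elim C' by linarith
  have n1: "real n >= 1" using elim by simp
  have ln0: "ln (real n) >= 0" "ln (40 * X n) >= 0" "ln (200 * X n) >= 0" using n1 x1 by auto
  have "log 2 (real n) <= 2 * ln (real n)"
  proof -
   have "ln (real n) * (1/2) <= ln (real n) * ln 2" using ln2_ge_two_thirds ln0(1) by (intro mult_left_mono) auto
   then show ?thesis unfolding log_def by (simp add: field_simps)
  qed
  then have "real (K n) <= 2 * ln (real n) + 2"
   unfolding K_def using ln0(1) by (simp add: of_nat_nat ceiling_le_iff) linarith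
  also have "... <= 2 * X n powr (1/11) + 2" using elim(1) unfolding X_def by simp
  finally have K: "real (K n) <= 2 * X n powr (1/11) + 2" .
  have "Lam n <= X n powr (1/11) + 2 * ln (200 * X n) + 2 * (2 * X n powr (1/11) + 2) * ln (40 * X n)"
   unfolding Lam_def using elim(1) K ln0 unfolding X_def[symmetric] by (intro add_mono mult_right_mono mult_left_mono) auto
  then have L: "Lam n <= X n powr (1/10)" using elim(2) by simp
  have Lge: "2 * ln (200 * X n) <= Lam n" unfolding Lam_def using ln0 by simp
  have x0: "X n > 0" using x1 by simp
  have p: "0 < (40 * X n) ^ K n" using x1 by simp
  have eps0: "eps n > 0" unfolding eps_def using n1 p x0 by (intro divide_pos_pos zero_less_power mult_pos_pos) auto
  have "1 / eps n = 2048 * (real n ^ 2 * ((40 * X n) ^ K n) ^ 2)"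
   unfolding eps_def using p n1 by (simp add: field_simps power_divide)
  then have "ln (1 / eps n) = ln (2048 * (real n ^ 2 * ((40 * X n) ^ K n) ^ 2))" by simp
  also have "... = ln 2048 + (ln (real n ^ 2) + ln (((40 * X n) ^ K n) ^ 2))"
  proof -
   have q: "0 < real n ^ 2" "0 < ((40 * X n) ^ K n) ^ 2" using p n1 x0 by (auto intro!: zero_less_power)
   have "ln (2048 * (real n ^ 2 * ((40 * X n) ^ K n) ^ 2)) = ln 2048 + ln (real n ^ 2 * ((40 * X n) ^ K n) ^ 2)"
    using q by (intro ln_mult_pos mult_pos_pos) auto
   moreover have "ln (real n ^ 2 * ((40 * X n) ^ K n) ^ 2) = ln (real n ^ 2) + ln (((40 * X n) ^ K n) ^ 2)"
    using q by (intro ln_mult_pos)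
   ultimately show ?thesis by simp
  qed
  also have "... = ln 2048 + (2 * ln (real n) + 2 * (real (K n) * ln (40 * X n)))"
   by (simp only: ln_realpow of_nat_numeral)
  also have "... <= 11 + 2 * Lam n"
  proof -
   have "ln (2048::real) = 11 * ln 2" using ln_realpow[of "2::real" 11] by simp
   then have "ln (2048::real) <= 11" using ln_2_less_1 by simp
   moreover have "0 <= real (K n) * ln (40 * X n)" using ln0 by (intro mult_nonneg_nonneg) auto
   moreover have "2 * (ln (real n) + 2 * ln (200 * X n) + 2 * real (K n) * ln (40 * X n))
    = 2 * ln (real n) + 4 * ln (200 * X n) + 4 * (real (K n) * ln (40 * X n))" by (simp add: algebra_simps)
   ultimately show ?thesis unfolding Lam_def using ln0 by linarith
  qed
  also have "... <= 20 * X n powr (1/10)"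
  proof -
   have "1 <= X n powr (1/10)" using x1 by (simp add: ge_one_powr_ge_zero)
   then show ?thesis using L by linarith
  qed
  finally have "ln (1 / eps n) <= 20 * X n powr (1/10)" .
  moreover have "eps n <= 1"
  proof -
   have "1 <= (40 * X n) ^ K n" using x1 by (intro one_le_power) auto
   then have "(1 / (40 * X n) ^ K n)^2 <= 1" by (intro power_le_one) auto
   moreover have "1 <= 2048 * real n ^ 2" using n1 one_le_power[OF n1, of 2] by linarith
   ultimately show ?thesis unfolding eps_def by (simp add: divide_le_eq)
  qed
  ultimately show ?case using L Lge eps0 by blast
 qed
 have e10: "eventually (%x::real. 2 * ln (200 * x) >= 1) at_top" by real_asymp
 have Linf: "filterlim Lam at_top at_top"
 proof (rule filterlim_at_top_mono)
  have "filterlim (%x::real. 2 * ln (200 * x)) at_top at_top" by real_asymp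
  then show "filterlim (%n. 2 * ln (200 * X n)) at_top at_top" by (rule filterlim_compose[OF _ Xinf])
  show "eventually (%n. 2 * ln (200 * X n) <= Lam n) at_top" using Lb by eventually_elim auto
 qed
 have evL: "eventually (%n. (2 + 2 * ln (131072 * Lam n)) / (131072 * Lam n) <= 1/4) at_top"
  using Linf e7 unfolding filterlim_iff by blast
 define B where "B n = 6 * X n powr (1/10) * 2 powr (- (X n / (8192 * C'))) + exp (- real n) + (1/2) powr n + 16 * 131072 ^ 2 * X n powr (- 3/10)" for n
 have bound: "eventually (%n. card {P : tuples n (d n). small_singular n (d n) (z * sqrt (d n)) (eps n) P} / card (tuples n (d n)) <= B n) at_top"
  using Lb evL up' ev[OF e2] ev[OF e3] ev[OF e4] ev[OF e6] ev[OF e8] e9 ev[OF e10]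
 proof eventually_elim
  case (elim n)
  have w: "cmod (z * sqrt (d n)) <= real (d n) / 2" using elim(8) unfolding X_def by (simp add: norm_mult)
  have "real (card {P : tuples n (d n). small_singular n (d n) (z * sqrt (d n)) (eps n) P}) <= card (tuples n (d n)) * B n"
   unfolding B_def X_def
  proof (rule small_singular_finite_bound[OF elim(9) elim(3) C' w refl refl])
   show "ln (real n) + 2 * ln (real (200 * d n)) + real (2 * (nat \<lceil>log 2 (real n)\<rceil> + 1)) * ln (real (40 * d n)) <= real (d n) powr (1/10)"
    using elim(1) unfolding Lam_def X_def K_def by simp
   show "1 <= ln (real n) + 2 * ln (real (200 * d n)) + real (2 * (nat \<lceil>log 2 (real n)\<rceil> + 1)) * ln (real (40 * d n))"
    using elim(1) elim(10) unfolding Lam_def X_def K_def by simp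
   show "(2 + 2 * ln (131072 * (ln (real n) + 2 * ln (real (200 * d n)) + real (2 * (nat \<lceil>log 2 (real n)\<rceil> + 1)) * ln (real (40 * d n))))) /
    (131072 * (ln (real n) + 2 * ln (real (200 * d n)) + real (2 * (nat \<lceil>log 2 (real n)\<rceil> + 1)) * ln (real (40 * d n)))) <= 1 / 4"
    using elim(2) unfolding Lam_def X_def K_def by simp
  qed (use elim in \<open>auto simp: X_def eps_def K_def\<close>)
  moreover have "0 < real (card (tuples n (d n)))" by (simp add: card_gt_0_iff)
  ultimately show ?case by (simp add: field_simps)
 qed
 have "B \<longlonglongrightarrow> 0"
 proof -
  have c: "8192 * C' > 0" using C' by simp
  have "((%x::real. 6 * x powr (1/10) * 2 powr (- (x / (8192 * C')))) \<longlongrightarrow> 0) at_top" using c by real_asymp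
  then have 1: "(%n. 6 * X n powr (1/10) * 2 powr (- (X n / (8192 * C')))) \<longlonglongrightarrow> 0" by (rule filterlim_compose[OF _ Xinf])
  have "((%x::real. 16 * 131072 ^ 2 * x powr (- 3/10)) \<longlongrightarrow> 0) at_top" by real_asymp
  then have 2: "(%n. 16 * 131072 ^ 2 * X n powr (- 3/10)) \<longlonglongrightarrow> 0" by (rule filterlim_compose[OF _ Xinf])
  have 3: "(%n::nat. exp (- real n)) \<longlonglongrightarrow> 0" "(%n::nat. (1/2::real) powr real n) \<longlonglongrightarrow> 0" by real_asymp+
  show ?thesis unfolding B_def using tendsto_add[OF tendsto_add[OF tendsto_add[OF 1 3(1)] 3(2)] 2] by simp
 qed
 then have "(%n. card {P : tuples n (d n). small_singular n (d n) (z * sqrt (d n)) (eps n) P} / card (tuples n (d n))) \<longlonglongrightarrow> 0"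
  by (intro tendsto_sandwich[OF _ bound tendsto_const]) auto
 moreover have "eventually (%n. 0 < eps n & eps n <= 1 & ln (1 / eps n) <= 20 * real (d n) powr (1/10)) at_top"
  using Lb unfolding X_def by eventually_elim auto
 ultimately show ?thesis using that by blast
qed

section \<open>Loop equations for the resolvent\<close>

text \<open>The hermitization of \<open>X\<close> minus \<open>\<i>t\<close>; row \<open>i\<close> of \<open>X\<close> has index \<open>i\<close> and column \<open>k\<close> has index \<open>n + k\<close>.\<close>
definition herm :: "nat => real => (nat => nat => complex) => nat => nat => complex" where
 "herm n t X p q = (if p < n & n <= q then X p (q - n) else if n <= p & q < n then cnj (X q (p - n))
  else if p = q then - \<i> * t else 0)"

section \<open>Hermitization and its resolvent\<close>

lemma sum_delta_mult:
 fixes f a :: "nat => complex"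
 assumes "p < N"
 shows "(SUM q<N. (if p = q then a q else 0) * f q) = a p * f p"
proof -
 have "(SUM q<N. (if p = q then a q else 0) * f q) = (SUM q<N. if p = q then a q * f q else 0)"
  by (intro sum.cong) auto
 then show ?thesis using assms by simp
qed

lemma sum_of_bool_mult:
 fixes f :: "nat => complex"
 assumes "p < N"
 shows "(SUM q<N. of_bool (p = q) * f q) = f p" "(SUM q<N. f q * of_bool (q = p)) = f p"
proof -
 show 1: "(SUM q<N. of_bool (p = q) * f q) = f p"
  using sum_delta_mult[OF assms, of "%_. 1" f] by (simp only: of_bool_def mult_1_left)
 have "(SUM q<N. f q * of_bool (q = p)) = (SUM q<N. of_bool (p = q) * f q)" by (intro sum.cong refl) auto
 then show "(SUM q<N. f q * of_bool (q = p)) = f p" unfolding 1 .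
qed

lemma sum_add_split:
 fixes f :: "nat => complex"
 shows "(SUM q<n+m. f q) = (SUM i<n. f i) + (SUM k<m. f (n + k))"
proof (induction m)
 case (Suc m)
 have "(SUM q<n + Suc m. f q) = (SUM q<n+m. f q) + f (n + m)" by simp
 then show ?case using Suc by simp
qed simp

lemma sum_double:
 fixes f :: "nat => complex"
 shows "(SUM q<2*n. f q) = (SUM i<n. f i) + (SUM k<n. f (n + k))"
 unfolding mult_2 by (rule sum_add_split)

text \<open>The matrix is hermitian up to the diagonal \<open>- \<i> * t\<close>, so the imaginary
  part of its quadratic form is \<open>- t\<close> times the squared norm. Invertibility and the
  bound \<open>1 / t\<close> for the resolvent follow.\<close>

lemma herm_dissipative:
 assumes "!!p. p < 2*n ==> y p = (SUM q<2*n. herm n t X p q * x q)"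
 shows "t * (SUM p<2*n. (cmod (x p))^2) <= cmod (SUM p<2*n. cnj (x p) * y p)"
proof -
 define M where "M p q = herm n t X p q + (if p = q then \<i> * t else 0)" for p q
 have Mh: "cnj (M p q) = M q p" for p q unfolding M_def herm_def by auto
 define S where "S = (SUM p<2*n. SUM q<2*n. cnj (x p) * M p q * x q)"
 have "cnj S = (SUM p<2*n. SUM q<2*n. cnj (x q) * M q p * x p)"
  unfolding S_def by (simp add: Mh mult_ac)
 also have "... = S" unfolding S_def by (rule sum.swap)
 finally have "Im S = 0" by (metis complex_cnj_cancel_iff Reals_cnj_iff complex_is_Real_iff)
 have sx: "(SUM q<2*n. (if p = q then \<i> * t else 0) * x q) = \<i> * t * x p" if "p < 2*n" for p
  using sum_delta_mult[OF that, of "%_. \<i> * t" x] .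
 have "(SUM p<2*n. cnj (x p) * y p) = (SUM p<2*n. cnj (x p) * ((SUM q<2*n. M p q * x q) - \<i> * t * x p))"
 proof (rule sum.cong[OF refl])
  fix p assume "p : {..<2*n}"
  then have p: "p < 2*n" by simp
  have "(SUM q<2*n. M p q * x q) = y p + \<i> * t * x p"
   unfolding M_def assms[OF p] sx[OF p, symmetric] by (simp add: distrib_right sum.distrib)
  then show "cnj (x p) * y p = cnj (x p) * ((SUM q<2*n. M p q * x q) - \<i> * t * x p)" by simp
 qed
 also have "... = S - \<i> * t * (SUM p<2*n. cnj (x p) * x p)"
  unfolding S_def by (simp add: right_diff_distrib sum_subtractf sum_distrib_left mult_ac)
 also have "(SUM p<2*n. cnj (x p) * x p) = complex_of_real (SUM p<2*n. (cmod (x p))^2)"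
  unfolding of_real_sum complex_norm_square by (simp add: mult.commute)
 finally have "Im (SUM p<2*n. cnj (x p) * y p) = - t * (SUM p<2*n. (cmod (x p))^2)" using \<open>Im S = 0\<close> by simp
 then show ?thesis using abs_Im_le_cmod[of "SUM p<2*n. cnj (x p) * y p"] by linarith
qed

lemma herm_bounded_below:
 assumes t: "t > 0" and y: "!!p. p < 2*n ==> y p = (SUM q<2*n. herm n t X p q * x q)"
 shows "t^2 * (SUM p<2*n. (cmod (x p))^2) <= (SUM p<2*n. (cmod (y p))^2)"
proof -
 define a where "a = (SUM p<2*n. (cmod (x p))^2)"
 define b where "b = (SUM p<2*n. (cmod (y p))^2)"
 have a0: "a >= 0" unfolding a_def by (simp add: sum_nonneg)
 have "t * a <= cmod (SUM p<2*n. cnj (x p) * y p)" unfolding a_def by (rule herm_dissipative[OF y])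
 also have "... <= (SUM p<2*n. cmod (x p) * cmod (y p))" by (rule order_trans[OF norm_sum]) (simp add: norm_mult)
 finally have "(t * a)^2 <= (SUM p<2*n. cmod (x p) * cmod (y p))^2" using t a0 by (intro power_mono) auto
 also have "... <= a * b" unfolding a_def b_def by (rule Cauchy_Schwarz_ineq_sum)
 finally have "a * (t^2 * a) <= a * b" by (simp add: power2_eq_square mult_ac)
 then show ?thesis unfolding a_def[symmetric] b_def[symmetric]
  using a0 by (cases "a = 0") (auto simp: b_def sum_nonneg)
qed

lemma finite_matrix_inverse:
 fixes K :: "nat => nat => complex"
 assumes "!!x. (!!p. p < N ==> (SUM q<N. K p q * x q) = 0) ==> (!!p. p < N ==> x p = 0)"
 shows "EX G. (ALL p<N. ALL r<N. (SUM q<N. K p q * G q r) = of_bool (p = r)) & (ALL p<N. ALL r<N. (SUM q<N. G p q * K q r) = of_bool (p = r))"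
proof -
 define A where "A = mat N N (%(i,k). K i k)"
 have A: "A : carrier_mat N N" by (simp add: A_def)
 have "det A ~= 0"
 proof
  assume "det A = 0"
  then obtain v where v: "v : carrier_vec N" "v ~= 0\<^sub>v N" "A *\<^sub>v v = 0\<^sub>v N"
   using det_0_iff_vec_prod_zero[OF A] by auto
  have "(SUM q<N. K p q * v $ q) = 0" if "p < N" for p
  proof -
   have "(A *\<^sub>v v) $ p = (SUM q<N. K p q * v $ q)"
    using that v(1) by (auto simp: A_def scalar_prod_def atLeast0LessThan intro!: sum.cong)
   then show ?thesis using v(3) that by simp
  qed
  then have "v $ p = 0" if "p < N" for p using assms[of "%p. v $ p"] that by blast
  then have "v = 0\<^sub>v N" using v(1) by (intro eq_vecI) auto
  then show False using v(2) by simp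
 qed
 then obtain B where B: "B : carrier_mat N N" "A * B = 1\<^sub>m N" "B * A = 1\<^sub>m N"
  using det_non_zero_imp_unit[OF A, of "()"] unfolding Units_def ring_mat_def by auto
 show ?thesis
 proof (intro exI[of _ "%p q. B $$ (p,q)"] conjI allI impI)
  fix p r assume pr: "p < N" "r < N"
  have "(A * B) $$ (p,r) = (SUM q<N. K p q * B $$ (q,r))"
   using pr B(1) by (auto simp: A_def scalar_prod_def atLeast0LessThan intro!: sum.cong)
  then show "(SUM q<N. K p q * B $$ (q,r)) = of_bool (p = r)" unfolding B(2) using pr by (auto simp: of_bool_def)
  have "(B * A) $$ (p,r) = (SUM q<N. B $$ (p,q) * K q r)"
   using pr B(1) by (auto simp: A_def scalar_prod_def atLeast0LessThan intro!: sum.cong)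
  then show "(SUM q<N. B $$ (p,q) * K q r) = of_bool (p = r)" unfolding B(3) using pr by (auto simp: of_bool_def)
 qed
qed

definition resolv :: "nat => real => (nat => nat => complex) => nat => nat => complex" where
 "resolv n t X = (SOME G. (ALL p<2*n. ALL r<2*n. (SUM q<2*n. herm n t X p q * G q r) = of_bool (p = r)) &
  (ALL p<2*n. ALL r<2*n. (SUM q<2*n. G p q * herm n t X q r) = of_bool (p = r)))"

context
 fixes n :: nat and t :: real and X :: "nat => nat => complex"
 assumes t: "t > 0"
begin

lemma resolv_inverse:
 "p < 2*n ==> r < 2*n ==> (SUM q<2*n. herm n t X p q * resolv n t X q r) = of_bool (p = r)"
 "p < 2*n ==> r < 2*n ==> (SUM q<2*n. resolv n t X p q * herm n t X q r) = of_bool (p = r)"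
proof -
 have "EX G. (ALL p<2*n. ALL r<2*n. (SUM q<2*n. herm n t X p q * G q r) = of_bool (p = r)) &
  (ALL p<2*n. ALL r<2*n. (SUM q<2*n. G p q * herm n t X q r) = of_bool (p = r))"
 proof (rule finite_matrix_inverse)
  fix x p assume x: "!!p. p < 2*n ==> (SUM q<2*n. herm n t X p q * x q) = 0" and p: "p < 2*n"
  have "t^2 * (SUM p<2*n. (cmod (x p))^2) <= (SUM p<2*n. (cmod 0)^2)"
   using herm_bounded_below[OF t, of n "%_. 0" X x] x by simp
  then have "(SUM p<2*n. (cmod (x p))^2) <= 0" using t by (simp add: mult_le_0_iff)
  then have "(SUM p<2*n. (cmod (x p))^2) = 0" by (simp add: order_antisym sum_nonneg)
  then show "x p = 0" using p by (subst (asm) sum_nonneg_eq_0_iff) auto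
 qed
 from someI_ex[OF this] show "p < 2*n ==> r < 2*n ==> (SUM q<2*n. herm n t X p q * resolv n t X q r) = of_bool (p = r)"
  "p < 2*n ==> r < 2*n ==> (SUM q<2*n. resolv n t X p q * herm n t X q r) = of_bool (p = r)"
  unfolding resolv_def by blast+
qed

lemma resolv_norm:
 "(SUM p<2*n. (cmod (SUM q<2*n. resolv n t X p q * y q))^2) <= (SUM q<2*n. (cmod (y q))^2) / t^2"
proof -
 define x where "x p = (SUM q<2*n. resolv n t X p q * y q)" for p
 have "(SUM q<2*n. herm n t X p q * x q) = y p" if p: "p < 2*n" for p
 proof -
  have "(SUM q<2*n. herm n t X p q * x q) = (SUM q<2*n. SUM r<2*n. herm n t X p q * resolv n t X q r * y r)"
   unfolding x_def by (simp add: sum_distrib_left mult.assoc)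
  also have "... = (SUM r<2*n. (SUM q<2*n. herm n t X p q * resolv n t X q r) * y r)"
   by (subst sum.swap) (simp add: sum_distrib_right)
  also have "... = (SUM r<2*n. of_bool (p = r) * y r)" by (intro sum.cong refl) (simp add: resolv_inverse p)
  also have "... = y p" by (rule sum_of_bool_mult[OF p])
  finally show ?thesis .
 qed
 then have "t^2 * (SUM p<2*n. (cmod (x p))^2) <= (SUM p<2*n. (cmod (y p))^2)" by (intro herm_bounded_below[OF t, where X = X]) auto
 then show ?thesis unfolding x_def using t by (simp add: field_simps)
qed

lemma resolv_column_norm: "q < 2*n ==> (SUM p<2*n. (cmod (resolv n t X p q))^2) <= 1 / t^2"
proof -
 assume q: "q < 2*n"
 have "(SUM p<2*n. (cmod (of_bool (p = q)))^2) = (SUM p<2*n. if p = q then 1 else (0::real))" by (intro sum.cong) auto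
 then have "(SUM p<2*n. (cmod (of_bool (p = q)))^2) = 1" using q by simp
 then show ?thesis using resolv_norm[of "%r. of_bool (r = q)"] by (simp only: sum_of_bool_mult[OF q])
qed

lemma resolv_entry: "p < 2*n ==> q < 2*n ==> cmod (resolv n t X p q) <= 1 / t"
proof -
 assume pq: "p < 2*n" "q < 2*n"
 have "(cmod (resolv n t X p q))^2 <= (SUM p<2*n. (cmod (resolv n t X p q))^2)"
  using pq by (intro member_le_sum) auto
 also have "... <= (1 / t)^2" using resolv_column_norm[OF pq(2)] by (simp add: power_divide)
 finally show ?thesis by (rule power2_le_imp_le) (use t in simp)
qed

text \<open>Conjugating by the grading operator maps the hermitization to its negative.\<close>
lemma resolv_adjoint:
 assumes "p < 2*n" "q < 2*n"
 shows "resolv n t X p q = (if p < n \<longleftrightarrow> q < n then - cnj (resolv n t X q p) else cnj (resolv n t X q p))"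
proof -
 let ?K = "herm n t X" and ?G = "resolv n t X"
 define s where "s p = (if p < n then 1 else (-1::complex))" for p
 have ss: "s p * s p = 1" "cnj (s p) = s p" for p unfolding s_def by auto
 have Ks: "?K p q = - (s p * s q * cnj (?K q p))" for p q unfolding herm_def s_def by auto
 define G' where "G' p q = - (s p * s q * cnj (?G q p))" for p q
 have KG': "(SUM q<2*n. ?K p q * G' q r) = of_bool (p = r)" if pr: "p < 2*n" "r < 2*n" for p r
 proof -
  have "(SUM q<2*n. ?K p q * G' q r) = (SUM q<2*n. s p * s r * cnj (?G r q * ?K q p))"
  proof (rule sum.cong[OF refl])
   fix q
   have "?K p q * G' q r = (s q * s q) * (s p * s r * cnj (?G r q * ?K q p))"
    unfolding G'_def by (subst Ks) (simp add: mult_ac)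
   then show "?K p q * G' q r = s p * s r * cnj (?G r q * ?K q p)" unfolding ss by simp
  qed
  also have "... = s p * s r * cnj (SUM q<2*n. ?G r q * ?K q p)" by (simp add: sum_distrib_left)
  also have "... = of_bool (p = r)" using pr ss by (simp add: resolv_inverse)
  finally show ?thesis .
 qed
 have "?G p q = (SUM r<2*n. ?G p r * of_bool (r = q))" by (rule sum_of_bool_mult[OF assms(2), symmetric])
 also have "... = (SUM r<2*n. ?G p r * (SUM s<2*n. ?K r s * G' s q))" by (intro sum.cong refl) (simp add: KG' assms)
 also have "... = (SUM r<2*n. SUM s<2*n. ?G p r * ?K r s * G' s q)" by (simp add: sum_distrib_left mult.assoc)
 also have "... = (SUM s<2*n. (SUM r<2*n. ?G p r * ?K r s) * G' s q)" by (subst sum.swap) (simp add: sum_distrib_right)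
 also have "... = (SUM s<2*n. of_bool (p = s) * G' s q)" by (intro sum.cong refl) (simp add: resolv_inverse assms)
 also have "... = G' p q" by (rule sum_of_bool_mult[OF assms(1)])
 finally have "?G p q = - (s p * s q * cnj (?G q p))" unfolding G'_def .
 then show ?thesis unfolding s_def by (cases "p < n"; cases "q < n") simp_all
qed

lemma resolv_row_norm: "p < 2*n ==> (SUM q<2*n. (cmod (resolv n t X p q))^2) <= 1 / t^2"
proof -
 assume p: "p < 2*n"
 have "cmod (resolv n t X p q) = cmod (resolv n t X q p)" if "q < 2*n" for q
  using resolv_adjoint[OF p that] by (metis complex_mod_cnj norm_minus_cancel)
 then have "(SUM q<2*n. (cmod (resolv n t X p q))^2) = (SUM q<2*n. (cmod (resolv n t X q p))^2)"
  by (intro sum.cong refl) (metis lessThan_iff)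
 then show ?thesis using resolv_column_norm[OF p] by simp
qed

lemma resolv_blocks:
 "i < n ==> r < 2*n ==> (SUM k<n. X i k * resolv n t X (n+k) r) = of_bool (i = r) + \<i> * t * resolv n t X i r"
 "k < n ==> r < 2*n ==> (SUM i<n. cnj (X i k) * resolv n t X i r) = of_bool (n + k = r) + \<i> * t * resolv n t X (n+k) r"
 "i < n ==> p < 2*n ==> (SUM k<n. resolv n t X p (n+k) * cnj (X i k)) = of_bool (p = i) + \<i> * t * resolv n t X p i"
proof -
 show "(SUM k<n. X i k * resolv n t X (n+k) r) = of_bool (i = r) + \<i> * t * resolv n t X i r" if "i < n" "r < 2*n"
 proof -
  have "(SUM q<n. herm n t X i q * resolv n t X q r) = (SUM q<n. (if i = q then - \<i> * t else 0) * resolv n t X q r)"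
   using that by (intro sum.cong) (auto simp: herm_def)
  then have "(SUM q<n. herm n t X i q * resolv n t X q r) = - \<i> * t * resolv n t X i r"
   by (simp only: sum_delta_mult[OF that(1)])
  moreover have "(SUM k<n. herm n t X i (n+k) * resolv n t X (n+k) r) = (SUM k<n. X i k * resolv n t X (n+k) r)"
   using that by (simp add: herm_def)
  moreover have "(SUM q<n. herm n t X i q * resolv n t X q r) + (SUM k<n. herm n t X i (n+k) * resolv n t X (n+k) r) = of_bool (i = r)"
   using resolv_inverse(1)[of i r] that by (subst sum_double[symmetric]) simp
  ultimately have "- \<i> * t * resolv n t X i r + (SUM k<n. X i k * resolv n t X (n+k) r) = of_bool (i = r)" by metis
  moreover have "S = b + \<i> * t * g" if "- \<i> * t * g + S = b" for S b g using that by auto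
  ultimately show ?thesis by blast
 qed
 show "(SUM i<n. cnj (X i k) * resolv n t X i r) = of_bool (n + k = r) + \<i> * t * resolv n t X (n+k) r" if "k < n" "r < 2*n"
 proof -
  have "(SUM q<n. herm n t X (n+k) (n+q) * resolv n t X (n+q) r) = (SUM q<n. (if k = q then - \<i> * t else 0) * resolv n t X (n+q) r)"
   using that by (intro sum.cong) (auto simp: herm_def)
  then have "(SUM q<n. herm n t X (n+k) (n+q) * resolv n t X (n+q) r) = - \<i> * t * resolv n t X (n+k) r"
   by (simp only: sum_delta_mult[OF that(1)])
  moreover have "(SUM i<n. herm n t X (n+k) i * resolv n t X i r) = (SUM i<n. cnj (X i k) * resolv n t X i r)"
   using that by (simp add: herm_def)
  moreover have "(SUM i<n. herm n t X (n+k) i * resolv n t X i r) + (SUM q<n. herm n t X (n+k) (n+q) * resolv n t X (n+q) r) = of_bool (n + k = r)"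
   using resolv_inverse(1)[of "n+k" r] that by (subst sum_double[symmetric]) simp
  ultimately have "(SUM i<n. cnj (X i k) * resolv n t X i r) + - \<i> * t * resolv n t X (n+k) r = of_bool (n + k = r)" by metis
  moreover have "S = b + \<i> * t * g" if "S + - \<i> * t * g = b" for S b g using that by auto
  ultimately show ?thesis by blast
 qed
 show "(SUM k<n. resolv n t X p (n+k) * cnj (X i k)) = of_bool (p = i) + \<i> * t * resolv n t X p i" if "i < n" "p < 2*n"
 proof -
  have "(SUM q<n. resolv n t X p q * herm n t X q i) = (SUM q<n. (if i = q then - \<i> * t else 0) * resolv n t X p q)"
   using that by (intro sum.cong) (auto simp: herm_def)
  then have "(SUM q<n. resolv n t X p q * herm n t X q i) = resolv n t X p i * (- \<i> * t)"
   by (simp only: sum_delta_mult[OF that(1)]) (rule mult.commute)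
  moreover have "(SUM k<n. resolv n t X p (n+k) * herm n t X (n+k) i) = (SUM k<n. resolv n t X p (n+k) * cnj (X i k))"
   using that by (simp add: herm_def)
  moreover have "(SUM q<n. resolv n t X p q * herm n t X q i) + (SUM k<n. resolv n t X p (n+k) * herm n t X (n+k) i) = of_bool (p = i)"
   using resolv_inverse(2)[of p i] that by (subst sum_double[symmetric]) simp
  ultimately have "resolv n t X p i * (- \<i> * t) + (SUM k<n. resolv n t X p (n+k) * cnj (X i k)) = of_bool (p = i)" by metis
  moreover have "S = b + \<i> * t * g" if "g * (- \<i> * t) + S = b" for S b g using that by auto
  ultimately show ?thesis by blast
 qed
qed

text \<open>Both diagonal blocks arise from the same double sum of
  \<open>resolv n t X i (n+k) * cnj (X i k)\<close>, evaluated once through the right and once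
  through the left inverse property.\<close>

lemma resolv_trace_eq: "(SUM k<n. resolv n t X (n+k) (n+k)) = (SUM i<n. resolv n t X i i)"
proof -
 have "(SUM i<n. SUM k<n. resolv n t X i (n+k) * cnj (X i k)) = of_nat n + \<i> * t * (SUM i<n. resolv n t X i i)"
  by (simp add: resolv_blocks(3) sum.distrib sum_distrib_left)
 moreover have "(SUM k<n. SUM i<n. cnj (X i k) * resolv n t X i (n+k)) = of_nat n + \<i> * t * (SUM k<n. resolv n t X (n+k) (n+k))"
  by (simp add: resolv_blocks(2) sum.distrib sum_distrib_left)
 moreover have "(SUM i<n. SUM k<n. resolv n t X i (n+k) * cnj (X i k)) = (SUM k<n. SUM i<n. cnj (X i k) * resolv n t X i (n+k))"
  by (subst sum.swap) (simp add: mult.commute)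
 ultimately show ?thesis using t by simp
qed

lemma resolv_offdiag_trace: "(SUM k<n. resolv n t X (n+k) k) = cnj (SUM i<n. resolv n t X i (n+i))"
proof -
 have "resolv n t X (n+k) k = cnj (resolv n t X k (n+k))" if "k < n" for k
  using that resolv_adjoint[of "n+k" k] by simp
 then have "(SUM k<n. resolv n t X (n+k) k) = (SUM k<n. cnj (resolv n t X k (n+k)))" by (intro sum.cong refl) simp
 then show ?thesis by (simp only: cnj_sum)
qed

text \<open>Eliminating the lower block shows that the upper left block of the resolvent is
  \<open>\<i> * t\<close> times the inverse of the Gram matrix plus \<open>t^2\<close>. Through this
  identity the eigenvalues of the Gram matrix determine the trace.\<close>

lemma resolv_gram:
 assumes "i < n" "j < n"
 shows "(SUM m<n. ((SUM k<n. X i k * cnj (X m k)) + t^2 * of_bool (i = m)) * resolv n t X m j) = \<i> * t * of_bool (i = j)"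
proof -
 have G: "(SUM m<n. cnj (X m k) * resolv n t X m j) = \<i> * t * resolv n t X (n+k) j" if "k < n" for k
  using resolv_blocks(2)[OF that, of j] assms by simp
 have "(SUM m<n. (SUM k<n. X i k * cnj (X m k)) * resolv n t X m j) = (SUM k<n. X i k * (SUM m<n. cnj (X m k) * resolv n t X m j))"
  by (simp add: sum_distrib_left sum_distrib_right) (subst sum.swap, simp add: mult_ac)
 also have "... = \<i> * t * (SUM k<n. X i k * resolv n t X (n+k) j)" by (simp add: G sum_distrib_left mult_ac)
 also have "... = \<i> * t * of_bool (i = j) - t^2 * resolv n t X i j"
  using resolv_blocks(1)[OF assms(1), of j] assms by (simp add: algebra_simps power2_eq_square)
 finally have 1: "(SUM m<n. (SUM k<n. X i k * cnj (X m k)) * resolv n t X m j) = \<i> * t * of_bool (i = j) - t^2 * resolv n t X i j" .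
 have 2: "(SUM m<n. t^2 * of_bool (i = m) * resolv n t X m j) = t^2 * resolv n t X i j"
 proof -
  have "(SUM m<n. complex_of_real (t^2 * of_bool (i = m)) * resolv n t X m j) = (SUM m<n. of_bool (i = m) * (complex_of_real (t^2) * resolv n t X m j))"
   by (intro sum.cong refl) auto
  then show ?thesis by (simp only: sum_of_bool_mult[OF assms(1)])
 qed
 show ?thesis by (simp only: distrib_right sum.distrib 1 2) simp
qed

end

lemma resolv_resolvent_identity:
 assumes t: "t > 0" and pr: "p < 2*n" "r < 2*n"
 shows "resolv n t X' p r - resolv n t X p r = (SUM q<2*n. SUM s<2*n. resolv n t X' p q * (herm n t X q s - herm n t X' q s) * resolv n t X s r)"
proof -
 let ?G = "resolv n t X" and ?G' = "resolv n t X'"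
 have "(SUM q<2*n. SUM s<2*n. ?G' p q * herm n t X q s * ?G s r) = (SUM q<2*n. ?G' p q * (SUM s<2*n. herm n t X q s * ?G s r))"
  by (simp add: sum_distrib_left mult.assoc)
 also have "... = (SUM q<2*n. ?G' p q * of_bool (q = r))" by (intro sum.cong refl) (simp add: resolv_inverse[OF t] pr)
 also have "... = ?G' p r" by (rule sum_of_bool_mult[OF pr(2)])
 finally have 1: "(SUM q<2*n. SUM s<2*n. ?G' p q * herm n t X q s * ?G s r) = ?G' p r" .
 have "(SUM q<2*n. SUM s<2*n. ?G' p q * herm n t X' q s * ?G s r) = (SUM s<2*n. (SUM q<2*n. ?G' p q * herm n t X' q s) * ?G s r)"
  by (subst sum.swap) (simp add: sum_distrib_right)
 also have "... = (SUM s<2*n. of_bool (p = s) * ?G s r)" by (intro sum.cong refl) (simp add: resolv_inverse[OF t] pr)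
 also have "... = ?G p r" by (rule sum_of_bool_mult[OF pr(1)])
 finally have 2: "(SUM q<2*n. SUM s<2*n. ?G' p q * herm n t X' q s * ?G s r) = ?G p r" .
 show ?thesis by (simp only: right_diff_distrib left_diff_distrib sum_subtractf 1 2)
qed

section \<open>Effect of a single swap on the resolvent of \<open>A - z\<close>\<close>

definition shifted :: "nat => complex => perms => nat => nat => complex" where
 "shifted d z P i k = (SUM l<d. of_bool (P l i = k)) / complex_of_real (sqrt d) - z * of_bool (i = k)"

text \<open>The perturbation is the product of a column vector supported on the two rows and a row
  vector supported on the two exchanged images; being of rank one, it has a hermitization of rank at
  most two.\<close>

lemma shifted_swap:
 assumes l: "l < d" and a: "i ~= j"
 shows "shifted d z (swap_at l i j P) r k = shifted d z P r k +
  (of_bool (r = i) - of_bool (r = j)) * (of_bool (k = P l j) - of_bool (k = P l i)) / complex_of_real (sqrt d)"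
proof -
 have "(SUM m<d. of_bool (swap_at l i j P m r = k)) = (SUM m<d. of_bool (P m r = k)) - of_bool (P l r = k) + (of_bool (swap_at l i j P l r = k) :: complex)"
 proof -
  have "(SUM m:{..<d}-{l}. of_bool (swap_at l i j P m r = k)) = (SUM m:{..<d}-{l}. of_bool (P m r = k) :: complex)"
   by (intro sum.cong) auto
  moreover have "(SUM m<d. f m) = f l + (SUM m:{..<d}-{l}. f m)" for f :: "nat => complex"
   using l by (intro sum.remove) auto
  ultimately show ?thesis by (metis (no_types, lifting) add.commute add_diff_cancel_left')
 qed
 moreover have "of_bool (swap_at l i j P l r = k) - of_bool (P l r = k) =
  (of_bool (r = i) - of_bool (r = j)) * (of_bool (k = P l j) - of_bool (k = P l i) :: complex)"
  using a by (cases "r = i"; cases "r = j") (auto simp: of_bool_def)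
 ultimately have "(SUM m<d. of_bool (swap_at l i j P m r = k)) = (SUM m<d. of_bool (P m r = k)) + 
  (of_bool (r = i) - of_bool (r = j)) * (of_bool (k = P l j) - of_bool (k = P l i) :: complex)"
  by (metis (no_types, lifting) add_diff_eq diff_add_eq)
 moreover have "(x + y) / s - v = x / s - v + y / s" for x y s v :: complex by (simp add: add_divide_distrib)
 ultimately show ?thesis unfolding shifted_def by metis
qed

context
 fixes n d :: nat and z :: complex and t :: real
 assumes t: "t > 0" and d: "d > 0"
begin

private abbreviation "G P \<equiv> resolv n t (shifted d z P)"

text \<open>The resolvent identity for this perturbation, kept exact: the left factors still belong
  to the swapped tuple. Replacing them by those of \<open>P\<close> produces the second order
  expansion.\<close>

lemma swap_resolv:
 assumes pi: "P : tuples n d" and l: "l < d" and ij: "i < n" "j < n" and pr: "p < 2*n" "r < 2*n"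
 shows "G (swap_at l i j P) p r - G P p r =
  - (1 / sqrt d) * ((G (swap_at l i j P) p i - G (swap_at l i j P) p j) * (G P (n + P l j) r - G P (n + P l i) r)
   + (G (swap_at l i j P) p (n + P l j) - G (swap_at l i j P) p (n + P l i)) * (G P i r - G P j r))"
proof (cases "i = j")
 case True
 have "swap_at l i i P = P" by (simp add: swap_at_def)
 then show ?thesis using True by simp
next
 case False
 let ?G' = "G (swap_at l i j P)" and ?G = "G P"
 define a where "a = n + P l i"
 define b where "b = n + P l j"
 have ab: "a < 2*n" "b < 2*n" "n <= a" "n <= b" using tuples_bound[OF pi] ij l unfolding a_def b_def by auto
 define u where "u q = (of_bool (q = i) - of_bool (q = j) :: complex)" for q
 define v where "v q = (of_bool (q = b) - of_bool (q = a) :: complex)" for q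
 define c where "c = complex_of_real (1 / sqrt d)"
 have cuv: "cnj c = c" "cnj (u q) = u q" "cnj (v q) = v q" for q unfolding c_def u_def v_def by auto
 have diff: "herm n t (shifted d z P) q s - herm n t (shifted d z (swap_at l i j P)) q s = - c * (u q * v s + v q * u s)"
  if "q < 2*n" "s < 2*n" for q s
 proof -
  have sh: "shifted d z (swap_at l i j P) r k = shifted d z P r k + c * (u r * v (n + k))" for r k
   unfolding shifted_swap[OF l False] c_def u_def v_def a_def b_def by simp
  have u0: "u q = 0" if "n <= q" for q using that ij unfolding u_def by auto
  have v0: "v q = 0" if "q < n" for q using that ab unfolding v_def by auto
  show ?thesis
   by (cases "q < n"; cases "s < n") (auto simp: herm_def sh u0 v0 cuv)
 qed
 have uG: "(SUM q<2*n. H q * u q) = H i - H j" for H :: "nat => complex"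
  unfolding u_def right_diff_distrib sum_subtractf using ij sum_of_bool_mult(2)[of i "2*n" H] sum_of_bool_mult(2)[of j "2*n" H] by simp
 have vG: "(SUM q<2*n. H q * v q) = H b - H a" for H :: "nat => complex"
  unfolding v_def right_diff_distrib sum_subtractf using ab sum_of_bool_mult(2)[of a "2*n" H] sum_of_bool_mult(2)[of b "2*n" H] by simp
 have "?G' p r - ?G p r = (SUM q<2*n. SUM s<2*n. ?G' p q * (- c * (u q * v s + v q * u s)) * ?G s r)"
  unfolding resolv_resolvent_identity[OF t pr] by (intro sum.cong refl) (simp add: diff)
 also have "... = (SUM q<2*n. SUM s<2*n. - c * ((?G' p q * u q) * (?G s r * v s)) + - c * ((?G' p q * v q) * (?G s r * u s)))"
  by (intro sum.cong refl) (simp add: algebra_simps)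
 also have "... = - c * ((SUM q<2*n. ?G' p q * u q) * (SUM s<2*n. ?G s r * v s)) + - c * ((SUM q<2*n. ?G' p q * v q) * (SUM s<2*n. ?G s r * u s))"
 proof -
  have "(SUM q<2*n. SUM s<2*n. - c * (f q * g s)) = - c * ((SUM q<2*n. f q) * (SUM s<2*n. g s))" for f g :: "nat => complex"
   unfolding sum_product by (simp only: sum_distrib_left[symmetric])
  then show ?thesis by (simp only: sum.distrib)
 qed
 also have "... = - c * ((?G' p i - ?G' p j) * (?G b r - ?G a r) + (?G' p b - ?G' p a) * (?G i r - ?G j r))"
  unfolding uG vG by (simp only: distrib_left)
 finally show ?thesis unfolding a_def b_def c_def by simp
qed

lemma G_entry: "p < 2*n ==> q < 2*n ==> cmod (G P p q) <= 1 / t"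
 by (rule resolv_entry[OF t])

lemma G_entry_diff: "p < 2*n ==> q < 2*n ==> p' < 2*n ==> q' < 2*n ==> cmod (G P p q - G P p' q') <= 2 / t"
 using G_entry[of p q P] G_entry[of p' q' P] norm_triangle_ineq4[of "G P p q" "G P p' q'"] by simp

context
 fixes P l i j
 assumes pi: "P : tuples n d" and l: "l < d" and ij: "i < n" "j < n"
begin

lemma images_bound: "n + P l i < 2*n" "n + P l j < 2*n"
 using tuples_bound[OF pi] ij l by auto

lemma swap_entry_diff:
 assumes pr: "p < 2*n" "r < 2*n"
 shows "cmod (G (swap_at l i j P) p r - G P p r) <= 8 / (sqrt d * t^2)"
proof -
 let ?G' = "G (swap_at l i j P)" and ?G = "G P"
 define A where "A = (?G' p i - ?G' p j) * (?G (n + P l j) r - ?G (n + P l i) r)"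
 define B where "B = (?G' p (n + P l j) - ?G' p (n + P l i)) * (?G i r - ?G j r)"
 have "cmod A <= (2/t) * (2/t)" "cmod B <= (2/t) * (2/t)" unfolding A_def B_def norm_mult using pr ij images_bound t
  by (intro mult_mono G_entry_diff; simp)+
 then have "cmod (A + B) <= 8 / t^2" using norm_triangle_ineq[of A B] by (simp add: power2_eq_square)
 then have "cmod (- (1 / sqrt d) * (A + B)) <= (1 / sqrt d) * (8 / t^2)"
  unfolding norm_mult using d by (intro mult_mono) (auto simp: norm_divide)
 then show ?thesis unfolding swap_resolv[OF pi l ij pr] A_def B_def by simp
qed

text \<open>Each replaced left factor costs one more entry difference
  \<open>8 / (sqrt d * t^2)\<close>, so the remainder gains a full \<open>1 / d\<close>; this beats
  the prefactor \<open>sqrt d\<close> of the loop equations.\<close>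

lemma swap_second_order:
 assumes pr: "p < 2*n" "r < 2*n"
 shows "cmod (G (swap_at l i j P) p r - (G P p r - (1 / sqrt d) * ((G P p i - G P p j) * (G P (n + P l j) r - G P (n + P l i) r)
   + (G P p (n + P l j) - G P p (n + P l i)) * (G P i r - G P j r)))) <= 64 / (d * t ^ 3)"
proof -
 let ?G' = "G (swap_at l i j P)" and ?G = "G P"
 let ?a = "n + P l i" and ?b = "n + P l j"
 define e where "e = 8 / (sqrt d * t^2)"
 have e0: "e >= 0" unfolding e_def by simp
 have D: "cmod (?G' p q - ?G p q) <= e" if "q < 2*n" for q unfolding e_def by (rule swap_entry_diff[OF pr(1) that])
 have D2: "cmod ((?G' p q - ?G' p s) - (?G p q - ?G p s)) <= 2 * e" if "q < 2*n" "s < 2*n" for q s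
 proof -
  have "(?G' p q - ?G' p s) - (?G p q - ?G p s) = (?G' p q - ?G p q) - (?G' p s - ?G p s)" by simp
  then have "cmod ((?G' p q - ?G' p s) - (?G p q - ?G p s)) <= cmod (?G' p q - ?G p q) + cmod (?G' p s - ?G p s)"
   by (metis norm_triangle_ineq4)
  then show ?thesis using D[OF that(1)] D[OF that(2)] by simp
 qed
 define A where "A = ((?G' p i - ?G' p j) - (?G p i - ?G p j)) * (?G ?b r - ?G ?a r)"
 define B where "B = ((?G' p ?b - ?G' p ?a) - (?G p ?b - ?G p ?a)) * (?G i r - ?G j r)"
 have "cmod A <= (2*e) * (2/t)" "cmod B <= (2*e) * (2/t)" unfolding A_def B_def norm_mult using pr ij images_bound t e0
  by (intro mult_mono G_entry_diff D2; simp)+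
 then have AB: "cmod (A + B) <= 8 * e / t" using norm_triangle_ineq[of A B] by simp
 have "?G' p r - (?G p r - (1 / sqrt d) * ((?G p i - ?G p j) * (?G ?b r - ?G ?a r) + (?G p ?b - ?G p ?a) * (?G i r - ?G j r)))
  = (?G' p r - ?G p r) + (1 / sqrt d) * ((?G p i - ?G p j) * (?G ?b r - ?G ?a r) + (?G p ?b - ?G p ?a) * (?G i r - ?G j r))" by simp
 also have "... = - (1 / sqrt d) * (A + B)" unfolding swap_resolv[OF pi l ij pr] A_def B_def by (simp add: algebra_simps)
 finally have "cmod (?G' p r - (?G p r - (1 / sqrt d) * ((?G p i - ?G p j) * (?G ?b r - ?G ?a r) + (?G p ?b - ?G p ?a) * (?G i r - ?G j r))))
  = cmod (- (1 / sqrt d) * (A + B))" by simp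
 also have "... <= (1 / sqrt d) * (8 * e / t)" unfolding norm_mult using d by (intro mult_mono AB) (auto simp: norm_divide)
 also have "... = 64 / ((sqrt d * sqrt d) * t ^ 3)" unfolding e_def using t by (simp add: power2_eq_square power3_eq_cube)
 finally show ?thesis by simp
qed

end

lemma G_col_sum: "q < 2*n ==> inj_on f {..<n} ==> f ` {..<n} <= {..<2*n} ==> (SUM m<n. (cmod (G P (f m) q))^2) <= 1 / t^2"
proof -
 assume a: "q < 2*n" "inj_on f {..<n}" "f ` {..<n} <= {..<2*n}"
 have "(SUM m<n. (cmod (G P (f m) q))^2) = (SUM p:f ` {..<n}. (cmod (G P p q))^2)"
  using a(2) by (simp add: sum.reindex)
 also have "... <= (SUM p<2*n. (cmod (G P p q))^2)" using a(3) by (intro sum_mono2) auto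
 also have "... <= 1 / t^2" by (rule resolv_column_norm[OF t a(1)])
 finally show ?thesis .
qed

lemma G_row_sum: "p < 2*n ==> inj_on f {..<n} ==> f ` {..<n} <= {..<2*n} ==> (SUM m<n. (cmod (G P p (f m)))^2) <= 1 / t^2"
proof -
 assume a: "p < 2*n" "inj_on f {..<n}" "f ` {..<n} <= {..<2*n}"
 have "(SUM m<n. (cmod (G P p (f m)))^2) = (SUM q:f ` {..<n}. (cmod (G P p q))^2)"
  using a(2) by (simp add: sum.reindex)
 also have "... <= (SUM q<2*n. (cmod (G P p q))^2)" using a(3) by (intro sum_mono2) auto
 also have "... <= 1 / t^2" by (rule resolv_row_norm[OF t a(1)])
 finally show ?thesis .
qed

lemma sum_sq_diff_le:
 fixes f g :: "nat => complex"
 assumes "(SUM m<n. (cmod (f m))^2) <= b" "(SUM m<n. (cmod (g m))^2) <= b"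
 shows "(SUM m<n. (cmod (f m - g m))^2) <= 4 * b"
proof -
 have "(cmod (f m - g m))^2 <= 2 * (cmod (f m))^2 + 2 * (cmod (g m))^2" for m
 proof -
  have "(cmod (f m - g m))^2 <= (cmod (f m) + cmod (g m))^2" by (intro power_mono norm_triangle_ineq4) auto
  also have "... <= 2 * (cmod (f m))^2 + 2 * (cmod (g m))^2" using sum_squares_bound[of "cmod (f m)" "cmod (g m)"] by (simp add: power2_sum)
  finally show ?thesis .
 qed
 then have "(SUM m<n. (cmod (f m - g m))^2) <= (SUM m<n. 2 * (cmod (f m))^2 + 2 * (cmod (g m))^2)" by (intro sum_mono)
 also have "... = 2 * (SUM m<n. (cmod (f m))^2) + 2 * (SUM m<n. (cmod (g m))^2)" by (simp add: sum.distrib sum_distrib_left)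
 finally show ?thesis using assms by simp
qed

lemma sum_mult_CS:
 fixes f g :: "nat => complex"
 assumes "(SUM m<n. (cmod (f m))^2) <= b^2" "(SUM m<n. (cmod (g m))^2) <= b^2" "b >= 0"
 shows "cmod (SUM m<n. f m * g m) <= b^2"
proof -
 have "cmod (SUM m<n. f m * g m) <= (SUM m<n. cmod (f m) * cmod (g m))" by (rule order_trans[OF norm_sum]) (simp add: norm_mult)
 also have "... <= b^2"
 proof (rule power2_le_imp_le)
  have "(SUM m<n. cmod (f m) * cmod (g m))^2 <= (SUM m<n. (cmod (f m))^2) * (SUM m<n. (cmod (g m))^2)" by (rule Cauchy_Schwarz_ineq_sum)
  also have "... <= b^2 * b^2" using assms by (intro mult_mono) (auto intro: sum_nonneg)
  finally show "(SUM m<n. cmod (f m) * cmod (g m))^2 <= (b^2)^2" by (simp add: power2_eq_square)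
 qed simp
 finally show ?thesis .
qed

definition gt :: "nat => nat => perms => complex" where
 "gt a b P = (SUM m<n. G P (a + m) (b + m)) / n"

lemma gt_norm:
 assumes "a = 0 \<or> a = n" "b = 0 \<or> b = n"
 shows "cmod (gt a b P) <= 1 / t"
proof (cases "n = 0")
 case False
 have "cmod (SUM m<n. G P (a + m) (b + m)) <= (SUM m<n. 1 / t)"
  using assms by (intro order_trans[OF norm_sum sum_mono] G_entry) auto
 then show ?thesis unfolding gt_def using False by (simp add: norm_divide field_simps)
next
 case True
 then have "gt a b P = 0" unfolding gt_def by simp
 then show ?thesis using t by simp
qed

text \<open>Rows and columns of the resolvent have euclidean norm at most \<open>1 / t\<close>, so
  Cauchy-Schwarz bounds the sum of all \<open>n\<close> diagonal changes by the bound for a single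
  entry. Normalized traces therefore move less by a factor \<open>n\<close>.\<close>

lemma gt_swap:
 assumes pi: "P : tuples n d" and l: "l < d" and ij: "i < n" "j < n" and ab: "a = 0 \<or> a = n" "b = 0 \<or> b = n"
 shows "cmod (gt a b (swap_at l i j P) - gt a b P) <= 8 / (n * sqrt d * t^2)"
proof -
 let ?G' = "G (swap_at l i j P)" and ?G = "G P"
 let ?a = "n + P l i" and ?b = "n + P l j"
 note ib = images_bound[OF pi l ij]
 have am: "a + m < 2*n" "b + m < 2*n" if "m < n" for m using that ab by auto
 have inj: "inj_on (%m. a + m) {..<n}" "inj_on (%m. b + m) {..<n}" by (auto simp: inj_on_def)
 have img: "(%m. a + m) ` {..<n} <= {..<2*n}" "(%m. b + m) ` {..<n} <= {..<2*n}" using am by auto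
 have c4: "4 * (1 / t^2) = (2/t)^2" by (simp add: power_divide)
 have 1: "cmod (SUM m<n. (?G' (a+m) i - ?G' (a+m) j) * (?G ?b (b+m) - ?G ?a (b+m))) <= (2/t)^2"
  using t ij ib by (intro sum_mult_CS; (subst c4[symmetric])?; (intro sum_sq_diff_le G_col_sum G_row_sum inj img)?) auto
 have 2: "cmod (SUM m<n. (?G' (a+m) ?b - ?G' (a+m) ?a) * (?G i (b+m) - ?G j (b+m))) <= (2/t)^2"
  using t ij ib by (intro sum_mult_CS; (subst c4[symmetric])?; (intro sum_sq_diff_le G_col_sum G_row_sum inj img)?) auto
 have "(SUM m<n. ?G' (a+m) (b+m)) - (SUM m<n. ?G (a+m) (b+m)) = (SUM m<n. - (1 / sqrt d) * ((?G' (a+m) i - ?G' (a+m) j) * (?G ?b (b+m) - ?G ?a (b+m))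
   + (?G' (a+m) ?b - ?G' (a+m) ?a) * (?G i (b+m) - ?G j (b+m))))"
  unfolding sum_subtractf[symmetric] by (intro sum.cong refl swap_resolv[OF pi l ij]) (use am in auto)
 also have "... = - (1 / sqrt d) * ((SUM m<n. (?G' (a+m) i - ?G' (a+m) j) * (?G ?b (b+m) - ?G ?a (b+m)))
  + (SUM m<n. (?G' (a+m) ?b - ?G' (a+m) ?a) * (?G i (b+m) - ?G j (b+m))))"
  by (simp only: sum_distrib_left[symmetric] sum.distrib)
 finally have "cmod ((SUM m<n. ?G' (a+m) (b+m)) - (SUM m<n. ?G (a+m) (b+m))) <= (1 / sqrt d) * (8 / t^2)"
 proof -
  assume e: "(SUM m<n. ?G' (a+m) (b+m)) - (SUM m<n. ?G (a+m) (b+m)) = - (1 / sqrt d) * ((SUM m<n. (?G' (a+m) i - ?G' (a+m) j) * (?G ?b (b+m) - ?G ?a (b+m)))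
  + (SUM m<n. (?G' (a+m) ?b - ?G' (a+m) ?a) * (?G i (b+m) - ?G j (b+m))))"
  have "(2/t)^2 + (2/t)^2 = 8 / t^2" by (simp add: power_divide)
  then show ?thesis unfolding e norm_mult using order_trans[OF norm_triangle_ineq add_mono[OF 1 2]] d
   by (intro mult_mono) (auto simp: norm_divide)
 qed
 then show ?thesis unfolding gt_def diff_divide_distrib[symmetric] norm_divide
  using ij by (simp add: field_simps)
qed

end

section \<open>Averaging over all swaps\<close>

context
 fixes n d :: nat and z :: complex and t :: real
 assumes t: "t > 0" and d: "d > 0" and n: "n > 0"
begin

private abbreviation "Gr P \<equiv> resolv n t (shifted d z P)"
private abbreviation "gtr a b P \<equiv> gt n d z t a b P"

text \<open>The normalized trace of the \<open>l\<close>-th permutation matrix times the lower left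
  (\<open>s = 0\<close>) or lower right (\<open>s = n\<close>) block of the resolvent.\<close>

definition xl :: "nat => nat => perms => complex" where
 "xl l s P = (SUM i<n. Gr P (n + P l i) (s + i)) / n"

lemma xl_norm:
 assumes "P : tuples n d" "l < d" "s = 0 \<or> s = n"
 shows "cmod (xl l s P) <= 1 / t"
proof -
 have "cmod (SUM i<n. Gr P (n + P l i) (s + i)) <= (SUM i<n. 1 / t)"
  using assms tuples_bound[OF assms(1)]
  by (intro order_trans[OF norm_sum sum_mono] resolv_entry[OF t]) auto
 then show ?thesis unfolding xl_def using n by (simp add: norm_divide field_simps)
qed

text \<open>After the swap the image of \<open>i\<close> under permutation \<open>l\<close> is
  \<open>P l j\<close>. As \<open>j\<close> is free, the entry no longer couples \<open>i\<close> to
  its own image; this makes the zeroth order term small and lets the first order term factorize into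
  traces.\<close>

lemma swap_average:
 assumes l: "l < d"
 shows "n * (SUM P:tuples n d. F P * (n * xl l s P)) =
  (SUM P:tuples n d. SUM i<n. SUM j<n. F (swap_at l i j P) * Gr (swap_at l i j P) (n + P l j) (s + i))"
proof -
 let ?Om = "tuples n d"
 have nx: "n * xl l s P = (SUM i<n. Gr P (n + P l i) (s + i))" for P unfolding xl_def using n by simp
 have "n * (SUM P:?Om. F P * (n * xl l s P)) = (SUM j<n. SUM P:?Om. SUM i<n. F P * Gr P (n + P l i) (s + i))"
  unfolding nx by (simp only: sum_distrib_left sum_constant card_lessThan)
 also have "... = (SUM j<n. SUM i<n. SUM P:?Om. F P * Gr P (n + P l i) (s + i))"
  by (intro sum.cong refl sum.swap)
 also have "... = (SUM j<n. SUM i<n. SUM P:?Om. F (swap_at l i j P) * Gr (swap_at l i j P) (n + P l j) (s + i))"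
 proof (rule sum.cong[OF refl], rule sum.cong[OF refl])
  fix j i assume "j : {..<n}" "i : {..<n}"
  then have "bij_betw (swap_at l i j) ?Om ?Om" using l by (intro bij_swap_at) auto
  from sum.reindex_bij_betw[OF this, of "%P. F P * Gr P (n + P l i) (s + i)"]
  show "(SUM P:?Om. F P * Gr P (n + P l i) (s + i)) = (SUM P:?Om. F (swap_at l i j P) * Gr (swap_at l i j P) (n + P l j) (s + i))"
   by simp
 qed
 also have "... = (SUM i<n. SUM j<n. SUM P:?Om. F (swap_at l i j P) * Gr (swap_at l i j P) (n + P l j) (s + i))" by (rule sum.swap)
 also have "... = (SUM i<n. SUM P:?Om. SUM j<n. F (swap_at l i j P) * Gr (swap_at l i j P) (n + P l j) (s + i))"
  by (intro sum.cong refl sum.swap)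
 also have "... = (SUM P:?Om. SUM i<n. SUM j<n. F (swap_at l i j P) * Gr (swap_at l i j P) (n + P l j) (s + i))" by (rule sum.swap)
 finally show ?thesis .
qed

text \<open>Where \<open>i\<close> and \<open>j\<close> stay entangled, the sum over
  \<open>j\<close> runs along a vector of euclidean norm at most \<open>1 / t\<close>, which gains a
  factor \<open>sqrt n\<close> over the trivial bound.\<close>

lemma cross_term_bound:
 fixes al \<beta> :: "nat => nat => complex"
 assumes "!!i. i < n ==> (SUM j<n. (cmod (al i j))^2) <= 1 / t^2" "!!i j. i < n ==> j < n ==> cmod (\<beta> i j) <= 1 / t"
 shows "cmod (SUM i<n. SUM j<n. al i j * \<beta> i j) <= n * sqrt n / t^2"
proof -
 have "cmod (SUM j<n. al i j * \<beta> i j) <= sqrt n / t^2" if i: "i < n" for i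
 proof -
  have "cmod (SUM j<n. al i j * \<beta> i j) <= (SUM j<n. cmod (al i j) * (1/t))"
   unfolding norm_mult[symmetric]
  proof (rule order_trans[OF norm_sum sum_mono])
   fix j assume "j : {..<n}"
   then have "cmod (al i j) * cmod (\<beta> i j) <= cmod (al i j) * (1/t)" using assms(2)[OF i, of j] by (intro mult_left_mono) auto
   then show "cmod (al i j * \<beta> i j) <= cmod (al i j) * (1/t)" by (simp only: norm_mult)
  qed
  also have "... = (SUM j<n. cmod (al i j) * 1) * (1/t)" by (simp only: sum_distrib_right mult_1_right)
  also have "... <= (sqrt n / t) * (1/t)"
  proof (rule mult_right_mono)
   show "(SUM j<n. cmod (al i j) * 1) <= sqrt n / t"
   proof (rule power2_le_imp_le)
    have "(SUM j<n. cmod (al i j) * 1)^2 <= (SUM j<n. (cmod (al i j))^2) * (SUM j<n. 1^2)" by (rule Cauchy_Schwarz_ineq_sum)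
    also have "... <= (1 / t^2) * n" using assms(1)[OF i] by (intro mult_mono) auto
    finally show "(SUM j<n. cmod (al i j) * 1)^2 <= (sqrt n / t)^2" by (simp add: power_divide)
   qed (use t in auto)
  qed (use t in auto)
  finally show ?thesis by (simp add: power2_eq_square)
 qed
 then have "(SUM i<n. cmod (SUM j<n. al i j * \<beta> i j)) <= (SUM i<n. sqrt n / t^2)" by (intro sum_mono) auto
 then show ?thesis using norm_sum[of "%i. SUM j<n. al i j * \<beta> i j" "{..<n}"] by simp
qed

context
 fixes P l s
 assumes pi: "P : tuples n d" and l: "l < d" and s: "s = 0 \<or> s = n"
begin

private abbreviation "T i j \<equiv> (Gr P (n + P l j) i - Gr P (n + P l j) j) * (Gr P (n + P l j) (s + i) - Gr P (n + P l i) (s + i))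
   + (Gr P (n + P l j) (n + P l j) - Gr P (n + P l j) (n + P l i)) * (Gr P i (s + i) - Gr P j (s + i))"

lemma perm_l: "P l permutes {..<n}" using tuples_permutes[OF pi l] .

lemma pl_bound: "i < n ==> n + P l i < 2*n" using tuples_bound[OF pi _ l] by simp

text \<open>Expanding gives eight products. In two of them the sums over \<open>i\<close> and
  \<open>j\<close> separate into normalized traces; the other six are cross terms.\<close>

lemma T_sum: "cmod ((SUM i<n. SUM j<n. T i j) - (n * n) * (xl l 0 P * xl l s P + gtr n n P * gtr 0 s P)) <= 6 * (n * sqrt n / t^2)"
proof -
 let ?G = "Gr P"
 let ?b = "%j. n + P l j"
 have injb: "inj_on ?b {..<n}" using permutes_inj[OF perm_l] by (auto simp: inj_on_def inj_def)
 have imgb: "?b ` {..<n} <= {..<2*n}" using pl_bound by auto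
 have inji: "inj_on (%j. j) {..<n}" "(%j. j) ` {..<n} <= {..<2*n}" by auto
 have sb: "i < n ==> s + i < 2*n" for i using s by auto
 have col: "(SUM j<n. (cmod (?G (?b j) q))^2) <= 1 / t^2" if "q < 2*n" for q
  by (rule G_col_sum[OF t d that injb imgb])
 have coli: "(SUM j<n. (cmod (?G j q))^2) <= 1 / t^2" if "q < 2*n" for q
  by (rule G_col_sum[OF t d that inji])
 note en = resolv_entry[OF t]
 let ?c = "n * sqrt n / t^2"
 have c1: "cmod (SUM i<n. SUM j<n. ?G (?b j) i * ?G (?b j) (s+i)) <= ?c"
  by (rule cross_term_bound; (rule col | rule en)) (use sb pl_bound in auto)
 have c2: "cmod (SUM i<n. SUM j<n. ?G (?b j) i * ?G (?b i) (s+i)) <= ?c"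
  by (rule cross_term_bound; (rule col | rule en)) (use sb pl_bound in auto)
 have c3: "cmod (SUM i<n. SUM j<n. ?G (?b j) (s+i) * ?G (?b j) j) <= ?c"
  by (rule cross_term_bound; (rule col | rule en)) (use sb pl_bound in auto)
 have c4: "cmod (SUM i<n. SUM j<n. ?G j (s+i) * ?G (?b j) (?b j)) <= ?c"
  by (rule cross_term_bound; (rule coli | rule en)) (use sb pl_bound in auto)
 have c5: "cmod (SUM i<n. SUM j<n. ?G (?b j) (?b i) * ?G i (s+i)) <= ?c"
  by (rule cross_term_bound; (rule col | rule en)) (use sb pl_bound in auto)
 have c6: "cmod (SUM i<n. SUM j<n. ?G (?b j) (?b i) * ?G j (s+i)) <= ?c"
  by (rule cross_term_bound; (rule col | rule en)) (use sb pl_bound in auto)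
 have m1: "(SUM i<n. SUM j<n. ?G (?b j) j * ?G (?b i) (s+i)) = (n * n) * (xl l 0 P * xl l s P)"
 proof -
  have "(SUM i<n. SUM j<n. ?G (?b j) j * ?G (?b i) (s+i)) = (SUM j<n. ?G (?b j) j) * (SUM i<n. ?G (?b i) (s+i))"
   unfolding sum_product by (rule sum.swap)
  then show ?thesis unfolding xl_def using n by simp
 qed
 have m2: "(SUM i<n. SUM j<n. ?G (?b j) (?b j) * ?G i (s+i)) = (n * n) * (gtr n n P * gtr 0 s P)"
 proof -
  have "(SUM j<n. ?G (?b j) (?b j)) = (SUM k<n. ?G (n+k) (n+k))"
   using sum.permute[OF perm_l, of "%k. ?G (n+k) (n+k)"] by (simp add: comp_def)
  moreover have "(SUM i<n. SUM j<n. ?G (?b j) (?b j) * ?G i (s+i)) = (SUM j<n. ?G (?b j) (?b j)) * (SUM i<n. ?G i (s+i))"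
   unfolding sum_product by (rule sum.swap)
  ultimately show ?thesis unfolding gt_def[OF t d] using n by simp
 qed
 have "(SUM i<n. SUM j<n. T i j) = (SUM i<n. SUM j<n. (?G (?b j) j * ?G (?b i) (s+i) + ?G (?b j) (?b j) * ?G i (s+i)) + (?G (?b j) i * ?G (?b j) (s+i) - ?G (?b j) i * ?G (?b i) (s+i)
   - ?G (?b j) (s+i) * ?G (?b j) j - ?G j (s+i) * ?G (?b j) (?b j) - ?G (?b j) (?b i) * ?G i (s+i) + ?G (?b j) (?b i) * ?G j (s+i)))"
  by (intro sum.cong refl) (simp add: algebra_simps)
 also have "... = (n * n) * (xl l 0 P * xl l s P) + (n * n) * (gtr n n P * gtr 0 s P) +
  ((SUM i<n. SUM j<n. ?G (?b j) i * ?G (?b j) (s+i)) - (SUM i<n. SUM j<n. ?G (?b j) i * ?G (?b i) (s+i)) - (SUM i<n. SUM j<n. ?G (?b j) (s+i) * ?G (?b j) j)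
   - (SUM i<n. SUM j<n. ?G j (s+i) * ?G (?b j) (?b j)) - (SUM i<n. SUM j<n. ?G (?b j) (?b i) * ?G i (s+i)) + (SUM i<n. SUM j<n. ?G (?b j) (?b i) * ?G j (s+i)))"
  by (simp only: sum.distrib sum_subtractf m1 m2)
 finally have e: "(SUM i<n. SUM j<n. T i j) - (n * n) * (xl l 0 P * xl l s P + gtr n n P * gtr 0 s P) =
  ((SUM i<n. SUM j<n. ?G (?b j) i * ?G (?b j) (s+i)) - (SUM i<n. SUM j<n. ?G (?b j) i * ?G (?b i) (s+i)) - (SUM i<n. SUM j<n. ?G (?b j) (s+i) * ?G (?b j) j)
   - (SUM i<n. SUM j<n. ?G j (s+i) * ?G (?b j) (?b j)) - (SUM i<n. SUM j<n. ?G (?b j) (?b i) * ?G i (s+i)) + (SUM i<n. SUM j<n. ?G (?b j) (?b i) * ?G j (s+i)))"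
  by (simp add: distrib_left)
 have tri: "cmod (a1 - a2 - a3 - a4 - a5 + a6) <= 6 * c" if "cmod a1 <= c" "cmod a2 <= c" "cmod a3 <= c" "cmod a4 <= c" "cmod a5 <= c" "cmod a6 <= c"
  for a1 a2 a3 a4 a5 a6 :: complex and c
 proof -
  have "cmod (a1 - a2 - a3 - a4 - a5 + a6) <= cmod a1 + cmod a2 + cmod a3 + cmod a4 + cmod a5 + cmod a6"
   using norm_triangle_ineq[of "a1 - a2 - a3 - a4 - a5" a6] norm_triangle_ineq4[of "a1 - a2 - a3 - a4" a5] norm_triangle_ineq4[of "a1 - a2 - a3" a4]
    norm_triangle_ineq4[of "a1 - a2" a3] norm_triangle_ineq4[of a1 a2] by linarith
  then show ?thesis using that by linarith
 qed
 show ?thesis unfolding e by (rule tri[OF c1 c2 c3 c4 c5 c6])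
qed

text \<open>This is the bilinear form of the resolvent on indicator vectors of blocks, so the
  operator norm gives \<open>n / t\<close> where entrywise estimates would give
  \<open>n * n / t\<close>.\<close>

lemma G_block_sum: "cmod (SUM i<n. SUM j<n. Gr P (n + P l j) (s + i)) <= n / t"
proof -
 let ?y = "%q. if s <= q & q < s + n then (1::complex) else 0"
 let ?x = "%p. SUM q<2*n. Gr P p q * ?y q"
 have x: "?x p = (SUM i<n. Gr P p (s + i))" for p
 proof -
  have "?x p = (SUM q:{s..<s+n}. Gr P p q)"
   using s by (intro sum.mono_neutral_cong_right) auto
  also have "... = (SUM i<n. Gr P p (s + i))"
   using sum.shift_bounds_nat_ivl[of "%q. Gr P p q" 0 s n] by (simp add: atLeast0LessThan add.commute)
  finally show ?thesis .
 qed
 have "(SUM q<2*n. (cmod (?y q))^2) = (SUM q:{s..<s+n}. 1)"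
  using s by (intro sum.mono_neutral_cong_right) auto
 then have ny: "(SUM q<2*n. (cmod (?y q))^2) = n" by simp
 have "(SUM k<n. (cmod (?x (n+k)))^2) = (SUM p:(%k. n + k) ` {..<n}. (cmod (?x p))^2)" by (simp add: sum.reindex)
 also have "... <= (SUM p<2*n. (cmod (?x p))^2)" by (intro sum_mono2) auto
 also have "... <= n / t^2" using resolv_norm[OF t, of n "shifted d z P" ?y] unfolding ny .
 finally have sq: "(SUM k<n. (cmod (?x (n+k)))^2) <= n / t^2" .
 have "(SUM i<n. SUM j<n. Gr P (n + P l j) (s + i)) = (SUM j<n. SUM i<n. Gr P (n + P l j) (s + i))" by (rule sum.swap)
 also have "... = (SUM k<n. SUM i<n. Gr P (n + k) (s + i))"
  using sum.permute[OF perm_l, of "%k. SUM i<n. Gr P (n + k) (s + i)"] by (simp add: comp_def)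
 also have "... = (SUM k<n. ?x (n+k))" by (simp only: x)
 finally have "cmod (SUM i<n. SUM j<n. Gr P (n + P l j) (s + i)) <= (SUM k<n. cmod (?x (n+k)) * 1)"
  using norm_sum[of "%k. ?x (n+k)" "{..<n}"] by simp
 also have "... <= n / t"
 proof (rule power2_le_imp_le)
  have "(SUM k<n. cmod (?x (n+k)) * 1)^2 <= (SUM k<n. (cmod (?x (n+k)))^2) * (SUM k<n. 1^2)" by (rule Cauchy_Schwarz_ineq_sum)
  also have "... <= (n / t^2) * n" using sq by (intro mult_mono) auto
  finally show "(SUM k<n. cmod (?x (n+k)) * 1)^2 <= (n / t)^2" by (simp add: power_divide power2_eq_square)
 qed (use t in auto)
 finally show ?thesis .
qed

end

end

text \<open>A Lipschitz test function; multiplied by \<open>w\<close> it detects the size of \<open>w\<close>.\<close>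
definition clip :: "complex => complex" where
 "clip w = cnj w / max 1 (cmod w)"

lemma clip_norm: "cmod (clip w) <= 1"
 unfolding clip_def by (simp add: norm_divide divide_le_eq)

lemma clip_mult: "clip w * w = complex_of_real (min (cmod w) ((cmod w)^2))"
proof -
 have e: "cnj w * w = complex_of_real ((cmod w)^2)" by (simp only: complex_norm_square mult.commute)
 have "clip w * w = complex_of_real ((cmod w)^2 / max 1 (cmod w))" unfolding clip_def of_real_divide e[symmetric] by simp
 moreover have "(cmod w)^2 / max 1 (cmod w) = min (cmod w) ((cmod w)^2)"
 proof (cases "cmod w <= 1")
  case True
  then have "cmod w * cmod w <= cmod w * 1" by (intro mult_left_mono) auto
  then show ?thesis using True by (simp add: power2_eq_square max_def min_def)
 next
  case False
  then have "cmod w * 1 <= cmod w * cmod w" by (intro mult_left_mono) auto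
  then show ?thesis using False by (simp add: power2_eq_square max_def min_def)
 qed
 ultimately show ?thesis by simp
qed

lemma clip_lipschitz: "cmod (clip w - clip v) <= 2 * cmod (w - v)"
proof -
 define M where "M = max 1 (cmod w)"
 define M' where "M' = max 1 (cmod v)"
 have M: "M >= 1" "M' >= 1" "cmod v <= M'" unfolding M_def M'_def by auto
 have MM: "\<bar>M' - M\<bar> <= cmod (w - v)" unfolding M_def M'_def
  using norm_triangle_ineq3[of w v] by (auto simp: max_def abs_if split: if_splits)
 have "clip w - clip v = (cnj w - cnj v) / M + cnj v * complex_of_real ((M' - M) / (M * M'))"
  unfolding clip_def M_def[symmetric] M'_def[symmetric] using M by (simp add: field_simps)
 then have "cmod (clip w - clip v) <= cmod ((cnj w - cnj v) / M) + cmod (cnj v * complex_of_real ((M' - M) / (M * M')))"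
  by (metis norm_triangle_ineq)
 also have "cmod ((cnj w - cnj v) / M) <= cmod (w - v)"
  using M by (simp add: norm_divide divide_le_eq mult_le_cancel_left1 flip: complex_cnj_diff)
 also have "cmod (cnj v * complex_of_real ((M' - M) / (M * M'))) <= cmod (w - v)"
 proof -
  have "cmod (cnj v * complex_of_real ((M' - M) / (M * M'))) = (cmod v / M') * (\<bar>M' - M\<bar> / M)"
   unfolding norm_mult norm_of_real using M by (simp add: abs_mult)
  also have "... <= 1 * (\<bar>M' - M\<bar> / 1)" using M by (intro mult_mono divide_left_mono) auto
  finally show ?thesis using MM by simp
 qed
 finally show ?thesis by simp
qed

context
 fixes n d :: nat and z :: complex and t :: real
 assumes t: "t > 0" and d: "d > 0" and n: "n > 0"
begin

private abbreviation "Gs P \<equiv> resolv n t (shifted d z P)"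
private abbreviation "gs a b P \<equiv> gt n d z t a b P"
private abbreviation "xs l s P \<equiv> xl n d z t l s P"

lemma xl_swap:
 assumes pi: "P : tuples n d" and l: "l < d" and ij: "i < n" "j < n" and s: "s = 0 \<or> s = n"
 shows "cmod (xs l s (swap_at l i j P) - xs l s P) <= 4 / (n * t) + 8 / (sqrt d * t^2)"
proof -
 let ?G' = "Gs (swap_at l i j P)" and ?G = "Gs P" and ?p = "swap_at l i j P"
 have pi': "?p : tuples n d" by (rule swap_at_in[OF pi l ij])
 define e where "e = 8 / (sqrt d * t^2)"
 have e0: "e >= 0" unfolding e_def by simp
 have tm: "cmod (?G' (n + ?p l m) (s + m) - ?G (n + P l m) (s + m)) <= e + 2/t * (of_bool (m = i) + of_bool (m = j))" if m: "m < n" for m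
 proof (cases "m = i \<or> m = j")
  case True
  have "cmod (?G' (n + ?p l m) (s + m)) <= 1/t" "cmod (?G (n + P l m) (s + m)) <= 1/t"
   using m s l tuples_bound[OF pi] tuples_bound[OF pi'] by (auto intro!: resolv_entry[OF t])
  then have "cmod (?G' (n + ?p l m) (s + m) - ?G (n + P l m) (s + m)) <= 2/t"
   using norm_triangle_ineq4[of "?G' (n + ?p l m) (s + m)" "?G (n + P l m) (s + m)"] by simp
  also have "... <= e + 2/t * (of_bool (m = i) + of_bool (m = j))"    proof -
   have "2/t * 1 <= 2/t * (of_bool (m = i) + of_bool (m = j))" using True t by (intro mult_left_mono) auto
   then show ?thesis using e0 by simp
  qed
  finally show ?thesis .
 next
  case False
  then have "?p l m = P l m" by simp
  moreover have "cmod (?G' (n + P l m) (s + m) - ?G (n + P l m) (s + m)) <= e"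
   unfolding e_def using m s l tuples_bound[OF pi] by (intro swap_entry_diff[OF t d pi l ij]) auto
  ultimately show ?thesis using False by simp
 qed
 have "cmod ((SUM m<n. ?G' (n + ?p l m) (s + m)) - (SUM m<n. ?G (n + P l m) (s + m))) <= (SUM m<n. e + 2/t * (of_bool (m = i) + of_bool (m = j)))"
  unfolding sum_subtractf[symmetric] by (rule order_trans[OF norm_sum sum_mono]) (use tm in auto)
 also have "... = n * e + 2/t * 2"
 proof -
  have "(SUM m<n. of_bool (m = k)) = (1::real)" if "k < n" for k
   using that by (simp add: of_bool_def)
  then have "(SUM m<n. of_bool (m = i) + of_bool (m = j)) = (2::real)" using ij by (simp only: sum.distrib)
  then show ?thesis by (simp only: sum.distrib sum_distrib_left[symmetric]) simp
 qed
 finally have "cmod ((SUM m<n. ?G' (n + ?p l m) (s + m)) - (SUM m<n. ?G (n + P l m) (s + m))) / n <= (n * e + 2/t * 2) / n"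
  by (intro divide_right_mono) auto
 then show ?thesis unfolding xl_def[OF t d n] diff_divide_distrib[symmetric] norm_divide e_def[symmetric]
  using n by (simp add: add_divide_distrib mult.commute)
qed

text \<open>Swap averaging with the test function \<open>cnj (xl l s P)\<close> reproduces the
  second moment, and the zeroth order term is small by \<open>G_block_sum\<close>. Hence products of
  two \<open>xl\<close> are negligible in the loop equations.\<close>

lemma sum_xl_sq:
 assumes l: "l < d" and s: "s = 0 \<or> s = n"
 shows "(SUM P:tuples n d. (cmod (xs l s P))^2) <= card (tuples n d) * (5 / (n * t^2) + 16 / (sqrt d * t ^ 3))"
proof -
 let ?Om = "tuples n d"
 define F where "F P = cnj (xs l s P)" for P
 define e where "e = 8 / (sqrt d * t^2)"
 have e0: "e >= 0" unfolding e_def by simp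
 define c where "c = (4 / (n * t) + e) * (1/t) + (1/t) * e"
 have one: "cmod (SUM i<n. SUM j<n. F (swap_at l i j P) * Gs (swap_at l i j P) (n + P l j) (s + i)) <= n / t * (1/t) + real n * real n * c"
  if pi: "P : ?Om" for P
 proof -
  have tm: "cmod (F (swap_at l i j P) * Gs (swap_at l i j P) (n + P l j) (s + i) - F P * Gs P (n + P l j) (s + i)) <= c"
   if ij: "i < n" "j < n" for i j
  proof -
   have pi': "swap_at l i j P : ?Om" by (rule swap_at_in[OF pi l ij])
   have b: "n + P l j < 2*n" "s + i < 2*n" using tuples_bound[OF pi] ij l s by auto
   have 1: "cmod (F (swap_at l i j P) - F P) <= 4 / (n * t) + e"
    unfolding F_def e_def using xl_swap[OF pi l ij s] by (metis complex_cnj_diff complex_mod_cnj)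
   have 2: "cmod (Gs (swap_at l i j P) (n + P l j) (s + i)) <= 1/t" by (rule resolv_entry[OF t b])
   have 3: "cmod (F P) <= 1/t" unfolding F_def using xl_norm[OF t d n pi l s] by simp
   have 4: "cmod (Gs (swap_at l i j P) (n + P l j) (s + i) - Gs P (n + P l j) (s + i)) <= e"
    unfolding e_def by (rule swap_entry_diff[OF t d pi l ij b])
   have eq: "F (swap_at l i j P) * Gs (swap_at l i j P) (n + P l j) (s + i) - F P * Gs P (n + P l j) (s + i)
    = (F (swap_at l i j P) - F P) * Gs (swap_at l i j P) (n + P l j) (s + i) + F P * (Gs (swap_at l i j P) (n + P l j) (s + i) - Gs P (n + P l j) (s + i))"
    by (simp add: algebra_simps)
   have "cmod (F (swap_at l i j P) * Gs (swap_at l i j P) (n + P l j) (s + i) - F P * Gs P (n + P l j) (s + i))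
    <= cmod (F (swap_at l i j P) - F P) * cmod (Gs (swap_at l i j P) (n + P l j) (s + i)) + cmod (F P) * cmod (Gs (swap_at l i j P) (n + P l j) (s + i) - Gs P (n + P l j) (s + i))"
    unfolding eq by (rule order_trans[OF norm_triangle_ineq]) (simp only: norm_mult)
   also have "... <= c" unfolding c_def using t e0 by (intro add_mono mult_mono 1 2 3 4) auto
   finally show ?thesis .
  qed
  have "cmod ((SUM i<n. SUM j<n. F (swap_at l i j P) * Gs (swap_at l i j P) (n + P l j) (s + i)) - (SUM i<n. SUM j<n. F P * Gs P (n + P l j) (s + i))) <= (SUM i<n. SUM j<n. c)"
   unfolding sum_subtractf[symmetric]
   by (intro order_trans[OF norm_sum sum_mono] tm) auto
  then have "cmod ((SUM i<n. SUM j<n. F (swap_at l i j P) * Gs (swap_at l i j P) (n + P l j) (s + i)) - (SUM i<n. SUM j<n. F P * Gs P (n + P l j) (s + i))) <= real n * real n * c" by simp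
  moreover have "cmod (SUM i<n. SUM j<n. F P * Gs P (n + P l j) (s + i)) <= n / t * (1/t)"
  proof -
   have "(SUM i<n. SUM j<n. F P * Gs P (n + P l j) (s + i)) = (SUM i<n. SUM j<n. Gs P (n + P l j) (s + i)) * F P"
    by (simp only: sum_distrib_left[symmetric] mult.commute)
   moreover have "cmod (F P) <= 1/t" unfolding F_def using xl_norm[OF t d n pi l s] by simp
   ultimately show ?thesis using G_block_sum[OF t d n pi l s] t by (simp only: norm_mult) (intro mult_mono, auto)
  qed
  moreover have "cmod a <= x + y" if "cmod (a - b) <= y" "cmod b <= x" for a b :: complex and x y
   using that norm_triangle_sub[of a b] by linarith
  ultimately show ?thesis by blast
 qed
 have "complex_of_real (real n * real n * (SUM P:?Om. (cmod (xs l s P))^2)) = n * (SUM P:?Om. F P * (n * xs l s P))"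
 proof -
  have "F P * (n * xs l s P) = n * complex_of_real ((cmod (xs l s P))^2)" for P
   unfolding F_def complex_norm_square by (simp add: mult_ac)
  then have "n * (SUM P:?Om. F P * (n * xs l s P)) = n * (n * (SUM P:?Om. complex_of_real ((cmod (xs l s P))^2)))"
   by (simp only: sum_distrib_left)
  then show ?thesis by (simp only: of_real_mult of_real_of_nat_eq of_real_sum mult.assoc)
 qed
 also have "... = (SUM P:?Om. SUM i<n. SUM j<n. F (swap_at l i j P) * Gs (swap_at l i j P) (n + P l j) (s + i))"
  by (rule swap_average[OF t d n l])
 finally have sq: "complex_of_real (real n * real n * (SUM P:?Om. (cmod (xs l s P))^2)) = (SUM P:?Om. SUM i<n. SUM j<n. F (swap_at l i j P) * Gs (swap_at l i j P) (n + P l j) (s + i))" .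
 have "real n * real n * (SUM P:?Om. (cmod (xs l s P))^2) <= cmod (SUM P:?Om. SUM i<n. SUM j<n. F (swap_at l i j P) * Gs (swap_at l i j P) (n + P l j) (s + i))"
  unfolding sq[symmetric] norm_of_real by (rule abs_ge_self)
 also have "... <= (SUM P:?Om. n / t * (1/t) + real n * real n * c)" by (intro order_trans[OF norm_sum sum_mono] one)
 also have "... = real n * real n * (card ?Om * (1 / (n * t^2) + c))" using n by (simp add: power2_eq_square field_simps)
 finally have "(SUM P:?Om. (cmod (xs l s P))^2) <= card ?Om * (1 / (n * t^2) + c)" using n by simp
 also have "1 / (n * t^2) + c = 5 / (n * t^2) + 16 / (sqrt d * t ^ 3)"
  unfolding c_def e_def using t n d by (simp add: field_simps power2_eq_square power3_eq_cube)
 finally show ?thesis .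
qed

text \<open>The swapped product is close to \<open>F P\<close> times the second order expansion. Its
  first order term is \<open>- 1 / sqrt d\<close> times the two products of traces found in
  \<open>T_sum\<close>, and multiplication by \<open>sqrt d\<close> puts these next to
  \<open>sqrt d * xl\<close>. \<open>kappa\<close> measures how much the test function moves under a
  swap.\<close>

lemma loop_single:
 assumes l: "l < d" and s: "s = 0 \<or> s = n"
  and F: "!!P. P : tuples n d ==> cmod (F P) <= 1"
  and F': "!!P i j. P : tuples n d ==> i < n ==> j < n ==> cmod (F (swap_at l i j P) - F P) <= kappa"
 shows "cmod (SUM P:tuples n d. F P * (sqrt d * xs l s P + (xs l 0 P * xs l s P + gs n n P * gs 0 s P)))
  <= card (tuples n d) * (sqrt d * (kappa / t + 64 / (d * t ^ 3) + 1 / (n * t)) + 6 / (sqrt n * t^2))"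
proof -
 let ?Om = "tuples n d"
 define m where "m P = xs l 0 P * xs l s P + gs n n P * gs 0 s P" for P
 define T where "T P i j = (Gs P (n + P l j) i - Gs P (n + P l j) j) * (Gs P (n + P l j) (s + i) - Gs P (n + P l i) (s + i))
   + (Gs P (n + P l j) (n + P l j) - Gs P (n + P l j) (n + P l i)) * (Gs P i (s + i) - Gs P j (s + i))" for P i j
 define Q where "Q P = (SUM i<n. SUM j<n. F (swap_at l i j P) * Gs (swap_at l i j P) (n + P l j) (s + i))" for P
 define q where "q = complex_of_real (1 / sqrt d)"
 have nq: "cmod q = 1 / sqrt d" unfolding q_def by (simp add: norm_divide)
 define c where "c = kappa / t + 64 / (d * t ^ 3)"
 have sd: "sqrt (real d) > 0" using d by simp
 have one: "cmod (Q P + (n * n) * q * (F P * m P)) <= real n * real n * c + n / t + (1 / sqrt d) * (6 * (n * sqrt n / t^2))"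
  if pi: "P : ?Om" for P
 proof -
  have tm: "cmod (F (swap_at l i j P) * Gs (swap_at l i j P) (n + P l j) (s + i) - F P * (Gs P (n + P l j) (s + i) - q * T P i j)) <= c"
   if ij: "i < n" "j < n" for i j
  proof -
   have b: "n + P l j < 2*n" "s + i < 2*n" using tuples_bound[OF pi] ij l s by auto
   let ?A = "Gs (swap_at l i j P) (n + P l j) (s + i)" and ?B = "Gs P (n + P l j) (s + i) - q * T P i j"
   have 2: "cmod ?A <= 1/t" by (rule resolv_entry[OF t b])
   have 4: "cmod (?A - ?B) <= 64 / (d * t ^ 3)"
    using swap_second_order[OF t d pi l ij b] unfolding T_def q_def by simp
   have eq: "F (swap_at l i j P) * ?A - F P * ?B = (F (swap_at l i j P) - F P) * ?A + F P * (?A - ?B)" by (simp add: algebra_simps)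
   have "cmod (F (swap_at l i j P) * ?A - F P * ?B) <= cmod (F (swap_at l i j P) - F P) * cmod ?A + cmod (F P) * cmod (?A - ?B)"
    unfolding eq by (rule order_trans[OF norm_triangle_ineq]) (simp only: norm_mult)
   also have "... <= kappa * (1/t) + 1 * (64 / (d * t ^ 3))"
    using t order_trans[OF norm_ge_zero F'[OF pi ij]] by (intro add_mono mult_mono F'[OF pi ij] 2 4 F[OF pi]) auto
   finally show ?thesis unfolding c_def by simp
  qed
  have "cmod (Q P - (SUM i<n. SUM j<n. F P * (Gs P (n + P l j) (s + i) - q * T P i j))) <= (SUM i<n. SUM j<n. c)"
   unfolding Q_def sum_subtractf[symmetric] by (intro order_trans[OF norm_sum sum_mono] tm) auto
  then have a1: "cmod (Q P - (SUM i<n. SUM j<n. F P * (Gs P (n + P l j) (s + i) - q * T P i j))) <= real n * real n * c" by simp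
  have eq: "(SUM i<n. SUM j<n. F P * (Gs P (n + P l j) (s + i) - q * T P i j))
   = F P * (SUM i<n. SUM j<n. Gs P (n + P l j) (s + i)) - F P * q * (SUM i<n. SUM j<n. T P i j)"
   by (simp only: right_diff_distrib sum_subtractf sum_distrib_left[symmetric] mult.assoc)
  define S where "S = (SUM i<n. SUM j<n. Gs P (n + P l j) (s + i))"
  define TT where "TT = (SUM i<n. SUM j<n. T P i j)"
  have a2: "cmod (F P * S) <= 1 * (n / t)" unfolding norm_mult S_def using G_block_sum[OF t d n pi l s] F[OF pi] by (intro mult_mono) auto
  have a3: "cmod (F P * q * (TT - (n * n) * m P)) <= 1 * (1 / sqrt d) * (6 * (n * sqrt n / t^2))"
   unfolding norm_mult nq TT_def T_def m_def using T_sum[OF t d n pi l s] F[OF pi] by (intro mult_mono) auto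
  have "Q P + (n * n) * q * (F P * m P) = (Q P - (F P * S - F P * q * TT)) + F P * S - F P * q * (TT - (n * n) * m P)"
   by (simp add: algebra_simps)
  moreover have "cmod (a + b - c) <= cmod a + cmod b + cmod c" for a b c :: complex
   using norm_triangle_ineq4[of "a + b" c] norm_triangle_ineq[of a b] by linarith
  ultimately have "cmod (Q P + (n * n) * q * (F P * m P)) <= cmod (Q P - (F P * S - F P * q * TT)) + cmod (F P * S) + cmod (F P * q * (TT - (n * n) * m P))"
   by metis
  then show ?thesis using a1 a2 a3 unfolding eq S_def[symmetric] TT_def[symmetric] by simp
 qed
 have key: "(n * n) * q * (SUM P:?Om. F P * (sqrt d * xs l s P + m P)) = (SUM P:?Om. Q P + (n * n) * q * (F P * m P))"
 proof -
  have q1: "q * complex_of_real (sqrt d) = 1" unfolding q_def using sd by simp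
  have "(n * n) * q * (F P * (sqrt d * xs l s P + m P)) = n * (F P * (n * xs l s P)) + (n * n) * q * (F P * m P)" for P
  proof -
   have "(n * n) * q * (F P * (sqrt d * xs l s P + m P)) = (q * complex_of_real (sqrt d)) * (n * (F P * (n * xs l s P))) + (n * n) * q * (F P * m P)"
    by (simp add: algebra_simps)
   then show ?thesis unfolding q1 by simp
  qed
  then have "(n * n) * q * (SUM P:?Om. F P * (sqrt d * xs l s P + m P)) = n * (SUM P:?Om. F P * (n * xs l s P)) + (SUM P:?Om. (n * n) * q * (F P * m P))"
   by (simp only: sum_distrib_left sum.distrib[symmetric])
  also have "n * (SUM P:?Om. F P * (n * xs l s P)) = (SUM P:?Om. Q P)" unfolding Q_def by (rule swap_average[OF t d n l])
  finally show ?thesis by (simp only: sum.distrib)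
 qed
 have "(real n * real n / sqrt d) * cmod (SUM P:?Om. F P * (sqrt d * xs l s P + m P)) = cmod (SUM P:?Om. Q P + (n * n) * q * (F P * m P))"
  unfolding key[symmetric] by (simp add: norm_mult nq)
 also have "... <= (SUM P:?Om. real n * real n * c + n / t + (1 / sqrt d) * (6 * (n * sqrt n / t^2)))"
  by (intro order_trans[OF norm_sum sum_mono] one)
 also have "... = (real n * real n / sqrt d) * (card ?Om * (sqrt d * (c + 1 / (n * t)) + 6 / (sqrt n * t^2)))"
 proof -
  have "real n * sqrt n = real n * real n / sqrt n" using n by (simp add: field_simps)
  then have "real n * real n * c + n / t + (1 / sqrt d) * (6 * (n * sqrt n / t^2)) = (real n * real n / sqrt d) * (sqrt d * (c + 1 / (n * t)) + 6 / (sqrt n * t^2))"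
   using n sd t by (simp add: field_simps)
  then show ?thesis by (simp add: mult_ac)
 qed
 finally have "cmod (SUM P:?Om. F P * (sqrt d * xs l s P + m P)) <= card ?Om * (sqrt d * (c + 1 / (n * t)) + 6 / (sqrt n * t^2))"
  using n sd by (simp add: divide_le_cancel mult_le_cancel_left_pos)
 then show ?thesis unfolding c_def m_def .
qed

end

section \<open>The two loop equations\<close>

context
 fixes n d :: nat and z :: complex and t :: real
 assumes t: "t > 0" and d: "d > 0" and n: "n > 0"
begin

private abbreviation "Gw P \<equiv> resolv n t (shifted d z P)"
private abbreviation "gw a b P \<equiv> gt n d z t a b P"
private abbreviation "xw l s P \<equiv> xl n d z t l s P"

text \<open>The cases \<open>s = 0\<close> and \<open>s = n\<close> are the two loop equations; both defects tend to zero.\<close>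
definition loop_defect :: "nat => perms => complex" where
 "loop_defect s P = of_bool (s = 0) + \<i> * t * gw 0 s P + z * gw n s P + gw n n P * gw 0 s P"

text \<open>Summing over the permutations reassembles the trace of \<open>A\<close> times a block of
  the resolvent, which the block form of the inverse property evaluates.\<close>

lemma sum_xl:
 assumes pi: "P : tuples n d" and s: "s = 0 \<or> s = n"
 shows "(SUM l<d. xw l s P) / sqrt d = of_bool (s = 0) + \<i> * t * gw 0 s P + z * gw n s P"
proof -
 let ?G = "Gw P"
 let ?q = "complex_of_real (sqrt d)"
 have row: "(SUM l<d. ?G (n + P l i) (s + i)) / ?q - z * ?G (n + i) (s + i) = of_bool (s = 0) + \<i> * t * ?G i (s + i)" if i: "i < n" for i
 proof -
  have b: "s + i < 2 * n" using i s by auto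
  have e: "(SUM k<n. of_bool (P l i = k) * ?G (n+k) (s+i)) = ?G (n + P l i) (s+i)" if "l < d" for l
   by (rule sum_of_bool_mult(1)) (use tuples_bound[OF pi i that] in simp)
  have "(SUM k<n. shifted d z P i k * ?G (n+k) (s+i)) = (SUM k<n. (SUM l<d. of_bool (P l i = k) * ?G (n+k) (s+i)) / ?q - z * (of_bool (i = k) * ?G (n+k) (s+i)))"
   unfolding shifted_def by (intro sum.cong refl) (simp only: left_diff_distrib sum_distrib_right times_divide_eq_left mult.assoc)
  also have "... = (SUM k<n. SUM l<d. of_bool (P l i = k) * ?G (n+k) (s+i)) / ?q - z * (SUM k<n. of_bool (i = k) * ?G (n+k) (s+i))"
   by (simp only: sum_subtractf sum_distrib_left sum_divide_distrib)
  also have "(SUM k<n. of_bool (i = k) * ?G (n+k) (s+i)) = ?G (n+i) (s+i)" by (rule sum_of_bool_mult(1)[OF i])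
  also have "(SUM k<n. SUM l<d. of_bool (P l i = k) * ?G (n+k) (s+i)) = (SUM l<d. SUM k<n. of_bool (P l i = k) * ?G (n+k) (s+i))" by (rule sum.swap)
  also have "... = (SUM l<d. ?G (n + P l i) (s+i))" using e by simp
  finally have "(SUM l<d. ?G (n + P l i) (s + i)) / ?q - z * ?G (n + i) (s + i) = of_bool (i = s + i) + \<i> * t * ?G i (s + i)"
   using resolv_blocks(1)[OF t i b, of "shifted d z P"] by simp
  then show ?thesis by simp
 qed
 have "(SUM i<n. (SUM l<d. ?G (n + P l i) (s + i)) / ?q - z * ?G (n + i) (s + i)) = (SUM i<n. of_bool (s = 0) + \<i> * t * ?G i (s + i))"
  using row by (intro sum.cong refl) auto
 then have tot: "(SUM i<n. SUM l<d. ?G (n + P l i) (s + i)) / ?q - z * (SUM i<n. ?G (n + i) (s + i)) = of_nat n * of_bool (s = 0) + \<i> * t * (SUM i<n. ?G i (s + i))"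
  by (simp only: sum_subtractf sum.distrib sum_distrib_left[symmetric] sum_divide_distrib[symmetric] sum_constant card_lessThan)
 have "(SUM l<d. xw l s P) = (SUM i<n. SUM l<d. ?G (n + P l i) (s + i)) / n"
  unfolding xl_def[OF t d n] sum_divide_distrib[symmetric] by (subst sum.swap) simp
 then have "(SUM l<d. xw l s P) / ?q = ((SUM i<n. SUM l<d. ?G (n + P l i) (s + i)) / ?q) / n" by simp
 also have "(SUM i<n. SUM l<d. ?G (n + P l i) (s + i)) / ?q = of_nat n * of_bool (s = 0) + \<i> * t * (SUM i<n. ?G i (s + i)) + z * (SUM i<n. ?G (n + i) (s + i))"
  using tot by (simp add: diff_eq_eq)
 also have "... / n = of_bool (s = 0) + \<i> * t * gw 0 s P + z * gw n s P"
  unfolding gt_def[OF t d] using n by (simp add: add_divide_distrib)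
 finally show ?thesis .
qed

lemma loop_defect_swap:
 assumes pi: "P : tuples n d" and l: "l < d" and ij: "i < n" "j < n" and s: "s = 0 \<or> s = n"
 shows "cmod (loop_defect s (swap_at l i j P) - loop_defect s P) <= (t + cmod z + 2 / t) * (8 / (n * sqrt d * t^2))"
proof -
 let ?p = "swap_at l i j P"
 define e where "e = 8 / (n * sqrt d * t^2)"
 have D: "cmod (gw a b ?p - gw a b P) <= e" if "a = 0 \<or> a = n" "b = 0 \<or> b = n" for a b
  unfolding e_def by (rule gt_swap[OF t d pi l ij that])
 have N: "cmod (gw a b rho) <= 1/t" if "a = 0 \<or> a = n" "b = 0 \<or> b = n" for a b rho
  by (rule gt_norm[OF t d that])
 have e0: "e >= 0" unfolding e_def by simp
 have eq: "loop_defect s ?p - loop_defect s P = \<i> * t * (gw 0 s ?p - gw 0 s P) + z * (gw n s ?p - gw n s P)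
  + ((gw n n ?p - gw n n P) * gw 0 s ?p + gw n n P * (gw 0 s ?p - gw 0 s P))"
  unfolding loop_defect_def by (simp add: algebra_simps)
 have "cmod (\<i> * t * (gw 0 s ?p - gw 0 s P)) <= t * e" using D[of 0 s] s t by (simp add: norm_mult)
 moreover have "cmod (z * (gw n s ?p - gw n s P)) <= cmod z * e" unfolding norm_mult using D[of n s] s by (intro mult_left_mono) auto
 moreover have "cmod ((gw n n ?p - gw n n P) * gw 0 s ?p) <= e * (1/t)" unfolding norm_mult
  using D[of n n] N[of 0 s ?p] s e0 by (intro mult_mono) auto
 moreover have "cmod (gw n n P * (gw 0 s ?p - gw 0 s P)) <= (1/t) * e" unfolding norm_mult
  using D[of 0 s] N[of n n P] s e0 t by (intro mult_mono) auto
 moreover have "cmod (a + b + (c + c')) <= cmod a + cmod b + (cmod c + cmod c')" for a b c c' :: complex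
  by (intro order_trans[OF norm_triangle_ineq] add_mono norm_triangle_ineq)
 ultimately have "cmod (loop_defect s ?p - loop_defect s P) <= t * e + cmod z * e + (e * (1/t) + (1/t) * e)"
  unfolding eq by (smt (verit, ccfv_threshold))
 then show ?thesis unfolding e_def[symmetric] by (simp add: algebra_simps)
qed

text \<open>Testing the loop equation against \<open>clip W\<close> for the defect \<open>W\<close>
  itself turns the left side into the mean of \<open>min (cmod W) ((cmod W)^2)\<close>. Smallness of
  \<open>W\<close> and its concentration come out together, because \<open>W\<close> and hence
  \<open>clip W\<close> barely move under a swap.\<close>

lemma loop_defect_bound:
 assumes s: "s = 0 \<or> s = n"
 shows "(SUM P:tuples n d. min (cmod (loop_defect s P)) ((cmod (loop_defect s P))^2)) <= card (tuples n d) *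
  (sqrt d * (2 * ((t + cmod z + 2 / t) * (8 / (n * sqrt d * t^2))) / t + 64 / (d * t ^ 3) + 1 / (n * t)) + 6 / (sqrt n * t^2)
   + (5 / (n * t^2) + 16 / (sqrt d * t ^ 3)))"
proof -
 let ?Om = "tuples n d"
 define kappa where "kappa = 2 * ((t + cmod z + 2 / t) * (8 / (n * sqrt d * t^2)))"
 define F where "F P = clip (loop_defect s P)" for P
 let ?y = "%l P. sqrt d * xw l s P + gw n n P * gw 0 s P" and ?A = "SUM P:?Om. F P * loop_defect s P"
 let ?X = "%l. SUM P:?Om. F P * (xw l 0 P * xw l s P)"
 let ?L = "%l. SUM P:?Om. F P * (sqrt d * xw l s P + (xw l 0 P * xw l s P + gw n n P * gw 0 s P))"
 have F1: "cmod (F P) <= 1" for P unfolding F_def by (rule clip_norm)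
 have F2: "cmod (F (swap_at l i j P) - F P) <= kappa" if "P : ?Om" "l < d" "i < n" "j < n" for P l i j
  unfolding F_def kappa_def using order_trans[OF clip_lipschitz mult_left_mono[OF loop_defect_swap[OF that s]]] by simp
 define b where "b = sqrt d * (kappa / t + 64 / (d * t ^ 3) + 1 / (n * t)) + 6 / (sqrt n * t^2)"
 define b2 where "b2 = 5 / (n * t^2) + 16 / (sqrt d * t ^ 3)"
 have L: "cmod (?L l) <= card ?Om * b" if "l < d" for l
  unfolding b_def by (rule loop_single[OF t d n that s]) (use F1 F2[OF _ that] in auto)
 have X: "cmod (?X l) <= card ?Om * b2" if l: "l < d" for l
 proof -
  have "cmod (F P * (xw l 0 P * xw l s P)) <= ((cmod (xw l 0 P))^2 + (cmod (xw l s P))^2) / 2" for P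
  proof -
   have "cmod (F P * (xw l 0 P * xw l s P)) <= 1 * (cmod (xw l 0 P) * cmod (xw l s P))"
    unfolding norm_mult using F1 by (intro mult_right_mono) auto
   then show ?thesis using sum_squares_bound[of "cmod (xw l 0 P)" "cmod (xw l s P)"] by simp
  qed
  then have "cmod (?X l) <= (SUM P:?Om. ((cmod (xw l 0 P))^2 + (cmod (xw l s P))^2) / 2)"
   by (intro order_trans[OF norm_sum sum_mono])
  also have "... = ((SUM P:?Om. (cmod (xw l 0 P))^2) + (SUM P:?Om. (cmod (xw l s P))^2)) / 2"
   by (simp only: sum_divide_distrib[symmetric] sum.distrib)
  also have "... <= (card ?Om * b2 + card ?Om * b2) / 2"
   unfolding b2_def by (intro divide_right_mono add_mono sum_xl_sq[OF t d n l] s) auto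
  finally show ?thesis by (simp add: mult.commute)
 qed
 have Y: "cmod (SUM P:?Om. F P * ?y l P) <= card ?Om * (b + b2)" if l: "l < d" for l
 proof -
  have eq: "(SUM P:?Om. F P * ?y l P) = (?L l) - (?X l)"
   unfolding sum_subtractf[symmetric] by (intro sum.cong refl) (simp add: algebra_simps)
  have "cmod (SUM P:?Om. F P * ?y l P) <= cmod (?L l) + cmod (?X l)"
   unfolding eq by (rule norm_triangle_ineq4)
  also have "... <= card ?Om * b + card ?Om * b2" by (intro add_mono L X l)
  finally show ?thesis by (simp add: distrib_left)
 qed
 have dq: "complex_of_real (sqrt d) * complex_of_real (sqrt d) = d" by (metis of_nat_0_le_iff of_real_mult of_real_of_nat_eq real_sqrt_mult_self abs_of_nat)
 have W: "d * loop_defect s P = (SUM l<d. sqrt d * xw l s P + gw n n P * gw 0 s P)" if "P : ?Om" for P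
 proof -
  have "loop_defect s P = (SUM l<d. xw l s P) / sqrt d + gw n n P * gw 0 s P"
   unfolding loop_defect_def sum_xl[OF that s] ..
  moreover have "d * ((SUM l<d. xw l s P) / sqrt d) = sqrt d * (SUM l<d. xw l s P)"
   unfolding dq[symmetric] using d by simp
  ultimately have "d * loop_defect s P = sqrt d * (SUM l<d. xw l s P) + d * (gw n n P * gw 0 s P)" by (simp only: distrib_left)
  then show ?thesis by (simp only: sum.distrib sum_distrib_left[symmetric] sum_constant card_lessThan mult.left_commute)
 qed
 have "d * ?A = (SUM P:?Om. F P * (d * loop_defect s P))"
  unfolding sum_distrib_left by (intro sum.cong refl) (simp only: mult.left_commute)
 also have "... = (SUM P:?Om. SUM l<d. F P * ?y l P)"
  by (intro sum.cong refl) (simp only: W sum_distrib_left)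
 also have "... = (SUM l<d. SUM P:?Om. F P * ?y l P)" by (rule sum.swap)
 finally have e1: "d * ?A = (SUM l<d. SUM P:?Om. F P * ?y l P)" .
 have "d * cmod ?A = cmod (d * ?A)" by (simp add: norm_mult)
 also have "... <= (SUM l<d. card ?Om * (b + b2))" unfolding e1 by (intro order_trans[OF norm_sum sum_mono] Y) auto
 finally have fin: "cmod ?A <= card ?Om * (b + b2)" using d by simp
 have e2: "?A = complex_of_real (SUM P:?Om. min (cmod (loop_defect s P)) ((cmod (loop_defect s P))^2))"
  unfolding F_def clip_mult by (simp only: of_real_sum)
 have "(SUM P:?Om. min (cmod (loop_defect s P)) ((cmod (loop_defect s P))^2)) <= card ?Om * (b + b2)"
  using fin abs_ge_self order_trans unfolding e2 norm_of_real by blast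
 then show ?thesis unfolding b_def b2_def kappa_def .
qed

text \<open>Since \<open>1 / t <= sqrt d\<close> and \<open>d <= C * n\<close>, all error terms are
  dominated by the single scale \<open>1 / (sqrt d * t ^ 3)\<close>.\<close>

lemma loop_defect_bound':
 fixes C Tm :: real
 assumes s: "s = 0 \<or> s = n" and C: "real d <= C * n" "C >= 1" and tt: "1 / sqrt d <= t" "t <= Tm" "Tm >= 1"
 shows "(SUM P:tuples n d. min (cmod (loop_defect s P)) ((cmod (loop_defect s P))^2)) <= card (tuples n d) *
  ((16 * C * (Tm + cmod z + 2) + 80 + C * Tm^2 + 11 * C * Tm) / (sqrt d * t ^ 3))"
proof (rule order_trans[OF loop_defect_bound[OF s] mult_left_mono])
 define r where "r = sqrt (real d)"
 have r: "r > 0" "r * r = d" "r >= 1" unfolding r_def using d by auto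
 have rn: "r * r <= C * n" using C r by simp
 have rt: "1 / t <= r" using tt(1) t r unfolding r_def[symmetric] by (simp add: field_simps)
 have dn: "r / n <= C / r" using rn r n by (simp add: field_simps)
 have a1: "r * (2 * ((t + cmod z + 2 / t) * (8 / (n * r * t^2))) / t) <= 16 * C * (Tm + cmod z + 2) / (r * t ^ 3)"
 proof -
  have "r * (2 * ((t + cmod z + 2 / t) * (8 / (n * r * t^2))) / t) = (16 * (t + cmod z + 2 / t) * (r / n)) / (r * t ^ 3)"
   using r t n by (simp add: field_simps power2_eq_square power3_eq_cube)
  also have "... <= (16 * ((Tm + cmod z + 2) * r) * (C / r)) / (r * t ^ 3)"
  proof (intro divide_right_mono mult_mono dn mult_left_mono)
   have "(Tm + cmod z) * 1 <= (Tm + cmod z) * r" using r tt by (intro mult_left_mono) auto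
   then show "t + cmod z + 2 / t <= (Tm + cmod z + 2) * r" using rt tt by (simp add: distrib_right)
  qed (use r t n tt C in auto)
  also have "... = 16 * C * (Tm + cmod z + 2) / (r * t ^ 3)" using r by simp
  finally show ?thesis .
 qed
 have a2: "r * (64 / (d * t ^ 3)) = 64 / (r * t ^ 3)" using r by (simp add: r(2)[symmetric])
 have a3: "r * (1 / (n * t)) <= C * Tm^2 / (r * t ^ 3)"
 proof -
  have "r * (1 / (n * t)) = ((r / n) * r * t^2) / (r * t ^ 3)" using r t n by (simp add: field_simps power2_eq_square power3_eq_cube)
  also have "... <= ((C / r) * r * Tm^2) / (r * t ^ 3)" using r t tt C by (intro divide_right_mono mult_mono power_mono dn) auto
  finally show ?thesis using r by simp
 qed
 have a4: "6 / (sqrt n * t^2) <= 6 * C * Tm / (r * t ^ 3)"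
 proof -
  have "r <= sqrt (C * n)" unfolding r_def using C by simp
  also have "... = sqrt C * sqrt n" by (rule real_sqrt_mult)
  also have "... <= C * sqrt n" using C by (intro mult_right_mono real_le_lsqrt) (auto simp: power2_eq_square)
  finally have "r / sqrt n <= C" using n by (simp add: field_simps)
  then have "6 * (r / sqrt n) * t / (r * t ^ 3) <= 6 * C * Tm / (r * t ^ 3)" using r t tt C by (intro divide_right_mono mult_mono) auto
  moreover have "6 / (sqrt n * t^2) = 6 * (r / sqrt n) * t / (r * t ^ 3)" using r t by (simp add: field_simps power2_eq_square power3_eq_cube)
  ultimately show ?thesis by simp
 qed
 have a5: "5 / (n * t^2) <= 5 * C * Tm / (r * t ^ 3)"
 proof -
  have "r / n <= C" using dn r C frac_le[of C C 1 r] by simp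
  then have "5 * (r / n) * t / (r * t ^ 3) <= 5 * C * Tm / (r * t ^ 3)" using r t tt C by (intro divide_right_mono mult_mono) auto
  moreover have "5 / (n * t^2) = 5 * (r / n) * t / (r * t ^ 3)" using r t by (simp add: field_simps power2_eq_square power3_eq_cube)
  ultimately show ?thesis by simp
 qed
 show "sqrt d * (2 * ((t + cmod z + 2 / t) * (8 / (n * sqrt d * t^2))) / t + 64 / (d * t ^ 3) + 1 / (n * t)) + 6 / (sqrt n * t^2) + (5 / (n * t^2) + 16 / (sqrt d * t ^ 3))
  <= (16 * C * (Tm + cmod z + 2) + 80 + C * Tm^2 + 11 * C * Tm) / (sqrt d * t ^ 3)"
 proof -
  have "64 / (r * t ^ 3) + 16 / (r * t ^ 3) = 80 / (r * t ^ 3)" "6 * C * Tm / (r * t ^ 3) + 5 * C * Tm / (r * t ^ 3) = 11 * C * Tm / (r * t ^ 3)"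
   by (simp_all add: add_divide_distrib[symmetric])
  moreover have "x1 + u + x3 + x4 + (x5 + v) <= y1 + w + y3 + y11"
   if "u + v = w" "y4 + y5 = y11" "x1 <= y1" "x3 <= y3" "x4 <= y4" "x5 <= y5" for x1 x3 x4 x5 y1 y3 y4 y5 y11 u v w :: real
   using that by linarith
  ultimately show ?thesis
   unfolding r_def[symmetric] distrib_left[of r] a2 add_divide_distrib[of _ _ "r * t ^ 3"] using a1 a3 a4 a5 by blast
 qed
qed auto

end

section \<open>Spectrum of the Gram matrix and eigenvalues of \<open>A\<close>\<close>

lemma trace_mult_commute:
 fixes A B :: "complex mat"
 assumes "A : carrier_mat n n" "B : carrier_mat n n"
 shows "(SUM i<n. (A * B) $$ (i,i)) = (SUM i<n. (B * A) $$ (i,i))"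
proof -
 have "(SUM i<n. (A * B) $$ (i,i)) = (SUM i<n. SUM k<n. A $$ (i,k) * B $$ (k,i))"
  using assms by (intro sum.cong refl) (auto simp: scalar_prod_def lessThan_atLeast0)
 also have "... = (SUM k<n. SUM i<n. B $$ (k,i) * A $$ (i,k))" by (subst sum.swap) (simp add: mult.commute)
 also have "... = (SUM i<n. (B * A) $$ (i,i))"
  using assms by (intro sum.cong refl) (auto simp: scalar_prod_def lessThan_atLeast0)
 finally show ?thesis .
qed

lemma trace_conjugate:
 fixes A P Q :: "complex mat"
 assumes "A : carrier_mat n n" "P : carrier_mat n n" "Q : carrier_mat n n" "Q * P = 1\<^sub>m n"
 shows "(SUM i<n. (P * A * Q) $$ (i,i)) = (SUM i<n. A $$ (i,i))"
proof -
 have "(SUM i<n. (P * A * Q) $$ (i,i)) = (SUM i<n. (P * (A * Q)) $$ (i,i))" using assms by (simp add: assoc_mult_mat[of P n n A n Q n])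
 also have "... = (SUM i<n. ((A * Q) * P) $$ (i,i))" using assms by (intro trace_mult_commute) auto
 also have "(A * Q) * P = A" using assms by (simp add: assoc_mult_mat[of A n n Q n P n])
 finally show ?thesis .
qed

text \<open>Backward substitution from the last row shows that \<open>M\<close> is upper triangular
  as well; the diagonal equations then decouple.\<close>

lemma diag_right_inverse_upper_triangular:
 fixes B M :: "complex mat"
 assumes B: "B : carrier_mat n n" "upper_triangular B" "!!i. i < n ==> B $$ (i,i) ~= 0"
  and M: "M : carrier_mat n n" "B * M = c \<cdot>\<^sub>m 1\<^sub>m n" and i: "i < n"
 shows "M $$ (i,i) = c / B $$ (i,i)"
proof -
 have row: "(SUM k:{i..<n}. B $$ (i,k) * M $$ (k,j)) = (if i = j then c else 0)" if "i < n" "j < n" for i j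
 proof -
  have "(B * M) $$ (i,j) = (SUM k<n. B $$ (i,k) * M $$ (k,j))" using B(1) M(1) that by (simp add: scalar_prod_def lessThan_atLeast0)
  also have "... = (SUM k:{i..<n}. B $$ (i,k) * M $$ (k,j))"
   using B that unfolding upper_triangular_def by (intro sum.mono_neutral_right) auto
  finally show ?thesis unfolding M(2) using that by (simp split: if_splits)
 qed
 have split: "(SUM k:{i..<n}. B $$ (i,k) * M $$ (k,j)) = B $$ (i,i) * M $$ (i,j) + (SUM k:{Suc i..<n}. B $$ (i,k) * M $$ (k,j))" if "i < n" for i j
  using that by (simp add: sum.atLeast_Suc_lessThan)
 have low: "i < n --> (ALL j<i. M $$ (i,j) = 0)" for i
 proof (induction "n - i" arbitrary: i rule: less_induct)
  case less
  show ?case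
  proof (intro impI allI)
   fix j assume a: "i < n" "j < i"
   have "(SUM k:{Suc i..<n}. B $$ (i,k) * M $$ (k,j)) = 0" using less a by (intro sum.neutral) auto
   then show "M $$ (i,j) = 0" using row[of i j] split[of i j] a B(3) by auto
  qed
 qed
 have "(SUM k:{Suc i..<n}. B $$ (i,k) * M $$ (k,i)) = 0" using low i by (intro sum.neutral) auto
 then show ?thesis using row[of i i] split[of i i] i B(3)[OF i] by (auto simp: field_simps)
qed

text \<open>The \<open>h i\<close> are the eigenvalues of the Gram matrix of the rows of
  \<open>X\<close>. They are described by the five facts used afterwards: sign, resolvent trace,
  Frobenius norm, determinant, and the lower bound by Rayleigh quotients.\<close>

definition gram_spec :: "nat => (nat => nat => complex) => (nat => real) => bool" where
 "gram_spec n X h \<longleftrightarrow> (ALL i<n. h i >= 0) &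
  (ALL t>0. (SUM i<n. resolv n t X i i) = \<i> * t * complex_of_real (SUM i<n. 1 / (h i + t^2))) &
  (SUM i<n. h i) = (SUM i<n. SUM k<n. (cmod (X i k))^2) &
  (PROD i<n. h i) = (cmod (det (mat n n (%(i,k). X i k))))^2 &
  (ALL b. (ALL x. b * (SUM i<n. (cmod (x i))^2) <= (SUM k<n. (cmod (SUM i<n. x i * X i k))^2)) --> (ALL i<n. b <= h i))"

text \<open>Schur triangularization suffices: trace, determinant and resolvent trace depend only on
  the diagonal of the triangular form, and an eigenvector shows that each diagonal entry is a
  Rayleigh quotient, hence real and nonnegative.\<close>

lemma gram_spectrum:
 fixes X :: "nat => nat => complex"
 shows "EX h. gram_spec n X h"
proof -
 let ?N = "%y. SUM i<n. (cmod (y i))^2" and ?S = "%y. SUM k<n. (cmod (SUM m<n. y m * X m k))^2"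
 define H where "H = mat n n (%(i,m). SUM k<n. X i k * cnj (X m k))"
 have Hc: "H : carrier_mat n n" unfolding H_def by simp
 from char_poly_factorized[OF Hc] obtain es where es: "char_poly H = (\<Prod>a\<leftarrow>es. [:- a, 1:])" "length es = n" by blast
 obtain B P Q where BPQ: "schur_decomposition H es = (B,P,Q)" by (cases "schur_decomposition H es") auto
 note sd = schur_decomposition[OF Hc es(1) BPQ]
 then have ut: "upper_triangular B" and diag: "diag_mat B = es" and w: "similar_mat_wit H B P Q" by auto
 note PQ = similar_mat_witD2[OF Hc w]
 have eig: "EX y. (?N y) > 0 & B $$ (i,i) * (?N y) = complex_of_real (?S y)" if i: "i < n" for i
 proof -
  define e where "e = B $$ (i,i)"
  have "e = es ! i" unfolding e_def diag[symmetric] diag_mat_def using i PQ by simp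
  then have "e : set es" using i es by simp
  then have "poly (char_poly H) e = 0" unfolding es(1) poly_prod_list map_map comp_def prod_list_zero_iff
   by (auto simp: poly_prod_list prod_list_zero_iff image_iff)
  then obtain v where v: "eigenvector H v e" using eigenvalue_root_char_poly[OF Hc] unfolding eigenvalue_def by blast
  then have vc: "v : carrier_vec n" and v0: "v ~= 0\<^sub>v n" and hv: "H *\<^sub>v v = e \<cdot>\<^sub>v v" using Hc unfolding eigenvector_def by auto
  have comp: "(SUM m<n. (SUM k<n. X j k * cnj (X m k)) * v $ m) = e * v $ j" if "j < n" for j
  proof -
   have "(H *\<^sub>v v) $ j = (SUM m<n. (SUM k<n. X j k * cnj (X m k)) * v $ m)"
    using that vc unfolding H_def by (simp add: scalar_prod_def lessThan_atLeast0)
   then show ?thesis using hv that vc by simp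
  qed
  \<comment> \<open>Conjugation turns the right eigenvector of the Gram matrix into a row vector, so
    that its Rayleigh quotient is expressed by the row combinations of \<open>X\<close> that occur
    in \<open>gram_spec\<close>.\<close>
  define y where "y m = cnj (v $ m)" for m
  have pos: "(?N y) > 0"
  proof -
   obtain m where "m < n" "v $ m ~= 0" using v0 vc by (metis carrier_vecD eq_vecI index_zero_vec(1) index_zero_vec(2))
   then show ?thesis unfolding y_def by (intro sum_pos2[of _ m]) auto
  qed
  have "e * (?N y) = (SUM j<n. y j * (e * v $ j))"
   unfolding y_def of_real_sum sum_distrib_left by (intro sum.cong refl) (simp add: complex_norm_square[unfolded of_real_power] mult.commute mult.left_commute)
  also have "... = (SUM j<n. y j * (SUM m<n. (SUM k<n. X j k * cnj (X m k)) * v $ m))" using comp by simp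
  also have "... = (SUM j<n. SUM m<n. SUM k<n. (y j * X j k) * cnj (y m * X m k))"
   unfolding y_def sum_distrib_left sum_distrib_right by (simp add: mult_ac)
  also have "... = (SUM j<n. SUM k<n. SUM m<n. (y j * X j k) * cnj (y m * X m k))"
   by (rule sum.cong[OF refl]) (rule sum.swap)
  also have "... = (SUM k<n. SUM j<n. SUM m<n. (y j * X j k) * cnj (y m * X m k))" by (rule sum.swap)
  also have "... = (SUM k<n. (SUM j<n. y j * X j k) * cnj (SUM m<n. y m * X m k))"
   by (simp only: cnj_sum sum_product)
  also have "... = complex_of_real (?S y)"
   by (simp only: complex_norm_square of_real_sum)
  finally show ?thesis using pos unfolding e_def by blast
 qed
 define h where "h i = Re (B $$ (i,i))" for i
 have eig': "EX y. (?N y) > 0 & h i * (?N y) = (?S y)"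
  and hB: "B $$ (i,i) = complex_of_real (h i)" if i: "i < n" for i
 proof -
  from eig[OF i] obtain y where y: "(?N y) > 0" "B $$ (i,i) * (?N y) = complex_of_real (?S y)" by blast
  define N S where "N = (?N y)" and "S = (?S y)"
  have e: "B $$ (i,i) * complex_of_real N = complex_of_real S" "N > 0" using y unfolding N_def S_def by auto
  then have b: "B $$ (i,i) = complex_of_real (S / N)" by (simp add: field_simps)
  then show "B $$ (i,i) = complex_of_real (h i)" unfolding h_def by simp
  have "h i * N = S" unfolding h_def b using e by simp
  then show "EX y. (?N y) > 0 & h i * (?N y) = (?S y)"
   using e unfolding N_def S_def by blast
 qed
 have lower: "ALL i<n. b <= h i" if b: "!!x. b * (?N x) <= (?S x)" for b
 proof (intro allI impI)
  fix i assume "i < n"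
  from eig'[OF this] obtain y where y: "(?N y) > 0" "h i * (?N y) = (?S y)" by blast
  show "b <= h i" using b[of y] y by (metis mult_le_cancel_right not_less_iff_gr_or_eq)
 qed
 have h0: "h i >= 0" if "i < n" for i using lower[of 0] that by (simp add: sum_nonneg)
 have tr: "(SUM i<n. resolv n t X i i) = \<i> * t * (SUM i<n. 1 / (h i + t^2))" if t: "t > 0" for t :: real
 proof -
  define G where "G = mat n n (%(i,j). resolv n t X i j)"
  have Gc: "G : carrier_mat n n" unfolding G_def by simp
  define T where "T = complex_of_real (t^2) \<cdot>\<^sub>m 1\<^sub>m n"
  have Tc: "T : carrier_mat n n" unfolding T_def by simp
  have HG: "(H + T) * G = (\<i> * t) \<cdot>\<^sub>m 1\<^sub>m n"
  proof (rule eq_matI)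
   fix i j assume "i < dim_row ((\<i> * t) \<cdot>\<^sub>m 1\<^sub>m n :: complex mat)" "j < dim_col ((\<i> * t) \<cdot>\<^sub>m 1\<^sub>m n :: complex mat)"
   then have ij: "i < n" "j < n" by auto
   have "((H + T) * G) $$ (i,j) = (SUM m<n. ((SUM k<n. X i k * cnj (X m k)) + t^2 * of_bool (i = m)) * resolv n t X m j)"
    using ij unfolding H_def T_def G_def by (auto simp: scalar_prod_def lessThan_atLeast0 intro!: sum.cong)
   also have "... = \<i> * t * of_bool (i = j)" by (rule resolv_gram[OF t ij])
   finally show "((H + T) * G) $$ (i,j) = ((\<i> * t) \<cdot>\<^sub>m 1\<^sub>m n) $$ (i,j)" using ij by simp
  qed (use Hc Gc Tc in auto)
  define M where "M = Q * G * P"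
  have Mc: "M : carrier_mat n n" unfolding M_def using PQ Gc by auto
  have QTP: "Q * (H + T) = (B + T) * Q"
  proof -
   have "Q * H = Q * (P * (B * Q))" using PQ by (simp add: assoc_mult_mat[of P n n B n Q n])
   also have "... = (Q * P) * (B * Q)" using PQ by (intro assoc_mult_mat[symmetric]) auto
   finally have q: "Q * H = B * Q" using PQ by (metis left_mult_one_mat mult_carrier_mat)
   have "Q * T = T * Q" unfolding T_def using PQ(7) by (simp add: mult_smult_distrib[of Q n n "1\<^sub>m n" n] mult_smult_assoc_mat[of "1\<^sub>m n" n n Q n])
   then show ?thesis using q PQ(5-7) Hc Tc by (simp add: mult_add_distrib_mat[of Q n n H n T] add_mult_distrib_mat[of B n n T Q n])
  qed
  have BM: "(B + T) * M = (\<i> * t) \<cdot>\<^sub>m 1\<^sub>m n"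
  proof -
   have BTc: "B + T : carrier_mat n n" using PQ Tc by simp
   have "(B + T) * M = ((B + T) * Q) * (G * P)" unfolding M_def using PQ Gc BTc
    by (simp add: assoc_mult_mat[of Q n n G n P n] assoc_mult_mat[of "B + T" n n Q n "G * P" n])
   also have "... = (Q * (H + T)) * (G * P)" unfolding QTP ..
   also have "... = Q * (((H + T) * G) * P)" using PQ(5-7) Gc Hc Tc
    by (simp add: assoc_mult_mat[of Q n n "H + T" n "G * P" n] assoc_mult_mat[of "H + T" n n G n P n])
   also have "... = (\<i> * t) \<cdot>\<^sub>m 1\<^sub>m n" unfolding HG using PQ(2,6,7) by (simp add: mult_smult_distrib[of Q n n P n] mult_smult_assoc_mat[of "1\<^sub>m n" n n P n])
   finally show ?thesis .
  qed
  have diagBT: "(B + T) $$ (i,i) = complex_of_real (h i + t^2)" if "i < n" for i using that PQ Tc hB[OF that] unfolding T_def by simp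
  have ht: "h i + t^2 > 0" if "i < n" for i using h0[OF that] t by (simp add: add_nonneg_pos)
  have utBT: "upper_triangular (B + T)"
  proof (rule upper_triangularI)
   fix i j assume a: "j < i" "i < dim_row (B + T)"
   then have "B $$ (i,j) = 0" using ut PQ Tc unfolding upper_triangular_def by auto
   then show "(B + T) $$ (i,j) = 0" using a PQ Tc unfolding T_def by auto
  qed
  have "M $$ (i,i) = (\<i> * t) / (B + T) $$ (i,i)" if "i < n" for i
  proof (rule diag_right_inverse_upper_triangular[OF _ utBT _ Mc BM that])
   show "B + T : carrier_mat n n" using PQ Tc by simp
   show "(B + T) $$ (i,i) ~= 0" if "i < n" for i using diagBT[OF that] ht[OF that] by (metis of_real_eq_0_iff less_irrefl)
  qed
  then have Mii: "M $$ (i,i) = \<i> * t * complex_of_real (1 / (h i + t^2))" if "i < n" for i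
   using diagBT[OF that] that by simp
  have "(SUM i<n. resolv n t X i i) = (SUM i<n. G $$ (i,i))" unfolding G_def by simp
  also have "... = (SUM i<n. M $$ (i,i))" unfolding M_def by (rule trace_conjugate[symmetric, OF Gc]) (use PQ in auto)
  also have "... = \<i> * t * (SUM i<n. complex_of_real (1 / (h i + t^2)))" using Mii by (simp add: sum_distrib_left)
  finally show ?thesis by (simp only: of_real_sum)
 qed
 have trH: "(SUM i<n. h i) = (SUM i<n. SUM k<n. (cmod (X i k))^2)"
 proof -
  have "complex_of_real (SUM i<n. h i) = (SUM i<n. B $$ (i,i))" using hB by simp
  also have "... = (SUM i<n. (P * B * Q) $$ (i,i))" by (rule trace_conjugate[symmetric]) (use PQ in auto)
  also have "... = (SUM i<n. H $$ (i,i))" using PQ(3) by simp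
  also have "... = complex_of_real (SUM i<n. SUM k<n. (cmod (X i k))^2)" unfolding H_def by (simp add: complex_norm_square[symmetric])
  finally show ?thesis unfolding of_real_eq_iff .
 qed
 have dt: "(PROD i<n. h i) = (cmod (det (mat n n (%(i,k). X i k))))^2"
 proof -
  define XM where "XM = mat n n (%(i,k). X i k)"
  interpret cnj: comm_ring_hom cnj by unfold_locales auto
  have XMc: "XM : carrier_mat n n" unfolding XM_def by simp
  have HX: "H = XM * transpose_mat (map_mat cnj XM)" unfolding H_def XM_def
   by (rule eq_matI) (auto simp: scalar_prod_def lessThan_atLeast0)
  have "det H = det XM * det (transpose_mat (map_mat cnj XM))" unfolding HX by (rule det_mult) (use XMc in auto)
  also have "det (transpose_mat (map_mat cnj XM)) = cnj (det XM)" using det_transpose[of "map_mat cnj XM" n] XMc by simp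
  finally have dH: "det H = complex_of_real ((cmod (det XM))^2)" by (simp only: complex_norm_square)
  have "det H = det P * det B * det Q" using det_mult[of P n B] det_mult[of "P * B" n Q] PQ by simp
  moreover have "det P * det Q = 1" using det_mult[of P n Q] PQ by simp
  ultimately have "det H = det B" by (metis mult.assoc mult.commute mult.right_neutral)
  also have "... = prod_list (diag_mat B)" by (rule det_upper_triangular[OF ut]) (use PQ in auto)
  also have "... = (PROD i<n. B $$ (i,i))" using PQ by (simp add: prod_list_diag_prod lessThan_atLeast0)
  also have "... = complex_of_real (PROD i<n. h i)" using hB by simp
  finally show ?thesis using dH unfolding XM_def by (metis of_real_eq_iff)
 qed
 have "gram_spec n X h" unfolding gram_spec_def using h0 tr trH dt lower by blast
 then show ?thesis by blast
qed

definition eigs :: "nat => nat => perms => complex list" where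
 "eigs n d P = (SOME es. char_poly (scaled_perm_sum n d P) = (\<Prod>a\<leftarrow>es. [:- a, 1:]) & length es = n)"

lemma eigs: "char_poly (scaled_perm_sum n d P) = (\<Prod>a\<leftarrow>eigs n d P. [:- a, 1:])" "length (eigs n d P) = n"
proof -
 have "scaled_perm_sum n d P : carrier_mat n n" unfolding scaled_perm_sum_def by simp
 from someI_ex[OF char_poly_factorized[OF this]]
 show "char_poly (scaled_perm_sum n d P) = (\<Prod>a\<leftarrow>eigs n d P. [:- a, 1:])" "length (eigs n d P) = n"
  unfolding eigs_def by auto
qed

lemma integral_ESD:
 fixes f :: "complex => real"
 assumes "n > 0"
 shows "(\<integral>x. f x \<partial>(ESD (scaled_perm_sum n d P))) = (\<Sum>a\<leftarrow>eigs n d P. f a) / n"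
proof -
 let ?es = "eigs n d P"
 have pr: "proots (\<Prod>a\<leftarrow>es. [:- a, 1:]) = mset es" for es :: "complex list"
 proof (induction es)
  case (Cons a es)
  have "(\<Prod>a\<leftarrow>es. [:- a, 1:]) ~= (0 :: complex poly)" by (auto simp: prod_list_zero_iff)
  then have "proots ([:- a, 1:] * (\<Prod>a\<leftarrow>es. [:- a, 1:])) = proots [:- a, 1:] + proots (\<Prod>a\<leftarrow>es. [:- a, 1:])"
   by (intro proots_mult) auto
  then show ?case using Cons by simp
 qed simp
 have cnt: "(SUM a:S. real (count_list es a) * f a) = (\<Sum>a\<leftarrow>es. f a)" if "finite S" "set es <= S" for es S
  using that
 proof (induction es)
  case (Cons b es)
  have "(SUM a:S. real (count_list (b # es) a) * f a) = (SUM a:S. real (count_list es a) * f a + (if a = b then f a else 0))"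
   by (intro sum.cong refl) (auto simp: algebra_simps)
  then show ?case using Cons by (simp add: sum.distrib)
 qed simp
 have ne: "mset ?es ~= {#}" using eigs(2)[of n d P] assms by auto
 have "(\<integral>x. f x \<partial>(ESD (scaled_perm_sum n d P))) = (SUM a:set ?es. f a * pmf (pmf_of_multiset (mset ?es)) a)"
  unfolding ESD_def eigs(1) pr by (rule integral_measure_pmf_real) (use set_pmf_of_multiset[OF ne] in auto)
 also have "... = (SUM a:set ?es. real (count (mset ?es) a) * f a) / n"
  unfolding sum_divide_distrib using eigs(2)[of n d P] by (intro sum.cong refl) (simp add: pmf_of_multiset[OF ne])
 also have "(SUM a:set ?es. real (count (mset ?es) a) * f a) = (\<Sum>a\<leftarrow>?es. f a)"
  unfolding count_mset by (rule cnt) auto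
 finally show ?thesis .
qed

lemma prod_eigs_det:
 "(\<Prod>a\<leftarrow>eigs n d P. cmod (z - a)) = cmod (det (mat n n (%(i,k). shifted d z P i k)))"
proof -
 let ?A = "scaled_perm_sum n d P"
 have Ac: "?A : carrier_mat n n" unfolding scaled_perm_sum_def by simp
 have "cmod (poly (char_poly ?A) z) = (\<Prod>a\<leftarrow>eigs n d P. cmod (z - a))"
 proof -
  have "cmod (poly (\<Prod>a\<leftarrow>es. [:- a, 1:]) z) = (\<Prod>a\<leftarrow>es. cmod (z - a))" for es
   by (induction es) (auto simp: norm_mult left_diff_distrib[symmetric])
  then show ?thesis unfolding eigs(1) .
 qed
 moreover have "cmod (poly (char_poly ?A) z) = cmod (det (char_matrix ?A z))"
 proof -
  have c: "char_matrix ?A z : carrier_mat n n" using Ac by simp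
  have "- char_matrix ?A z = (-1) \<cdot>\<^sub>m char_matrix ?A z" by (rule eq_matI) auto
  then show ?thesis unfolding char_poly_matrix[OF Ac] using c by (simp add: norm_mult norm_power)
 qed
 moreover have "char_matrix ?A z = mat n n (%(i,k). shifted d z P i k)"
 proof (rule eq_matI)
  fix i j assume "i < dim_row (mat n n (%(i,k). shifted d z P i k))" "j < dim_col (mat n n (%(i,k). shifted d z P i k))"
  then have ij: "i < n" "j < n" by auto
  have "(SUM l<d. of_bool (P l i = j)) = (of_nat (card {l : {..<d}. P l i = j}) :: complex)"
   by (simp add: of_bool_def sum.If_cases Int_def)
  then show "char_matrix ?A z $$ (i,j) = mat n n (%(i,k). shifted d z P i k) $$ (i,j)"
   using ij unfolding char_matrix_def scaled_perm_sum_def shifted_def by simp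
 qed (use Ac in \<open>auto simp: char_matrix_def\<close>)
 ultimately show ?thesis by simp
qed

section \<open>Convergence of the logarithmic potential\<close>

definition avg :: "nat => nat => (perms => real) => real" where
 "avg n d F = (SUM P:tuples n d. F P) / card (tuples n d)"

lemma avg_mono: "(!!P. P : tuples n d ==> F P <= F' P) ==> avg n d F <= avg n d F'"
 unfolding avg_def by (intro divide_right_mono sum_mono) auto

lemma avg_add: "avg n d (%P. F P + F' P) = avg n d F + avg n d F'"
 unfolding avg_def by (simp add: sum.distrib add_divide_distrib)

lemma avg_cmult: "avg n d (%P. c * F P) = c * avg n d F"
 unfolding avg_def by (simp add: sum_distrib_left)

lemma tuples_finite_pos: "finite (tuples n d)" "card (tuples n d) > 0"
 by (simp_all add: card_perm_tuples)

lemma avg_const: "avg n d (%_. c) = c"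
 unfolding avg_def using tuples_finite_pos(2)[of n d] by simp

lemma avg_nonneg: "(!!P. P : tuples n d ==> 0 <= F P) ==> 0 <= avg n d F"
 unfolding avg_def by (intro divide_nonneg_nonneg sum_nonneg) auto

lemma avg_of_bool: "avg n d (%P. of_bool (Q P)) = card {P : tuples n d. Q P} / card (tuples n d)"
 unfolding avg_def using tuples_finite_pos(1)[of n d] by (simp add: of_bool_def sum.If_cases Int_def)

lemma avg_mult_le:
 "avg n d (%P. F P * F' P) <= sqrt (avg n d (%P. (F P)^2)) * sqrt (avg n d (%P. (F' P)^2))"
proof -
 let ?S = "tuples n d" and ?c = "real (card (tuples n d))"
 have c: "?c > 0" using tuples_finite_pos(2) by simp
 have "(SUM P:?S. F P * F' P)^2 <= (SUM P:?S. (F P)^2) * (SUM P:?S. (F' P)^2)" by (rule Cauchy_Schwarz_ineq_sum)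
 then have "(SUM P:?S. F P * F' P) <= sqrt ((SUM P:?S. (F P)^2) * (SUM P:?S. (F' P)^2))"
  by (rule real_le_rsqrt)
 then have "(SUM P:?S. F P * F' P) / ?c <= sqrt ((SUM P:?S. (F P)^2) * (SUM P:?S. (F' P)^2)) / ?c"
  by (intro divide_right_mono) auto
 also have "... = sqrt ((SUM P:?S. (F P)^2) / ?c) * sqrt ((SUM P:?S. (F' P)^2) / ?c)"
  using c by (simp add: real_sqrt_mult real_sqrt_divide)
 finally show ?thesis unfolding avg_def .
qed

lemma avg_sqrt_le:
 assumes "!!P. P : tuples n d ==> 0 <= F P"
 shows "avg n d (%P. sqrt (F P)) <= sqrt (avg n d F)"
proof -
 have "avg n d (%P. sqrt (F P) * 1) <= sqrt (avg n d (%P. (sqrt (F P))^2)) * sqrt (avg n d (%P. 1^2))"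
  by (rule avg_mult_le)
 also have "avg n d (%P. (sqrt (F P))^2) = avg n d F" unfolding avg_def using assms by simp
 finally show ?thesis by (simp add: avg_const)
qed

lemma avg_markov:
 assumes "!!P. P : tuples n d ==> 0 <= F P" "del > 0"
 shows "avg n d (%P. of_bool (del < F P)) <= avg n d F / del"
proof -
 have "avg n d (%P. of_bool (del < F P)) <= avg n d (%P. (1/del) * F P)"
  using assms by (intro avg_mono) (auto simp: field_simps of_bool_def)
 then show ?thesis unfolding avg_cmult by simp
qed

text \<open>For the eigenvalues \<open>h\<close> of the Gram matrix this is the imaginary part of
  the normalized resolvent trace at \<open>\<i> * t\<close>.\<close>

definition res_mean :: "nat => (nat => real) => real => real" where
 "res_mean n h t = t / n * (SUM i<n. 1 / (h i + t^2))"

definition log_mean :: "nat => (nat => real) => real => real" where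
 "log_mean n h t = (SUM i<n. ln (h i + t^2)) / (2 * n)"

text \<open>What remains of the loop equations after eliminating the off-diagonal trace; here \<open>q\<close> is the square of \<open>|z|\<close>.\<close>
definition quad_defect :: "real => real => real => real" where
 "quad_defect q a t = 1 - a * (t + a) - q * a / (t + a)"

text \<open>Up to the defect, the derivative along \<open>a = res_mean n h t\<close> is \<open>a\<close>, the derivative of \<open>log_mean n h\<close>.\<close>
definition pot_approx :: "real => real => real => real" where
 "pot_approx q a t = ln ((t + a)^2 + q) / 2 - a^2 / 2"

section \<open>Deterministic estimates for the regularized potential\<close>

context
 fixes n :: nat and h :: "nat => real"
 assumes n: "n > 0" and h: "!!i. i < n ==> h i >= 0"
begin

lemma shift_pos: "i < n ==> t > 0 ==> h i + t^2 > 0"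
 using h[of i] by (simp add: add_nonneg_pos)

lemma res_mean_bounds:
 assumes t: "t > 0"
 shows "res_mean n h t > 0" "res_mean n h t <= 1 / t"
proof -
 have "(SUM i<n. 1 / (h i + t^2)) > 0" using shift_pos t n by (intro sum_pos) auto
 then show "res_mean n h t > 0" unfolding res_mean_def using t n by simp
 have "(SUM i<n. 1 / (h i + t^2)) <= (SUM i<n. 1 / t^2)" by (rule sum_mono) (use h t in \<open>auto intro!: frac_le\<close>)
 then have "(SUM i<n. 1 / (h i + t^2)) <= n / t^2" by simp
 then have "res_mean n h t <= t / n * (n / t^2)" unfolding res_mean_def using t by (intro mult_left_mono) auto
 then show "res_mean n h t <= 1 / t" using n t by (simp add: power2_eq_square)
qed

lemma log_mean_deriv:
 assumes t: "t > 0"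
 shows "(log_mean n h has_real_derivative res_mean n h t) (at t)"
proof -
 have "((%t. SUM i<n. ln (h i + t^2)) has_real_derivative (SUM i<n. 2 * t / (h i + t^2))) (at t)"
  by (rule DERIV_sum) (use shift_pos[OF _ t] in \<open>auto intro!: derivative_eq_intros\<close>)
 then have "((%t. (SUM i<n. ln (h i + t^2)) / (2 * n)) has_real_derivative (SUM i<n. 2 * t / (h i + t^2)) / (2 * n)) (at t)"
  by (rule DERIV_cdivide)
 moreover have "(SUM i<n. 2 * t / (h i + t^2)) / (2 * n) = res_mean n h t"
  unfolding res_mean_def sum_divide_distrib sum_distrib_left by (intro sum.cong refl) simp
 ultimately show ?thesis unfolding log_mean_def[abs_def] by simp
qed

definition res_mean' :: "real => real" where
 "res_mean' t = (SUM i<n. (h i - t^2) / (h i + t^2)^2) / n"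

lemma res_mean_deriv:
 assumes t: "t > 0"
 shows "(res_mean n h has_real_derivative res_mean' t) (at t)" "\<bar>res_mean' t\<bar> <= 1 / t^2"
proof -
 have "((%t. SUM i<n. t / (h i + t^2)) has_real_derivative (SUM i<n. (h i - t^2) / (h i + t^2)^2)) (at t)"
 proof (rule DERIV_sum)
  fix i assume "i : {..<n}"
  then have "h i + t^2 ~= 0" using shift_pos[of i t] t by simp
  then show "((%t. t / (h i + t^2)) has_real_derivative (h i - t^2) / (h i + t^2)^2) (at t)"
   by (auto intro!: derivative_eq_intros simp: power2_eq_square)
 qed
 then have "((%t. (SUM i<n. t / (h i + t^2)) / n) has_real_derivative res_mean' t) (at t)"
  unfolding res_mean'_def by (rule DERIV_cdivide)
 moreover have "(%t. (SUM i<n. t / (h i + t^2)) / n) = res_mean n h"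
  unfolding res_mean_def by (intro ext) (simp add: sum_distrib_left sum_divide_distrib mult.commute)
 ultimately show "(res_mean n h has_real_derivative res_mean' t) (at t)" by simp
 have "\<bar>(h i - t^2) / (h i + t^2)^2\<bar> <= 1 / t^2" if "i < n" for i
 proof -
  have "\<bar>(h i - t^2) / (h i + t^2)^2\<bar> = \<bar>h i - t^2\<bar> / (h i + t^2)^2" by simp
  also have "... <= (h i + t^2) / (h i + t^2)^2"
   by (rule divide_right_mono) (use h[OF that] zero_le_power2[of t] in linarith, simp)
  also have "... = 1 / (h i + t^2)" using shift_pos[OF that t] by (simp add: power2_eq_square)
  also have "... <= 1 / t^2" using h[OF that] t by (intro frac_le) auto
  finally show ?thesis .
 qed
 then have "\<bar>SUM i<n. (h i - t^2) / (h i + t^2)^2\<bar> <= (SUM i<n. 1 / t^2)"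
  by (intro order_trans[OF sum_abs sum_mono]) auto
 then show "\<bar>res_mean' t\<bar> <= 1 / t^2" unfolding res_mean'_def using n by (simp add: field_simps)
qed

lemma res_mean_continuous: "0 < eta ==> continuous_on {eta..Tm} (res_mean n h)"
 by (intro continuous_at_imp_continuous_on ballI DERIV_isCont[OF res_mean_deriv(1)]) auto

lemma quad_defect_continuous:
 assumes "0 < eta"
 shows "continuous_on {eta..Tm} (%t. quad_defect q (res_mean n h t) t)"
 unfolding quad_defect_def
proof (intro continuous_intros res_mean_continuous assms)
 show "ALL t:{eta..Tm}. t + res_mean n h t ~= 0" using res_mean_bounds(1) assms by (smt (verit) atLeastAtMost_iff)
qed

lemma log_mean_diff:
 assumes "0 < eta" "eta <= Tm"
 shows "log_mean n h Tm - log_mean n h eta = integral {eta..Tm} (res_mean n h)"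
proof -
 have "(res_mean n h has_integral (log_mean n h Tm - log_mean n h eta)) {eta..Tm}"
  by (rule fundamental_theorem_of_calculus[OF assms(2)])
   (use assms log_mean_deriv in \<open>auto simp: has_real_derivative_iff_has_vector_derivative[symmetric] intro: has_field_derivative_at_within\<close>)
 then show ?thesis by (simp add: integral_unique)
qed

text \<open>With \<open>s = t + a\<close> and \<open>Q = s^2 + q\<close> the difference of
  \<open>log_mean\<close> and \<open>pot_approx\<close> has derivative
  \<open>(a - s / Q) * (1 + a')\<close>, and \<open>a - s / Q\<close> is \<open>- s / Q\<close>
  times the quadratic defect. The difference is thus constant wherever the defect vanishes.\<close>

lemma pot_approx_diff:
 fixes q :: real
 assumes eta: "0 < eta" "eta <= Tm" and q: "q >= 0"
 shows "\<bar>(log_mean n h Tm - pot_approx q (res_mean n h Tm) Tm) - (log_mean n h eta - pot_approx q (res_mean n h eta) eta)\<bar>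
  <= integral {eta..Tm} (%t. (1 / eta * (1 + 1 / eta\<^sup>2)) * \<bar>quad_defect q (res_mean n h t) t\<bar>)"
proof -
 define a where "a = res_mean n h"
 define psi where "psi t = log_mean n h t - pot_approx q (a t) t" for t
 define psi' where "psi' t = (a t - (t + a t) / ((t + a t)^2 + q)) * (1 + res_mean' t)" for t
 have a0: "a t > 0" if "t > 0" for t using res_mean_bounds(1)[OF that] unfolding a_def .
 have der: "(psi has_real_derivative psi' t) (at t)" if t: "t > 0" for t
 proof -
  have Q: "(t + a t)^2 + q > 0" using a0[OF t] t q by (simp add: add_pos_nonneg)
  have A: "(a has_real_derivative res_mean' t) (at t)" unfolding a_def by (rule res_mean_deriv(1)[OF t])
  have "((%t. pot_approx q (a t) t) has_real_derivative ((t + a t) * (1 + res_mean' t)) / ((t + a t)^2 + q) - a t * res_mean' t) (at t)"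
   unfolding pot_approx_def using Q A
   by (auto intro!: derivative_eq_intros A simp: field_simps)
  from DERIV_diff[OF log_mean_deriv[OF t] this] show ?thesis unfolding psi_def psi'_def a_def[symmetric]
   using Q by (simp add: field_simps)
 qed
 have int: "(psi' has_integral (psi Tm - psi eta)) {eta..Tm}"
  by (rule fundamental_theorem_of_calculus[OF eta(2)])
   (use eta der in \<open>auto simp: has_real_derivative_iff_has_vector_derivative[symmetric] intro: has_field_derivative_at_within\<close>)
 have bd: "norm (psi' t) <= (1 / eta * (1 + 1 / eta\<^sup>2)) * \<bar>quad_defect q (a t) t\<bar>" if "t : {eta..Tm}" for t
 proof -
  have t: "t > 0" "eta <= t" using that eta by auto
  define s Q where "s = t + a t" and "Q = s^2 + q"
  have s: "s > 0" "s >= eta" using a0[OF t(1)] t unfolding s_def by auto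
  have Q: "Q > 0" "Q >= s^2" unfolding Q_def using s q by (auto simp: add_pos_nonneg)
  have "quad_defect q (a t) t = 1 - a t * Q / s"
   unfolding quad_defect_def s_def[symmetric] Q_def using s by (simp add: field_simps power2_eq_square)
  then have "a t - s / Q = - (s / Q) * quad_defect q (a t) t" using s Q by (simp only:) (simp add: field_simps)
  then have "\<bar>a t - s / Q\<bar> = s / Q * \<bar>quad_defect q (a t) t\<bar>" using s Q by (simp add: abs_mult)
  also have "s / Q <= s / s^2" using s Q by (intro divide_left_mono) auto
  also have "s / s^2 = 1 / s" using s by (simp add: power2_eq_square)
  also have "1 / s <= 1 / eta" using s eta by (intro frac_le) auto
  finally have 1: "\<bar>a t - s / Q\<bar> <= 1 / eta * \<bar>quad_defect q (a t) t\<bar>" by (simp add: mult_right_mono)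
  have "\<bar>1 + res_mean' t\<bar> <= 1 + 1 / t^2" using res_mean_deriv(2)[OF t(1)] by linarith
  also have "1 / t^2 <= 1 / eta\<^sup>2" using t eta by (intro frac_le power_mono) auto
  finally have 2: "\<bar>1 + res_mean' t\<bar> <= 1 + 1 / eta\<^sup>2" by simp
  have "norm (psi' t) = \<bar>a t - s / Q\<bar> * \<bar>1 + res_mean' t\<bar>" unfolding psi'_def s_def Q_def by (simp add: abs_mult)
  also have "... <= (1 / eta * \<bar>quad_defect q (a t) t\<bar>) * (1 + 1 / eta\<^sup>2)" using 1 2 eta by (intro mult_mono) auto
  finally show ?thesis by (simp add: mult_ac)
 qed
 have "norm (integral {eta..Tm} psi') <= integral {eta..Tm} (%t. (1 / eta * (1 + 1 / eta\<^sup>2)) * \<bar>quad_defect q (a t) t\<bar>)"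
 proof (rule integral_norm_bound_integral)
  show "psi' integrable_on {eta..Tm}" using int by blast
  show "(%t. (1 / eta * (1 + 1 / eta\<^sup>2)) * \<bar>quad_defect q (a t) t\<bar>) integrable_on {eta..Tm}"
   unfolding a_def by (intro integrable_continuous_interval continuous_intros quad_defect_continuous eta)
 qed (use bd in auto)
 then show ?thesis using int unfolding psi_def a_def by (simp add: integral_unique)
qed

text \<open>For large \<open>Tm\<close> both expressions are \<open>ln Tm\<close> up to a multiple
  of \<open>1 / Tm^2\<close>, which fixes the constant of integration. The \<open>h i\<close> enter
  only through their mean.\<close>

lemma pot_approx_top:
 fixes q :: real
 assumes Tm: "Tm >= 1" and q: "q >= 0"
 shows "\<bar>log_mean n h Tm - pot_approx q (res_mean n h Tm) Tm\<bar> <= ((SUM i<n. h i) / n + q + 4) / Tm^2"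
proof -
 define a where "a = res_mean n h Tm"
 have a: "a > 0" "a <= 1 / Tm" unfolding a_def using res_mean_bounds[of Tm] Tm by auto
 have ln_bd: "0 <= ln (x + Tm^2) - ln (Tm^2) & ln (x + Tm^2) - ln (Tm^2) <= x / Tm^2" if "x >= 0" for x
 proof -
  have "ln (x + Tm^2) - ln (Tm^2) = ln (1 + x / Tm^2)" 
  proof -
   have "0 < x + Tm^2" using that Tm by (simp add: add_nonneg_pos)
   then have "ln (x + Tm^2) - ln (Tm^2) = ln ((x + Tm^2) / Tm^2)" using Tm by (subst ln_div) auto
   then show ?thesis using Tm by (simp add: add_divide_distrib add.commute)
  qed
  moreover have "x / Tm^2 >= 0" using that by simp
  ultimately show ?thesis using ln_add_one_self_le_self[of "x / Tm^2"] by simp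
 qed
 have lT: "ln (Tm^2) / 2 = ln Tm" using Tm by (simp add: ln_realpow)
 have "log_mean n h Tm - ln Tm = (SUM i<n. ln (h i + Tm^2) - ln (Tm^2)) / (2 * n)"
  unfolding log_mean_def using n lT by (simp add: sum_subtractf diff_divide_distrib)
 moreover have "0 <= (SUM i<n. ln (h i + Tm^2) - ln (Tm^2))" using ln_bd h by (intro sum_nonneg) auto
 moreover have "(SUM i<n. ln (h i + Tm^2) - ln (Tm^2)) <= (SUM i<n. h i / Tm^2)" using ln_bd h by (intro sum_mono) auto
 ultimately have 1: "0 <= log_mean n h Tm - ln Tm" "log_mean n h Tm - ln Tm <= (SUM i<n. h i / Tm^2) / (2 * n)"
  using n by (auto intro!: divide_right_mono)
 have "(SUM i<n. h i / Tm^2) / (2 * n) <= (SUM i<n. h i) / n / Tm^2"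
 proof -
  have "0 <= (SUM i<n. h i) / n / Tm^2" using h by (intro divide_nonneg_nonneg sum_nonneg) auto
  moreover have "(SUM i<n. h i / Tm^2) / (2 * n) = ((SUM i<n. h i) / n / Tm^2) / 2" unfolding sum_divide_distrib[symmetric] by simp
  moreover have "x / 2 <= x" if "0 <= x" for x :: real using that by simp
  ultimately show ?thesis by presburger
 qed
 then have 1: "\<bar>log_mean n h Tm - ln Tm\<bar> <= (SUM i<n. h i) / n / Tm^2" using 1 by linarith
 define x where "x = (Tm + a)^2 + q - Tm^2"
 have x: "x = 2 * (Tm * a) + a^2 + q" unfolding x_def by (simp add: power2_eq_square algebra_simps)
 have Ta: "Tm * a <= 1" using a Tm by (simp add: field_simps)
 have a1: "a <= 1" using a Tm by (smt (verit) divide_le_eq_1)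
 have a2: "a^2 <= 1 / Tm^2" using power_mono[OF a(2), of 2] a by (simp add: power_divide)
 have aa: "a^2 <= 1" using a1 a by (simp add: power_le_one)
 have x03: "0 <= x" "x <= q + 3" unfolding x using a Tm q Ta aa by (auto intro!: add_nonneg_nonneg)
 have pa: "pot_approx q a Tm - ln Tm = (ln (x + Tm^2) - ln (Tm^2)) / 2 - a^2 / 2"
  unfolding pot_approx_def x_def using lT by (simp add: diff_divide_distrib)
 have "x / Tm^2 <= (q + 3) / Tm^2" using x03 by (intro divide_right_mono) auto
 then have 2: "\<bar>pot_approx q a Tm - ln Tm\<bar> <= (q + 3) / Tm^2 + 1 / Tm^2" 
 proof -
  have "\<bar>L / 2 - v / 2\<bar> <= y + w" if "0 <= L & L <= u" "u <= y" "0 <= v" "v <= w" for L u v w y :: real using that by linarith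
  from this[OF ln_bd[OF x03(1)] \<open>x / Tm^2 <= (q + 3) / Tm^2\<close> zero_le_power2[of a] a2] show ?thesis
   unfolding pa .
 qed
 have "\<bar>log_mean n h Tm - pot_approx q a Tm\<bar> <= (SUM i<n. h i) / n / Tm^2 + ((q + 3) / Tm^2 + 1 / Tm^2)" using 1 2 by linarith
 also have "... = ((SUM i<n. h i) / n + q + 4) / Tm^2" by (simp add: add_divide_distrib)
 finally show ?thesis unfolding a_def .
qed

text \<open>Termwise, \<open>ln (1 + t^2 / h)\<close> is at most
  \<open>2 * (1 + ln (1 / b)) * t^2 / (h + t^2)\<close>: for \<open>h >= t^2\<close> by
  \<open>ln (1 + x) <= x\<close>, otherwise because the last quotient is at least 1/2. So the lower
  bound \<open>b\<close> enters only through its logarithm, multiplied by the small quantity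
  \<open>t * res_mean\<close>.\<close>

lemma log_mean_zero_diff:
 assumes t: "0 < t" "t <= 1" and b: "0 < b" "b <= 1" and hb: "!!i. i < n ==> b <= h i"
 shows "0 <= log_mean n h t - (SUM i<n. ln (h i)) / (2 * n)"
  "log_mean n h t - (SUM i<n. ln (h i)) / (2 * n) <= t * res_mean n h t * (1 + ln (1 / b))"
proof -
 have hp: "h i > 0" if "i < n" for i using hb[OF that] b by linarith
 have eq: "log_mean n h t - (SUM i<n. ln (h i)) / (2 * n) = (SUM i<n. ln (h i + t^2) - ln (h i)) / (2 * n)"
  unfolding log_mean_def by (simp add: sum_subtractf diff_divide_distrib)
 have up: "ln (h i + t^2) - ln (h i) <= 2 * (1 + ln (1 / b)) * (t^2 / (h i + t^2))" and lo: "0 <= ln (h i + t^2) - ln (h i)" if i: "i < n" for i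
 proof -
  let ?x = "h i"
  have l: "ln (1 / b) >= 0" using b by simp
  show "0 <= ln (?x + t^2) - ln ?x" using hp[OF i] by (simp add: ln_mono add_pos_nonneg)
  show "ln (?x + t^2) - ln ?x <= 2 * (1 + ln (1 / b)) * (t^2 / (?x + t^2))"
  proof (cases "?x >= t^2")
   case True
   have "ln (?x + t^2) - ln ?x = ln (1 + t^2 / ?x)" 
   proof -
    have "0 < ?x + t^2" using hp[OF i] by (simp add: add_pos_nonneg)
    then have "ln (?x + t^2) - ln ?x = ln ((?x + t^2) / ?x)" using hp[OF i] by (subst ln_div) auto
    then show ?thesis using hp[OF i] by (simp add: add_divide_distrib)
   qed
   also have "... <= t^2 / ?x" using hp[OF i] by (intro ln_add_one_self_le_self) simp
   also have "... <= 2 * (t^2 / (?x + t^2))"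
   proof -
    have "t^2 * (?x + t^2) <= t^2 * (2 * ?x)" using True by (intro mult_left_mono) auto
    then show ?thesis using hp[OF i] t by (simp add: field_simps add_pos_pos)
   qed
   also have "... <= 2 * (1 + ln (1 / b)) * (t^2 / (?x + t^2))" using l hp[OF i] by (intro mult_right_mono) auto
   finally show ?thesis .
  next
   case False
   have t2: "t^2 <= 1" using t by (simp add: power_le_one)
   have "ln (?x + t^2) <= ln 2" using False t2 hp[OF i] t by (subst ln_le_cancel_iff) auto
   moreover have "- ln ?x <= ln (1 / b)" using hb[OF i] b hp[OF i] by (simp add: ln_div)
   ultimately have "ln (?x + t^2) - ln ?x <= 1 + ln (1 / b)" using ln_2_less_1 by linarith
   also have "... <= (1 + ln (1 / b)) * (2 * (t^2 / (?x + t^2)))"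
   proof -
    have "1 <= 2 * (t^2 / (?x + t^2))" using False hp[OF i] by (simp add: field_simps)
    then have "(1 + ln (1 / b)) * 1 <= (1 + ln (1 / b)) * (2 * (t^2 / (?x + t^2)))" using l by (intro mult_left_mono) auto
    then show ?thesis by simp
   qed
   also have "... = 2 * (1 + ln (1 / b)) * (t^2 / (?x + t^2))" by (simp only: mult.assoc mult.left_commute[of _ 2])
   finally show ?thesis .
  qed
 qed
 show "0 <= log_mean n h t - (SUM i<n. ln (h i)) / (2 * n)" unfolding eq using lo by (intro divide_nonneg_nonneg sum_nonneg) auto
 have "(SUM i<n. ln (h i + t^2) - ln (h i)) / (2 * n) <= (SUM i<n. 2 * (1 + ln (1 / b)) * (t^2 / (h i + t^2))) / (2 * n)"
  using up by (intro divide_right_mono sum_mono) auto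
 also have "... = (2 * (1 + ln (1 / b))) * (t^2 * (SUM i<n. 1 / (h i + t^2))) / (2 * n)"
  by (simp add: sum_distrib_left)
 also have "... = t * res_mean n h t * (1 + ln (1 / b))" unfolding res_mean_def using n by (simp add: power2_eq_square field_simps)
 finally show "log_mean n h t - (SUM i<n. ln (h i)) / (2 * n) <= t * res_mean n h t * (1 + ln (1 / b))" unfolding eq .
qed

end

text \<open>Despite the short name these are the squares of the singular values of
  \<open>A - z\<close>.\<close>

definition sv :: "nat => nat => complex => perms => nat => real" where
 "sv n d z P = (SOME h. gram_spec n (shifted d z P) h)"

lemma gram_spec_sv: "gram_spec n (shifted d z P) (sv n d z P)"
 unfolding sv_def by (rule someI_ex[OF gram_spectrum])

lemma sv_nonneg: "i < n ==> sv n d z P i >= 0"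
 using gram_spec_sv unfolding gram_spec_def by blast

lemma sv_resolv: "t > 0 ==> (SUM i<n. resolv n t (shifted d z P) i i) = \<i> * t * complex_of_real (SUM i<n. 1 / (sv n d z P i + t^2))"
 using gram_spec_sv unfolding gram_spec_def by blast

lemma sv_sum: "(SUM i<n. sv n d z P i) = (SUM i<n. SUM k<n. (cmod (shifted d z P i k))^2)"
 using gram_spec_sv unfolding gram_spec_def by blast

lemma sv_prod: "(PROD i<n. sv n d z P i) = (cmod (det (mat n n (%(i,k). shifted d z P i k))))^2"
 using gram_spec_sv unfolding gram_spec_def by blast

lemma sv_lower:
 assumes "!!x. b * (SUM i<n. (cmod (x i))^2) <= (SUM k<n. (cmod (SUM i<n. x i * shifted d z P i k))^2)" "i < n"
 shows "b <= sv n d z P i"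
 using gram_spec_sv assms unfolding gram_spec_def by blast

abbreviation "sva n d z t P \<equiv> res_mean n (sv n d z P) t"

section \<open>From the loop equations to a scalar equation\<close>

context
 fixes n d :: nat and z :: complex and t :: real
 assumes t: "t > 0" and d: "d > 0" and n: "n > 0"
begin

lemma gt_spectral:
 shows "gt n d z t 0 0 P = \<i> * sva n d z t P" "gt n d z t n n P = \<i> * sva n d z t P"
  "gt n d z t n 0 P = cnj (gt n d z t 0 n P)"
proof -
 have e: "(SUM i<n. resolv n t (shifted d z P) i i) / n = \<i> * sva n d z t P"
  unfolding sv_resolv[OF t] res_mean_def by simp
 show "gt n d z t 0 0 P = \<i> * sva n d z t P" unfolding gt_def[OF t d] using e by simp
 show "gt n d z t n n P = \<i> * sva n d z t P" unfolding gt_def[OF t d] resolv_trace_eq[OF t] using e by simp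
 show "gt n d z t n 0 P = cnj (gt n d z t 0 n P)" unfolding gt_def[OF t d] using resolv_offdiag_trace[OF t, of n "shifted d z P"] by simp
qed

lemma loop_defect_spectral:
 defines "a \<equiv> %P. sva n d z t P"
 shows "loop_defect n d z t 0 P = complex_of_real (1 - a P * (t + a P)) + z * cnj (gt n d z t 0 n P)"
  "loop_defect n d z t n P = \<i> * (complex_of_real (t + a P) * gt n d z t 0 n P + z * complex_of_real (a P))"
 unfolding loop_defect_def[OF t d n] gt_spectral a_def using n by (simp_all add: algebra_simps)

text \<open>The equation for \<open>s = n\<close> determines the off-diagonal trace as
  \<open>- z * a / (t + a)\<close> up to its defect; substituted into the other equation it leaves a
  scalar relation for \<open>a\<close>.\<close>

lemma quad_defect_bound:
 "\<bar>quad_defect ((cmod z)^2) (sva n d z t P) t\<bar> <= cmod (loop_defect n d z t 0 P) + cmod z / t * cmod (loop_defect n d z t n P)"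
proof -
 define a g W1 W2 where "a = sva n d z t P" and "g = gt n d z t 0 n P" and "W1 = loop_defect n d z t 0 P" and "W2 = loop_defect n d z t n P"
 define s where "s = t + a"
 have a: "a > 0" unfolding a_def by (rule res_mean_bounds(1)[OF n sv_nonneg t])
 have s: "s > 0" "s >= t" unfolding s_def using a t by auto
 have W: "W1 = complex_of_real (1 - a * s) + z * cnj g" "W2 = \<i> * (complex_of_real s * g + z * complex_of_real a)"
  unfolding W1_def W2_def loop_defect_spectral a_def g_def s_def by auto
 have "cnj W2 = - \<i> * (complex_of_real s * cnj g + cnj z * complex_of_real a)" unfolding W(2) by simp
 then have "\<i> * cnj W2 = complex_of_real s * cnj g + cnj z * complex_of_real a" by simp
 then have "z * (\<i> * cnj W2) = complex_of_real s * (z * cnj g) + (z * cnj z) * complex_of_real a"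
  by (simp add: algebra_simps)
 then have "z * (\<i> * cnj W2) / complex_of_real s = z * cnj g + complex_of_real ((cmod z)^2 * a / s)"
  unfolding complex_norm_square[symmetric] using s by (simp add: add_divide_distrib)
 then have "complex_of_real (quad_defect ((cmod z)^2) a t) = W1 - z * (\<i> * cnj W2) / complex_of_real s"
  unfolding W(1) quad_defect_def s_def[symmetric] by simp
 then have "\<bar>quad_defect ((cmod z)^2) a t\<bar> <= cmod W1 + cmod (z * (\<i> * cnj W2) / complex_of_real s)"
  by (metis norm_of_real norm_triangle_ineq4)
 also have "cmod (z * (\<i> * cnj W2) / complex_of_real s) = cmod z * cmod W2 / s" using s by (simp add: norm_mult norm_divide)
 also have "... <= cmod z * cmod W2 / t" using s t by (intro divide_left_mono) auto
 finally show ?thesis unfolding a_def W1_def W2_def by simp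
qed

text \<open>Let \<open>a >= 1\<close>. The equation for \<open>s = n\<close> bounds the off-diagonal
  trace by \<open>1 + cmod z\<close>, and then the one for \<open>s = 0\<close> bounds
  \<open>a * (t + a)\<close>. Neither bound deteriorates as \<open>t\<close> decreases.\<close>

lemma res_mean_bounded:
 assumes W1: "cmod (loop_defect n d z t 0 P) <= 1" and W2: "cmod (loop_defect n d z t n P) <= 1"
 shows "sva n d z t P <= 3 + cmod z + (cmod z)^2"
proof -
 define a g where "a = sva n d z t P" and "g = gt n d z t 0 n P"
 have a: "a > 0" unfolding a_def by (rule res_mean_bounds(1)[OF n sv_nonneg t])
 show ?thesis
 proof (cases "a >= 1")
  case True
  define s where "s = t + a"
  have s: "s >= a" "s > 0" unfolding s_def using t a by auto
  have W: "cmod (complex_of_real (1 - a * s) + z * cnj g) <= 1" "cmod (complex_of_real s * g + z * complex_of_real a) <= 1"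
   using W1 W2 unfolding loop_defect_spectral a_def g_def s_def by (auto simp: norm_mult)
  have "s * cmod g = cmod ((complex_of_real s * g + z * complex_of_real a) - z * complex_of_real a)" using s by (simp add: norm_mult)
  also have "... <= 1 + cmod z * a" using W(2) norm_triangle_ineq4[of "complex_of_real s * g + z * complex_of_real a" "z * complex_of_real a"] a
   by (simp add: norm_mult)
  finally have "a * cmod g <= 1 + cmod z * a" using s by (meson mult_right_mono norm_ge_zero order_trans)
  also have "... <= a * (1 + cmod z)" using True by (simp add: algebra_simps)
  finally have g: "cmod g <= 1 + cmod z" using a by simp
  have "\<bar>1 - a * s\<bar> = cmod ((complex_of_real (1 - a * s) + z * cnj g) - z * cnj g)" by (simp only: add_diff_cancel_right' norm_of_real)
  also have "... <= 1 + cmod z * cmod g"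
   using W(1) norm_triangle_ineq4[of "complex_of_real (1 - a * s) + z * cnj g" "z * cnj g"] by (simp add: norm_mult)
  also have "... <= 1 + cmod z * (1 + cmod z)" using g by (intro add_left_mono mult_left_mono) auto
  finally have "a * s <= 2 + cmod z + (cmod z)^2" by (simp add: algebra_simps power2_eq_square)
  moreover have "a * 1 <= a * s" using True s by (intro mult_left_mono) auto
  ultimately show ?thesis unfolding a_def[symmetric] by simp
 next
  case False
  then show ?thesis unfolding a_def[symmetric] using zero_le_power2[of "cmod z"] norm_ge_zero[of z] by linarith
 qed
qed

text \<open>The defects \<open>w\<close> are controlled through the mean of
  \<open>min w (w^2)\<close>. The first claim uses that \<open>w\<close> is at most this minimum
  plus its square root. For the second, the trace is bounded where both defects are at most 1;
  elsewhere the trivial bound \<open>1 / t\<close> is charged to the defect that exceeds 1.\<close>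

lemma avg_defect_bounds:
 fixes C Tm :: real
 defines "b \<equiv> (16 * C * (Tm + cmod z + 2) + 80 + C * Tm^2 + 11 * C * Tm) / (sqrt d * t ^ 3)"
 assumes C: "real d <= C * n" "C >= 1" and tt: "1 / sqrt d <= t" "t <= Tm" "Tm >= 1"
 shows "avg n d (%P. \<bar>quad_defect ((cmod z)^2) (sva n d z t P) t\<bar>) <= (1 + cmod z / t) * (b + sqrt b)"
  "avg n d (%P. sva n d z t P) <= 3 + cmod z + (cmod z)^2 + 2 * b / t"
proof -
 let ?W = "%s P. cmod (loop_defect n d z t s P)"
 let ?m = "%s P. min (?W s P) ((?W s P)^2)"
 have b0: "b >= 0" unfolding b_def using C tt t by (intro divide_nonneg_nonneg add_nonneg_nonneg mult_nonneg_nonneg) auto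
 have m: "avg n d (?m s) <= b" if "s = 0 \<or> s = n" for s
 proof -
  have "card (tuples n d) > 0" by (rule tuples_finite_pos)
  then show ?thesis using loop_defect_bound'[OF t d n that C tt] unfolding avg_def b_def by (simp add: divide_le_eq mult.commute)
 qed
 have m0: "?m s P >= 0" for s P by simp
 have w: "w <= min w (w^2) + sqrt (min w (w^2))" if "w >= 0" for w :: real
 proof (cases "w <= 1")
  case True
  then have "w^2 <= w" using that by (simp add: power2_eq_square mult_left_le)
  then show ?thesis using that by (simp add: min_def)
 next
  case False
  then have "w <= w^2" by (simp add: power2_eq_square)
  then show ?thesis using that by (simp add: min_def)
 qed
 have aW: "avg n d (?W s) <= b + sqrt b" if s: "s = 0 \<or> s = n" for s
 proof -
  have "avg n d (?W s) <= avg n d (%P. ?m s P + sqrt (?m s P))" by (intro avg_mono w) auto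
  also have "... <= avg n d (?m s) + sqrt (avg n d (?m s))" unfolding avg_add by (intro add_left_mono avg_sqrt_le m0)
  also have "... <= b + sqrt b" using m[OF s] by (intro add_mono) auto
  finally show ?thesis .
 qed
 have "avg n d (%P. \<bar>quad_defect ((cmod z)^2) (sva n d z t P) t\<bar>) <= avg n d (%P. ?W 0 P + cmod z / t * ?W n P)"
  by (intro avg_mono quad_defect_bound)
 also have "... = avg n d (?W 0) + cmod z / t * avg n d (?W n)" by (simp only: avg_add avg_cmult)
 also have "... <= (b + sqrt b) + cmod z / t * (b + sqrt b)" using t by (intro add_mono mult_left_mono aW) auto
 finally show "avg n d (%P. \<bar>quad_defect ((cmod z)^2) (sva n d z t P) t\<bar>) <= (1 + cmod z / t) * (b + sqrt b)"
  by (simp add: distrib_right)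
 let ?C = "3 + cmod z + (cmod z)^2"
 have "sva n d z t P <= ?C + (1 / t) * (?m 0 P + ?m n P)" for P
 proof (cases "?W 0 P <= 1 & ?W n P <= 1")
  case True
  then have "sva n d z t P <= ?C" using res_mean_bounded by blast
  moreover have "0 <= (1 / t) * (?m 0 P + ?m n P)" using t by (intro mult_nonneg_nonneg add_nonneg_nonneg m0) auto
  ultimately show ?thesis by linarith
 next
  case False
  have "1 <= min w (w^2)" if "w > 1" for w :: real using that by (simp add: one_le_power)
  then have "1 <= ?m 0 P + ?m n P" using False m0[of 0 P] m0[of n P] by (smt (verit))
  then have "1 / t * 1 <= (1 / t) * (?m 0 P + ?m n P)" using t by (intro mult_left_mono) auto
  moreover have "sva n d z t P <= 1 / t" by (rule res_mean_bounds(2)[OF n sv_nonneg t])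
  moreover have "0 <= ?C" by (simp add: add_nonneg_nonneg)
  ultimately show ?thesis by linarith
 qed
 then have "avg n d (%P. sva n d z t P) <= avg n d (%P. ?C + (1 / t) * (?m 0 P + ?m n P))" by (intro avg_mono)
 also have "... = ?C + (1 / t) * (avg n d (?m 0) + avg n d (?m n))" by (simp only: avg_add avg_cmult avg_const)
 also have "... <= ?C + (1 / t) * (b + b)" using t by (intro add_left_mono mult_left_mono add_mono m) auto
 finally show "avg n d (%P. sva n d z t P) <= ?C + 2 * b / t" by simp
qed

end

lemma shifted_transpose:
 fixes z :: complex
 assumes pi: "P : tuples n d" and d: "d > 0" and k: "k < n"
 shows "(SUM i<n. x i * shifted d z P i k) = perm_op d (z * sqrt d) (inv_tuple P) x k / sqrt d"
proof -
 define u where "u j = (of_bool (j = k) :: complex)" for j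
 have "perm_op d (z * sqrt d) P u i = sqrt d * shifted d z P i k" for i
  unfolding perm_op_def shifted_def u_def using d by (simp add: right_diff_distrib)
 then have e: "shifted d z P i k = perm_op d (z * sqrt d) P u i / sqrt d" for i using d by simp
 have "(SUM i<n. x i * shifted d z P i k) = (SUM i<n. x i * perm_op d (z * sqrt d) P u i) / sqrt d"
  unfolding e by (simp add: sum_divide_distrib)
 also have "(SUM i<n. x i * perm_op d (z * sqrt d) P u i) = (SUM j<n. of_bool (j = k) * perm_op d (z * sqrt d) (inv_tuple P) x j)"
  unfolding perm_op_transpose[OF pi] u_def by (simp only: mult.commute)
 also have "... = (SUM j<n. of_bool (k = j) * perm_op d (z * sqrt d) (inv_tuple P) x j)" by (simp only: eq_commute)
 also have "... = perm_op d (z * sqrt d) (inv_tuple P) x k" by (rule sum_of_bool_mult(1)[OF k])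
 finally show ?thesis .
qed

lemma sv_ge:
 fixes z :: complex and eps :: real
 assumes pi: "P : tuples n d" and d: "d > 0" and ns: "~ small_singular n d (z * sqrt d) eps P" and i: "i < n"
 shows "eps\<^sup>2 / d <= sv n d z P i"
proof (rule sv_lower[OF _ i])
 fix x :: "nat => complex"
 have e: "(SUM k<n. (cmod (SUM i<n. x i * shifted d z P i k))^2) = (SUM k<n. (cmod (perm_op d (z * sqrt d) (inv_tuple P) x k))^2) / d"
  unfolding sum_divide_distrib by (intro sum.cong refl) (simp add: shifted_transpose[OF pi d] norm_divide power_divide)
 show "eps\<^sup>2 / d * (SUM i<n. (cmod (x i))^2) <= (SUM k<n. (cmod (SUM i<n. x i * shifted d z P i k))^2)"
 proof (cases "(SUM i<n. (cmod (x i))^2) > 0")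
  case True
  then have "eps\<^sup>2 * (SUM i<n. (cmod (x i))^2) <= (SUM k<n. (cmod (perm_op d (z * sqrt d) (inv_tuple P) x k))^2)"
   using ns unfolding small_singular_def by (meson linorder_le_cases)
  then show ?thesis unfolding e by (simp add: divide_right_mono)
 next
  case False
  then have "(SUM i<n. (cmod (x i))^2) = 0" by (meson antisym_conv1 sum_nonneg zero_le_power2 linorder_not_le order_antisym)
  then show ?thesis by (simp add: sum_nonneg)
 qed
qed

section \<open>Frobenius norm and the upper tail of the potential\<close>

definition frob :: "nat => nat => perms => real" where
 "frob n d P = (SUM i<n. SUM k<n. (SUM l<d. of_bool (P l i = k))^2) / (d * n)"

lemma frob_nonneg: "frob n d P >= 0"
 unfolding frob_def by (intro divide_nonneg_nonneg sum_nonneg) auto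

lemma sv_mean_le:
 assumes d: "d > 0" and n: "n > 0"
 shows "(SUM i<n. sv n d z P i) / n <= 2 * (frob n d P + (cmod z)^2)"
proof -
 define A where "A i k = (SUM l<d. of_bool (P l i = k) :: real)" for i k
 have "(cmod (shifted d z P i k))^2 <= 2 * ((A i k)^2 / d) + 2 * ((cmod z)^2 * of_bool (i = k))" for i k
 proof -
  have "shifted d z P i k = complex_of_real (A i k / sqrt d) - z * of_bool (i = k)"
   unfolding shifted_def A_def by simp
  then have "cmod (shifted d z P i k) <= cmod (complex_of_real (A i k / sqrt d)) + cmod (z * of_bool (i = k))"
   using norm_triangle_ineq4 by metis
  also have "... = \<bar>A i k / sqrt d\<bar> + cmod z * of_bool (i = k)" by (simp add: norm_mult del: of_real_divide)
  finally have "(cmod (shifted d z P i k))^2 <= (\<bar>A i k / sqrt d\<bar> + cmod z * of_bool (i = k))^2" by (intro power_mono) auto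
  also have "... <= 2 * \<bar>A i k / sqrt d\<bar>\<^sup>2 + 2 * (cmod z * of_bool (i = k))^2"
   using sum_squares_bound[of "\<bar>A i k / sqrt d\<bar>" "cmod z * of_bool (i = k)"] by (simp add: power2_sum)
  also have "(cmod z * of_bool (i = k))^2 = (cmod z)^2 * of_bool (i = k)" by (simp add: of_bool_def)
  also have "\<bar>A i k / sqrt d\<bar>\<^sup>2 = (A i k)^2 / d" using d by (simp add: power_divide)
  finally show ?thesis .
 qed
 then have "(SUM i<n. sv n d z P i) <= (SUM i<n. SUM k<n. 2 * ((A i k)^2 / d) + 2 * ((cmod z)^2 * of_bool (i = k)))"
  unfolding sv_sum by (intro sum_mono)
 also have "... = 2 * (SUM i<n. SUM k<n. (A i k)^2) / d + 2 * (SUM i<n. (cmod z)^2 * (SUM k<n. of_bool (i = k)))"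
  by (simp only: sum.distrib sum_distrib_left[symmetric] sum_divide_distrib[symmetric] times_divide_eq_right)
 also have "(SUM i<n. (cmod z)^2 * (SUM k<n. of_bool (i = k))) = (SUM i<n. (cmod z)^2)"
  by (intro sum.cong refl) (simp add: of_bool_def)
 finally show ?thesis unfolding frob_def A_def[symmetric] using n d by (simp add: field_simps)
qed

lemma avg_sum: "finite S ==> avg n d (%P. SUM i:S. F i P) = (SUM i:S. avg n d (F i))"
 unfolding avg_def by (subst sum.swap) (simp add: sum_divide_distrib)

text \<open>After expanding the square, equal slots contribute 1, and two different slots agree at a
  given entry with probability at most \<open>(exp 1 / n)^2\<close>. The latter sum up to
  \<open>exp 2 * d / n\<close>, where \<open>d <= C * n\<close> enters.\<close>

lemma avg_frob_le:
 fixes C :: real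
 assumes n: "n > 0" and d: "d > 0" and C: "real d <= C * n"
 shows "avg n d (frob n d) <= 1 + exp 2 * C"
proof -
 let ?o = "%l l' i k. avg n d (%P. of_bool (P l i = k) * of_bool (P l' i = k))"
 have off: "?o l l' i k <= exp 2 / n^2"
  if "l < d" "l' < d" "l ~= l'" "i < n" for l l' i k
 proof -
  let ?E = "{(l,i,k),(l',i,k)}"
  have "?o l l' i k = avg n d (%P. of_bool (ALL (l,i,k):?E. P l i = k))"
   unfolding avg_def by (simp add: of_bool_conj)
  also have "... = real (card {P : tuples n d. ALL (l,i,k):?E. P l i = k}) / card (tuples n d)" by (rule avg_of_bool)
  also have "... <= card (tuples n d) * (exp 1 / real n) ^ card ?E / card (tuples n d)"
   using that n by (intro divide_right_mono card_tuples_prescribed_le) auto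
  also have "... = (exp 1 / real n)^2" using tuples_finite_pos(2)[of n d] that by (simp add: card_insert_if power2_eq_square)
  also have "... = exp 2 / n^2" by (simp add: power_divide exp_double[symmetric])
  finally show ?thesis .
 qed
 have diag: "(SUM k<n. of_bool (P l i = k) * of_bool (P l i = k)) <= (1::real)" for P :: "nat => nat => nat" and l i
 proof -
  have "(SUM k<n. of_bool (P l i = k) * of_bool (P l i = k)) = (SUM k<n. if P l i = k then 1 else (0::real))" by (intro sum.cong refl) auto
  then show ?thesis by simp
 qed
 have one: "(SUM k<n. ?o l l' i k) <= of_bool (l = l') + exp 2 / n"
  if l: "l < d" "l' < d" "i < n" for l l' i
 proof (cases "l = l'")
  case True
  have "(SUM k<n. ?o l l i k) = avg n d (%P. SUM k<n. of_bool (P l i = k) * of_bool (P l i = k))"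
   by (rule avg_sum[symmetric]) simp
  also have "... <= avg n d (%_. 1)" by (intro avg_mono diag)
  finally have "(SUM k<n. ?o l l i k) <= 1" unfolding avg_const .
  moreover have "0 <= exp 2 / real n" by simp
  ultimately have "(SUM k<n. ?o l l i k) <= 1 + exp 2 / n" by linarith
  then show ?thesis unfolding True[symmetric] by simp
 next
  case False
  have "(SUM k<n. ?o l l' i k) <= (SUM k<n. exp 2 / n^2)" by (intro sum_mono off l False)
  then show ?thesis using n False by (simp add: power2_eq_square)
 qed
 have "avg n d (frob n d) = avg n d (%P. (1 / (d * n)) * (SUM i<n. SUM k<n. (SUM l<d. SUM l'<d. of_bool (P l i = k) * of_bool (P l' i = k))))"
  unfolding frob_def power2_eq_square sum_product by (simp only: times_divide_eq_left mult_1 of_nat_mult)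
 also have "... = (1 / (d * n)) * (SUM i<n. SUM k<n. SUM l<d. SUM l'<d. ?o l l' i k)"
  unfolding avg_cmult by (simp only: avg_sum finite_lessThan)
 also have "(SUM i<n. SUM k<n. SUM l<d. SUM l'<d. ?o l l' i k)
  = (SUM i<n. SUM l<d. SUM l'<d. SUM k<n. ?o l l' i k)"
 proof (rule sum.cong[OF refl])
  fix i
  have "(SUM k<n. SUM l<d. SUM l'<d. ?o l l' i k) = (SUM l<d. SUM k<n. SUM l'<d. ?o l l' i k)"
   by (rule sum.swap)
  also have "... = (SUM l<d. SUM l'<d. SUM k<n. ?o l l' i k)"
   by (rule sum.cong[OF refl]) (rule sum.swap)
  finally show "(SUM k<n. SUM l<d. SUM l'<d. ?o l l' i k) = (SUM l<d. SUM l'<d. SUM k<n. ?o l l' i k)" .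
 qed
 also have "(1 / (d * n)) * (SUM i<n. SUM l<d. SUM l'<d. SUM k<n. ?o l l' i k)
  <= (1 / (d * n)) * (SUM i<n. SUM l<d. SUM l'<d. of_bool (l = l') + exp 2 / n)"
  using one by (intro mult_left_mono sum_mono) auto
 also have "(SUM i<n. SUM l<d. SUM l'<d. of_bool (l = l') + exp 2 / n) = n * (d * (1 + d * (exp 2 / n)))"
 proof -
  have "(SUM l'<d. of_bool (l = l') + exp 2 / n) = 1 + d * (exp 2 / n)" if "l < d" for l
   using that by (simp add: sum.distrib of_bool_def)
  then show ?thesis by simp
 qed
 also have "(1 / (d * n)) * (n * (d * (1 + d * (exp 2 / n)))) = 1 + exp 2 * (d / n)" using n d by (simp add: field_simps)
 also have "... <= 1 + exp 2 * C" using C n by (intro add_left_mono mult_left_mono) (auto simp: field_simps)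
 finally show ?thesis .
qed

definition log_pot :: "nat => nat => complex => perms => real" where
 "log_pot n d z P = (\<Sum>a\<leftarrow>eigs n d P. ln (cmod (z - a))) / n"

lemma log_pot_sv:
 assumes z: "z ~: set (eigs n d P)"
 shows "log_pot n d z P = (SUM i<n. ln (sv n d z P i)) / (2 * n)" "!!i. i < n ==> sv n d z P i > 0"
proof -
 have lnp: "ln (\<Prod>a\<leftarrow>es. cmod (z - a)) = (\<Sum>a\<leftarrow>es. ln (cmod (z - a))) & (\<Prod>a\<leftarrow>es. cmod (z - a)) > 0" if "z ~: set es" for es
  using that by (induction es) (auto simp: ln_mult_pos)
 define p where "p = (\<Prod>a\<leftarrow>eigs n d P. cmod (z - a))"
 have p: "p > 0" "ln p = (\<Sum>a\<leftarrow>eigs n d P. ln (cmod (z - a)))" using lnp[OF z] unfolding p_def by auto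
 have sp: "(PROD i<n. sv n d z P i) = p^2" unfolding sv_prod p_def prod_eigs_det ..
 show pos: "sv n d z P i > 0" if "i < n" for i
 proof -
  have "(PROD i<n. sv n d z P i) ~= 0" unfolding sp using p by simp
  then have "sv n d z P i ~= 0" using that by auto
  then show ?thesis using sv_nonneg[OF that, of d z P] by linarith
 qed
 have "(SUM i<n. ln (sv n d z P i)) = ln (PROD i<n. sv n d z P i)" by (rule ln_prod[symmetric]) (use pos in \<open>force+\<close>)
 also have "... = 2 * ln p" unfolding sp using p by (simp add: ln_realpow)
 finally show "log_pot n d z P = (SUM i<n. ln (sv n d z P i)) / (2 * n)" unfolding log_pot_def p(2)[symmetric] by simp
qed

lemma not_eig_if_sv_pos:
 assumes "!!i. i < n ==> sv n d z P i > 0"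
 shows "z ~: set (eigs n d P)"
proof
 assume "z : set (eigs n d P)"
 then have "(\<Prod>a\<leftarrow>eigs n d P. cmod (z - a)) = 0" by (auto simp: prod_list_zero_iff image_iff intro!: bexI[of _ z])
 then have "(PROD i<n. sv n d z P i) = 0" unfolding sv_prod prod_eigs_det[symmetric] by simp
 then show False using assms by (metis finite_lessThan lessThan_iff less_irrefl prod_zero_iff)
qed

text \<open>By concavity of the logarithm the potential is at most half the logarithm of the mean
  squared singular value. The square of its positive part thus has bounded mean, which later serves
  as uniform integrability.\<close>

lemma log_pot_upper:
 assumes z: "z ~: set (eigs n d P)" and n: "n > 0" and d: "d > 0"
 shows "(max 0 (log_pot n d z P))^2 <= 2 * (frob n d P + (cmod z)^2)"
proof -
 let ?s = "sv n d z P"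
 note sp = log_pot_sv(2)[OF z]
 define m where "m = (SUM i<n. ?s i) / n"
 have m: "m > 0" unfolding m_def using sp n by (intro divide_pos_pos sum_pos) auto
 have "(SUM i<n. ln (?s i)) <= (SUM i<n. ln m + (?s i / m - 1))"
 proof (rule sum_mono)
  fix i assume "i : {..<n}"
  then have "?s i > 0" using sp by simp
  then have "ln (?s i / m) <= ?s i / m - 1" using m by (intro ln_le_minus_one) simp
  then show "ln (?s i) <= ln m + (?s i / m - 1)" using \<open>?s i > 0\<close> m by (simp add: ln_div)
 qed
 also have "... = n * ln m + ((SUM i<n. ?s i) / m - n)" by (simp add: sum.distrib sum_subtractf sum_divide_distrib)
 also have "(SUM i<n. ?s i) / m = n" unfolding m_def using m n by (auto simp: m_def)
 finally have "log_pot n d z P <= ln m / 2" unfolding log_pot_sv(1)[OF z] using n by (simp add: field_simps)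
 then have "(max 0 (log_pot n d z P))^2 <= (max 0 (ln m / 2))^2" by (intro power_mono) auto
 also have "... <= m"
 proof (cases "m <= 1")
  case True
  then show ?thesis using m by (simp add: max_def)
 next
  case False
  then have "ln m / 2 = ln (sqrt m)" by (simp add: ln_sqrt)
  also have "... <= sqrt m" using m by (intro ln_bound[THEN order_trans]) auto
  finally have "(max 0 (ln m / 2))^2 <= (sqrt m)^2" using False by (intro power_mono) auto
  then show ?thesis using m by simp
 qed
 also have "... <= 2 * (frob n d P + (cmod z)^2)" unfolding m_def by (rule sv_mean_le[OF d n])
 finally show ?thesis .
qed

text \<open>The logarithmic potential of the limit law: the mean of \<open>ln (cmod (z - a))\<close>
  over \<open>a\<close> uniform in the unit disk.\<close>

definition disk_pot :: "complex => real" where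
 "disk_pot z = (if cmod z <= 1 then ((cmod z)^2 - 1) / 2 else ln (cmod z))"

text \<open>With \<open>s = eta + a\<close> and \<open>Q = s^2 + q\<close> a small defect makes
  \<open>a * (Q - 1)\<close> positive and of order \<open>eta\<close>, so \<open>a\<close> or
  \<open>Q - 1\<close> is small. Outside the disk \<open>Q - 1\<close> stays away from 0 and
  \<open>a\<close> must be small. Inside, positivity gives \<open>Q > 1\<close>, which rules out the
  spurious root near 0 when \<open>q < 1\<close>; then \<open>Q\<close> is close to 1 and
  \<open>a^2\<close> close to \<open>1 - q\<close>.\<close>

lemma pot_approx_near_disk_pot:
 assumes eps: "eps > 0"
 obtains eta0 where "eta0 > 0" "!!eta. 0 < eta ==> eta < eta0 ==>
  EX del>0. ALL a>0. \<bar>quad_defect ((cmod z)^2) a eta\<bar> <= del --> \<bar>pot_approx ((cmod z)^2) a eta - disk_pot z\<bar> <= eps"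
proof -
 define q where "q = (cmod z)^2"
 have q0: "q >= 0" unfolding q_def by simp
 have basic: "a * ((eta + a)^2 + q - 1) <= 2 * eta & (eta + a)^2 + q > 1 & eta + a <= 3"
  if eta: "0 < eta" "eta <= 1" and a: "a > 0" and qd: "\<bar>quad_defect q a eta\<bar> <= eta / 6" for a eta
 proof -
  define s Q omega where "s = eta + a" and "Q = s^2 + q" and "omega = quad_defect q a eta"
  have s: "s > 0" unfolding s_def using a eta by simp
  have "a * Q = s * (1 - omega)" unfolding omega_def quad_defect_def s_def[symmetric] Q_def using s by (simp add: field_simps power2_eq_square)
  then have aQ: "a * (Q - 1) = eta - s * omega" unfolding s_def by (simp add: algebra_simps)
  have w: "\<bar>omega\<bar> <= eta / 6" "\<bar>omega\<bar> <= 1" using qd eta unfolding omega_def by auto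
  have "a * s^2 <= a * Q" unfolding Q_def using a q0 by simp
  also have "... = s * (1 - omega)" by fact
  also have "... <= s * 2" using s w by (intro mult_left_mono) auto
  finally have "s * (a * s) <= s * 2" by (simp add: power2_eq_square mult_ac)
  then have "a * s <= 2" using s by simp
  moreover have "a * a <= a * s" unfolding s_def using a eta by simp
  ultimately have "a^2 <= 2^2" by (simp add: power2_eq_square)
  then have "a <= 2" by (rule power2_le_imp_le) simp
  then have s3: "s <= 3" unfolding s_def using eta by simp
  \<comment> \<open>The tolerance \<open>eta / 6\<close> is chosen so that, with
    \<open>s <= 3\<close>, the defect term is at most \<open>eta / 2\<close> and cannot change the
    sign.\<close>
  have "\<bar>s * omega\<bar> <= 3 * (eta / 6)" unfolding abs_mult using s s3 w by (intro mult_mono) auto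
  then have "a * (Q - 1) <= 2 * eta" "a * (Q - 1) > 0" using aQ eta by auto
  then show ?thesis using s3 a unfolding Q_def s_def by (auto simp: zero_less_mult_iff)
 qed
 show thesis
 proof (cases "cmod z <= 1")
  case True
  define kappa where "kappa = 1 - q"
  have k: "0 <= kappa" unfolding kappa_def q_def using True by (simp add: power_le_one)
  have U: "disk_pot z = - kappa / 2" unfolding disk_pot_def kappa_def q_def using True by simp
  define e where "e = min (eps / 2) 1"
  have e: "0 < e" "e <= eps / 2" "e <= 1" unfolding e_def using eps by auto
  \<comment> \<open>The last two constraints refute \<open>e <= s^2 - kappa\<close>: it would force
    \<open>a >= sqrt e / 2\<close>, and then \<open>a * (s^2 - kappa)\<close> would exceed
    \<open>2 * eta\<close>.\<close>
  define eta0 where "eta0 = min (min 1 (eps / 6)) (min (sqrt e / 2) (sqrt e * e / 4))"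
  show thesis
  proof (rule that[of eta0])
   show "eta0 > 0" unfolding eta0_def using e eps by simp
   fix eta assume eta: "0 < eta" "eta < eta0"
   then have eta': "eta <= 1" "eta < eps / 6" "eta < sqrt e / 2" "eta < sqrt e * e / 4" unfolding eta0_def by auto
   have "\<bar>pot_approx q a eta - disk_pot z\<bar> <= eps" if a: "a > 0" and qd: "\<bar>quad_defect q a eta\<bar> <= eta / 6" for a
   proof -
    define s where "s = eta + a"
    from basic[OF eta(1) eta'(1) a qd] have b: "a * (s^2 - kappa) <= 2 * eta" "s^2 - kappa > 0" "s <= 3" unfolding s_def kappa_def by (auto simp: algebra_simps)
    have s0: "s > 0" unfolding s_def using a eta by simp
    have small: "s^2 - kappa < e"
    proof (rule ccontr)
     assume "~ s^2 - kappa < e"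
     then have g: "e <= s^2 - kappa" by simp
     then have "e <= s^2" using k by simp
     then have "sqrt e <= s" using s0 by (simp add: real_le_lsqrt)
     then have "sqrt e / 2 <= a" using eta'(3) unfolding s_def by simp
     then have "sqrt e / 2 * e <= a * (s^2 - kappa)" using g e a by (intro mult_mono) auto
     then show False using b(1) eta'(4) by simp
    qed
    have Q: "s^2 + q = 1 + (s^2 - kappa)" unfolding kappa_def by simp
    have l: "0 <= ln (s^2 + q)" "ln (s^2 + q) <= e" unfolding Q using b(2) small ln_add_one_self_le_self[of "s^2 - kappa"] by auto
    have "s^2 - a^2 = eta * (s + a)" unfolding s_def by (simp add: power2_eq_square algebra_simps)
    moreover have "eta * (s + a) <= eta * 6" using b(3) eta unfolding s_def by (intro mult_left_mono) auto
    moreover have "eta * (s + a) >= 0" using s0 a eta by simp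
    ultimately have "0 <= s^2 - a^2" "s^2 - a^2 <= 6 * eta" by auto
    then show ?thesis unfolding U pot_approx_def s_def[symmetric] using l small b(2) eta'(2) e(2) eps by (simp add: abs_le_iff)
   qed
   then show "EX del>0. ALL a>0. \<bar>quad_defect ((cmod z)^2) a eta\<bar> <= del --> \<bar>pot_approx ((cmod z)^2) a eta - disk_pot z\<bar> <= eps"
    using eta unfolding q_def by (intro exI[of _ "eta / 6"]) auto
  qed
 next
  case False
  define k where "k = q - 1"
  have k: "k > 0" "q > 1" unfolding k_def q_def using False by (auto simp: one_less_power)
  have U: "disk_pot z = ln q / 2" unfolding disk_pot_def q_def using False by (simp add: ln_realpow)
  \<comment> \<open>From \<open>a * k <= 2 * eta\<close> follows
    \<open>s = eta + a <= eta * M\<close>.\<close>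
  define M where "M = 2 / k + 1"
  have M: "M >= 1" unfolding M_def using k by simp
  define e where "e = min eps 1"
  have e: "0 < e" "e <= eps" "e <= 1" unfolding e_def using eps by auto
  show thesis
  proof (rule that[of "e / M"])
   show "e / M > 0" using e M by simp
   fix eta assume eta: "0 < eta" "eta < e / M"
   then have etaM: "eta * M < e" using M by (simp add: field_simps)
   have "eta * 1 <= eta * M" using eta M by (intro mult_left_mono) auto
   then have eta1: "eta <= 1" using etaM e by simp
   have "\<bar>pot_approx q a eta - disk_pot z\<bar> <= eps" if a: "a > 0" and qd: "\<bar>quad_defect q a eta\<bar> <= eta / 6" for a
   proof -
    define s where "s = eta + a"
    from basic[OF eta(1) eta1 a qd] have b: "a * (s^2 + k) <= 2 * eta" unfolding s_def k_def by (auto simp: algebra_simps)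
    have "a * k <= a * (s^2 + k)" using a by simp
    then have "a <= 2 * eta / k" using b k by (simp add: field_simps)
    then have "s <= eta * M" unfolding s_def M_def by (simp add: algebra_simps)
    then have s: "s <= e" "s > 0" using etaM a eta unfolding s_def by auto
    have s2: "s^2 <= e" using s e by (smt (verit) mult_left_le power2_eq_square)
    have "a^2 <= s^2" unfolding s_def using a eta by (intro power_mono) auto
    then have a2: "a^2 <= e" using s2 by simp
    have "ln (s^2 + q) - ln q = ln (1 + s^2 / q)"
    proof -
     have "ln (s^2 + q) - ln q = ln ((s^2 + q) / q)" using k add_nonneg_pos[OF zero_le_power2[of s], of q] by (subst ln_div) auto
     then show ?thesis using k by (simp add: add_divide_distrib add.commute)
    qed
    moreover have "0 <= ln (1 + s^2 / q)" "ln (1 + s^2 / q) <= s^2 / q" using k ln_add_one_self_le_self[of "s^2 / q"] by auto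
    moreover have "s^2 / q <= s^2" using k mult_left_mono[of 1 q "s^2"] by (simp add: divide_le_eq)
    ultimately have "0 <= ln (s^2 + q) - ln q" "ln (s^2 + q) - ln q <= e" using s2 by auto
    then show ?thesis unfolding U pot_approx_def s_def[symmetric] abs_le_iff using a2 e zero_le_power2[of a] by (intro conjI; linarith)
   qed
   then show "EX del>0. ALL a>0. \<bar>quad_defect ((cmod z)^2) a eta\<bar> <= del --> \<bar>pot_approx ((cmod z)^2) a eta - disk_pot z\<bar> <= eps"
    using eta unfolding q_def by (intro exI[of _ "eta / 6"]) auto
  qed
 qed
qed

lemma avg_integral_le:
 fixes f :: "perms => real => real"
 assumes cont: "!!P. continuous_on {eta..u} (f P)" and le: "eta <= u" and B: "!!t. t : {eta..u} ==> avg n d (%P. f P t) <= B"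
 shows "avg n d (%P. integral {eta..u} (f P)) <= (u - eta) * B"
proof -
 have int: "f P integrable_on {eta..u}" for P by (rule integrable_continuous_interval[OF cont])
 have "avg n d (%P. integral {eta..u} (f P)) = integral {eta..u} (%t. avg n d (%P. f P t))"
  unfolding avg_def using int by (simp add: integral_sum integral_divide)
 also have "... <= integral {eta..u} (%t. B)"
  by (rule integral_le) (use B int in \<open>auto simp: avg_def intro!: integrable_on_divide integrable_sum integrable_const_ivl\<close>)
 also have "... = (u - eta) * B" using le by simp
 finally show ?thesis .
qed

abbreviation "svl n d z t P \<equiv> log_mean n (sv n d z P) t"
abbreviation "svq n d z t P \<equiv> quad_defect ((cmod z)^2) (sva n d z t P) t"

section \<open>Limits along the sequence \<open>d n\<close>\<close>

context
 fixes d :: "nat => nat" and z :: complex and C :: real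
 assumes dinf: "filterlim d at_top at_top"
  and up: "eventually (%n. real (d n) <= C * real n) at_top" and C: "C >= 1"
begin

lemma ev_pos: "eventually (%n. n > 0 & d n > 0) at_top"
 using filterlim_at_top[THEN iffD1, rule_format, OF dinf, of 1] eventually_gt_at_top[of 0] by eventually_elim auto

lemma inv_sqrt_d_tendsto: "(%n. 1 / sqrt (d n)) \<longlonglongrightarrow> 0"
proof -
 have "filterlim (%n. sqrt (real (d n))) at_top at_top"
  by (rule filterlim_compose[OF sqrt_at_top filterlim_compose[OF filterlim_real_sequentially dinf]])
 then show ?thesis by (intro tendsto_divide_0[OF tendsto_const] filterlim_at_top_imp_at_infinity)
qed

lemma avg_quad_defect_uniform:
 assumes eta: "0 < eta" "eta <= 1" and Tm: "Tm >= 1"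
 obtains B where "B \<longlonglongrightarrow> 0"
  "eventually (%n. ALL t:{eta..Tm}. avg n (d n) (%P. \<bar>svq n (d n) z t P\<bar>) <= B n) at_top"
proof -
 define K where "K = 16 * C * (Tm + cmod z + 2) + 80 + C * Tm^2 + 11 * C * Tm"
 have K: "K >= 0" unfolding K_def using C Tm by (intro add_nonneg_nonneg mult_nonneg_nonneg) auto
 define b where "b n = K / eta ^ 3 * (1 / sqrt (d n))" for n
 define B where "B n = (1 + cmod z / eta) * (b n + sqrt (b n))" for n
 have b: "b \<longlonglongrightarrow> 0" unfolding b_def using tendsto_mult_right_zero[OF inv_sqrt_d_tendsto] by blast
 have sb: "(%n. sqrt (b n)) \<longlonglongrightarrow> 0" using tendsto_real_sqrt[OF b] by simp
 have "B \<longlonglongrightarrow> 0" unfolding B_def using tendsto_mult_right_zero[OF tendsto_add_zero[OF b sb]] by blast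
 moreover have "eventually (%n. ALL t:{eta..Tm}. avg n (d n) (%P. \<bar>svq n (d n) z t P\<bar>) <= B n) at_top"
  using ev_pos up order_tendstoD(2)[OF inv_sqrt_d_tendsto eta(1)]
 proof eventually_elim
  case (elim n)
  show ?case
  proof
   fix t assume t: "t : {eta..Tm}"
   define b' where "b' = K / (sqrt (d n) * t ^ 3)"
   have "avg n (d n) (%P. \<bar>svq n (d n) z t P\<bar>) <= (1 + cmod z / t) * (b' + sqrt b')"
    unfolding b'_def K_def by (rule avg_defect_bounds(1)) (use t eta elim C Tm in auto)
   also have "... <= (1 + cmod z / eta) * (b n + sqrt (b n))"
   proof -
    have "b' = K / t ^ 3 * (1 / sqrt (d n))" unfolding b'_def by simp
    also have "... <= b n" unfolding b_def using K t eta by (intro mult_right_mono divide_left_mono power_mono) auto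
    finally have "b' <= b n" .
    moreover have "b' >= 0" unfolding b'_def using K t eta by simp
    moreover have "cmod z / t <= cmod z / eta" using t eta by (intro divide_left_mono) auto
    ultimately show ?thesis using eta by (intro mult_mono add_mono) auto
   qed
   finally show "avg n (d n) (%P. \<bar>svq n (d n) z t P\<bar>) <= B n" unfolding B_def .
  qed
 qed
 ultimately show ?thesis using that by blast
qed

text \<open>The contribution of large defects is of order \<open>1 / (sqrt d * t ^ 4)\<close>, one
  more factor \<open>1 / t\<close> than the mean defect. It stays bounded down to
  \<open>t = d powr (-1/8)\<close>.\<close>

lemma avg_res_mean_bounded:
 obtains K where "K > 0" "eventually (%n. ALL t:{real (d n) powr (-1/8)..1}. avg n (d n) (%P. sva n (d n) z t P) <= K) at_top"
proof -
 define K where "K = 16 * C * (1 + cmod z + 2) + 80 + C * 1^2 + 11 * C * 1"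
 have K: "K >= 0" unfolding K_def using C by (intro add_nonneg_nonneg mult_nonneg_nonneg) auto
 let ?C = "3 + cmod z + (cmod z)^2"
 have "?C + 2 * K > 0" using K by (intro add_pos_nonneg) auto
 moreover have "eventually (%n. ALL t:{real (d n) powr (-1/8)..1}. avg n (d n) (%P. sva n (d n) z t P) <= ?C + 2 * K) at_top"
  using ev_pos up
 proof eventually_elim
  case (elim n)
  define D where "D = real (d n)"
  have D: "D >= 1" unfolding D_def using elim by simp
  show ?case
  proof
   fix t assume t: "t : {real (d n) powr (-1/8)..1}"
   have t0: "t > 0" using t D unfolding D_def by (smt (verit) atLeastAtMost_iff powr_gt_zero)
   have "1 / sqrt (d n) = D powr (-1/2)" using D powr_minus_divide[of D "1/2"] powr_half_sqrt[of D] unfolding D_def by simp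
   also have "... <= D powr (-1/8)" using D by (intro powr_mono) auto
   also have "... <= t" using t unfolding D_def by simp
   finally have sq: "1 / sqrt (d n) <= t" .
   define b where "b = K / (sqrt (d n) * t ^ 3)"
   have "avg n (d n) (%P. sva n (d n) z t P) <= ?C + 2 * b / t"
    unfolding b_def K_def by (rule avg_defect_bounds(2)) (use t t0 sq elim C in auto)
   also have "2 * b / t <= 2 * K"
   proof -
    have "(D powr (-1/8)) ^ 4 <= t ^ 4" using t unfolding D_def by (intro power_mono) auto
    moreover have "(D powr (-1/8)) ^ 4 = D powr (-1/2)" using D by (simp add: powr_powr[symmetric] powr_realpow[symmetric] powr_powr)
    moreover have "sqrt D * D powr (-1/2) = 1" using D by (simp add: powr_half_sqrt[symmetric] powr_add[symmetric])
    ultimately have "1 <= sqrt D * t ^ 4" using D by (metis mult_left_mono real_sqrt_ge_zero order_trans zero_le_one)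
    then have "K / (sqrt D * t ^ 4) <= K / 1" using K by (intro divide_left_mono) auto
    moreover have "b / t = K / (sqrt D * t ^ 4)" unfolding b_def D_def using t0 by (simp add: field_simps power_eq_if)
    ultimately show ?thesis by simp
   qed
   finally show "avg n (d n) (%P. sva n (d n) z t P) <= ?C + 2 * K" by simp
  qed
 qed
 ultimately show ?thesis using that by blast
qed

text \<open>The order of limits matters: first \<open>Tm\<close> is made large, so that the boundary
  term is small uniformly in \<open>n\<close> by the Frobenius bound; then, on the fixed interval
  from \<open>eta\<close> to \<open>Tm\<close>, the mean defect tends to 0.\<close>

lemma avg_pot_approx_tendsto:
 assumes eta: "0 < eta" "eta <= 1"
 shows "(%n. avg n (d n) (%P. \<bar>svl n (d n) z eta P - pot_approx ((cmod z)^2) (sva n (d n) z eta P) eta\<bar>)) \<longlonglongrightarrow> 0"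
  (is "?f \<longlonglongrightarrow> 0")
proof (rule LIMSEQ_I)
 fix r :: real assume r: "r > 0"
 let ?q = "(cmod z)^2"
 define M where "M = 2 * (1 + exp 2 * C + ?q) + ?q + 4"
 have M: "M > 0" unfolding M_def using C by (intro add_nonneg_pos mult_nonneg_nonneg add_nonneg_nonneg) auto
 define Tm where "Tm = 1 + M / r * 2"
 have Tm: "Tm >= 1" unfolding Tm_def using M r by simp
 have TmM: "M / Tm^2 < r / 2 + 0"
 proof -
  have "M / Tm^2 <= M / Tm" using Tm M by (intro divide_left_mono) (auto simp: power2_eq_square)
  also have "... < r / 2" unfolding Tm_def using M r by (simp add: field_simps add_pos_pos)
  finally show ?thesis by simp
 qed
 define c where "c = 1 / eta * (1 + 1 / eta\<^sup>2)"
 have c: "c > 0" unfolding c_def using eta by (simp add: add_pos_pos)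
 obtain B where B: "B \<longlonglongrightarrow> 0" "eventually (%n. ALL t:{eta..Tm}. avg n (d n) (%P. \<bar>svq n (d n) z t P\<bar>) <= B n) at_top"
  by (rule avg_quad_defect_uniform[OF eta Tm]) blast
 have "(%n. (Tm - eta) * (c * B n)) \<longlonglongrightarrow> 0" using tendsto_mult_right_zero[OF tendsto_mult_right_zero[OF B(1)]] by blast
 then have "eventually (%n. (Tm - eta) * (c * B n) < r / 2) at_top" using r by (intro order_tendstoD(2)) auto
 then have "eventually (%n. norm (?f n - 0) < r) at_top" using B(2) ev_pos up
 proof eventually_elim
  case (elim n)
  then have n: "n > 0" and dn: "d n > 0" and upn: "real (d n) <= C * real n" by auto
  let ?psi = "%t P. svl n (d n) z t P - pot_approx ?q (sva n (d n) z t P) t"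
  have "?f n <= avg n (d n) (%P. \<bar>?psi Tm P\<bar> + \<bar>?psi Tm P - ?psi eta P\<bar>)" by (intro avg_mono) linarith
  also have "... = avg n (d n) (%P. \<bar>?psi Tm P\<bar>) + avg n (d n) (%P. \<bar>?psi Tm P - ?psi eta P\<bar>)" by (rule avg_add)
  also have "avg n (d n) (%P. \<bar>?psi Tm P\<bar>) <= M / Tm^2"
  proof -
   have "avg n (d n) (%P. \<bar>?psi Tm P\<bar>) <= avg n (d n) (%P. (1 / Tm^2) * (2 * frob n (d n) P + (2 * ?q + ?q + 4)))"
   proof (rule avg_mono)
    fix P
    have "\<bar>?psi Tm P\<bar> <= ((SUM i<n. sv n (d n) z P i) / n + ?q + 4) / Tm^2"
     by (rule pot_approx_top[OF n sv_nonneg Tm]) auto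
    also have "... <= (2 * (frob n (d n) P + ?q) + ?q + 4) / Tm^2"
     using sv_mean_le[OF dn n, of z P] by (intro divide_right_mono) auto
    finally show "\<bar>?psi Tm P\<bar> <= (1 / Tm^2) * (2 * frob n (d n) P + (2 * ?q + ?q + 4))"
     by (simp add: algebra_simps add_divide_distrib)
   qed
   also have "... = (1 / Tm^2) * (2 * avg n (d n) (frob n (d n)) + (2 * ?q + ?q + 4))" by (simp only: avg_cmult avg_add avg_const)
   also have "... <= (1 / Tm^2) * (2 * (1 + exp 2 * C) + (2 * ?q + ?q + 4))"
    using avg_frob_le[OF n dn upn] by (intro mult_left_mono) auto
   also have "... = M / Tm^2" unfolding M_def by (simp add: algebra_simps add_divide_distrib)
   finally show ?thesis .
  qed
  also have "avg n (d n) (%P. \<bar>?psi Tm P - ?psi eta P\<bar>) <= (Tm - eta) * (c * B n)"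
  proof -
   have "avg n (d n) (%P. \<bar>?psi Tm P - ?psi eta P\<bar>) <= avg n (d n) (%P. integral {eta..Tm} (%t. c * \<bar>svq n (d n) z t P\<bar>))"
    unfolding c_def by (intro avg_mono pot_approx_diff[OF n sv_nonneg eta(1)]) (use eta Tm in auto)
   also have "... <= (Tm - eta) * (c * B n)"
   proof (rule avg_integral_le)
    show "continuous_on {eta..Tm} (%t. c * \<bar>svq n (d n) z t P\<bar>)" for P
     by (intro continuous_intros quad_defect_continuous[OF n sv_nonneg eta(1)])
    show "avg n (d n) (%P. c * \<bar>svq n (d n) z t P\<bar>) <= c * B n" if "t : {eta..Tm}" for t
     unfolding avg_cmult using elim that c by (intro mult_left_mono) auto
   qed (use eta Tm in auto)
   finally show ?thesis .
  qed
  finally have "?f n < r" using TmM elim(1) by linarith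
  moreover have "?f n >= 0" by (rule avg_nonneg) simp
  ultimately show ?case by simp
 qed
 then show "EX no. ALL n>=no. norm (?f n - 0) < r" unfolding eventually_sequentially .
qed

text \<open>The comparison passes through two heights. From 0 to \<open>tau = d powr (-1/8)\<close>
  the least singular value is used (\<open>X1\<close>); from \<open>tau\<close> to a small fixed
  \<open>eta\<close> the bound on the mean trace makes the mean increment at most
  \<open>K * eta\<close> (\<open>X2\<close>); at \<open>eta\<close> the potential is close to
  \<open>pot_approx\<close>, and this to \<open>disk_pot\<close>. The four errors of size
  \<open>del / 4\<close> add up to \<open>del\<close>.\<close>

lemma log_pot_converges:
 assumes lnn: "eventually (%n. ln (real n) <= real (d n) powr (1/11)) at_top" and del: "del > 0"
 shows "(%n. avg n (d n) (%P. of_bool (del < \<bar>log_pot n (d n) z P - disk_pot z\<bar>))) \<longlonglongrightarrow> 0" (is "?f \<longlonglongrightarrow> 0")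
proof (rule LIMSEQ_I)
 fix r :: real assume r: "r > 0"
 let ?q = "(cmod z)^2"
 define e where "e = del / 4"
 have e: "e > 0" unfolding e_def using del by simp
 obtain eps :: "nat => real" where eps: "eventually (%n. 0 < eps n & eps n <= 1 & ln (1 / eps n) <= 20 * real (d n) powr (1/10)) at_top"
  "(%n. card {P : tuples n (d n). small_singular n (d n) (z * sqrt (d n)) (eps n) P} / card (tuples n (d n))) \<longlonglongrightarrow> 0"
  using least_singular_value_bound[OF dinf lnn up] by blast
 obtain K where K: "K > 0" "eventually (%n. ALL t:{real (d n) powr (-1/8)..1}. avg n (d n) (%P. sva n (d n) z t P) <= K) at_top"
  by (rule avg_res_mean_bounded) blast
 obtain eta0 where eta0: "eta0 > 0" "!!eta. 0 < eta ==> eta < eta0 ==>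
  EX del>0. ALL a>0. \<bar>quad_defect ?q a eta\<bar> <= del --> \<bar>pot_approx ?q a eta - disk_pot z\<bar> <= e"
  by (rule pot_approx_near_disk_pot[OF e]) blast
 define eta where "eta = min (eta0 / 2) (min 1 (e * r / (2 * K)))"
 have eta: "0 < eta" "eta < eta0" "eta <= 1" unfolding eta_def using eta0 e r K by auto
 have etaK: "K * eta / e <= r / 2"
 proof -
  have "eta <= e * r / (2 * K)" unfolding eta_def by simp
  then show ?thesis using K e by (simp add: field_simps)
 qed
 obtain del' where del': "del' > 0" "!!a. a > 0 ==> \<bar>quad_defect ?q a eta\<bar> <= del' ==> \<bar>pot_approx ?q a eta - disk_pot z\<bar> <= e"
  using eta0(2)[OF eta(1,2)] by blast
 obtain B where B: "B \<longlonglongrightarrow> 0" "eventually (%n. ALL t:{eta..1}. avg n (d n) (%P. \<bar>svq n (d n) z t P\<bar>) <= B n) at_top"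
  by (rule avg_quad_defect_uniform[OF eta(1,3), of 1]) auto
 define D where "D n = real (d n)" for n
 have Dinf: "filterlim D at_top at_top" unfolding D_def by (rule filterlim_compose[OF filterlim_real_sequentially dinf])
 \<comment> \<open>This bounds the first increment per unit of trace: the
   \<open>d powr (1/10)\<close> from the least singular value loses against
   \<open>d powr (-1/8)\<close>.\<close>
 define A where "A n = D n powr (-1/8) * (1 + (40 * D n powr (1/10) + ln (D n)))" for n
 have A: "A \<longlonglongrightarrow> 0"
 proof -
  have "((%x::real. x powr (-1/8) * (1 + (40 * x powr (1/10) + ln x))) \<longlongrightarrow> 0) at_top" by real_asymp
  from filterlim_compose[OF this Dinf] show ?thesis unfolding A_def .
 qed
 have eta0: "eventually (%n. D n powr (-1/8) < eta) at_top"
 proof -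
  have "((%x::real. x powr (-1/8)) \<longlongrightarrow> 0) at_top" by real_asymp
  from order_tendstoD(2)[OF filterlim_compose[OF this Dinf] eta(1)] show ?thesis .
 qed
 let ?P1 = "%n. card {P : tuples n (d n). small_singular n (d n) (z * sqrt (d n)) (eps n) P} / card (tuples n (d n))"
 let ?psi = "%n P. \<bar>svl n (d n) z eta P - pot_approx ?q (sva n (d n) z eta P) eta\<bar>"
 let ?P4 = "%n. avg n (d n) (?psi n)"
 have lim: "(%n. ?P1 n + A n * K / e + ?P4 n / e + B n / del') \<longlonglongrightarrow> 0 + 0 * K / e + 0 / e + 0 / del'"
  by (intro tendsto_intros eps(2) A B avg_pot_approx_tendsto eta) (use e del' in auto)
 have "eventually (%n. ?P1 n + A n * K / e + ?P4 n / e + B n / del' < r / 2) at_top"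
  using lim r by (intro order_tendstoD(2)[OF lim]) auto
 then have "eventually (%n. norm (?f n - 0) < r) at_top" using eps(1) K(2) B(2) eta0 ev_pos
 proof eventually_elim
  case (elim n)
  then have n: "n > 0" and dn: "d n > 0" by auto
  define tau where "tau = D n powr (-1/8)"
  have D1: "D n >= 1" unfolding D_def using dn by simp
  have tau: "0 < tau" "tau < eta" "tau <= 1" unfolding tau_def using elim(5) D1 eta by auto
  define b where "b = (eps n)^2 / D n"
  have b: "0 < b" "b <= 1" unfolding b_def using elim(2) D1 by (auto simp: power_le_one divide_le_eq intro: order_trans[of _ 1])
  have lnb: "ln (1 / b) <= 40 * D n powr (1/10) + ln (D n)"
  proof -
   have "ln (1 / b) = 2 * ln (1 / eps n) + ln (D n)" unfolding b_def using elim(2) D1 by (simp add: ln_div ln_realpow)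
   then show ?thesis using elim(2) unfolding D_def by linarith
  qed
  let ?SS = "%P. small_singular n (d n) (z * sqrt (d n)) (eps n) P"
  define X1 where "X1 P = tau * sva n (d n) z tau P * (1 + (40 * D n powr (1/10) + ln (D n)))" for P
  define X2 where "X2 P = integral {tau..eta} (%t. sva n (d n) z t P)" for P
  have sva0: "sva n (d n) z t P > 0" if "t > 0" for t P by (rule res_mean_bounds(1)[OF n sv_nonneg that])
  have X1: "X1 P >= 0" for P unfolding X1_def using sva0[OF tau(1), of P] tau D1 by (intro mult_nonneg_nonneg add_nonneg_nonneg) auto
  have X2eq: "X2 P = svl n (d n) z eta P - svl n (d n) z tau P" for P
   unfolding X2_def by (rule log_mean_diff[OF n sv_nonneg, symmetric]) (use tau in auto)
  have X2: "X2 P >= 0" for P unfolding X2_def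
   by (rule integral_nonneg) (use tau sva0 in \<open>auto intro!: integrable_continuous_interval res_mean_continuous[OF n sv_nonneg] less_imp_le\<close>)
  have key: "of_bool (del < \<bar>log_pot n (d n) z P - disk_pot z\<bar>) <= (of_bool (?SS P) + of_bool (e < X1 P) + of_bool (e < X2 P) + of_bool (e < ?psi n P) + of_bool (del' < \<bar>svq n (d n) z eta P\<bar>) :: real)"
   if pi: "P : tuples n (d n)" for P
  proof -
   have "\<bar>log_pot n (d n) z P - disk_pot z\<bar> <= del"
    if ns: "~ ?SS P" and le: "X1 P <= e" "X2 P <= e" "?psi n P <= e" "\<bar>svq n (d n) z eta P\<bar> <= del'"
   proof -
    have svb: "b <= sv n (d n) z P i" if "i < n" for i unfolding b_def D_def by (rule sv_ge[OF pi dn ns that])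
    then have "sv n (d n) z P i > 0" if "i < n" for i using b that by (meson less_le_trans)
    then have zn: "z ~: set (eigs n (d n) P)" by (rule not_eig_if_sv_pos)
    note z0 = log_mean_zero_diff[where h = "sv n (d n) z P", OF n sv_nonneg tau(1,3) b svb, folded log_pot_sv(1)[OF zn]]
    have "svl n (d n) z tau P - log_pot n (d n) z P <= tau * sva n (d n) z tau P * (1 + ln (1 / b))" using z0(2) by simp
    also have "... <= X1 P" unfolding X1_def using lnb sva0[OF tau(1), of P] tau by (intro mult_left_mono) auto
    finally have 1: "svl n (d n) z tau P - log_pot n (d n) z P <= e" "0 <= svl n (d n) z tau P - log_pot n (d n) z P" using le z0(1) by auto
    have 2: "\<bar>pot_approx ?q (sva n (d n) z eta P) eta - disk_pot z\<bar> <= e" by (rule del'(2)[OF sva0[OF eta(1)] le(4)])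
    show ?thesis using 1 2 le X2[of P] X2eq[of P] e unfolding e_def by linarith
   qed
   then show ?thesis by (cases "?SS P"; cases "e < X1 P"; cases "e < X2 P"; cases "e < ?psi n P"; cases "del' < \<bar>svq n (d n) z eta P\<bar>") (auto simp: not_less)
  qed
  have "?f n <= avg n (d n) (%P. of_bool (?SS P) + of_bool (e < X1 P) + of_bool (e < X2 P) + of_bool (e < ?psi n P) + of_bool (del' < \<bar>svq n (d n) z eta P\<bar>))"
   by (rule avg_mono[OF key])
  also have "... = ?P1 n + avg n (d n) (%P. of_bool (e < X1 P)) + avg n (d n) (%P. of_bool (e < X2 P)) + avg n (d n) (%P. of_bool (e < ?psi n P)) + avg n (d n) (%P. of_bool (del' < \<bar>svq n (d n) z eta P\<bar>))"
   by (simp only: avg_add avg_of_bool)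
  also have "avg n (d n) (%P. of_bool (e < X1 P)) <= A n * K / e"
  proof -
   have "avg n (d n) (%P. of_bool (e < X1 P)) <= avg n (d n) X1 / e" using X1 e by (intro avg_markov) auto
   also have "avg n (d n) X1 = A n * avg n (d n) (%P. sva n (d n) z tau P)"
    unfolding avg_cmult[symmetric] X1_def A_def tau_def by (simp only: mult_ac)
   also have "... <= A n * K"
   proof (rule mult_left_mono)
    show "avg n (d n) (%P. sva n (d n) z tau P) <= K" using elim(3) tau unfolding tau_def D_def by simp
    show "0 <= A n" unfolding A_def using D1 by (intro mult_nonneg_nonneg add_nonneg_nonneg) auto
   qed
   finally show ?thesis using e by (simp add: divide_right_mono)
  qed
  also have "avg n (d n) (%P. of_bool (e < X2 P)) <= K * eta / e"
  proof -
   have "avg n (d n) (%P. of_bool (e < X2 P)) <= avg n (d n) X2 / e" using X2 e by (intro avg_markov) auto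
   also have "avg n (d n) X2 <= (eta - tau) * K" unfolding X2_def
   proof (rule avg_integral_le)
    show "continuous_on {tau..eta} (%t. sva n (d n) z t P)" for P by (rule res_mean_continuous[OF n sv_nonneg tau(1)])
    show "avg n (d n) (%P. sva n (d n) z t P) <= K" if "t : {tau..eta}" for t using elim(3) that eta unfolding tau_def D_def by auto
   qed (use tau in auto)
   also have "... <= K * eta" using K tau by (simp add: algebra_simps)
   finally show ?thesis using e by (simp add: divide_right_mono)
  qed
  also have "avg n (d n) (%P. of_bool (e < ?psi n P)) <= ?P4 n / e" using e by (intro avg_markov) auto
  also have "avg n (d n) (%P. of_bool (del' < \<bar>svq n (d n) z eta P\<bar>)) <= B n / del'"
  proof -
   have "avg n (d n) (%P. of_bool (del' < \<bar>svq n (d n) z eta P\<bar>)) <= avg n (d n) (%P. \<bar>svq n (d n) z eta P\<bar>) / del'"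
    using del' by (intro avg_markov) auto
   also have "... <= B n / del'" using elim(4) eta del' by (intro divide_right_mono) auto
   finally show ?thesis .
  qed
  finally have "?f n < r" using elim(1) etaK by linarith
  moreover have "?f n >= 0" by (rule avg_nonneg) simp
  ultimately show ?case by simp
 qed
 then show "EX no. ALL n>=no. norm (?f n - 0) < r" unfolding eventually_sequentially .
qed

end

section \<open>Circular means and weak convergence\<close>

definition unit_ivl :: "real measure" where
 "unit_ivl = restrict_space lborel {0..1}"

definition circ :: "complex measure" where
 "circ = distr unit_ivl borel (%t. exp (2 * of_real pi * \<i> * of_real t))"

lemma circ_map_measurable [measurable]: "(%t. exp (2 * of_real pi * \<i> * of_real t)) : unit_ivl \<rightarrow>\<^sub>M (borel :: complex measure)"
 unfolding unit_ivl_def by (intro measurable_restrict_space1 borel_measurable_continuous_onI continuous_intros) auto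

lemma space_circ [simp]: "space circ = UNIV" and sets_circ [simp, measurable_cong]: "sets circ = sets borel"
 by (simp_all add: circ_def)

lemma prob_space_circ: "prob_space circ"
 unfolding circ_def
proof (rule prob_space.prob_space_distr[OF _ circ_map_measurable])
 show "prob_space unit_ivl"
  by (rule prob_spaceI) (simp add: unit_ivl_def space_restrict_space emeasure_restrict_space)
qed

interpretation circ: prob_space circ by (rule prob_space_circ)

lemma prob_circ_UNIV [simp]: "measure circ UNIV = 1"
 using circ.prob_space by simp

lemma integral_circ:
 fixes f :: "complex => real"
 assumes "continuous_on (sphere 0 1) f" "f : borel_measurable borel"
 shows "integral\<^sup>L circ f = integral {0..1} (%t. f (exp (2 * of_real pi * \<i> * of_real t)))"
proof -
 let ?e = "%t::real. exp (2 * of_real pi * \<i> * of_real t) :: complex"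
 have "integral\<^sup>L circ f = integral\<^sup>L unit_ivl (%t. f (?e t))" unfolding circ_def by (rule integral_distr) (use assms in auto)
 also have "... = set_lebesgue_integral lborel {0..1} (%t. f (?e t))"
  unfolding unit_ivl_def set_lebesgue_integral_def by (rule integral_restrict_space) auto
 also have "... = integral {0..1} (%t. f (?e t))"
 proof (rule set_borel_integral_eq_integral(2))
  have "continuous_on {0..1} (%t. f (?e t))"
   by (rule continuous_on_compose2[OF assms(1)]) (auto intro!: continuous_intros simp: norm_exp_eq_Re)
  then show "set_integrable lborel {0..1} (%t. f (?e t))" by (rule borel_integrable_atLeastAtMost')
 qed
 finally show ?thesis .
qed

lemma circ_mean_value:
 assumes F: "F holomorphic_on cball 0 1" and m: "(%u. Re (F u)) : borel_measurable borel"
 shows "(\<integral>u. Re (F u) \<partial>circ) = Re (F 0)"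
proof -
 let ?e = "%t::real. exp (2 * of_real pi * \<i> * of_real t) :: complex"
 have "((%u. F u / (u - 0)) has_contour_integral (2 * of_real pi * \<i> * F 0)) (circlepath 0 1)"
  by (rule Cauchy_integral_circlepath_simple[OF F]) simp
 then have "((%t. F (circlepath 0 1 t) / (circlepath 0 1 t) * vector_derivative (circlepath 0 1) (at t within {0..1})) has_integral (2 * of_real pi * \<i> * F 0)) {0..1}"
  unfolding has_contour_integral_def by simp
 then have "((%t. (2 * of_real pi * \<i>) * F (?e t)) has_integral (2 * of_real pi * \<i> * F 0)) {0..1}"
 proof (rule has_integral_eq[rotated])
  fix t :: real assume "t : {0..1}"
  then have "vector_derivative (circlepath 0 1) (at t within {0..1}) = 2 * pi * \<i> * ?e t"
   using vector_derivative_circlepath01[of t 0 1] by (simp add: mult_ac)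
  moreover have "circlepath 0 1 t = ?e t" by (simp add: circlepath)
  ultimately show "F (circlepath 0 1 t) / circlepath 0 1 t * vector_derivative (circlepath 0 1) (at t within {0..1}) = (2 * of_real pi * \<i>) * F (?e t)"
   by simp
 qed
 from has_integral_mult_right[OF this, of "1 / (2 * of_real pi * \<i>)"]
 have "((%t. F (?e t)) has_integral F 0) {0..1}" by (simp add: field_simps)
 from has_integral_linear[OF this bounded_linear_Re] have "((%t. Re (F (?e t))) has_integral Re (F 0)) {0..1}" by (simp add: o_def)
 moreover have "continuous_on (sphere 0 1) (%u. Re (F u))"
  by (intro continuous_intros continuous_on_subset[OF holomorphic_on_imp_continuous_on[OF F]]) auto
 ultimately show ?thesis using integral_circ[OF _ m] by (simp add: integral_unique)
qed

lemma AE_circ_norm: "AE u in circ. cmod u = 1"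
 unfolding circ_def by (subst AE_distr_iff) (auto simp: norm_exp_eq_Re)

lemma AE_circ_not_countable:
 assumes "countable F"
 shows "AE u in circ. u ~: F"
proof -
 let ?e = "%t::real. exp (2 * of_real pi * \<i> * of_real t) :: complex"
 have cp: "countable {t. ?e t = p}" for p
 proof (cases "EX s. ?e s = p")
  case True
  then obtain s where s: "?e s = p" by blast
  have "{t. ?e t = p} <= range (%k::int. s + of_int k)"
  proof
   fix t assume "t : {t. ?e t = p}"
   then have "?e t = ?e s" using s by simp
   then obtain k :: int where "2 * of_real pi * \<i> * of_real t = 2 * of_real pi * \<i> * of_real s + complex_of_real (real_of_int (2 * k) * pi) * \<i>"
    unfolding exp_eq by blast
   then have "2 * pi * t = 2 * pi * s + real_of_int (2 * k) * pi" by (auto simp: complex_eq_iff)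
   then have "pi * t = pi * (s + of_int k)" by (simp add: algebra_simps)
   then have "t = s + of_int k" by simp
   then show "t : range (%k::int. s + of_int k)" by blast
  qed
  then show ?thesis by (rule countable_subset) auto
 qed auto
 have c: "countable {t. ?e t : F}"
 proof -
  have "{t. ?e t : F} = (UN p:F. {t. ?e t = p})" by auto
  then show ?thesis using assms cp by auto
 qed
 have "AE t in lborel. ?e t ~: F"
  by (rule AE_I'[of "{t. ?e t : F}"]) (use c in \<open>auto intro: countable_imp_null_set_lborel\<close>)
 then have "AE t in unit_ivl. ?e t ~: F" unfolding unit_ivl_def by (subst AE_restrict_space_iff) auto
 moreover have "{u : space borel. u ~: F} : sets borel"
 proof -
  have "F : sets borel" using assms by (simp add: sets.countable)
  moreover have "{u : space borel. u ~: F} = - F" by auto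
  ultimately show ?thesis by (simp add: borel_comp)
 qed
 ultimately show ?thesis unfolding circ_def by (subst AE_distr_iff) auto
qed

text \<open>Multiply by \<open>cnj u\<close>, of modulus 1, and conjugate. This exchanges centre and
  radius, so the case \<open>cmod c < r\<close> of the circular mean becomes one without a zero
  inside the disk.\<close>

lemma cmod_add_circle: "cmod u = 1 ==> cmod (c + of_real r * u) = cmod (of_real r + cnj c * u)"
proof -
 assume u: "cmod u = 1"
 have "cmod (c + of_real r * u) = cmod (cnj u * (c + of_real r * u))" using u by (simp add: norm_mult)
 also have "cnj u * (c + of_real r * u) = cnj (of_real r + cnj c * u)"
  using u complex_norm_square[of u] by (simp add: algebra_simps)
 finally show ?thesis by (simp only: complex_mod_cnj)
qed

text \<open>Mean value property: \<open>Ln (1 + mu * u)\<close> is holomorphic on the closed disk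
  and vanishes at the centre.\<close>

lemma circ_log_lt:
 assumes "cmod mu < 1"
 shows "integrable circ (%u. ln (cmod (1 + mu * u)))" "(\<integral>u. ln (cmod (1 + mu * u)) \<partial>circ) = 0"
proof -
 have nz: "1 + mu * w ~: \<real>\<^sub>\<le>\<^sub>0" if "w : cball 0 1" for w
 proof -
  have "cmod (mu * w) <= cmod mu * 1" unfolding norm_mult using that by (intro mult_left_mono) auto
  then have "\<bar>Re (mu * w)\<bar> < 1" using assms abs_Re_le_cmod[of "mu * w"] by linarith
  then have "Re (1 + mu * w) > 0" by simp
  then show ?thesis by (simp add: complex_nonpos_Reals_iff)
 qed
 have F: "(%w. Ln (1 + mu * w)) holomorphic_on cball 0 1" using nz by (intro holomorphic_intros) auto
 have eq: "AE u in circ. Re (Ln (1 + mu * u)) = ln (cmod (1 + mu * u))"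
  using AE_circ_norm
 proof eventually_elim
  case (elim u)
  then have "1 + mu * u ~= 0" using nz[of u] by auto
  then show ?case by (rule Re_Ln)
 qed
 have m: "(%u. Re (Ln (1 + mu * u))) : borel_measurable borel" by measurable
 have "(\<integral>u. ln (cmod (1 + mu * u)) \<partial>circ) = (\<integral>u. Re (Ln (1 + mu * u)) \<partial>circ)"
  by (rule integral_cong_AE) (use eq in auto)
 also have "... = 0" using circ_mean_value[OF F m] by simp
 finally show "(\<integral>u. ln (cmod (1 + mu * u)) \<partial>circ) = 0" .
 show "integrable circ (%u. ln (cmod (1 + mu * u)))"
 proof (rule circ.integrable_const_bound)
  show "AE u in circ. norm (ln (cmod (1 + mu * u))) <= max (ln 2) (- ln (1 - cmod mu))"
   using AE_circ_norm
  proof eventually_elim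
   case (elim u)
   have "1 - cmod mu <= cmod (1 + mu * u)" using norm_diff_ineq[of 1 "mu * u"] elim by (simp add: norm_mult)
   moreover have "cmod (1 + mu * u) <= 2" using norm_triangle_ineq[of 1 "mu * u"] elim assms by (simp add: norm_mult)
   ultimately have "ln (1 - cmod mu) <= ln (cmod (1 + mu * u))" "ln (cmod (1 + mu * u)) <= ln 2"
    using assms by (auto intro!: ln_mono)
   then show ?case by auto
  qed
 qed auto
qed

text \<open>Now the singularity lies on the circle. Shrinking \<open>mu\<close> by
  \<open>s k < 1\<close> gives the previous case, and
  \<open>cmod (1 + mu * u) <= 2 * cmod (1 + s k * mu * u)\<close> keeps the approximants between
  \<open>f - ln 2\<close> and \<open>ln 2\<close>. Fatou's lemma yields integrability of
  \<open>f\<close>, after which dominated convergence applies.\<close>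

lemma circ_log_eq:
 assumes mu: "cmod mu = 1"
 shows "integrable circ (%u. ln (cmod (1 + mu * u)))" "(\<integral>u. ln (cmod (1 + mu * u)) \<partial>circ) = 0"
proof -
 define s where "s k = 1 - 1 / real (k + 2)" for k :: nat
 have s: "0 < s k" "s k < 1" for k unfolding s_def by (auto simp: field_simps)
 have slim: "s \<longlonglongrightarrow> 1" unfolding s_def by real_asymp
 define f where "f u = ln (cmod (1 + mu * u))" for u
 define g where "g k u = ln (cmod (1 + (of_real (s k) * mu) * u))" for k u
 have gi: "integrable circ (g k)" "integral\<^sup>L circ (g k) = 0" for k
  unfolding g_def using circ_log_lt[of "of_real (s k) * mu"] s[of k] mu by (auto simp: norm_mult)
 have nz: "AE u in circ. 1 + mu * u ~= 0"
 proof -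
  have "mu ~= 0" using mu by auto
  then have "(1 + mu * u = 0) = (u = - 1 / mu)" for u by (auto simp: field_simps add_eq_0_iff)
  then show ?thesis using AE_circ_not_countable[of "{- 1 / mu}"] by simp
 qed
 have pt: "g k u <= ln 2" "f u - ln 2 <= g k u" if "cmod u = 1" "1 + mu * u ~= 0" for k u
 proof -
  have n1: "cmod (mu * u) = 1" using that mu by (simp add: norm_mult)
  have lo: "1 - s k <= cmod (1 + (of_real (s k) * mu) * u)"
   using norm_diff_ineq[of 1 "(of_real (s k) * mu) * u"] n1 s[of k] by (simp add: norm_mult mult.assoc)
  have "cmod (1 + mu * u) <= cmod (1 + (of_real (s k) * mu) * u) + cmod (of_real (1 - s k) * (mu * u))"
   by (rule order_trans[OF _ norm_triangle_ineq]) (simp add: algebra_simps)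
  also have "cmod (of_real (1 - s k) * (mu * u)) = 1 - s k" unfolding norm_mult[of _ "mu * u"] n1 norm_of_real using s[of k] by simp
  finally have "cmod (1 + mu * u) <= 2 * cmod (1 + (of_real (s k) * mu) * u)" using lo by simp
  then have "ln (cmod (1 + mu * u)) <= ln (2 * cmod (1 + (of_real (s k) * mu) * u))" using that by (intro ln_mono) auto
  also have "... = ln 2 + g k u" unfolding g_def using lo s[of k] by (subst ln_mult_pos) auto
  finally show "f u - ln 2 <= g k u" unfolding f_def by simp
  have "cmod (1 + (of_real (s k) * mu) * u) <= 2"
   using norm_triangle_ineq[of 1 "(of_real (s k) * mu) * u"] n1 s[of k] by (simp add: norm_mult mult.assoc)
  then show "g k u <= ln 2" unfolding g_def using lo s[of k] by (intro ln_mono) auto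
 qed
 have lim: "AE u in circ. (%k. g k u) \<longlonglongrightarrow> f u"
  using nz
 proof eventually_elim
  case (elim u)
  have "(%k. ln (cmod (1 + (of_real (s k) * mu) * u))) \<longlonglongrightarrow> ln (cmod (1 + (of_real 1 * mu) * u))"
   by (intro tendsto_intros slim) (use elim in auto)
  then show ?case unfolding g_def f_def by simp
 qed
 have fm: "f : borel_measurable circ" "g k : borel_measurable circ" for k unfolding f_def g_def by measurable
 have "(\<integral>\<^sup>+u. ennreal (ln 2 - f u) \<partial>circ) <= (\<integral>\<^sup>+u. liminf (%k. ennreal (ln 2 - g k u)) \<partial>circ)"
 proof (rule nn_integral_mono_AE)
  show "AE u in circ. ennreal (ln 2 - f u) <= liminf (%k. ennreal (ln 2 - g k u))"
   using lim
  proof eventually_elim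
   case (elim u)
   have "(%k. ennreal (ln 2 - g k u)) \<longlonglongrightarrow> ennreal (ln 2 - f u)" by (intro tendsto_intros tendsto_ennrealI elim)
   then show ?case by (simp add: lim_imp_Liminf)
  qed
 qed
 also have "... <= liminf (%k. \<integral>\<^sup>+u. ennreal (ln 2 - g k u) \<partial>circ)" by (rule nn_integral_liminf) (use fm in measurable)
 also have "(%k. \<integral>\<^sup>+u. ennreal (ln 2 - g k u) \<partial>circ) = (%k. ennreal (ln 2))"
 proof
  fix k
  have "(\<integral>\<^sup>+u. ennreal (ln 2 - g k u) \<partial>circ) = ennreal (\<integral>u. ln 2 - g k u \<partial>circ)"
  proof (rule nn_integral_eq_integral)
   show "AE u in circ. 0 <= ln 2 - g k u" using AE_circ_norm nz by eventually_elim (use pt in auto)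
  qed (use gi in auto)
  then show "(\<integral>\<^sup>+u. ennreal (ln 2 - g k u) \<partial>circ) = ennreal (ln 2)" using gi by simp
 qed
 finally have fin: "(\<integral>\<^sup>+u. ennreal (ln 2 - f u) \<partial>circ) < \<infinity>" using Liminf_const[of sequentially "ennreal (ln 2)"] by (simp add: le_less_trans[OF _ ennreal_less_top])
 have f2: "AE u in circ. f u <= ln 2"
  using AE_circ_norm
 proof eventually_elim
  case (elim u)
  have "cmod (1 + mu * u) <= 2" using norm_triangle_ineq[of 1 "mu * u"] elim mu by (simp add: norm_mult)
  then show ?case unfolding f_def by (cases "cmod (1 + mu * u) = 0") (auto intro: ln_mono)
 qed
 have if2: "integrable circ (%u. ln 2 - f u)"
 proof (rule integrableI_nonneg)
  show "AE u in circ. 0 <= ln 2 - f u" using f2 by eventually_elim simp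
 qed (use fin fm in auto)
 have "integrable circ (%u. ln 2 - (ln 2 - f u))" by (intro Bochner_Integration.integrable_diff if2) auto
 then have fi: "integrable circ f" by simp
 then show "integrable circ (%u. ln (cmod (1 + mu * u)))" unfolding f_def .
 have "(%k. integral\<^sup>L circ (g k)) \<longlonglongrightarrow> integral\<^sup>L circ f"
 proof (rule integral_dominated_convergence[where w = "%u. 2 * ln 2 + (ln 2 - f u)"])
  show "AE u in circ. norm (g k u) <= 2 * ln 2 + (ln 2 - f u)" for k
   using AE_circ_norm nz f2
  proof eventually_elim
   case (elim u)
   show ?case using pt[OF elim(1,2), of k] elim(3) ln_gt_zero[of "2::real"] unfolding real_norm_def by linarith
  qed
 qed (use lim fm Bochner_Integration.integrable_add[OF _ if2, of "%_. 2 * ln 2"] in auto)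
 then show "(\<integral>u. ln (cmod (1 + mu * u)) \<partial>circ) = 0" unfolding gi f_def[abs_def, symmetric] by (simp add: LIMSEQ_const_iff)
qed

lemma circ_log:
 assumes r: "r > 0"
 shows "integrable circ (%u. ln (cmod (c + of_real r * u)))" "(\<integral>u. ln (cmod (c + of_real r * u)) \<partial>circ) = ln (max r (cmod c))"
proof -
 have base: "integrable circ (%u. ln (cmod (1 + mu * u)))" "(\<integral>u. ln (cmod (1 + mu * u)) \<partial>circ) = 0" if "cmod mu <= 1" for mu
  using circ_log_lt[of mu] circ_log_eq[of mu] that by (cases "cmod mu = 1"; simp)+
 have nzAE: "AE u in circ. c + of_real r * u ~= 0"
 proof -
  have "(c + of_real r * u = 0) = (u = - c / of_real r)" for u using r by (auto simp: field_simps add_eq_0_iff)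
  then show ?thesis using AE_circ_not_countable[of "{- c / of_real r}"] by simp
 qed
 obtain m mu where m: "m > 0" "m = max r (cmod c)" and mu: "cmod mu <= 1"
  and eq: "!!u. cmod u = 1 ==> cmod (c + of_real r * u) = m * cmod (1 + mu * u)"
 proof (cases "r <= cmod c")
  case True
  show thesis
  proof (rule that[of "cmod c" "of_real r / c"])
   fix u :: complex assume "cmod u = 1"
   have "c ~= 0" using True r by auto
   then have "c + of_real r * u = c * (1 + of_real r / c * u)" by (simp add: field_simps)
   then show "cmod (c + of_real r * u) = cmod c * cmod (1 + of_real r / c * u)" by (metis norm_mult)
  qed (use True r in \<open>auto simp: norm_divide divide_le_eq\<close>)
 next
  case False
  show thesis
  proof (rule that[of r "cnj c / of_real r"])
   fix u :: complex assume u: "cmod u = 1"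
   have "of_real r + cnj c * u = of_real r * (1 + cnj c / of_real r * u)" using r by (simp add: field_simps)
   then show "cmod (c + of_real r * u) = r * cmod (1 + cnj c / of_real r * u)" unfolding cmod_add_circle[OF u] using r by (simp add: norm_mult)
  qed (use False r in \<open>auto simp: norm_divide\<close>)
 qed
 have AEeq: "AE u in circ. ln m + ln (cmod (1 + mu * u)) = ln (cmod (c + of_real r * u))"
  using AE_circ_norm nzAE
 proof eventually_elim
  case (elim u)
  then have "cmod (1 + mu * u) ~= 0" using eq[of u] m by auto
  then show ?case unfolding eq[OF elim(1)] using m by (simp add: ln_mult_pos)
 qed
 have i: "integrable circ (%u. ln m + ln (cmod (1 + mu * u)))" by (intro Bochner_Integration.integrable_add base mu) auto
 show "integrable circ (%u. ln (cmod (c + of_real r * u)))"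
  by (rule integrable_cong_AE_imp[OF i]) (use AEeq in auto)
 have "(\<integral>u. ln (cmod (c + of_real r * u)) \<partial>circ) = (\<integral>u. ln m + ln (cmod (1 + mu * u)) \<partial>circ)"
  by (rule integral_cong_AE) (use AEeq in auto)
 also have "... = ln m" using base[OF mu] by (subst Bochner_Integration.integral_add) auto
 finally show "(\<integral>u. ln (cmod (c + of_real r * u)) \<partial>circ) = ln (max r (cmod c))" using m by simp
qed

text \<open>Truncation at \<open>rho\<close> is a circular mean of radius \<open>rho\<close>, and the two means commute.\<close>
lemma circ_log_truncated_le:
 assumes r: "r > 0" and rho: "rho > 0"
 shows "integrable circ (%u. ln (max rho (cmod (c + of_real r * u))))"
  "(\<integral>u. ln (max rho (cmod (c + of_real r * u))) \<partial>circ) <= ln (max r (cmod c)) + rho / r"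
proof -
 let ?g = "%u. ln (max rho (cmod (c + of_real r * u)))" and ?h = "%v. ln (max r (cmod (c + of_real rho * v)))"
 define K where "K = ln (1 + cmod c + r + rho)"
 have bd: "cmod (c + of_real r * u + of_real rho * v) <= cmod c + r + rho" if "cmod u = 1" "cmod v = 1" for u v
  by (intro order_trans[OF norm_triangle_ineq] add_mono) (use that r rho in \<open>auto simp: norm_mult\<close>)
 have K0: "K >= 0" unfolding K_def using r rho by (simp add: add_nonneg_nonneg)
 interpret P: pair_prob_space circ circ ..
 \<comment> \<open>The constant \<open>K\<close> dominates the logarithm over both circles, so
   \<open>f\<close> is nonnegative almost everywhere; this gives integrability on the product from
   the iterated integrals.\<close>
 define f where "f u v = K - ln (cmod (c + of_real r * u + of_real rho * v))" for u v
 have fm: "case_prod f : borel_measurable (circ \<Otimes>\<^sub>M circ)" unfolding f_def by measurable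
 have f0: "f u v >= 0" if "cmod u = 1" "cmod v = 1" for u v
 proof (cases "cmod (c + of_real r * u + of_real rho * v) = 0")
  case False
  then have "ln (cmod (c + of_real r * u + of_real rho * v)) <= K" unfolding K_def using bd[OF that] by (intro ln_mono) auto
  then show ?thesis unfolding f_def by simp
 qed (use K0 in \<open>simp add: f_def\<close>)
 have iv: "integrable circ (f u)" "integral\<^sup>L circ (f u) = K - ?g u" for u
 proof -
  show "integrable circ (f u)" unfolding f_def by (intro Bochner_Integration.integrable_diff circ_log[OF rho]) auto
  show "integral\<^sup>L circ (f u) = K - ?g u"
   unfolding f_def using circ_log[OF rho, of "c + of_real r * u"] by (subst Bochner_Integration.integral_diff) (auto simp: circ.prob_space)
 qed
 have iu: "integral\<^sup>L circ (%u. f u v) = K - ?h v" for v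
 proof -
  have e: "f u v = K - ln (cmod ((c + of_real rho * v) + of_real r * u))" for u unfolding f_def by (simp add: algebra_simps)
  show ?thesis unfolding e using circ_log[OF r, of "c + of_real rho * v"] by (subst Bochner_Integration.integral_diff) (auto simp: circ.prob_space)
 qed
 have trunc_int: "integrable circ (%u. ln (max rho (cmod (c + of_real r * u))))" if "r > 0" "rho > 0" for r rho
 proof (rule circ.integrable_const_bound)
  show "AE u in circ. norm (ln (max rho (cmod (c + of_real r * u)))) <= max \<bar>ln rho\<bar> \<bar>ln (max rho (cmod c + r))\<bar>"
   using AE_circ_norm
  proof eventually_elim
   case (elim u)
   have "cmod (c + of_real r * u) <= cmod c + r" using norm_triangle_ineq[of c "of_real r * u"] elim that by (simp add: norm_mult)
   then have "ln rho <= ln (max rho (cmod (c + of_real r * u)))" "ln (max rho (cmod (c + of_real r * u))) <= ln (max rho (cmod c + r))"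
    using that by (auto intro!: ln_mono)
   then show ?case unfolding real_norm_def by linarith
  qed
 qed auto
 show ti: "integrable circ (%u. ?g u)" by (rule trunc_int[OF r rho])
 have "integrable (circ \<Otimes>\<^sub>M circ) (case_prod f)"
 proof (rule P.Fubini_integrable[OF fm])
  have "AE u in circ. integral\<^sup>L circ (f u) = (\<integral>v. norm (case_prod f (u, v)) \<partial>circ)"
   using AE_circ_norm
  proof eventually_elim
   case (elim u)
   show ?case
   proof (rule integral_cong_AE)
    show "AE v in circ. f u v = norm (case_prod f (u, v))" using AE_circ_norm by eventually_elim (use f0 elim in auto)
   qed (use fm in auto)
  qed
  then have ae: "AE u in circ. K - ?g u = (\<integral>v. norm (case_prod f (u, v)) \<partial>circ)" unfolding iv .
  show "integrable circ (%u. \<integral>v. norm (case_prod f (u, v)) \<partial>circ)"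
  proof (rule integrable_cong_AE_imp[OF _ _ ae])
   show "integrable circ (%u. K - ?g u)" using ti by auto
   show "(%u. \<integral>v. norm (case_prod f (u, v)) \<partial>circ) : borel_measurable circ" using fm by measurable
  qed
 qed (use iv in auto)
 then have "(\<integral>v. (\<integral>u. f u v \<partial>circ) \<partial>circ) = (\<integral>u. (\<integral>v. f u v \<partial>circ) \<partial>circ)" by (rule P.Fubini_integral)
 then have "(\<integral>v. K - ?h v \<partial>circ) = (\<integral>u. K - ?g u \<partial>circ)"
  unfolding iu iv .
 then have sw: "(\<integral>u. ?g u \<partial>circ) = (\<integral>v. ?h v \<partial>circ)"
  using ti trunc_int[OF rho r] by (simp add: circ.prob_space)
 also have "... <= (\<integral>v. ln (max r (cmod c)) + rho / r \<partial>circ)"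
 proof (rule integral_mono_AE)
  show "AE v in circ. ?h v <= ln (max r (cmod c)) + rho / r"
   using AE_circ_norm
  proof eventually_elim
   case (elim v)
   define m where "m = max r (cmod c)"
   have m: "m >= r" "m > 0" unfolding m_def using r by auto
   have "cmod (c + of_real rho * v) <= cmod c + rho" using norm_triangle_ineq[of c "of_real rho * v"] elim rho by (simp add: norm_mult)
   then have "max r (cmod (c + of_real rho * v)) <= m + rho" unfolding m_def using rho by auto
   then have "?h v <= ln (m + rho)" using r by (intro ln_mono) auto
   also have "m + rho = m * (1 + rho / m)" using m by (simp add: field_simps)
   also have "ln ... = ln m + ln (1 + rho / m)" using m rho by (intro ln_mult_pos) (auto simp: add_pos_pos)
   also have "ln (1 + rho / m) <= rho / m" using m rho by (intro ln_add_one_self_le_self) auto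
   also have "rho / m <= rho / r" using m r rho by (intro divide_left_mono) auto
   finally show ?case unfolding m_def by simp
  qed
 qed (use trunc_int[OF rho r] in auto)
 also have "... = ln (max r (cmod c)) + rho / r" by (simp add: circ.prob_space)
 finally show "(\<integral>u. ?g u \<partial>circ) <= ln (max r (cmod c)) + rho / r" .
qed

section \<open>Eigenvalue averages and circular means of the potential\<close>

definition eig_mean :: "nat => nat => (complex => real) => perms => real" where
 "eig_mean n d f P = (SUM i<n. f (eigs n d P ! i)) / n"

lemma eig_mean_sum_list: "eig_mean n d f P = (\<Sum>a\<leftarrow>eigs n d P. f a) / n"
 unfolding eig_mean_def by (simp add: sum_list_sum_nth eigs(2) lessThan_atLeast0)

lemma eig_mean_mono: "(!!a. a : set (eigs n d P) ==> f a <= g a) ==> eig_mean n d f P <= eig_mean n d g P"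
 unfolding eig_mean_def by (intro divide_right_mono sum_mono) (auto simp: eigs(2))

lemma eig_mean_const: "n > 0 ==> eig_mean n d (%_. c) P = c"
 unfolding eig_mean_def by simp

lemma eig_mean_diff: "eig_mean n d (%a. f a - g a) P = eig_mean n d f P - eig_mean n d g P"
 unfolding eig_mean_def by (simp add: sum_subtractf diff_divide_distrib)

lemma eig_mean_cmult: "eig_mean n d (%a. c * f a) P = c * eig_mean n d f P"
 unfolding eig_mean_def by (simp add: sum_distrib_left)

lemma eig_mean_abs_le: "\<bar>eig_mean n d f P\<bar> <= eig_mean n d (%a. \<bar>f a\<bar>) P"
 unfolding eig_mean_def by (simp add: divide_right_mono)

lemma log_pot_eq: "log_pot n d z P = eig_mean n d (%a. ln (cmod (z - a))) P"
 unfolding log_pot_def eig_mean_sum_list ..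

lemma integral_eig_mean:
 assumes "!!a. integrable M (%u. f u a)"
 shows "integrable M (%u. eig_mean n d (f u) P)" "(\<integral>u. eig_mean n d (f u) P \<partial>M) = eig_mean n d (%a. \<integral>u. f u a \<partial>M) P"
 unfolding eig_mean_def using assms by auto

lemma integral_avg:
 assumes "!!P. integrable M (%u. f u P)"
 shows "integrable M (%u. avg n d (f u))" "(\<integral>u. avg n d (f u) \<partial>M) = avg n d (%P. \<integral>u. f u P \<partial>M)"
 unfolding avg_def using assms by auto

lemma eig_mean_measurable [measurable (raw)]:
 assumes "!!a. (%u. f u a) : borel_measurable M"
 shows "(%u. eig_mean n d (f u) P) : borel_measurable M"
 unfolding eig_mean_def using assms by measurable

lemma avg_measurable [measurable (raw)]:
 assumes "!!P. (%u. f u P) : borel_measurable M"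
 shows "(%u. avg n d (f u)) : borel_measurable M"
 unfolding avg_def using assms by measurable

lemma disk_pot_continuous: "continuous_on UNIV disk_pot"
proof -
 have e: "disk_pot z = ((min (cmod z) 1)^2 - 1) / 2 + ln (max (cmod z) 1)" for z
  unfolding disk_pot_def by (auto simp: min_def max_def)
 show ?thesis unfolding e[abs_def] by (intro continuous_intros) auto
qed

lemma disk_pot_measurable [measurable]: "disk_pot : borel_measurable borel"
 by (rule borel_measurable_continuous_onI[OF disk_pot_continuous])

lemma disk_pot_bound: "\<bar>disk_pot z\<bar> <= 1 + cmod z"
proof (cases "cmod z <= 1")
 case True
 then have c1: "(cmod z)^2 <= 1" by (simp add: power_le_one)
 have aux: "\<bar>(x - 1) / 2\<bar> <= 1 + y" if "0 <= x" "x <= 1" "0 <= y" for x y :: real using that by (simp add: abs_le_iff)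
 have "\<bar>((cmod z)^2 - 1) / 2\<bar> <= 1 + cmod z" by (rule aux[OF zero_le_power2 c1 norm_ge_zero])
 then show ?thesis unfolding disk_pot_def using True by simp
next
 case False
 then show ?thesis unfolding disk_pot_def using ln_bound[of "cmod z"] by force
qed

definition circ_mean :: "(complex => real) => complex => real => real" where
 "circ_mean f w r = (\<integral>u. f (w + of_real r * u) \<partial>circ)"

lemma AE_circ_disk_pot: "r > 0 ==> AE u in circ. \<bar>disk_pot (w + of_real r * u)\<bar> <= 1 + cmod w + r"
 using AE_circ_norm
proof eventually_elim
 case (elim u)
 have "cmod (w + of_real r * u) <= cmod w + r" using norm_triangle_ineq[of w "of_real r * u"] elim by (simp add: norm_mult)
 then show ?case using disk_pot_bound[of "w + of_real r * u"] by simp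
qed

lemma disk_pot_integrable: "r > 0 ==> integrable circ (%u. disk_pot (w + of_real r * u))"
 by (rule circ.integrable_const_bound[where B = "1 + cmod w + r"]) (use AE_circ_disk_pot in auto)

lemma circ_mean_disk_pot_bound: "r > 0 ==> \<bar>circ_mean disk_pot w r\<bar> <= 1 + cmod w + r"
proof -
 assume r: "r > 0"
 have "\<bar>circ_mean disk_pot w r\<bar> <= (\<integral>u. \<bar>disk_pot (w + of_real r * u)\<bar> \<partial>circ)" unfolding circ_mean_def by (rule integral_abs_bound)
 also have "... <= (\<integral>u. 1 + cmod w + r \<partial>circ)"
  by (rule integral_mono_AE) (use disk_pot_integrable[OF r] AE_circ_disk_pot[OF r] in auto)
 finally show ?thesis by simp
qed

context
 fixes d :: "nat => nat" and C :: real
 assumes dinf: "filterlim d at_top at_top"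
  and up: "eventually (%n. real (d n) <= C * real n) at_top" and C: "C >= 1"
  and lnn: "eventually (%n. ln (real n) <= real (d n) powr (1/11)) at_top"
begin

lemma le_one_plus_square: "y <= 1 + y^2" for y :: real
proof -
 have "0 <= (y - 1)^2" "0 <= y^2" by auto
 moreover have "(y - 1)^2 = y^2 - 2 * y + 1" by (simp add: power2_diff)
 ultimately show ?thesis by linarith
qed

text \<open>The first factor discards the junk value \<open>ln 0 = 0\<close> at the eigenvalues; truncation keeps the last term bounded.\<close>
definition pot_excess :: "real => nat => complex => perms => real" where
 "pot_excess rho n z P = of_bool (z ~: set (eigs n (d n) P)) *
  (max 0 (log_pot n (d n) z P - disk_pot z) + max 0 (disk_pot z - eig_mean n (d n) (%a. ln (max rho (cmod (z - a)))) P))"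

lemma pot_excess_nonneg: "pot_excess rho n z P >= 0"
 unfolding pot_excess_def by (intro mult_nonneg_nonneg add_nonneg_nonneg) auto

lemma pot_excess_le:
 assumes "rho > 0"
 shows "pot_excess rho n z P <= \<bar>log_pot n (d n) z P - disk_pot z\<bar>"
proof (cases "z : set (eigs n (d n) P)")
 case False
 have "log_pot n (d n) z P <= eig_mean n (d n) (%a. ln (max rho (cmod (z - a)))) P"
  unfolding log_pot_eq using False assms by (intro eig_mean_mono ln_mono) auto
 then show ?thesis unfolding pot_excess_def using False by (auto simp: max_def)
qed (simp add: pot_excess_def)

text \<open>The upper part is controlled by \<open>log_pot_upper\<close>, and the lower part is
  bounded because the truncated logarithm is at least \<open>ln rho\<close>. Together they give the
  second moment with which convergence in probability becomes convergence in mean.\<close>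

lemma pot_excess_sq:
 fixes B :: real
 assumes rho: "0 < rho" and n: "n > 0" "d n > 0" and B: "2 * \<bar>disk_pot z\<bar> + \<bar>ln rho\<bar> <= B"
 shows "(pot_excess rho n z P)^2 <= 4 * frob n (d n) P + (4 * (cmod z)^2 + 2 * B^2)"
proof (cases "z : set (eigs n (d n) P)")
 case True
 then show ?thesis unfolding pot_excess_def using frob_nonneg[of n "d n" P] by (simp add: add_nonneg_nonneg)
next
 case False
 let ?V = "max 0 (log_pot n (d n) z P)"
 have "eig_mean n (d n) (%a. ln rho) P <= eig_mean n (d n) (%a. ln (max rho (cmod (z - a)))) P"
  using rho by (intro eig_mean_mono ln_mono) auto
 then have "ln rho <= eig_mean n (d n) (%a. ln (max rho (cmod (z - a)))) P" using n by (simp add: eig_mean_const)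
 then have "pot_excess rho n z P <= ?V + B" unfolding pot_excess_def using False B by (auto simp: max_def abs_if split: if_splits)
 then have "(pot_excess rho n z P)^2 <= (?V + B)^2" using pot_excess_nonneg by (intro power_mono) auto
 also have "... <= 2 * ?V^2 + 2 * B^2" using sum_squares_bound[of ?V B] by (simp add: power2_sum)
 also have "?V^2 <= 2 * (frob n (d n) P + (cmod z)^2)" by (rule log_pot_upper[OF False n])
 finally show ?thesis by simp
qed

text \<open>Values up to \<open>r / 2\<close> are harmless; for the others use Cauchy-Schwarz
  between the bounded second moment and the probability, which tends to 0 by
  \<open>log_pot_converges\<close>.\<close>

lemma avg_pot_excess_tendsto:
 assumes rho: "0 < rho"
 shows "(%n. avg n (d n) (pot_excess rho n z)) \<longlonglongrightarrow> 0"
proof (rule LIMSEQ_I)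
 fix r :: real assume r: "r > 0"
 define B where "B = 2 * \<bar>disk_pot z\<bar> + \<bar>ln rho\<bar>"
 define H where "H = 4 * (1 + exp 2 * C) + (4 * (cmod z)^2 + 2 * B^2)"
 let ?p = "%n. avg n (d n) (%P. of_bool (r / 2 < \<bar>log_pot n (d n) z P - disk_pot z\<bar>))"
 have "(%n. sqrt H * sqrt (?p n)) \<longlonglongrightarrow> sqrt H * sqrt 0"
  by (intro tendsto_intros log_pot_converges[OF dinf up C lnn]) (use r in auto)
 then have "eventually (%n. sqrt H * sqrt (?p n) < r / 2) at_top" using r by (intro order_tendstoD(2)) auto
 then have "eventually (%n. norm (avg n (d n) (pot_excess rho n z) - 0) < r) at_top"
  using ev_pos[OF dinf up C] up
 proof eventually_elim
  case (elim n)
  let ?Y = "pot_excess rho n z"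
  let ?I = "%P. of_bool (r / 2 < \<bar>log_pot n (d n) z P - disk_pot z\<bar>) :: real"
  have "avg n (d n) ?Y <= avg n (d n) (%P. r / 2 + ?Y P * ?I P)"
  proof (rule avg_mono)
   fix P
   show "?Y P <= r / 2 + ?Y P * ?I P"
    using pot_excess_le[OF rho, of n z P] r by (cases "r / 2 < \<bar>log_pot n (d n) z P - disk_pot z\<bar>") auto
  qed
  also have "... = r / 2 + avg n (d n) (%P. ?Y P * ?I P)" by (simp only: avg_add avg_const)
  also have "avg n (d n) (%P. ?Y P * ?I P) <= sqrt (avg n (d n) (%P. (?Y P)^2)) * sqrt (avg n (d n) (%P. (?I P)^2))"
   by (rule avg_mult_le)
  also have "... = sqrt (avg n (d n) (%P. (?Y P)^2)) * sqrt (?p n)" by (simp only: of_bool_def if_distrib[where f = "%x. x^2"] one_power2 zero_power2)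
  also have "... <= sqrt H * sqrt (?p n)"
  proof (intro mult_right_mono real_sqrt_le_mono)
   have "avg n (d n) (%P. (?Y P)^2) <= avg n (d n) (%P. 4 * frob n (d n) P + (4 * (cmod z)^2 + 2 * B^2))"
    using elim by (intro avg_mono pot_excess_sq[OF rho]) (auto simp: B_def)
   also have "... = 4 * avg n (d n) (frob n (d n)) + (4 * (cmod z)^2 + 2 * B^2)" by (simp only: avg_add avg_cmult avg_const)
   also have "... <= H" unfolding H_def using avg_frob_le[of n "d n" C] elim by (intro add_right_mono mult_left_mono) auto
   finally show "avg n (d n) (%P. (?Y P)^2) <= H" .
   show "0 <= sqrt (?p n)" by (intro real_sqrt_ge_zero avg_nonneg) auto
  qed
  finally have "avg n (d n) ?Y < r" using elim(1) by linarith
  moreover have "avg n (d n) ?Y >= 0" by (intro avg_nonneg pot_excess_nonneg)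
  ultimately show ?case by simp
 qed
 then show "EX no. ALL n>=no. norm (avg n (d n) (pot_excess rho n z) - 0) < r" unfolding eventually_sequentially .
qed

lemma pot_excess_measurable [measurable]: "(%u. pot_excess rho n (w + of_real r * u) P) : borel_measurable borel"
proof -
 have "{z. z ~: set (eigs n (d n) P)} = - set (eigs n (d n) P)" by auto
 then have [measurable]: "Measurable.pred borel (%z. z ~: set (eigs n (d n) P))"
  by (simp add: pred_def borel_comp sets.countable[OF _ countable_finite] finite_imp_closed borel_closed)
 have "(%z. pot_excess rho n z P) : borel_measurable borel" unfolding pot_excess_def log_pot_eq by measurable
 then show ?thesis by measurable
qed

text \<open>The mean of \<open>log_pot\<close> over the circle is exactly the eigenvalue average of
  \<open>ln (max r (cmod (w - a)))\<close>, which gives the upper estimate. For the lower one the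
  truncated logarithm is used, whose circular mean is larger by at most
  \<open>rho / r\<close>.\<close>

lemma eig_log_mean_diff_le:
 assumes r: "r > 0" and rho: "0 < rho" and n: "n > 0"
  and int: "integrable circ (%u. pot_excess rho n (w + of_real r * u) P)"
 shows "\<bar>eig_mean n (d n) (%a. ln (max r (cmod (w - a)))) P - circ_mean disk_pot w r\<bar>
  <= (\<integral>u. pot_excess rho n (w + of_real r * u) P \<partial>circ) + rho / r"
proof -
 let ?z = "%u. w + of_real r * u"
 let ?V = "%u. log_pot n (d n) (?z u) P"
 let ?W = "%u. eig_mean n (d n) (%a. ln (max rho (cmod (?z u - a)))) P"
 let ?Y = "%u. pot_excess rho n (?z u) P"
 let ?L = "eig_mean n (d n) (%a. ln (max r (cmod (w - a)))) P"
 have sw: "?z u - a = (w - a) + of_real r * u" for u a by simp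
 have Vi: "integrable circ ?V" and VL: "(\<integral>u. ?V u \<partial>circ) = ?L"
  unfolding log_pot_eq sw by (subst integral_eig_mean; use circ_log[OF r] in simp)+
 have Wi: "integrable circ ?W" and WL: "(\<integral>u. ?W u \<partial>circ) <= ?L + rho / r"
 proof -
  show "integrable circ ?W" unfolding sw by (rule integral_eig_mean(1)) (rule circ_log_truncated_le(1)[OF r rho])
  have "(\<integral>u. ?W u \<partial>circ) = eig_mean n (d n) (%a. \<integral>u. ln (max rho (cmod ((w - a) + of_real r * u))) \<partial>circ) P"
   unfolding sw by (rule integral_eig_mean(2)) (rule circ_log_truncated_le(1)[OF r rho])
  also have "... <= eig_mean n (d n) (%a. ln (max r (cmod (w - a))) - (- rho / r)) P"
   using circ_log_truncated_le(2)[OF r rho] by (intro eig_mean_mono) auto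
  also have "... = ?L + rho / r" unfolding eig_mean_diff eig_mean_const[OF n] by simp
  finally show "(\<integral>u. ?W u \<partial>circ) <= ?L + rho / r" .
 qed
 have Ui: "integrable circ (%u. disk_pot (?z u))" by (rule disk_pot_integrable[OF r])
 have ae: "AE u in circ. ?z u ~: set (eigs n (d n) P)"
 proof -
  have "AE u in circ. u ~: (%a. (a - w) / of_real r) ` set (eigs n (d n) P)" by (rule AE_circ_not_countable) (simp add: countable_finite)
  then show ?thesis
  proof eventually_elim
   case (elim u)
   show ?case
   proof
    assume "?z u : set (eigs n (d n) P)"
    moreover have "u = (?z u - w) / of_real r" using r by simp
    ultimately show False using elim by blast
   qed
  qed
 qed
 have "?L - circ_mean disk_pot w r = (\<integral>u. ?V u - disk_pot (?z u) \<partial>circ)"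
  unfolding circ_mean_def using Vi Ui VL by simp
 also have "... <= (\<integral>u. ?Y u \<partial>circ)"
  by (rule integral_mono_AE) (use Vi Ui int ae in \<open>auto simp: pot_excess_def elim!: eventually_mono\<close>)
 finally have 1: "?L - circ_mean disk_pot w r <= (\<integral>u. ?Y u \<partial>circ)" .
 have "circ_mean disk_pot w r - (\<integral>u. ?W u \<partial>circ) = (\<integral>u. disk_pot (?z u) - ?W u \<partial>circ)"
  unfolding circ_mean_def using Wi Ui by simp
 also have "... <= (\<integral>u. ?Y u \<partial>circ)"
  by (rule integral_mono_AE) (use Wi Ui int ae in \<open>auto simp: pot_excess_def elim!: eventually_mono\<close>)
 finally have 2: "circ_mean disk_pot w r - (\<integral>u. ?W u \<partial>circ) <= (\<integral>u. ?Y u \<partial>circ)" .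
 show ?thesis using 1 2 WL rho r by (smt (verit) divide_pos_pos)
qed

text \<open>Convergence in mean at each point of the circle is integrated by dominated convergence;
  the dominating constant comes from \<open>y <= 1 + y^2\<close> and the second moment bound,
  uniform along the circle. The truncation level is fixed beforehand by
  \<open>rho / r = e / 2\<close>.\<close>

lemma avg_eig_log_mean_tendsto:
 assumes r: "r > 0"
 shows "(%n. avg n (d n) (%P. \<bar>eig_mean n (d n) (%a. ln (max r (cmod (w - a)))) P - circ_mean disk_pot w r\<bar>)) \<longlonglongrightarrow> 0"
  (is "?f \<longlonglongrightarrow> 0")
proof (rule LIMSEQ_I)
 fix e :: real assume e: "e > 0"
 define rho where "rho = r * (e / 2)"
 have rho: "rho > 0" "rho / r = e / 2" unfolding rho_def using r e by auto
 define R where "R = 1 + cmod w + r"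
 define B where "B = 2 * R + \<bar>ln rho\<bar>"
 define H where "H = 4 * (1 + exp 2 * C) + (4 * R^2 + 2 * B^2)"
 from eventually_conj[OF ev_pos[OF dinf up C] up] obtain N where N: "!!n. n >= N ==> n > 0 & d n > 0 & real (d n) <= C * real n"
  unfolding eventually_sequentially by blast
 let ?z = "%u. w + of_real r * u"
 have sq: "AE u in circ. ALL P. (pot_excess rho n (?z u) P)^2 <= 4 * frob n (d n) P + (4 * R^2 + 2 * B^2)" if n: "n >= N" for n
  using AE_circ_norm AE_circ_disk_pot[OF r, of w]
 proof eventually_elim
  case (elim u)
  have "cmod (?z u) <= R" unfolding R_def using norm_triangle_ineq[of w "of_real r * u"] elim r by (simp add: norm_mult)
  then have zR: "(cmod (?z u))^2 <= R^2" by (intro power_mono) auto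
  have B: "2 * \<bar>disk_pot (?z u)\<bar> + \<bar>ln rho\<bar> <= B" unfolding B_def using elim(2) unfolding R_def by simp
  show ?case
  proof
   fix P
   show "(pot_excess rho n (?z u) P)^2 <= 4 * frob n (d n) P + (4 * R^2 + 2 * B^2)"
    using pot_excess_sq[OF rho(1) _ _ B, of n P] N[OF n] zR by simp
  qed
 qed
 have int: "integrable circ (%u. pot_excess rho n (?z u) P)" if n: "n >= N" for n P
 proof (rule circ.integrable_const_bound)
  show "AE u in circ. norm (pot_excess rho n (?z u) P) <= 1 + (4 * frob n (d n) P + (4 * R^2 + 2 * B^2))"
   using sq[OF n]
  proof eventually_elim
   case (elim u)
   have "y <= 1 + y^2" for y :: real by (rule le_one_plus_square)
   from this[of "pot_excess rho n (?z u) P"] show ?case using elim[rule_format, of P] pot_excess_nonneg[of rho n "?z u" P] by simp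
  qed
 qed auto
 \<comment> \<open>The bounds hold for \<open>n >= N\<close> only; setting the earlier terms to 0
   lets dominated convergence be applied to the whole sequence.\<close>
 define h where "h n u = (if n >= N then avg n (d n) (pot_excess rho n (?z u)) else 0)" for n u
 have "(%n. integral\<^sup>L circ (h n)) \<longlonglongrightarrow> integral\<^sup>L circ (%u. 0)"
 proof (rule integral_dominated_convergence[where w = "%u. 1 + H"])
  show "AE u in circ. (%n. h n u) \<longlonglongrightarrow> 0"
  proof (rule AE_I2)
   fix u
   show "(%n. h n u) \<longlonglongrightarrow> 0"
   proof (rule Lim_transform_eventually[OF avg_pot_excess_tendsto[OF rho(1), of "?z u"]])
    show "eventually (%n. avg n (d n) (pot_excess rho n (?z u)) = h n u) at_top"
     using eventually_ge_at_top[of N] by eventually_elim (simp add: h_def)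
   qed
  qed
  show "h n : borel_measurable circ" for n
  proof (cases "n >= N")
   case True
   have "(%u. avg n (d n) (%P. pot_excess rho n (?z u) P)) : borel_measurable borel"
    by (rule avg_measurable[OF pot_excess_measurable])
   then show ?thesis using True unfolding h_def[abs_def] by simp
  qed (simp add: h_def[abs_def])
  show "AE u in circ. norm (h n u) <= 1 + H" for n
  proof (cases "n >= N")
   case True
   show ?thesis using sq[OF True]
   proof eventually_elim
    case (elim u)
    have y: "y <= 1 + y^2" for y :: real by (rule le_one_plus_square)
    have "avg n (d n) (pot_excess rho n (?z u)) <= avg n (d n) (%P. 1 + (4 * frob n (d n) P + (4 * R^2 + 2 * B^2)))"
     using elim y by (intro avg_mono) (meson add_left_mono order_trans)
    also have "... = 1 + (4 * avg n (d n) (frob n (d n)) + (4 * R^2 + 2 * B^2))" by (simp only: avg_add avg_cmult avg_const)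
    also have "... <= 1 + H" unfolding H_def using avg_frob_le[of n "d n" C] N[OF True] by simp
    finally show ?case unfolding h_def using True by (simp add: avg_nonneg pot_excess_nonneg)
   qed
  next
   case False
   have "0 <= 1 + H" unfolding H_def using C by (intro add_nonneg_nonneg mult_nonneg_nonneg) auto
   then show ?thesis using False unfolding h_def by simp
  qed
 qed auto
 then have "eventually (%n. integral\<^sup>L circ (h n) < e / 2) at_top" using e by (intro order_tendstoD(2)) auto
 then have "eventually (%n. norm (?f n - 0) < e) at_top" using eventually_ge_at_top[of N]
 proof eventually_elim
  case (elim n)
  have "?f n <= avg n (d n) (%P. (\<integral>u. pot_excess rho n (?z u) P \<partial>circ) + rho / r)"
   using N[OF elim(2)] by (intro avg_mono eig_log_mean_diff_le r rho(1) int elim(2)) auto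
  also have "... = avg n (d n) (%P. \<integral>u. pot_excess rho n (?z u) P \<partial>circ) + e / 2" unfolding avg_add avg_const rho(2) ..
  also have "avg n (d n) (%P. \<integral>u. pot_excess rho n (?z u) P \<partial>circ) = integral\<^sup>L circ (h n)"
   using integral_avg(2)[OF int[OF elim(2)], of n "d n"] elim(2) unfolding h_def[abs_def] by simp
  finally have "?f n < e" using elim(1) by simp
  moreover have "?f n >= 0" by (rule avg_nonneg) simp
  ultimately show ?case by simp
 qed
 then show "EX no. ALL n>=no. norm (?f n - 0) < e" unfolding eventually_sequentially .
qed

end

section \<open>Logarithmic bumps and test functions\<close>

text \<open>A bump of radius \<open>2 * r\<close>, which is a difference of two circular means of the logarithmic kernel.\<close>
definition hat :: "real => complex => complex => real" where
 "hat r w a = ln (max (2 * r) (cmod (w - a))) - ln (max r (cmod (w - a)))"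

lemma hat_bounds:
 assumes r: "r > 0"
 shows "0 <= hat r w a" "hat r w a <= ln 2" "cmod (w - a) >= 2 * r ==> hat r w a = 0"
proof -
 let ?x = "cmod (w - a)"
 show "0 <= hat r w a" unfolding hat_def using r by (simp add: ln_mono)
 have "ln (max (2 * r) ?x) <= ln (2 * max r ?x)" using r by (intro ln_mono) auto
 also have "... = ln 2 + ln (max r ?x)" using r by (intro ln_mult_pos) auto
 finally show "hat r w a <= ln 2" unfolding hat_def by simp
 show "hat r w a = 0" if "?x >= 2 * r" using that r unfolding hat_def by (simp add: max_def)
qed

lemma hat_measurable [measurable]: "(%w. hat r w a) : borel_measurable borel"
 unfolding hat_def by measurable

lemma emeasure_disc: "s >= 0 ==> emeasure lborel (cball (a :: complex) s) = ennreal (pi * s^2)"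
 by (simp add: emeasure_cball eval_unit_ball_vol)

text \<open>The bump is a mixture of disk indicators: the integral of \<open>1 / s\<close> over
  those \<open>s\<close> from \<open>r\<close> to \<open>2 * r\<close> with
  \<open>cmod (w - a) <= s\<close>. After exchanging the integrals the disk of radius
  \<open>s\<close> contributes \<open>pi * s^2 / s\<close>.\<close>

lemma nn_integral_hat:
 assumes r: "r > 0"
 shows "(\<integral>\<^sup>+w. ennreal (hat r w a) \<partial>lborel) = ennreal (3 / 2 * pi * r^2)"
proof -
 define k where "k w s = ennreal (1 / s) * (indicator {r..2*r} s * indicator {s. cmod (w - a) <= s} s)" for w :: complex and s :: real
 have inner: "(\<integral>\<^sup>+s. k w s \<partial>lborel) = ennreal (hat r w a)" for w
 proof (cases "cmod (w - a) <= 2 * r")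
  case True
  define x where "x = max r (cmod (w - a))"
  have x: "0 < x" "x <= 2 * r" unfolding x_def using r True by auto
  have "(\<integral>\<^sup>+s. k w s \<partial>lborel) = (\<integral>\<^sup>+s. ennreal (1 / s) * indicator {x..2*r} s \<partial>lborel)"
   unfolding k_def x_def by (intro nn_integral_cong) (auto simp: indicator_def)
  also have "... = ln (2 * r) - ln x"
   by (rule nn_integral_FTC_Icc) (use x in \<open>auto intro!: derivative_eq_intros\<close>)
  also have "ln (2 * r) - ln x = hat r w a" unfolding hat_def x_def using True by (simp add: max_def)
  finally show ?thesis .
 next
  case False
  then have "k w s = 0" for s unfolding k_def by (auto simp: indicator_def)
  then show ?thesis using hat_bounds(3)[OF r, of w a] False by simp
 qed
 have km: "case_prod k : borel_measurable (lborel \<Otimes>\<^sub>M lborel)" unfolding k_def by measurable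
 have "(\<integral>\<^sup>+w. ennreal (hat r w a) \<partial>lborel) = (\<integral>\<^sup>+w. (\<integral>\<^sup>+s. k w s \<partial>lborel) \<partial>lborel)" unfolding inner ..
 also have "... = (\<integral>\<^sup>+s. (\<integral>\<^sup>+w. k w s \<partial>lborel) \<partial>lborel)" by (rule lborel_pair.Fubini'[OF km, symmetric])
 also have "... = (\<integral>\<^sup>+s. ennreal (pi * s) * indicator {r..2*r} s \<partial>lborel)"
 proof (rule nn_integral_cong)
  fix s :: real
  show "(\<integral>\<^sup>+w. k w s \<partial>lborel) = ennreal (pi * s) * indicator {r..2*r} s"
  proof (cases "s : {r..2*r}")
   case True
   then have s: "s > 0" using r by auto
   have "(\<integral>\<^sup>+w. k w s \<partial>lborel) = (\<integral>\<^sup>+w. ennreal (1 / s) * indicator (cball a s) w \<partial>lborel)"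
    unfolding k_def using True by (intro nn_integral_cong) (auto simp: indicator_def dist_norm norm_minus_commute)
   also have "... = ennreal (1 / s) * emeasure lborel (cball a s)" by (rule nn_integral_cmult_indicator) simp
   also have "... = ennreal (1 / s) * ennreal (pi * s^2)" using s by (simp add: emeasure_disc)
   also have "... = ennreal (pi * s)" using s by (simp add: ennreal_mult[symmetric] power2_eq_square)
   finally show ?thesis using True by simp
  next
   case False
   then show ?thesis unfolding k_def by simp
  qed
 qed
 also have "... = pi * (2 * r)^2 / 2 - pi * r^2 / 2"
  by (rule nn_integral_FTC_Icc) (use r in \<open>auto intro!: derivative_eq_intros\<close>)
 also have "pi * (2 * r)^2 / 2 - pi * r^2 / 2 = 3 / 2 * pi * r^2" by (simp add: power2_eq_square)
 finally show ?thesis .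
qed

lemma hat_integral:
 assumes r: "r > 0"
 shows "integrable lborel (%w. hat r w a)" "(\<integral>w. hat r w a \<partial>lborel) = 3 / 2 * pi * r^2"
proof -
 show i: "integrable lborel (%w. hat r w a)"
  by (rule integrableI_nonneg) (use hat_bounds[OF r] nn_integral_hat[OF r, of a] in auto)
 show "(\<integral>w. hat r w a \<partial>lborel) = 3 / 2 * pi * r^2"
  using nn_integral_hat[OF r, of a] hat_bounds(1)[OF r] by (subst integral_eq_nn_integral) auto
qed

lemma circ_mean_cong:
 assumes "!!u. cmod u = 1 ==> f (w + of_real r * u) = g (w + of_real r * u)"
  "f : borel_measurable borel" "g : borel_measurable borel"
 shows "circ_mean f w r = circ_mean g w r"
 unfolding circ_mean_def
proof (rule integral_cong_AE)
 show "AE u in circ. f (w + of_real r * u) = g (w + of_real r * u)" using AE_circ_norm by eventually_elim (rule assms(1))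
qed (use assms(2,3) in measurable)

text \<open>The inner branch of \<open>disk_pot\<close> continued to the whole plane, where its
  circular means are explicit.\<close>

abbreviation "quad_pot \<equiv> (%z. ((cmod z)^2 - 1) / 2)"

lemma circ_mean_quad_pot:
 shows "integrable circ (%u. quad_pot (w + of_real r * u))" "circ_mean quad_pot w r = ((cmod w)^2 + r^2 - 1) / 2"
proof -
 have hol: "(%u. of_real r * cnj w * u) holomorphic_on cball 0 1" by (intro holomorphic_intros)
 have m0: "(\<integral>u. Re (of_real r * cnj w * u) \<partial>circ) = 0"
  using circ_mean_value[OF hol] by simp
 have i0: "integrable circ (%u. Re (of_real r * cnj w * u))"
 proof (rule circ.integrable_const_bound)
  show "AE u in circ. norm (Re (of_real r * cnj w * u)) <= \<bar>r\<bar> * cmod w"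
   using AE_circ_norm
  proof eventually_elim
   case (elim u)
   show ?case using abs_Re_le_cmod[of "of_real r * cnj w * u"] elim by (simp add: norm_mult)
  qed
 qed measurable
 have ae: "AE u in circ. ((cmod w)^2 + r^2 - 1) / 2 + Re (of_real r * cnj w * u) = quad_pot (w + of_real r * u)"
  using AE_circ_norm
 proof eventually_elim
  case (elim u)
  have "(Re u)^2 + (Im u)^2 = 1" using elim cmod_power2[of u] by simp
  then have "r^2 * (Re u)^2 + r^2 * (Im u)^2 = r^2" by (metis distrib_left mult.right_neutral)
  then show ?case unfolding cmod_power2 by (simp add: power2_sum power_mult_distrib algebra_simps add_divide_distrib diff_divide_distrib)
 qed
 have i1: "integrable circ (%u. ((cmod w)^2 + r^2 - 1) / 2 + Re (of_real r * cnj w * u))" using i0 by simp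
 show "integrable circ (%u. quad_pot (w + of_real r * u))" by (rule integrable_cong_AE_imp[OF i1 _ ae]) measurable
 have "circ_mean quad_pot w r = (\<integral>u. ((cmod w)^2 + r^2 - 1) / 2 + Re (of_real r * cnj w * u) \<partial>circ)"
  unfolding circ_mean_def by (rule integral_cong_AE[symmetric]) (use ae in \<open>measurable\<close>)
 also have "... = ((cmod w)^2 + r^2 - 1) / 2" using i0 m0 by (subst Bochner_Integration.integral_add) auto
 finally show "circ_mean quad_pot w r = ((cmod w)^2 + r^2 - 1) / 2" .
qed

text \<open>With \<open>x = (cmod z)^2\<close> the gap outside the disk is half of
  \<open>x - 1 - ln x\<close>, which is at most \<open>(x - 1)^2\<close>, and
  \<open>x - 1 <= 12 * r\<close> in this range. The two branches agree to first order across the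
  unit circle, which makes the boundary error quadratic in \<open>r\<close>.\<close>

lemma disk_pot_quad_pot:
 assumes "cmod z <= 1 + 4 * r" "0 < r" "r <= 1 / 4"
 shows "disk_pot z <= quad_pot z" "quad_pot z - disk_pot z <= 72 * r^2"
proof -
 have "disk_pot z <= quad_pot z & quad_pot z - disk_pot z <= 72 * r^2"
 proof (cases "cmod z <= 1")
  case False
  define x where "x = (cmod z)^2"
  have x: "x > 1" unfolding x_def using False by (simp add: one_less_power)
  have U: "disk_pot z = ln x / 2" unfolding disk_pot_def x_def using False by (simp add: ln_realpow)
  have 1: "ln x <= x - 1" using x by (intro ln_le_minus_one) auto
  have "ln (1 / x) <= 1 / x - 1" using x by (intro ln_le_minus_one) auto
  then have "1 - 1 / x <= ln x" using x by (simp add: ln_div)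
  then have "x - 1 - ln x <= x - 2 + 1 / x" by simp
  also have "... = (x - 1)^2 / x" using x by (simp add: field_simps power2_eq_square)
  also have "... <= (x - 1)^2" using x by (simp add: divide_le_eq mult_left_mono[of 1 x "(x - 1)^2", simplified])
  also have "... <= (12 * r)^2"
  proof (rule power_mono)
   have "x <= (1 + 4 * r)^2" unfolding x_def using assms by (intro power_mono) auto
   also have "... = 1 + 8 * r + 16 * (r * r)" by (simp add: power2_eq_square algebra_simps)
   also have "r * r <= r * (1 / 4)" using assms by (intro mult_left_mono) auto
   finally show "x - 1 <= 12 * r" by simp
  qed (use x in simp)
  finally have "x - 1 - ln x <= 144 * r^2" by (simp add: power_mult_distrib)
  then show ?thesis unfolding U x_def[symmetric] using 1 by (auto simp: diff_divide_distrib[symmetric] divide_le_eq)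
 qed (use assms in \<open>simp add: disk_pot_def\<close>)
 then show "disk_pot z <= quad_pot z" "quad_pot z - disk_pot z <= 72 * r^2" by auto
qed

definition pot_diff :: "real => complex => real" where
 "pot_diff r w = circ_mean disk_pot w (2 * r) - circ_mean disk_pot w r"

lemma circle_bounds:
 assumes "cmod u = 1" "rho > 0"
 shows "cmod (w + of_real rho * u) <= cmod w + rho" "cmod w - rho <= cmod (w + of_real rho * u)"
 using norm_triangle_ineq[of w "of_real rho * u"] norm_diff_ineq[of w "of_real rho * u"] assms by (auto simp: norm_mult)

lemma quad_pot_measurable: "quad_pot : borel_measurable borel" by measurable

text \<open>Well inside the disk the potential is the quadratic one, whose circular means differ by
  \<open>3 / 2 * r^2\<close>; well outside it is harmonic and the difference vanishes. Near the unit
  circle the quadratic potential is accurate up to \<open>72 * r^2\<close> at both radii, and 75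
  leaves room for the indicator.\<close>

lemma pot_diff_approx:
 assumes r: "0 < r" "r <= 1 / 4"
 shows "\<bar>pot_diff r w - 3 / 2 * r^2 * indicator (cball 0 1) w\<bar> <= 75 * r^2 * indicator (cball 0 (1 + 2 * r) - cball 0 (1 - 2 * r)) w"
proof -
 let ?M = "circ_mean disk_pot w"
 consider "cmod w <= 1 - 2 * r" | "cmod w > 1 + 2 * r" | "1 - 2 * r < cmod w" "cmod w <= 1 + 2 * r" by linarith
 then show ?thesis
 proof cases
  case 1
  have "?M rho = circ_mean quad_pot w rho" if "0 < rho" "rho <= 2 * r" for rho
  proof (rule circ_mean_cong)
   fix u :: complex assume u: "cmod u = 1"
   have "cmod (w + of_real rho * u) <= 1" using circle_bounds(1)[OF u that(1), of w] 1 that by linarith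
   then show "disk_pot (w + of_real rho * u) = quad_pot (w + of_real rho * u)" unfolding disk_pot_def by simp
  qed (use quad_pot_measurable in auto)
  then have e: "?M rho = ((cmod w)^2 + rho\<^sup>2 - 1) / 2" if "0 < rho" "rho <= 2 * r" for rho unfolding circ_mean_quad_pot(2) using that by simp
  have "?M r = ((cmod w)^2 + r^2 - 1) / 2" "?M (2 * r) = ((cmod w)^2 + (2 * r)^2 - 1) / 2" by (rule e; use r in simp)+
  then have "pot_diff r w = 3 / 2 * r^2" unfolding pot_diff_def by (simp add: power2_eq_square field_simps)
  then show ?thesis using 1 r by (simp add: indicator_def)
 next
  case 2
  have "?M rho = ln (cmod w)" if "0 < rho" "rho <= 2 * r" for rho
  proof -
   have "?M rho = circ_mean (%z. ln (cmod z)) w rho"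
   proof (rule circ_mean_cong)
    fix u :: complex assume u: "cmod u = 1"
    have "cmod (w + of_real rho * u) > 1" using circle_bounds(2)[OF u that(1), of w] 2 that by linarith
    then show "disk_pot (w + of_real rho * u) = ln (cmod (w + of_real rho * u))" unfolding disk_pot_def by simp
   qed auto
   also have "... = ln (max rho (cmod w))" unfolding circ_mean_def by (rule circ_log(2)[OF that(1)])
   also have "max rho (cmod w) = cmod w" using that 2 r by simp
   finally show ?thesis .
  qed
  then have "pot_diff r w = 0" unfolding pot_diff_def using r by simp
  then show ?thesis using 2 r by (simp add: indicator_def)
 next
  case 3
  have D: "0 <= circ_mean quad_pot w rho - ?M rho" "circ_mean quad_pot w rho - ?M rho <= 72 * r^2" if "0 < rho" "rho <= 2 * r" for rho
  proof -
   let ?q = "%u. quad_pot (w + of_real rho * u) - disk_pot (w + of_real rho * u)"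
   have i: "integrable circ ?q" by (intro Bochner_Integration.integrable_diff circ_mean_quad_pot(1) disk_pot_integrable that)
   have e: "circ_mean quad_pot w rho - ?M rho = integral\<^sup>L circ ?q"
    unfolding circ_mean_def by (rule Bochner_Integration.integral_diff[symmetric]) (intro circ_mean_quad_pot(1) disk_pot_integrable that)+
   have ae: "AE u in circ. 0 <= ?q u & ?q u <= 72 * r^2"
    using AE_circ_norm
   proof eventually_elim
    case (elim u)
    have "cmod (w + of_real rho * u) <= 1 + 4 * r" using circle_bounds(1)[OF elim that(1), of w] 3 that by linarith
    from disk_pot_quad_pot[OF this r] show ?case by simp
   qed
   show "0 <= circ_mean quad_pot w rho - ?M rho" unfolding e by (rule integral_nonneg_AE) (use ae in auto)
   have "integral\<^sup>L circ ?q <= (\<integral>u. 72 * r^2 \<partial>circ)" by (rule integral_mono_AE) (use i ae in auto)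
   then show "circ_mean quad_pot w rho - ?M rho <= 72 * r^2" unfolding e by simp
  qed
  have "circ_mean quad_pot w (2 * r) - circ_mean quad_pot w r = 3 / 2 * r^2" unfolding circ_mean_quad_pot(2) by (simp add: power2_eq_square field_simps)
  then have "\<bar>pot_diff r w - 3 / 2 * r^2\<bar> <= 72 * r^2" unfolding pot_diff_def using D[of r] D[of "2 * r"] r by linarith
  moreover have "\<bar>3 / 2 * r^2 * indicator (cball 0 1) w - 3 / 2 * r^2\<bar> <= 3 / 2 * r^2" by (simp add: indicator_def)
  ultimately have "\<bar>pot_diff r w - 3 / 2 * r^2 * indicator (cball 0 1) w\<bar> <= 75 * r^2" using zero_le_power2[of r] by linarith
  moreover have "w : cball 0 (1 + 2 * r) - cball 0 (1 - 2 * r)" using 3 by simp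
  ultimately show ?thesis by simp
 qed
qed

lemma pot_diff_measurable [measurable]: "pot_diff r : borel_measurable borel"
 unfolding pot_diff_def circ_mean_def by measurable

lemma measure_disc: "s >= 0 ==> measure lborel (cball (a :: complex) s) = pi * s^2"
 using emeasure_disc[of s a] by (simp add: measure_def)

text \<open>Convolution with the bump, not normalized: the total mass of the bump is
  \<open>3 / 2 * pi * r^2\<close>.\<close>

definition smoothed :: "(complex => real) => real => complex => real" where
 "smoothed f r a = (\<integral>w. f w * hat r w a \<partial>lborel)"

context
 fixes f :: "complex => real" and R M :: real
 assumes fc: "continuous_on UNIV f" and supp: "!!z. cmod z > R ==> f z = 0" and R: "R > 0"
  and M: "!!z. \<bar>f z\<bar> <= M"
begin

lemma f_measurable [measurable]: "f : borel_measurable borel"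
 by (rule borel_measurable_continuous_onI[OF fc])

lemma M_nonneg: "0 <= M"
 using M[of 0] by linarith

lemma f_mult_integrable:
 assumes [measurable]: "g : borel_measurable borel" and g: "!!w. w : cball 0 R ==> \<bar>g w\<bar> <= K"
 shows "integrable lborel (%w. f w * g w)"
proof (rule Bochner_Integration.integrable_bound)
 show "integrable lborel (%w::complex. M * K * indicator (cball 0 R) w)"
  using emeasure_disc[of R 0] R by (intro integrable_mult_right integrable_real_indicator) auto
 show "AE w in lborel. norm (f w * g w) <= norm (M * K * indicator (cball 0 R) w)"
 proof (rule AE_I2)
  fix w
  show "norm (f w * g w) <= norm (M * K * indicator (cball 0 R) w)"
  proof (cases "w : cball 0 R")
   case True
   then have K: "0 <= K" using g[OF True] by linarith
   have "\<bar>f w\<bar> * \<bar>g w\<bar> <= M * K" using M[of w] g[OF True] M_nonneg by (intro mult_mono) auto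
   then show ?thesis using True K M_nonneg by (simp add: abs_mult)
  next
   case False
   then show ?thesis using supp[of w] by simp
  qed
 qed
qed measurable

lemma f_hat_integrable: "r > 0 ==> integrable lborel (%w. f w * hat r w a)"
 by (rule f_mult_integrable[where K = "ln 2"]) (use hat_bounds(1,2)[of r _ a] in auto)

lemma smoothed_approx:
 assumes r: "r > 0" and omega: "!!x y. cmod (x - y) <= 2 * r ==> \<bar>f x - f y\<bar> <= omega"
 shows "\<bar>smoothed f r a - 3 / 2 * pi * r^2 * f a\<bar> <= 3 / 2 * pi * r^2 * omega"
proof -
 note hi = hat_integral[OF r, of a]
 have e: "smoothed f r a - 3 / 2 * pi * r^2 * f a = (\<integral>w. f w * hat r w a - f a * hat r w a \<partial>lborel)"
  unfolding smoothed_def using f_hat_integrable[OF r, of a] hi by simp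
 have "\<bar>\<integral>w. f w * hat r w a - f a * hat r w a \<partial>lborel\<bar> <= (\<integral>w. \<bar>f w * hat r w a - f a * hat r w a\<bar> \<partial>lborel)" by (rule integral_abs_bound)
 also have "... <= (\<integral>w. omega * hat r w a \<partial>lborel)"
 proof (rule integral_mono)
  fix w
  show "\<bar>f w * hat r w a - f a * hat r w a\<bar> <= omega * hat r w a"
  proof (cases "cmod (w - a) <= 2 * r")
   case True
   have "\<bar>f w * hat r w a - f a * hat r w a\<bar> = \<bar>f w - f a\<bar> * hat r w a"
    using hat_bounds(1)[OF r, of w a] by (simp add: left_diff_distrib[symmetric] abs_mult)
   then show ?thesis using omega[OF True] hat_bounds(1)[OF r, of w a] by (simp add: mult_right_mono)
  next
   case False
   then show ?thesis using hat_bounds(3)[OF r, of w a] by simp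
  qed
 qed (use f_hat_integrable[OF r, of a] hi in auto)
 also have "... = 3 / 2 * pi * r^2 * omega" using hi by simp
 finally show ?thesis unfolding e .
qed

lemma pot_diff_integrable: "r > 0 ==> integrable lborel (%w. f w * pot_diff r w)"
proof (rule f_mult_integrable[where K = "2 * (1 + R + 2 * r)"])
 fix w :: complex assume r: "r > 0" and "w : cball 0 R"
 then have "cmod w <= R" by simp
 then show "\<bar>pot_diff r w\<bar> <= 2 * (1 + R + 2 * r)"
  unfolding pot_diff_def using circ_mean_disk_pot_bound[OF r, of w] circ_mean_disk_pot_bound[of "2 * r" w] r by (auto simp: abs_le_iff)
qed measurable

text \<open>The error lives on an annulus of width \<open>4 * r\<close> around the unit circle, of
  area \<open>8 * pi * r\<close>. It is therefore of order \<open>r ^ 3\<close>, one order below the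
  main term.\<close>

lemma pot_diff_integral_approx:
 assumes r: "0 < r" "r <= 1 / 4"
 shows "\<bar>(\<integral>w. f w * pot_diff r w \<partial>lborel) - 3 / 2 * r^2 * (\<integral>w. f w * indicator (cball 0 1) w \<partial>lborel)\<bar> <= 600 * pi * M * r ^ 3"
proof -
 let ?A = "cball 0 (1 + 2 * r) - cball 0 (1 - 2 * r) :: complex set"
 have i1: "integrable lborel (%w. f w * indicator (cball 0 1) w)" by (rule f_mult_integrable[where K = 1]) (auto simp: indicator_def)
 have iA: "integrable lborel (%w. indicator ?A w :: real)"
 proof (rule integrable_real_indicator)
  have "emeasure lborel ?A <= emeasure lborel (cball (0::complex) (1 + 2 * r))" by (rule emeasure_mono) auto
  then show "emeasure lborel ?A < \<infinity>" using emeasure_disc[of "1 + 2 * r" 0] r by (auto simp: le_less_trans[OF _ ennreal_less_top])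
 qed auto
 have mA: "(\<integral>w. indicator ?A w \<partial>lborel) = 8 * pi * r"
 proof -
  have "(\<integral>w. indicator ?A w \<partial>lborel) = measure lborel ?A" by simp
  also have "... = measure lborel (cball (0::complex) (1 + 2 * r)) - measure lborel (cball (0::complex) (1 - 2 * r))"
   by (rule measure_Diff) (use emeasure_disc[of "1 + 2 * r" 0] r in auto)
  also have "... = 8 * pi * r" using r by (simp add: measure_disc power2_eq_square algebra_simps)
  finally show ?thesis .
 qed
 have "(\<integral>w. f w * pot_diff r w \<partial>lborel) - 3 / 2 * r^2 * (\<integral>w. f w * indicator (cball 0 1) w \<partial>lborel)
  = (\<integral>w. f w * pot_diff r w - 3 / 2 * r^2 * (f w * indicator (cball 0 1) w) \<partial>lborel)"
  using i1 pot_diff_integrable[OF r(1)] by simp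
 also have "\<bar>...\<bar> <= (\<integral>w. \<bar>f w * pot_diff r w - 3 / 2 * r^2 * (f w * indicator (cball 0 1) w)\<bar> \<partial>lborel)" by (rule integral_abs_bound)
 also have "... <= (\<integral>w. (M * (75 * r^2)) * indicator ?A w \<partial>lborel)"
 proof (rule integral_mono)
  fix w
  have "\<bar>f w * pot_diff r w - 3 / 2 * r^2 * (f w * indicator (cball 0 1) w)\<bar> = \<bar>f w\<bar> * \<bar>pot_diff r w - 3 / 2 * r^2 * indicator (cball 0 1) w\<bar>"
   unfolding abs_mult[symmetric] by (simp add: algebra_simps)
  also have "... <= M * (75 * r^2 * indicator ?A w)" using M[of w] M_nonneg pot_diff_approx[OF r, of w] by (intro mult_mono) auto
  finally show "\<bar>f w * pot_diff r w - 3 / 2 * r^2 * (f w * indicator (cball 0 1) w)\<bar> <= (M * (75 * r^2)) * indicator ?A w" by (simp add: mult.assoc)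
 qed (use i1 iA pot_diff_integrable[OF r(1)] in auto)
 also have "... = M * (75 * r^2) * (8 * pi * r)" using iA mA by simp
 also have "... = 600 * pi * M * r ^ 3" by (simp add: power2_eq_square power3_eq_cube)
 finally show ?thesis .
qed

context
 fixes d :: "nat => nat" and C :: real
 assumes dinf: "filterlim d at_top at_top"
  and up: "eventually (%n. real (d n) <= C * real n) at_top" and C: "C >= 1"
  and lnn: "eventually (%n. ln (real n) <= real (d n) powr (1/11)) at_top"
begin

text \<open>After exchanging eigenvalue average and integral, the error is the integral over centres
  \<open>w\<close> of \<open>f w\<close> times the error for the bump at \<open>w\<close>. The
  latter splits into the errors of two circular means, of radii \<open>2 * r\<close> and
  \<open>r\<close>, and dominated convergence in \<open>w\<close> applies since \<open>f\<close> is
  bounded with bounded support.\<close>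

lemma avg_smoothed_tendsto:
 assumes r: "r > 0"
 shows "(%n. avg n (d n) (%P. \<bar>eig_mean n (d n) (smoothed f r) P - (\<integral>w. f w * pot_diff r w \<partial>lborel)\<bar>)) \<longlonglongrightarrow> 0"
  (is "?F \<longlonglongrightarrow> 0")
proof -
 define D where "D n w P = eig_mean n (d n) (hat r w) P - pot_diff r w" for n w P
 have em: "0 <= eig_mean n (d n) (hat r w) P" "eig_mean n (d n) (hat r w) P <= ln 2" for n w P
 proof -
  have "eig_mean n (d n) (%_. 0) P <= eig_mean n (d n) (hat r w) P" by (rule eig_mean_mono) (use hat_bounds[OF r] in auto)
  then show "0 <= eig_mean n (d n) (hat r w) P" by (simp add: eig_mean_def)
  have "eig_mean n (d n) (hat r w) P <= eig_mean n (d n) (%_. ln 2) P" by (rule eig_mean_mono) (use hat_bounds[OF r] in auto)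
  also have "... <= ln 2" by (simp add: eig_mean_def)
  finally show "eig_mean n (d n) (hat r w) P <= ln 2" .
 qed
 define K where "K = ln 2 + 2 * (1 + R + 2 * r)"
 have DK: "\<bar>D n w P\<bar> <= K" if "w : cball 0 R" for n w P
 proof -
  have "cmod w <= R" using that by simp
  then show ?thesis unfolding D_def K_def pot_diff_def
   using em[of n w P] circ_mean_disk_pot_bound[OF r, of w] circ_mean_disk_pot_bound[of "2 * r" w] r by (auto simp: abs_le_iff)
 qed
 have Dm [measurable]: "(%w. D n w P) : borel_measurable borel" for n P unfolding D_def by measurable
 have fD: "integrable lborel (%w. f w * D n w P)" for n P by (rule f_mult_integrable[OF Dm DK])
 have eq: "eig_mean n (d n) (smoothed f r) P - (\<integral>w. f w * pot_diff r w \<partial>lborel) = (\<integral>w. f w * D n w P \<partial>lborel)" for n P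
 proof -
  have "eig_mean n (d n) (smoothed f r) P = (\<integral>w. eig_mean n (d n) (%a. f w * hat r w a) P \<partial>lborel)"
   unfolding smoothed_def[abs_def] by (rule integral_eig_mean(2)[symmetric]) (rule f_hat_integrable[OF r])
  moreover have "integrable lborel (%w. eig_mean n (d n) (%a. f w * hat r w a) P)"
   by (rule integral_eig_mean(1)) (rule f_hat_integrable[OF r])
  ultimately show ?thesis unfolding D_def right_diff_distrib eig_mean_cmult using pot_diff_integrable[OF r] by simp
 qed
 define h where "h n w = avg n (d n) (%P. \<bar>f w * D n w P\<bar>)" for n w
 have "(%n. integral\<^sup>L lborel (h n)) \<longlonglongrightarrow> integral\<^sup>L lborel (%w::complex. 0)"
 proof (rule integral_dominated_convergence[where w = "%w. (M * K) * indicator (cball 0 R) w"])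
  show "h n : borel_measurable lborel" for n unfolding h_def[abs_def] by measurable
  show "integrable lborel (%w::complex. (M * K) * indicator (cball 0 R) w)"
   using emeasure_disc[of R 0] R by (intro integrable_mult_right integrable_real_indicator) auto
  show "AE w in lborel. norm (h n w) <= (M * K) * indicator (cball 0 R) w" for n
  proof (rule AE_I2)
   fix w
   have "h n w >= 0" unfolding h_def by (rule avg_nonneg) simp
   moreover have "h n w <= (M * K) * indicator (cball 0 R) w"
   proof (cases "w : cball 0 R")
    case True
    have "h n w <= avg n (d n) (%_. M * K)" unfolding h_def abs_mult
     by (intro avg_mono mult_mono M DK[OF True] M_nonneg) auto
    then show ?thesis using True by (simp add: avg_const)
   next
    case False
    then have "f w = 0" using supp[of w] by simp
    then show ?thesis using False unfolding h_def by (simp add: avg_const)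
   qed
   ultimately show "norm (h n w) <= (M * K) * indicator (cball 0 R) w" by simp
  qed
  show "AE w in lborel. (%n. h n w) \<longlonglongrightarrow> 0"
  proof (rule AE_I2)
   fix w
   let ?E = "%rho n P. \<bar>eig_mean n (d n) (%a. ln (max rho (cmod (w - a)))) P - circ_mean disk_pot w rho\<bar>"
   have lim: "(%n. \<bar>f w\<bar> * (avg n (d n) (?E (2 * r) n) + avg n (d n) (?E r n))) \<longlonglongrightarrow> \<bar>f w\<bar> * (0 + 0)"
    by (intro tendsto_intros avg_eig_log_mean_tendsto[OF dinf up C lnn]) (use r in auto)
   show "(%n. h n w) \<longlonglongrightarrow> 0"
   proof (rule tendsto_sandwich[OF _ _ tendsto_const])
    show "(%n. \<bar>f w\<bar> * (avg n (d n) (?E (2 * r) n) + avg n (d n) (?E r n))) \<longlonglongrightarrow> 0" using lim by simp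
    show "eventually (%n. 0 <= h n w) sequentially" unfolding h_def by (intro always_eventually allI avg_nonneg) simp
    show "eventually (%n. h n w <= \<bar>f w\<bar> * (avg n (d n) (?E (2 * r) n) + avg n (d n) (?E r n))) sequentially"
    proof (intro always_eventually allI)
     fix n
     have "\<bar>D n w P\<bar> <= ?E (2 * r) n P + ?E r n P" for P
      unfolding D_def pot_diff_def hat_def[abs_def] eig_mean_diff by linarith
     then have "h n w <= avg n (d n) (%P. \<bar>f w\<bar> * (?E (2 * r) n P + ?E r n P))"
      unfolding h_def abs_mult by (intro avg_mono mult_left_mono) auto
     then show "h n w <= \<bar>f w\<bar> * (avg n (d n) (?E (2 * r) n) + avg n (d n) (?E r n))" by (simp only: avg_cmult avg_add)
    qed
   qed
  qed
 qed simp
 then have lim: "(%n. integral\<^sup>L lborel (h n)) \<longlonglongrightarrow> 0" by simp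
 show ?thesis
 proof (rule tendsto_sandwich[OF _ _ tendsto_const lim])
  show "eventually (%n. 0 <= ?F n) sequentially" by (intro always_eventually allI avg_nonneg) simp
  show "eventually (%n. ?F n <= integral\<^sup>L lborel (h n)) sequentially"
  proof (intro always_eventually allI)
   fix n
   have "?F n <= avg n (d n) (%P. \<integral>w. \<bar>f w * D n w P\<bar> \<partial>lborel)" unfolding eq by (intro avg_mono integral_abs_bound)
   also have "... = integral\<^sup>L lborel (h n)" unfolding h_def[abs_def] by (rule integral_avg(2)[symmetric]) (use fD in auto)
   finally show "?F n <= integral\<^sup>L lborel (h n)" .
  qed
 qed
qed

lemma uniformly_close:
 assumes e: "e > 0"
 obtains del where "del > 0" "!!x y. cmod (x - y) < del ==> \<bar>f x - f y\<bar> <= e"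
proof -
 have "uniformly_continuous_on (cball 0 (R + 1)) f"
  by (rule compact_uniformly_continuous[OF continuous_on_subset[OF fc]]) auto
 then obtain del where del: "del > 0" "!!x y. x : cball 0 (R + 1) ==> y : cball 0 (R + 1) ==> dist y x < del ==> dist (f y) (f x) < e"
  unfolding uniformly_continuous_on_def using e by metis
 show thesis
 proof (rule that[of "min del 1"])
  fix x y assume xy: "cmod (x - y) < min del 1"
  show "\<bar>f x - f y\<bar> <= e"
  proof (cases "cmod x <= R + 1 & cmod y <= R + 1")
   case True
   then show ?thesis using del(2)[of y x] xy by (simp add: dist_norm)
  next
   case False
   have "\<bar>cmod x - cmod y\<bar> < 1" using xy norm_triangle_ineq3[of x y] by linarith
   then have "cmod x > R" "cmod y > R" using False by auto
   then show ?thesis using supp e by simp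
  qed
 qed (use del in auto)
qed

text \<open>Relative to the mass \<open>c\<close> of the bump, smoothing costs the modulus of
  continuity of \<open>f\<close> and the boundary costs a multiple of \<open>r\<close>. Both are
  made small by fixing \<open>r\<close> before \<open>n\<close> tends to infinity.\<close>

lemma avg_eig_mean_tendsto:
 "(%n. avg n (d n) (%P. \<bar>eig_mean n (d n) f P - (\<integral>w. f w * indicator (cball 0 1) w \<partial>lborel) / pi\<bar>)) \<longlonglongrightarrow> 0"
  (is "?F \<longlonglongrightarrow> 0")
proof (rule LIMSEQ_I)
 fix e :: real assume e: "e > 0"
 let ?I = "\<integral>w. f w * indicator (cball 0 1) w \<partial>lborel"
 obtain del where del: "del > 0" "!!x y. cmod (x - y) < del ==> \<bar>f x - f y\<bar> <= e / 4" by (rule uniformly_close[of "e / 4"]) (use e in auto)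
 \<comment> \<open>1600 is \<open>4 * 400\<close>: the boundary error divided by \<open>c\<close>
   equals \<open>400 * M * r\<close>, which is to be at most \<open>e / 4\<close>.\<close>
 define r where "r = min (min (del / 3) (1 / 4)) (e / (1600 * (M + 1)))"
 have r: "0 < r" "r <= 1 / 4" "2 * r < del" "r <= e / (1600 * (M + 1))" 
 proof -
  show "0 < r" unfolding r_def using del e M_nonneg by (simp add: add_nonneg_pos)
  have "r <= del / 3" "r <= 1 / 4" "r <= e / (1600 * (M + 1))" unfolding r_def by (auto simp: min_def)
  then show "r <= 1 / 4" "2 * r < del" "r <= e / (1600 * (M + 1))" using del(1) by auto
 qed
 define c where "c = 3 / 2 * pi * r^2"
 have c: "c > 0" unfolding c_def using r by simp
 have Mr: "600 * pi * M * r ^ 3 / c <= e / 4"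
 proof -
  have "600 * pi * M * r ^ 3 / c = 400 * M * r" unfolding c_def using r by (simp add: field_simps power2_eq_square power3_eq_cube)
  also have "... <= 400 * (M + 1) * r" using r by simp
  also have "... <= e / 4" using r(4) M_nonneg by (simp add: field_simps)
  finally show ?thesis .
 qed
 let ?J = "\<integral>w. f w * pot_diff r w \<partial>lborel"
 let ?S = "%n P. \<bar>eig_mean n (d n) (smoothed f r) P - ?J\<bar>"
 have "(%n. avg n (d n) (?S n) / c) \<longlonglongrightarrow> 0 / c" by (intro tendsto_intros avg_smoothed_tendsto r) (use c in auto)
 then have "eventually (%n. avg n (d n) (?S n) / c < e / 4) sequentially" using e by (intro order_tendstoD(2)) auto
 then have "eventually (%n. norm (?F n - 0) < e) at_top" using eventually_gt_at_top[of 0]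
 proof eventually_elim
  case (elim n)
  have "\<bar>eig_mean n (d n) f P - ?I / pi\<bar> <= e / 2 + (1 / c) * ?S n P" for P
  proof -
   have 1: "\<bar>eig_mean n (d n) (smoothed f r) P - c * eig_mean n (d n) f P\<bar> <= c * (e / 4)"
   proof -
    have "\<bar>eig_mean n (d n) (smoothed f r) P - c * eig_mean n (d n) f P\<bar> = \<bar>eig_mean n (d n) (%a. smoothed f r a - c * f a) P\<bar>"
     by (simp only: eig_mean_diff eig_mean_cmult)
    also have "... <= eig_mean n (d n) (%a. \<bar>smoothed f r a - c * f a\<bar>) P" by (rule eig_mean_abs_le)
    also have "... <= eig_mean n (d n) (%a. c * (e / 4)) P"
     unfolding c_def by (intro eig_mean_mono smoothed_approx[OF r(1)] del(2)) (use r in auto)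
    also have "... = c * (e / 4)" using elim by (simp add: eig_mean_const)
    finally show ?thesis .
   qed
   have 2: "\<bar>?J - 3 / 2 * r^2 * ?I\<bar> <= c * (e / 4)"
   proof -
    have "600 * pi * M * r ^ 3 <= e / 4 * c" using Mr c by (simp only: pos_divide_le_eq)
    then show ?thesis using order_trans[OF pot_diff_integral_approx[OF r(1,2)]] by (simp only: mult.commute)
   qed
   have 3: "3 / 2 * r^2 * ?I = c * (?I / pi)" unfolding c_def by simp
   have tri: "\<bar>x - y\<bar> <= p + \<bar>s - j\<bar> + q" if "\<bar>s - x\<bar> <= p" "\<bar>j - y\<bar> <= q" for x y p q s j :: real using that by linarith
   have "c * \<bar>eig_mean n (d n) f P - ?I / pi\<bar> = \<bar>c * eig_mean n (d n) f P - c * (?I / pi)\<bar>"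
    using c by (simp only: right_diff_distrib[symmetric] abs_mult abs_of_pos)
   also have "... <= c * (e / 4) + ?S n P + c * (e / 4)" using tri[OF 1 2[unfolded 3]] .
   also have "... = c * (e / 2 + (1 / c) * ?S n P)" using c by (simp add: field_simps)
   finally show ?thesis using c by simp
  qed
  then have "?F n <= avg n (d n) (%P. e / 2 + (1 / c) * ?S n P)" by (intro avg_mono)
  also have "... = e / 2 + avg n (d n) (?S n) / c" by (simp only: avg_add avg_const avg_cmult) simp
  also have "... < e / 2 + e / 4" using elim by simp
  also have "... < e" using e by simp
  finally have "?F n < e" .
  moreover have "?F n >= 0" by (rule avg_nonneg) simp
  ultimately show ?case by simp
 qed
 then show "EX no. ALL n>=no. norm (?F n - 0) < e" unfolding eventually_sequentially .
qed

end

end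

lemma integral_unif_disk:
 fixes f :: "complex => real"
 assumes [measurable]: "f : borel_measurable borel"
 shows "(\<integral>z. f z \<partial>unif_disk) = (\<integral>w. f w * indicator (cball 0 1) w \<partial>lborel) / pi"
proof -
 have d: "uniform_measure lborel (cball 0 1) = density lborel (%w::complex. ennreal (indicator (cball 0 1) w / pi))"
  unfolding uniform_measure_def
 proof (intro arg_cong[where f = "density lborel"] ext)
  fix w :: complex
  show "indicator (cball 0 1) w / emeasure lborel (cball (0::complex) 1) = ennreal (indicator (cball 0 1) w / pi)"
   using emeasure_disc[of 1 0] by (simp add: indicator_def divide_ennreal[of 1 pi, simplified])
 qed
 have "(\<integral>z. f z \<partial>unif_disk) = (\<integral>w. (indicator (cball 0 1) w / pi) *\<^sub>R f w \<partial>lborel)"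
  unfolding unif_disk_def d by (rule integral_density) (measurable, auto)
 also have "... = (\<integral>w. (f w * indicator (cball 0 1) w) / pi \<partial>lborel)" by (simp add: mult.commute)
 finally show ?thesis by simp
qed

theorem theorem1p1:
  fixes d :: "nat \<Rightarrow> nat"
  assumes pos: "\<And>n. d n > 0"
    and lower: "eventually (\<lambda>n. ln (real n) ^ 12 / (ln (ln (real n))) ^ 4 \<le> real (d n)) at_top"
    and upper: "(\<lambda>n. real (d n)) \<in> O(\<lambda>n. real n)"
  shows "weak_conv_in_prob (\<lambda>n. rand_perms n (d n))
           (\<lambda>n \<pi>. ESD (scaled_perm_sum n (d n) \<pi>)) unif_disk"
proof -
 have dinf: "filterlim d at_top at_top"
 proof -
  have "filterlim (%n::nat. ln (real n) ^ 12 / (ln (ln (real n))) ^ 4) at_top at_top" by real_asymp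
  then have "filterlim (%n. real (d n)) at_top at_top" by (rule filterlim_at_top_mono) (rule lower)
  then show ?thesis by (simp add: filterlim_sequentially_iff_filterlim_real)
 qed
 have lnn: "eventually (%n. ln (real n) <= real (d n) powr (1/11)) at_top"
 proof -
  \<comment> \<open>One of the twelve logarithms pays for the division by the fourth power of
    \<open>ln (ln n)\<close>; the eleventh power that remains is what the proof uses.\<close>
  have "eventually (%n::nat. ln (real n) ^ 11 <= ln (real n) ^ 12 / (ln (ln (real n))) ^ 4) at_top" by real_asymp
  moreover have "eventually (%n::nat. ln (real n) > 0) at_top" by real_asymp
  ultimately show ?thesis using lower
  proof eventually_elim
   case (elim n)
   have "ln (real n) ^ 11 = ln (real n) powr 11" using elim(2) powr_realpow[of "ln (real n)" 11] by simp
   then have "ln (real n) = (ln (real n) ^ 11) powr (1/11)" using elim(2) by (simp only: powr_powr) simp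
   also have "... <= real (d n) powr (1/11)" using elim by (intro powr_mono2) auto
   finally show ?case .
  qed
 qed
 obtain C where C: "C >= 1" and up: "eventually (%n. real (d n) <= C * real n) at_top"
 proof -
  from landau_o.bigE[OF upper] obtain c where c: "eventually (%n. norm (real (d n)) <= c * norm (real n)) at_top" by blast
  show thesis
  proof (rule that[of "max c 1"])
   show "eventually (%n. real (d n) <= max c 1 * real n) at_top" using c
   proof eventually_elim
    case (elim n)
    have "c * real n <= max c 1 * real n" by (intro mult_right_mono) auto
    then show ?case using elim by simp
   qed
  qed simp
 qed
 note main = avg_eig_mean_tendsto[OF _ _ _ _ dinf up C lnn]
 \<comment> \<open>So far the limit is available for test functions of bounded support. Applied to
   \<open>cut\<close>, whose integral against the uniform law on the disk is 1, it shows that the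
   mean of \<open>1 - cut\<close> over the eigenvalues tends to 0, so that a bounded
   \<open>f\<close> may be multiplied by \<open>cut\<close>.\<close>
 define cut where "cut z = max 0 (min 1 (2 - cmod z))" for z :: complex
 have cutc: "continuous_on UNIV cut" unfolding cut_def by (intro continuous_intros)
 have cut: "0 <= cut z" "cut z <= 1" "cmod z > 2 ==> cut z = 0" "cmod z <= 1 ==> cut z = 1" for z unfolding cut_def by auto
 let ?I = "%f. (\<integral>w. f w * indicator (cball 0 1) w \<partial>lborel) / pi :: real"
 let ?E = "%f n P. \<bar>eig_mean n (d n) f P - ?I f\<bar>"
 have Icut: "?I cut = 1"
 proof -
  have "(\<integral>w. cut w * indicator (cball 0 1) w \<partial>lborel) = (\<integral>w. indicator (cball (0::complex) 1) w \<partial>lborel)"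
   by (intro Bochner_Integration.integral_cong refl) (auto simp: indicator_def cut)
  also have "... = pi" using measure_disc[of 1 0] by simp
  finally show ?thesis by simp
 qed
 have limcut: "(%n. avg n (d n) (?E cut n)) \<longlonglongrightarrow> 0"
  by (rule main[of cut 2 1]) (use cut cutc in auto)
 show ?thesis unfolding weak_conv_in_prob_def
 proof (intro allI impI)
  fix f :: "complex => real" and eps :: real
  assume f: "continuous_on UNIV f & bounded (range f)" and eps: "eps > 0"
  then have fm: "f : borel_measurable borel" by (intro borel_measurable_continuous_onI) auto
  from f obtain B where B: "!!z. \<bar>f z\<bar> <= B" by (auto simp: bounded_iff)
  have B0: "B >= 0" using B[of 0] by linarith
  define g where "g z = f z * cut z" for z
  have gB: "\<bar>g z\<bar> <= B" for z
   using mult_mono[OF B[of z] cut(2)[of z]] cut(1)[of z] B0 unfolding g_def by (simp add: abs_mult)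
  have limg: "(%n. avg n (d n) (?E g n)) \<longlonglongrightarrow> 0"
  proof (rule main[of g 2 B])
   show "continuous_on UNIV g" unfolding g_def using f cutc by (intro continuous_intros) auto
  qed (use gB cut(3) in \<open>auto simp: g_def\<close>)
  have Ig: "?I g = ?I f"
   unfolding g_def by (intro arg_cong[where f = "%x. x / pi"] Bochner_Integration.integral_cong refl) (auto simp: indicator_def cut)
  have Ef: "?E f n P <= ?E g n P + B * ?E cut n P" if n: "n > 0" for n P
  proof -
   have "\<bar>eig_mean n (d n) f P - eig_mean n (d n) g P\<bar> <= eig_mean n (d n) (%a. \<bar>f a - g a\<bar>) P"
    unfolding eig_mean_diff[symmetric] by (rule eig_mean_abs_le)
   also have "... <= eig_mean n (d n) (%a. B * (1 - cut a)) P"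
   proof (rule eig_mean_mono)
    fix a
    have "f a - g a = f a * (1 - cut a)" unfolding g_def by (simp add: right_diff_distrib)
    then have "\<bar>f a - g a\<bar> = \<bar>f a\<bar> * (1 - cut a)" using cut(2)[of a] by (simp add: abs_mult)
    then show "\<bar>f a - g a\<bar> <= B * (1 - cut a)" using B[of a] cut(2)[of a] by (simp add: mult_right_mono)
   qed
   also have "... = B * (1 - eig_mean n (d n) cut P)" unfolding eig_mean_cmult eig_mean_diff eig_mean_const[OF n] ..
   also have "... <= B * ?E cut n P" unfolding Icut using B0 by (intro mult_left_mono) auto
   finally show ?thesis unfolding Ig by linarith
  qed
  have limf: "(%n. avg n (d n) (%P. ?E g n P + B * ?E cut n P) / eps) \<longlonglongrightarrow> 0"
   unfolding avg_add avg_cmult using tendsto_divide[OF tendsto_add[OF limg tendsto_mult[OF tendsto_const limcut]] tendsto_const, of eps B] eps by simp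
  show "(%n. measure_pmf.prob (rand_perms n (d n)) {P. \<bar>(\<integral>z. f z \<partial>ESD (scaled_perm_sum n (d n) P)) - (\<integral>z. f z \<partial>unif_disk)\<bar> > eps}) \<longlonglongrightarrow> 0"
  proof (rule tendsto_sandwich[OF _ _ tendsto_const limf])
   show "eventually (%n. measure_pmf.prob (rand_perms n (d n)) {P. \<bar>(\<integral>z. f z \<partial>ESD (scaled_perm_sum n (d n) P)) - (\<integral>z. f z \<partial>unif_disk)\<bar> > eps}
    <= avg n (d n) (%P. ?E g n P + B * ?E cut n P) / eps) sequentially"
    using eventually_gt_at_top[of 0]
   proof eventually_elim
    case (elim n)
    have "measure_pmf.prob (rand_perms n (d n)) {P. \<bar>(\<integral>z. f z \<partial>ESD (scaled_perm_sum n (d n) P)) - (\<integral>z. f z \<partial>unif_disk)\<bar> > eps} = avg n (d n) (%P. of_bool (eps < ?E f n P))"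
     unfolding prob_rand_perms avg_of_bool integral_ESD[OF elim] integral_unif_disk[OF fm] eig_mean_sum_list ..
    also have "... <= avg n (d n) (?E f n) / eps" using eps by (intro avg_markov) auto
    also have "... <= avg n (d n) (%P. ?E g n P + B * ?E cut n P) / eps" using eps by (intro divide_right_mono avg_mono Ef elim) auto
    finally show ?case .
   qed
  qed auto
 qed
qed

end
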